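(* Let $k\ge1$ be an integer, let $1<p<\infty$, and let $A\subset(H^p)^k$ be a closed convex set. Then $A\cap B_\infty(1)\neq\emptyset$ if and only if $A\cap B_{u,p}(1)\neq\emptyset$ for all exhaustion vector-functions $u=(u_1,\dots,u_k)\in\mathcal{E}_1^k$.
   Context: $\mathbb{D}=\{z\in\mathbb{C}:|z|<1\}$. An exhaustion function is a continuous subharmonic function $u:\mathbb{D}\to[-\infty,0)$ such that $u(z)\to0$ as $|z|\to1$; the class of these is $\mathcal{E}$. $\Delta$ is the Laplace operator in the sense of distributions. $\mathcal{E}_1$ is the set of $u\in\mathcal{E}$ with $\int_{\mathbb{D}}\Delta u=1$, and $\mathcal{E}_1^k$ is the set of $u=(u_1,\dots,u_k)$ with all $u_j\in\mathcal{E}_1$. For $u\in\mathcal{E}$ and $r<0$ put $B_{u,r}=\{z\in\mathbb{D}:u(z)<r\}$, $S_{u,r}=\{z\in\mathbb{D}:u(z)=r\}$, $u_r=\max\{u,r\}$, and $\mu_{u,r}=\Delta u_r-\chi_{\mathbb{D}\setminus B_{u,r}}\,\Delta u$, a non-negative measure supported by $S_{u,r}$. For $0<p<\infty$ the Poletsky--Stessin Hardy space $H^p_u$ consists of all holomorphic functions $f$ on $\mathbb{D}$ with $$\|f\|_{u,p}^p=\limsup_{r\to0^-}\int_{S_{u,r}}|f|^p\,d\mu_{u,r}<\infty .$$ It is known that $H^p_u$ is contained in the classical Hardy space $H^p$ of the disk. For $u=(u_1,\dots,u_k)\in\mathcal{E}_1^k$, $H^p_u=H^p_{u_1}\times\cdots\times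 H^p_{u_k}$ with the norm $\|(f_1,\dots,f_k)\|_{u,p}=\sum_{j=1}^k\|f_j\|_{u_j,p}$, and $B_{u,p}(r)$ is the closed ball of radius $r$ centered at the origin of $H^p_u$. $(H^p)^k$ is the $k$-fold product of the classical Hardy space with the norm $\|f\|_p=\sum_{j=1}^k\|f_j\|_p$, where the $H^p$ norm is taken with respect to the normalized Lebesgue measure on the unit circle; "closed" means closed in this norm. $(H^\infty)^k$ carries the norm $\|f\|_\infty=\sum_{j=1}^k\|f_j\|_\infty$, and $B_\infty(r)$ is the closed ball of radius $r$ centered at the origin of $(H^\infty)^k$. *)

theory Defs
  imports "HOL-Analysis.Analysis"
begin

abbreviation unit_disc :: "complex set" where
  "unit_disc \<equiv> ball 0 1"

text \<open>Normalized Lebesgue measure on the unit circle.\<close>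

definition circle_measure :: "complex measure" where
  "circle_measure = distr (uniform_measure lborel {0..2 * pi}) borel cis"


section \<open>Exhaustion functions\<close>

text \<open>
  The mean of an extended real-valued function over a circle, as the integral of the positive part
  minus the integral of the negative part. An upper semicontinuous function with values below
  \<open>\<infinity>\<close> is bounded above on circles, so the first integral is then finite and the
  difference is meaningful.
\<close>

definition circle_mean :: "(complex \<Rightarrow> ereal) \<Rightarrow> complex \<Rightarrow> real \<Rightarrow> ereal" where
  "circle_mean u z s =
     enn2ereal (\<integral>\<^sup>+ w. e2ennreal (u (z + of_real s * w)) \<partial>circle_measure)
     - enn2ereal (\<integral>\<^sup>+ w. e2ennreal (- u (z + of_real s * w)) \<partial>circle_measure)"

definition subharmonic_on :: "complex set \<Rightarrow> (complex \<Rightarrow> ereal) \<Rightarrow> bool" where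
  "subharmonic_on S u \<longleftrightarrow>
     (\<forall>z\<in>S. u z < \<infinity>) \<and>
     (\<forall>c. openin (top_of_set S) {z\<in>S. u z < c}) \<and>
     (\<forall>z s. 0 < s \<and> cball z s \<subseteq> S \<longrightarrow> u z \<le> circle_mean u z s)"

text \<open>Only the values on the disk matter, here and in all notions derived from \<open>u\<close>.\<close>

definition exhaustions :: "(complex \<Rightarrow> ereal) set" where
  "exhaustions = {u. continuous_on unit_disc u \<and> subharmonic_on unit_disc u \<and>
     (\<forall>z\<in>unit_disc. u z < 0) \<and> (u \<longlongrightarrow> 0) (filtercomap norm (at_left 1))}"


section \<open>The distributional Laplacian\<close>

definition dir_deriv :: "complex \<Rightarrow> (complex \<Rightarrow> real) \<Rightarrow> complex \<Rightarrow> real" where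
  "dir_deriv v f = (\<lambda>z. frechet_derivative f (at z) v)"

primrec Ck :: "nat \<Rightarrow> (complex \<Rightarrow> real) \<Rightarrow> bool" where
  "Ck 0 f \<longleftrightarrow> continuous_on UNIV f"
| "Ck (Suc n) f \<longleftrightarrow>
     (\<forall>z. f differentiable (at z)) \<and> Ck n (dir_deriv 1 f) \<and> Ck n (dir_deriv \<i> f)"

definition laplace :: "(complex \<Rightarrow> real) \<Rightarrow> complex \<Rightarrow> real" where
  "laplace f z = dir_deriv 1 (dir_deriv 1 f) z + dir_deriv \<i> (dir_deriv \<i> f) z"

definition test_function :: "(complex \<Rightarrow> real) \<Rightarrow> bool" where
  "test_function \<phi> \<longleftrightarrow> (\<forall>n. Ck n \<phi>) \<and>
     (\<exists>K. compact K \<and> K \<subseteq> unit_disc \<and> (\<forall>z. z \<notin> K \<longrightarrow> \<phi> z = 0))"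

definition radon_on_disc :: "complex measure \<Rightarrow> bool" where
  "radon_on_disc M \<longleftrightarrow> sets M = sets (restrict_space borel unit_disc) \<and>
     (\<forall>K. compact K \<and> K \<subseteq> unit_disc \<longrightarrow> emeasure M K < \<infinity>)"

text \<open>
  The Laplacian in the sense of distributions (without a factor \<open>1 / (2 * pi)\<close>) of a subharmonic
  function on the disk, as the measure representing it. A subharmonic function that is not
  identically \<open>- \<infinity>\<close> on the disk is locally integrable and equals
  \<open>- \<infinity>\<close> only on a null set, so \<^const>\<open>real_of_ereal\<close> changes it only on a null set.
\<close>

definition has_laplacian :: "(complex \<Rightarrow> ereal) \<Rightarrow> complex measure \<Rightarrow> bool" where
  "has_laplacian u M \<longleftrightarrow> radon_on_disc M \<and>
     (\<forall>\<phi>. test_function \<phi> \<longrightarrow>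
        (LINT z|M. \<phi> z) = (LINT z:unit_disc|lborel. real_of_ereal (u z) * laplace \<phi> z))"

definition laplacian :: "(complex \<Rightarrow> ereal) \<Rightarrow> complex measure" where
  "laplacian u = (THE M. has_laplacian u M)"

definition exhaustions1 :: "(complex \<Rightarrow> ereal) set" where
  "exhaustions1 = {u \<in> exhaustions. emeasure (laplacian u) unit_disc = 1}"


section \<open>Poletsky--Stessin Hardy spaces\<close>

definition sublevel :: "(complex \<Rightarrow> ereal) \<Rightarrow> real \<Rightarrow> complex set" where
  "sublevel u r = {z \<in> unit_disc. u z < ereal r}"

definition level :: "(complex \<Rightarrow> ereal) \<Rightarrow> real \<Rightarrow> complex set" where
  "level u r = {z \<in> unit_disc. u z = ereal r}"

definition trunc :: "(complex \<Rightarrow> ereal) \<Rightarrow> real \<Rightarrow> complex \<Rightarrow> ereal" where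
  "trunc u r z = max (u z) (ereal r)"

text \<open>
  The measure \<open>\<Delta> u\<^sub>r - \<chi> \<Delta> u\<close>, with \<open>\<chi>\<close> the indicator of the complement of the sublevel set.
  Both terms may have infinite mass, so the difference is expressed by adding
  \<open>\<chi> \<Delta> u\<close> on the other side.
\<close>

definition level_measure :: "(complex \<Rightarrow> ereal) \<Rightarrow> real \<Rightarrow> complex measure" where
  "level_measure u r = (THE M. radon_on_disc M \<and>
     (\<forall>E\<in>sets (restrict_space borel unit_disc).
        emeasure M E + emeasure (laplacian u) (E - sublevel u r) = emeasure (laplacian (trunc u r)) E))"

definition PS_limsup :: "(complex \<Rightarrow> ereal) \<Rightarrow> real \<Rightarrow> (complex \<Rightarrow> complex) \<Rightarrow> ennreal" where
  "PS_limsup u p f = Limsup (at_left 0)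
     (\<lambda>r. \<integral>\<^sup>+ z\<in>level u r. ennreal (norm (f z) powr p) \<partial>level_measure u r)"

text \<open>
  Functions on the disk are represented by functions on the plane that vanish off the disk, so that
  distinct elements of the spaces below are distinct as functions on the disk.
\<close>

definition disc_holomorphic :: "(complex \<Rightarrow> complex) set" where
  "disc_holomorphic = {f. f holomorphic_on unit_disc \<and> (\<forall>z. z \<notin> unit_disc \<longrightarrow> f z = 0)}"

definition PS_space :: "(complex \<Rightarrow> ereal) \<Rightarrow> real \<Rightarrow> (complex \<Rightarrow> complex) set" where
  "PS_space u p = {f \<in> disc_holomorphic. PS_limsup u p f < \<infinity>}"

definition PS_norm :: "(complex \<Rightarrow> ereal) \<Rightarrow> real \<Rightarrow> (complex \<Rightarrow> complex) \<Rightarrow> real" where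
  "PS_norm u p f = enn2real (PS_limsup u p f) powr (1 / p)"

definition PS_ball ::
    "('k::finite \<Rightarrow> complex \<Rightarrow> ereal) \<Rightarrow> real \<Rightarrow> real \<Rightarrow> ('k \<Rightarrow> complex \<Rightarrow> complex) set" where
  "PS_ball u p R = {f. (\<forall>j. f j \<in> PS_space (u j) p) \<and> (\<Sum>j\<in>UNIV. PS_norm (u j) p (f j)) \<le> R}"


section \<open>Classical Hardy spaces\<close>

definition hardy_sup :: "real \<Rightarrow> (complex \<Rightarrow> complex) \<Rightarrow> ennreal" where
  "hardy_sup p f =
     (SUP s\<in>{0..<1}. \<integral>\<^sup>+ w. ennreal (norm (f (of_real s * w)) powr p) \<partial>circle_measure)"

definition hardy_space :: "real \<Rightarrow> (complex \<Rightarrow> complex) set" where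
  "hardy_space p = {f \<in> disc_holomorphic. hardy_sup p f < \<infinity>}"

definition hardy_norm :: "real \<Rightarrow> (complex \<Rightarrow> complex) \<Rightarrow> real" where
  "hardy_norm p f = enn2real (hardy_sup p f) powr (1 / p)"

definition hardy_power :: "real \<Rightarrow> ('k::finite \<Rightarrow> complex \<Rightarrow> complex) set" where
  "hardy_power p = {f. \<forall>j. f j \<in> hardy_space p}"

definition hardy_dist ::
    "real \<Rightarrow> ('k::finite \<Rightarrow> complex \<Rightarrow> complex) \<Rightarrow> ('k \<Rightarrow> complex \<Rightarrow> complex) \<Rightarrow> real" where
  "hardy_dist p f g = (\<Sum>j\<in>UNIV. hardy_norm p (\<lambda>z. f j z - g j z))"

text \<open>The norm topology; \<open>hardy_dist p\<close> is a metric for \<open>p \<ge> 1\<close>.\<close>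

definition hardy_topology :: "real \<Rightarrow> ('k::finite \<Rightarrow> complex \<Rightarrow> complex) topology" where
  "hardy_topology p = Metric_space.mtopology (hardy_power p) (hardy_dist p)"

text \<open>Function types are not an instance of \<^class>\<open>real_vector\<close>, so \<open>convex\<close> does not apply.\<close>

definition convex_tuples :: "('k \<Rightarrow> complex \<Rightarrow> complex) set \<Rightarrow> bool" where
  "convex_tuples A \<longleftrightarrow> (\<forall>f\<in>A. \<forall>g\<in>A. \<forall>t\<in>{0..1::real}.
     (\<lambda>j z. of_real (1 - t) * f j z + of_real t * g j z) \<in> A)"

definition Hinf_space :: "(complex \<Rightarrow> complex) set" where
  "Hinf_space = {f \<in> disc_holomorphic. bounded (f ` unit_disc)}"

definition Hinf_norm :: "(complex \<Rightarrow> complex) \<Rightarrow> real" where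
  "Hinf_norm f = (SUP z\<in>unit_disc. norm (f z))"

definition Hinf_ball :: "real \<Rightarrow> ('k::finite \<Rightarrow> complex \<Rightarrow> complex) set" where
  "Hinf_ball R = {f. (\<forall>j. f j \<in> Hinf_space) \<and> (\<Sum>j\<in>UNIV. Hinf_norm (f j)) \<le> R}"

end

theory Submission
  imports Defs "HOL-Complex_Analysis.Complex_Analysis" "HOL-Probability.Probability_Measure"
begin

text \<open>
  For \<open>u\<close> of Laplacian mass 1 the measures \<open>\<mu>\<^bsub>u,r\<^esub>\<close> have mass at most 1, so the Poletsky--Stessin norms are
  bounded by the supremum norms.

  Conversely, let \<open>u\<^sub>j\<close> be a combination of Green functions with poles \<open>0, a\<^sub>1\<^sub>j, \<dots>, a\<^sub>n\<^sub>j\<close> whose masses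
  \<open>c\<^sub>0 > 0\<close>, \<open>c\<^sub>1, \<dots>, c\<^sub>n\<close> add up to 1. Comparing \<open>|f|\<^sup>p\<close> with smooth subharmonic functions gives
  \<open>\<parallel>f\<parallel>\<^sup>p \<ge> c\<^sub>0 \<parallel>f\<parallel>\<^sup>p + \<Sum>\<^sub>i c\<^sub>i |f(a\<^sub>i\<^sub>j)|\<^sup>p\<close>, with the \<open>H\<^sup>p\<^bsub>u\<^sub>j\<^esub>\<close> norm on the left and the \<open>H\<^sup>p\<close> norm on
  the right. By Jensen's inequality every convex combination of the convex functionals
  \<open>\<Sum>\<^sub>j \<parallel>f\<^sub>j\<parallel>\<^sub>p\<close> and \<open>\<Sum>\<^sub>j |f\<^sub>j(a\<^sub>i\<^sub>j)|\<close> is therefore at most 1 (up to an arbitrarily small error, needed when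
  the weight of the pole 0 vanishes) somewhere on \<open>A\<close>, and a minimax argument yields an element of
  \<open>A\<close> at which all these functionals are at most \<open>1 + \<epsilon>\<close>. Letting the poles run through a countable dense
  subset of the polydisc produces a decreasing sequence of convex sets, in which almost norm-minimal
  elements converge by uniform convexity. Their limit lies in \<open>A\<close> because \<open>A\<close> is closed, and it satisfies
  \<open>\<Sum>\<^sub>j |g\<^sub>j(a\<^sub>j)| \<le> 1\<close> on the whole polydisc.
\<close>

section \<open>The circle measure\<close>

text \<open>\<open>laplacian\<close> and \<open>level_measure\<close> are definite descriptions, so
  nothing can be said about the Poletsky--Stessin norms before these measures are known to exist and
  to be unique; hence the Riesz theorem for test functions and the regularity arguments. A Laplacian
  is accessible only through pairings with smooth compactly supported functions. This is why |f|^p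
  is approximated by powers of |q|^2 + \<epsilon> with Taylor polynomials q, and why the comparisons
  are between functions that agree near the unit circle. The H^p norm in the lower bound comes from
  the pole 0: raising ln |z| to max (ln |z|, ln s) sweeps the point mass at 0 onto the circle of
  radius s, and all s < 1 are used. The Laplacian mass of a Green function (classically 2 pi) enters
  as a constant \<open>\<kappa>\<close>, positive and common to all poles, by which the weights are
  divided. The norm functional accompanies the point evaluations because it bounds the sets in which
  the minimizing sequence is chosen; a positive weight on it also shows that the functions concerned
  have finite H^p norm.\<close>

lemma sets_circle_measure [measurable_cong, simp]: "sets circle_measure = sets borel"
  by (simp add: circle_measure_def)

lemma space_circle_measure [simp]: "space circle_measure = UNIV"
  by (simp add: circle_measure_def)

lemma cis_borel_measurable [measurable]: "cis \<in> borel_measurable borel"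
  by (intro borel_measurable_continuous_onI continuous_intros)

lemma prob_space_circle_measure: "prob_space circle_measure"
  unfolding circle_measure_def
  by (intro prob_space.prob_space_distr prob_space_uniform_measure) auto

interpretation circ: prob_space circle_measure
  by (rule prob_space_circle_measure)

lemma AE_circle_norm: "AE w in circle_measure. norm w = 1"
  unfolding circle_measure_def by (subst AE_distr_iff) auto

lemma AE_circleI: "(\<And>w. norm w = 1 \<Longrightarrow> P w) \<Longrightarrow> AE w in circle_measure. P w"
  using AE_circle_norm by eventually_elim blast

text \<open>Continuity is asked only on the unit circle, which carries the measure, so that
  integrands with singularities elsewhere, such as logarithms, are covered. Measurability is global
  because the measure lives on the plane.\<close>

lemma integral_circle_measure:
  fixes g :: "complex \<Rightarrow> 'a :: euclidean_space"
  assumes "continuous_on (sphere 0 1) g" and [measurable]: "g \<in> borel_measurable borel"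
  shows "integrable circle_measure g"
    and "(LINT w|circle_measure. g w) = integral {0..2*pi} (\<lambda>t. g (cis t)) /\<^sub>R (2*pi)"
proof -
  have c: "continuous_on {0..2*pi} (\<lambda>t. g (cis t))"
    by (rule continuous_on_compose2[OF assms(1)]) (auto intro!: continuous_intros)
  have "bounded (g ` sphere 0 1)"
    by (intro compact_imp_bounded compact_continuous_image assms) auto
  then obtain B where "\<forall>x\<in>g ` sphere 0 1. norm x \<le> B"
    by (auto simp: bounded_iff)
  then have B: "\<And>w. norm w = 1 \<Longrightarrow> norm (g w) \<le> B"
    by auto
  show "integrable circle_measure g"
    by (rule circ.integrable_const_bound[where B = B]) (auto intro!: AE_circleI B)
  have si: "set_integrable lborel {0..2*pi} (\<lambda>t. g (cis t))"
    unfolding set_integrable_def by (rule borel_integrable_compact) (use c in auto)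
  have "(LINT w|circle_measure. g w) = (LINT t|uniform_measure lborel {0..2*pi}. g (cis t))"
    unfolding circle_measure_def by (subst integral_distr) auto
  also have "\<dots> = (LINT t:{0..2*pi}|lborel. g (cis t)) /\<^sub>R (2*pi)"
  proof -
    have "uniform_measure lborel {0..2*pi} = density lborel (\<lambda>t. ennreal (indicator {0..2*pi} t / (2*pi)))"
      unfolding uniform_measure_def using divide_ennreal[of 1 "2*pi"] by (intro density_cong) (auto simp: indicator_def)
    then show ?thesis
      by (simp add: integral_density set_lebesgue_integral_def mult.commute flip: integral_scaleR_right)
         (simp add: field_simps)
  qed
  also have "(LINT t:{0..2*pi}|lborel. g (cis t)) = integral {0..2*pi} (\<lambda>t. g (cis t))"
    using si by (rule set_borel_integral_eq_integral)
  finally show "(LINT w|circle_measure. g w) = integral {0..2*pi} (\<lambda>t. g (cis t)) /\<^sub>R (2*pi)" .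
qed

text \<open>The substitution u = z + s w turns du / (u - a) into i s w dt / (z + s w - a); division
  by 2 pi i leaves the circular mean with the factor s w.\<close>

lemma circle_Cauchy_formula:
  assumes "f holomorphic_on S" "open S" "cball z s \<subseteq> S" "dist z a < s"
    and [measurable]: "f \<in> borel_measurable borel"
  shows "(LINT w|circle_measure. f (z + of_real s * w) * (of_real s * w) / (z + of_real s * w - a)) = f a"
    (is "(LINT w|_. ?g w) = _")
proof -
  have s: "s > 0" using assms(4) zero_le_dist[of z a] by linarith
  have nz: "z + of_real s * w \<noteq> a" if "norm w = 1" for w
  proof
    assume "z + of_real s * w = a"
    then have "dist z a = norm (of_real s * w)" by (auto simp: dist_norm)
    then show False using assms(4) s that by (simp add: norm_mult)
  qed
  have "continuous_on (sphere 0 1) (\<lambda>w. f (z + of_real s * w))"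
    by (rule continuous_on_compose2[OF holomorphic_on_imp_continuous_on[OF assms(1)]])
       (use s assms(3) in \<open>auto intro!: continuous_intros simp: dist_norm norm_mult\<close>)
  then have "continuous_on (sphere 0 1) ?g"
    by (intro continuous_intros) (use nz in auto)
  moreover have "?g \<in> borel_measurable borel" by measurable
  ultimately have "(LINT w|circle_measure. ?g w) = integral {0..2*pi} (\<lambda>t. ?g (cis t)) /\<^sub>R (2*pi)"
    by (rule integral_circle_measure)
  also have "((\<lambda>u. f u / (u - a)) has_contour_integral (2 * of_real pi * \<i> * f a)) (circlepath z s)"
    by (rule Cauchy_integral_circlepath)
       (use assms holomorphic_on_subset[OF assms(1,3)] ball_subset_cball[of z s] in
         \<open>auto intro!: holomorphic_on_imp_continuous_on simp: dist_norm norm_minus_commute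
          intro: holomorphic_on_subset\<close>)
  then have "((\<lambda>t. f (z + s * cis t) / (z + s * cis t - a) * s * \<i> * cis t)
      has_integral (2 * of_real pi * \<i> * f a)) {0..2*pi}"
    unfolding circlepath_def by (subst (asm) has_contour_integral_part_circlepath_iff) auto
  from has_integral_mult_right[OF this, of "1/\<i>"]
  have "((\<lambda>t. ?g (cis t)) has_integral (2 * of_real pi * f a)) {0..2*pi}"
    by (simp add: field_simps)
  then have "integral {0..2*pi} (\<lambda>t. ?g (cis t)) = 2 * of_real pi * f a"
    by (rule integral_unique)
  finally show ?thesis by (simp add: scaleR_conv_of_real)
qed

lemma circle_mean_value:
  assumes "f holomorphic_on S" "open S" "cball z s \<subseteq> S" "0 < s"
    and [measurable]: "f \<in> borel_measurable borel"
  shows "(LINT w|circle_measure. f (z + of_real s * w)) = f z"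
proof -
  have "(LINT w|circle_measure. f (z + of_real s * w)) =
      (LINT w|circle_measure. f (z + of_real s * w) * (of_real s * w) / (z + of_real s * w - z))"
    by (rule integral_cong_AE; (measurable; fail)?; rule AE_circleI) (use assms in auto)
  also have "\<dots> = f z" by (rule circle_Cauchy_formula) (use assms in auto)
  finally show ?thesis .
qed

text \<open>The means of w and w^2 vanish by the mean value property; their real and imaginary parts
  together with |w| = 1 give all the values. These moments occur in second-order Taylor expansions
  of circular means.\<close>

lemma circle_moments:
  shows "(LINT w|circle_measure. Re w) = 0" "(LINT w|circle_measure. Im w) = 0"
    "(LINT w|circle_measure. (Re w)\<^sup>2) = 1/2" "(LINT w|circle_measure. (Im w)\<^sup>2) = 1/2"
    "(LINT w|circle_measure. Re w * Im w) = 0"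
proof -
  have I: "integrable circle_measure g" if "continuous_on UNIV g" for g :: "complex \<Rightarrow> 'a::euclidean_space"
    by (rule integral_circle_measure)
       (use that in \<open>auto intro: continuous_on_subset borel_measurable_continuous_onI\<close>)
  have m: "(LINT w|circle_measure. w ^ n) = 0" if "n > 0" for n
    using circle_mean_value[of "\<lambda>w. w ^ n" UNIV 0 1, OF holomorphic_on_power[OF holomorphic_on_ident]] that
    by auto
  have i: "integrable circle_measure (\<lambda>w. w ^ n)" for n
    by (intro I continuous_intros)
  show 1: "(LINT w|circle_measure. Re w) = 0" "(LINT w|circle_measure. Im w) = 0"
    using m[of 1] i[of 1] integral_Re[of circle_measure "\<lambda>w. w"] integral_Im[of circle_measure "\<lambda>w. w"] by auto
  have "(LINT w|circle_measure. (Re w)\<^sup>2) = (LINT w|circle_measure. 1/2 + Re (w ^ 2) / 2)"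
    by (intro integral_cong_AE AE_circleI)
       (auto simp: power2_eq_square cmod_def field_simps)
  also have "\<dots> = 1/2" 
    using m[of 2] i[of 2] by (subst Bochner_Integration.integral_add) (auto simp: circ.prob_space[simplified])
  finally show 2: "(LINT w|circle_measure. (Re w)\<^sup>2) = 1/2" .
  have "(LINT w|circle_measure. (Im w)\<^sup>2) = (LINT w|circle_measure. 1 - (Re w)^2)"
    by (intro integral_cong_AE AE_circleI)
       (auto simp: power2_eq_square cmod_def)
  also have "\<dots> = 1/2" 
    using 2 by (subst Bochner_Integration.integral_diff) (auto simp: circ.prob_space[simplified] intro!: I continuous_intros)
  finally show "(LINT w|circle_measure. (Im w)\<^sup>2) = 1/2" .
  have "(LINT w|circle_measure. Re w * Im w) = (LINT w|circle_measure. Im (w^2) / 2)"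
    by (intro Bochner_Integration.integral_cong) (auto simp: power2_eq_square)
  also have "\<dots> = 0" using m[of 2] i[of 2] by simp
  finally show "(LINT w|circle_measure. Re w * Im w) = 0" .
qed

section \<open>Smooth functions\<close>

lemma dir_deriv_eq: "(f has_derivative f') (at z) \<Longrightarrow> dir_deriv v f z = f' v"
  unfolding dir_deriv_def by (metis frechet_derivative_at)

lemma dir_deriv_works:
  "f differentiable (at z) \<Longrightarrow> (f has_derivative (\<lambda>v. dir_deriv v f z)) (at z)"
  unfolding dir_deriv_def using frechet_derivative_works by blast

lemma dir_deriv_decompose:
  assumes "f differentiable (at z)"
  shows "dir_deriv v f z = Re v * dir_deriv 1 f z + Im v * dir_deriv \<i> f z"
proof -
  have l: "linear (\<lambda>v. dir_deriv v f z)"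
    using dir_deriv_works[OF assms] has_derivative_linear by blast
  have "v = Re v *\<^sub>R 1 + Im v *\<^sub>R \<i>" by (simp add: complex_eq_iff)
  then have "dir_deriv v f z = dir_deriv (Re v *\<^sub>R 1 + Im v *\<^sub>R \<i>) f z" by simp
  also have "\<dots> = Re v * dir_deriv 1 f z + Im v * dir_deriv \<i> f z"
    using linear_add[OF l] linear_scale[OF l] by simp
  finally show ?thesis .
qed

lemma dir_deriv_cong_open:
  assumes "open S" "z \<in> S" "\<And>w. w \<in> S \<Longrightarrow> f w = g w"
  shows "dir_deriv v f z = dir_deriv v g z"
proof -
  have "(f has_derivative D) (at z) \<longleftrightarrow> (g has_derivative D) (at z)" for D
    using has_derivative_transform_within_open[of f D z UNIV S g]
      has_derivative_transform_within_open[of g D z UNIV S f] assms by metis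
  then show ?thesis by (simp add: dir_deriv_def frechet_derivative_def)
qed

lemma laplace_cong_open:
  assumes "open S" "z \<in> S" "\<And>w. w \<in> S \<Longrightarrow> f w = g w"
  shows "laplace f z = laplace g z"
proof -
  have "dir_deriv v f w = dir_deriv v g w" if "w \<in> S" for v w
    by (rule dir_deriv_cong_open[OF assms(1) that assms(3)])
  then show ?thesis
    unfolding laplace_def using dir_deriv_cong_open[OF assms(1,2)] by (metis (no_types))
qed

lemma Ck_differentiable: "Ck (Suc n) f \<Longrightarrow> f differentiable (at z)"
  by simp

lemma Ck_continuous: "Ck n f \<Longrightarrow> continuous_on S f"
proof (cases n)
  case 0
  then show "Ck n f \<Longrightarrow> continuous_on S f" by (auto intro: continuous_on_subset)
next
  case (Suc m)
  then show "Ck n f \<Longrightarrow> continuous_on S f" 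
    by (intro continuous_at_imp_continuous_on ballI differentiable_imp_continuous_within) auto
qed

lemma Ck_dir_deriv: "Ck (Suc n) f \<Longrightarrow> v = 1 \<or> v = \<i> \<Longrightarrow> Ck n (dir_deriv v f)"
  by auto

lemma Ck_SucI:
  assumes "\<And>z. f differentiable (at z)" "\<And>v. v = 1 \<or> v = \<i> \<Longrightarrow> Ck n (dir_deriv v f)"
  shows "Ck (Suc n) f"
  using assms by auto

lemma Ck_SucD: "Ck (Suc n) f \<Longrightarrow> Ck n f"
proof (induction n arbitrary: f)
  case 0
  then show ?case using Ck_continuous by (metis Ck.simps(1))
next
  case (Suc n)
  show ?case
    by (rule Ck_SucI) (rule Ck_differentiable[OF Suc.prems] Suc.IH Ck_dir_deriv[OF Suc.prems] | assumption)+
qed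

lemma dir_deriv_const [simp]: "dir_deriv v (\<lambda>z. c) = (\<lambda>z. 0)"
  by (rule ext, rule dir_deriv_eq) auto

lemma Ck_const: "Ck n (\<lambda>z. c)"
  by (induction n arbitrary: c) auto

lemma dir_deriv_linear: "bounded_linear f \<Longrightarrow> dir_deriv v f = (\<lambda>z. f v)"
  by (rule ext, rule dir_deriv_eq) (rule bounded_linear_imp_has_derivative)

lemma Ck_linear: "bounded_linear f \<Longrightarrow> Ck n f"
  by (cases n) (simp_all add: dir_deriv_linear linear_continuous_on bounded_linear_imp_differentiable Ck_const)

lemma Ck_Re: "Ck n Re" and Ck_Im: "Ck n Im"
  by (auto intro: Ck_linear bounded_linear_Re bounded_linear_Im)

lemma dir_deriv_add:
  assumes "f differentiable (at z)" "g differentiable (at z)"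
  shows "dir_deriv v (\<lambda>z. f z + g z) z = dir_deriv v f z + dir_deriv v g z"
  by (rule dir_deriv_eq) (intro has_derivative_add dir_deriv_works assms)

lemma Ck_add: "Ck n f \<Longrightarrow> Ck n g \<Longrightarrow> Ck n (\<lambda>z. f z + g z)"
proof (induction n arbitrary: f g)
  case (Suc n)
  have "dir_deriv v (\<lambda>z. f z + g z) = (\<lambda>z. dir_deriv v f z + dir_deriv v g z)" for v
    using Suc.prems by (intro ext dir_deriv_add) auto
  moreover have "Ck n (\<lambda>z. dir_deriv v f z + dir_deriv v g z)" if "v = 1 \<or> v = \<i>" for v
    by (rule Suc.IH) (rule Ck_dir_deriv[OF Suc.prems(1) that] Ck_dir_deriv[OF Suc.prems(2) that])+
  moreover have "(\<lambda>z. f z + g z) differentiable (at z)" for z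
    using Suc.prems by (simp add: differentiable_add)
  ultimately show ?case by (intro Ck_SucI) simp_all
qed (simp add: continuous_on_add)

lemma dir_deriv_mult:
  assumes "f differentiable (at z)" "g differentiable (at z)"
  shows "dir_deriv v (\<lambda>z. f z * g z) z = f z * dir_deriv v g z + dir_deriv v f z * g z"
  by (rule dir_deriv_eq) (intro has_derivative_mult dir_deriv_works assms)

lemma Ck_mult: "Ck n f \<Longrightarrow> Ck n g \<Longrightarrow> Ck n (\<lambda>z. f z * g z)"
proof (induction n arbitrary: f g)
  case (Suc n)
  have "dir_deriv v (\<lambda>z. f z * g z) = (\<lambda>z. f z * dir_deriv v g z + dir_deriv v f z * g z)" for v
    using Suc.prems by (intro ext dir_deriv_mult) auto
  moreover have "Ck n (\<lambda>z. f z * dir_deriv v g z + dir_deriv v f z * g z)" if "v = 1 \<or> v = \<i>" for v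
    by (rule Ck_add; rule Suc.IH)
       (rule Ck_SucD[OF Suc.prems(1)] Ck_SucD[OF Suc.prems(2)]
          Ck_dir_deriv[OF Suc.prems(1) that] Ck_dir_deriv[OF Suc.prems(2) that])+
  moreover have "(\<lambda>z. f z * g z) differentiable (at z)" for z
    using Suc.prems by (simp add: differentiable_mult)
  ultimately show ?case by (intro Ck_SucI) simp_all
qed (simp add: continuous_on_mult)

lemma Ck_cmult: "Ck n f \<Longrightarrow> Ck n (\<lambda>z. c * f z)"
  by (intro Ck_mult Ck_const)

lemma Ck_diff: "Ck n f \<Longrightarrow> Ck n g \<Longrightarrow> Ck n (\<lambda>z. f z - g z)"
  using Ck_add[of n f "\<lambda>z. (-1) * g z"] Ck_cmult[of n g "-1"] by simp

lemma Ck_prod: "finite I \<Longrightarrow> (\<And>i. i \<in> I \<Longrightarrow> Ck n (f i)) \<Longrightarrow> Ck n (\<lambda>z. \<Prod>i\<in>I. f i z)"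
proof (induction I rule: finite_induct)
  case (insert x F)
  then show ?case using Ck_mult[of n "f x"] by simp
qed (simp add: Ck_const)

lemma Ck_power: "Ck n f \<Longrightarrow> Ck n (\<lambda>z. f z ^ m)"
proof (induction m)
  case (Suc m)
  then show ?case using Ck_mult[of n f "\<lambda>z. f z ^ m"] by simp
qed (simp add: Ck_const)

lemma dir_deriv_compose:
  assumes "(h has_real_derivative h') (at (f z))" "f differentiable (at z)"
  shows "(\<lambda>z. h (f z)) differentiable (at z)"
    and "dir_deriv v (\<lambda>z. h (f z)) z = h' * dir_deriv v f z"
proof -
  have *: "((\<lambda>z. h (f z)) has_derivative (\<lambda>v. h' * dir_deriv v f z)) (at z)"
    using has_derivative_compose[OF dir_deriv_works[OF assms(2)], of h "(*) h'"] assms(1)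
    by (simp add: has_field_derivative_def)
  then show "(\<lambda>z. h (f z)) differentiable (at z)" by (auto simp: differentiable_def)
  show "dir_deriv v (\<lambda>z. h (f z)) z = h' * dir_deriv v f z"
    using dir_deriv_eq[OF *] .
qed

text \<open>\<open>Q\<close> stands for a class of one-variable functions that is closed under
  differentiation along the range of \<open>f\<close>. Carrying a class instead of a single function
  lets the induction on the order pass from h to h'.\<close>

lemma Ck_compose:
  assumes Q: "\<And>h. Q h \<Longrightarrow> \<exists>h'. Q h' \<and> (\<forall>z. (h has_real_derivative h' (f z)) (at (f z)))"
    and "Q h" "Ck n f"
  shows "Ck n (\<lambda>z. h (f z))"
  using assms(2,3)
proof (induction n arbitrary: h)
  case 0
  then obtain h' where "\<And>z. (h has_real_derivative h' (f z)) (at (f z))" using Q by blast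
  then have "\<And>z. isCont h (f z)" using DERIV_isCont by blast
  moreover have "isCont f z" for z using 0 by (simp add: continuous_on_eq_continuous_at)
  ultimately show ?case by (simp add: continuous_on_eq_continuous_at isCont_o2)
next
  case (Suc n)
  then obtain h' where h': "Q h'" "\<And>z. (h has_real_derivative h' (f z)) (at (f z))" using Q by blast
  have f: "f differentiable (at z)" for z using Suc.prems by simp
  have "dir_deriv v (\<lambda>z. h (f z)) = (\<lambda>z. h' (f z) * dir_deriv v f z)" for v
    using dir_deriv_compose(2)[OF h'(2) f] by blast
  moreover have "Ck n (\<lambda>z. h' (f z))"
    by (rule Suc.IH) (use h' Ck_SucD[OF Suc.prems(2)] in auto)
  moreover have "Ck n (\<lambda>z. h' (f z) * dir_deriv v f z)" if "v = 1 \<or> v = \<i>" for v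
    by (rule Ck_mult) (fact, rule Ck_dir_deriv[OF Suc.prems(2) that])
  ultimately show ?case 
    using dir_deriv_compose(1)[OF h'(2) f] by (intro Ck_SucI) simp_all
qed

lemma Ck_powr:
  assumes "Ck n f" "\<And>z. f z > 0"
  shows "Ck n (\<lambda>z. f z powr a)"
proof -
  have "Ck n (\<lambda>z. (\<lambda>x. 1 * x powr a) (f z))"
  proof (rule Ck_compose[where Q = "\<lambda>h. \<exists>c a. h = (\<lambda>x. c * x powr a)", OF _ _ assms(1)])
    fix h assume "\<exists>c a. h = (\<lambda>x::real. c * x powr a)"
    then obtain c a where h: "h = (\<lambda>x. c * x powr a)" by blast
    have D: "(h has_real_derivative (c * a) * f z powr (a - 1)) (at (f z))" for z
      unfolding h using assms(2)[of z] by (auto intro!: derivative_eq_intros)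
    show "\<exists>h'. (\<exists>c a. h' = (\<lambda>x. c * x powr a)) \<and> (\<forall>z. (h has_real_derivative h' (f z)) (at (f z)))"
      by (rule exI[of _ "\<lambda>x. (c * a) * x powr (a - 1)"], rule conjI, rule exI, rule exI, rule refl, rule allI, rule D)
  qed (intro exI, rule refl)
  then show ?thesis by simp
qed

section \<open>Flat functions and smooth cut-offs\<close>

text \<open>The extra power \<open>t ^ n\<close> serves the induction: \<open>pCons\<close> moves
  one factor t from the polynomial into it.\<close>

lemma poly_exp_tendsto_0: "((\<lambda>t. t ^ n * poly p t / exp t) \<longlongrightarrow> (0::real)) at_top"
proof (induction p arbitrary: n)
  case (pCons a p)
  have 1: "((\<lambda>t. a * (t ^ n / exp t)) \<longlongrightarrow> a * 0) at_top"
    by (rule tendsto_mult_left) (rule tendsto_power_div_exp_0)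
  have "((\<lambda>t. a * (t ^ n / exp t) + t ^ Suc n * poly p t / exp t) \<longlongrightarrow> a * 0 + 0) at_top"
    by (rule tendsto_add[OF 1 pCons.IH])
  moreover have "a * (t ^ n / exp t) + t ^ Suc n * poly p t / exp t = t ^ n * poly (pCons a p) t / exp t" for t
    by (simp add: algebra_simps add_divide_distrib)
  ultimately show ?case by simp
qed simp

text \<open>A whole family indexed by polynomials in 1/x, because it is stable under
  differentiation, whereas the single function exp (-1/x) is not.\<close>

definition flat :: "real poly \<Rightarrow> real \<Rightarrow> real" where
  "flat p x = (if x > 0 then poly p (1 / x) * exp (- (1 / x)) else 0)"

text \<open>With t = 1/x, the derivative of p(t) exp(-t) in x is (p(t) - p'(t)) t^2 exp(-t), and
  \<open>[:0, 0, 1:]\<close> is the polynomial t^2. At x = 0 the right difference quotient is t p(t)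
  exp(-t), which tends to 0.\<close>

lemma flat_has_derivative:
  "(flat p has_real_derivative flat ((p - pderiv p) * [:0, 0, 1:]) x) (at x)"
proof (cases x "0::real" rule: linorder_cases)
  case less
  have "((\<lambda>_. 0) has_real_derivative 0) (at x)" by simp
  then have "(flat p has_real_derivative 0) (at x)"
    by (rule has_field_derivative_transform_within_open[where S = "{..<0}"])
       (use less in \<open>auto simp: flat_def\<close>)
  then show ?thesis using less by (simp add: flat_def)
next
  case greater
  have "((\<lambda>x. poly p (1 / x) * exp (- (1 / x))) has_real_derivative
      poly ((p - pderiv p) * [:0, 0, 1:]) (1 / x) * exp (- (1 / x))) (at x)"
    using greater 
    by (auto intro!: derivative_eq_intros DERIV_chain'[where g = "poly p"] poly_DERIV 
        simp: field_simps power2_eq_square)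
  then have "(flat p has_real_derivative poly ((p - pderiv p) * [:0, 0, 1:]) (1 / x) * exp (- (1 / x))) (at x)"
    by (rule has_field_derivative_transform_within_open[where S = "{0<..}"])
       (use greater in \<open>auto simp: flat_def\<close>)
  then show ?thesis using greater by (simp add: flat_def)
next
  case equal
  have "((\<lambda>x. (inverse x) ^ 1 * poly p (inverse x) / exp (inverse x)) \<longlongrightarrow> 0) (at_right (0::real))"
    by (rule filterlim_compose[OF poly_exp_tendsto_0 filterlim_inverse_at_top_right])
  then have "((\<lambda>h. flat p h / h) \<longlongrightarrow> 0) (at_right 0)"
    by (rule Lim_transform_eventually)
       (auto simp: eventually_at_filter flat_def exp_minus field_simps)
  moreover have "((\<lambda>h. flat p h / h) \<longlongrightarrow> 0) (at_left 0)"
    by (rule Lim_transform_eventually[OF tendsto_const])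
       (auto simp: eventually_at_filter flat_def)
  ultimately have "((\<lambda>h. flat p h / h) \<longlongrightarrow> 0) (at 0)"
    by (simp add: filterlim_split_at)
  then show ?thesis using equal by (simp add: flat_def DERIV_def)
qed

lemma Ck_flat: 
  assumes "Ck n f"
  shows "Ck n (\<lambda>z. flat p (f z))"
proof (rule Ck_compose[where Q = "\<lambda>h. \<exists>p. h = flat p" and f = f])
  show "\<exists>h'. (\<exists>p. h' = flat p) \<and> (\<forall>z. (h has_real_derivative h' (f z)) (at (f z)))"
    if "\<exists>p. h = flat p" for h
    using flat_has_derivative that by metis
  show "\<exists>q. flat p = flat q" by (rule exI, rule refl)
qed (rule assms)

text \<open>The quotient is written with exponent -1 so that \<open>Ck_powr\<close> applies; the
  denominator is positive because t and 1 - t are never both nonpositive.\<close>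

definition smooth_step :: "real \<Rightarrow> real" where
  "smooth_step t = flat 1 t * (flat 1 t + flat 1 (1 - t)) powr (-1)"

lemma flat_1: "flat 1 t \<ge> 0" "flat 1 t > 0 \<longleftrightarrow> t > 0" "t \<le> 0 \<Longrightarrow> flat 1 t = 0"
  by (auto simp: flat_def)

lemma smooth_step_denom: "flat 1 t + flat 1 (1 - t) > 0"
  using flat_1[of t] flat_1[of "1 - t"] by (cases "t > 0") auto

lemma smooth_step:
  "smooth_step t \<ge> 0" "smooth_step t \<le> 1" "t \<le> 0 \<Longrightarrow> smooth_step t = 0" "t \<ge> 1 \<Longrightarrow> smooth_step t = 1"
  using flat_1[of t] flat_1[of "1 - t"] smooth_step_denom[of t]
  by (auto simp: smooth_step_def powr_minus_divide divide_simps)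

lemma Ck_smooth_step: "Ck n f \<Longrightarrow> Ck n (\<lambda>z. smooth_step (f z))"
  unfolding smooth_step_def
  by (intro Ck_mult Ck_powr Ck_add Ck_flat Ck_diff Ck_const smooth_step_denom)

text \<open>The argument of \<open>smooth_step\<close> is (4 r^2 - |z - x|^2) / (3 r^2): at least 1
  within distance r of x and at most 0 beyond distance 2 r. The squared distance is smooth, being a
  polynomial in Re and Im.\<close>

definition bump :: "complex \<Rightarrow> real \<Rightarrow> complex \<Rightarrow> real" where
  "bump x r z = smooth_step ((4 * r\<^sup>2 - ((Re z - Re x)\<^sup>2 + (Im z - Im x)\<^sup>2)) * (1 / (3 * r\<^sup>2)))"

lemma bump:
  assumes "r > 0"
  shows "bump x r z \<ge> 0" "bump x r z \<le> 1" "z \<in> cball x r \<Longrightarrow> bump x r z = 1"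
    "z \<notin> cball x (2 * r) \<Longrightarrow> bump x r z = 0" "Ck n (bump x r)"
proof -
  have d: "(Re z - Re x)\<^sup>2 + (Im z - Im x)\<^sup>2 = (dist x z)\<^sup>2"
    by (simp add: dist_norm cmod_power2 power2_commute)
  show "bump x r z \<ge> 0" "bump x r z \<le> 1" by (auto simp: bump_def smooth_step)
  show "bump x r z = 1" if "z \<in> cball x r"
  proof -
    have "(dist x z)\<^sup>2 \<le> r\<^sup>2" using that by (intro power_mono) auto
    then show ?thesis using assms unfolding bump_def d by (intro smooth_step) (auto simp: field_simps)
  qed
  show "bump x r z = 0" if "z \<notin> cball x (2 * r)"
  proof -
    have "(2 * r)\<^sup>2 \<le> (dist x z)\<^sup>2" using that assms by (intro power_mono) auto
    then show ?thesis using assms unfolding bump_def d 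
      by (intro smooth_step) (auto simp: field_simps power_mult_distrib)
  qed
  have *: "bump x r = (\<lambda>z. smooth_step ((4 * r\<^sup>2 - ((Re z - Re x)\<^sup>2 + (Im z - Im x)\<^sup>2)) * (1 / (3 * r\<^sup>2))))"
    by (auto simp: bump_def)
  show "Ck n (bump x r)"
    unfolding * by (intro Ck_smooth_step Ck_mult Ck_diff Ck_add Ck_power Ck_const Ck_Re Ck_Im)
qed

lemma dir_deriv_translate: "dir_deriv v (\<lambda>z. f (z + b)) z = dir_deriv v f (z + b)"
proof -
  have *: "((\<lambda>z. g (z + c)) has_derivative D) (at y)" if "(g has_derivative D) (at (y + c))"
    for g :: "complex \<Rightarrow> real" and c D y
  proof -
    have "((\<lambda>z. z + c) has_derivative (\<lambda>z. z)) (at y)"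
      by (auto intro!: derivative_eq_intros)
    from has_derivative_compose[OF this that] show ?thesis .
  qed
  have "((\<lambda>z. f (z + b)) has_derivative D) (at z) \<longleftrightarrow> (f has_derivative D) (at (z + b))" for D
    using *[of f D z b] *[of "\<lambda>z. f (z + b)" D "z + b" "-b"] by auto
  then show ?thesis by (simp add: dir_deriv_def frechet_derivative_def)
qed

lemma Ck_translate: "Ck n f \<Longrightarrow> Ck n (\<lambda>z. f (z + b))"
proof (induction n arbitrary: f)
  case 0
  then have "continuous_on UNIV f" by simp
  then have "continuous_on UNIV (\<lambda>z. f (z + b))"
    by (rule continuous_on_compose2) (intro continuous_on_add continuous_on_id continuous_on_const, simp)
  then show ?case by simp
next
  case (Suc n)
  have "(\<lambda>z. f (z + b)) differentiable (at z)" for z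
    using differentiable_chain_at[of "\<lambda>z. z + b" z f] Ck_differentiable[OF Suc.prems] by (simp add: o_def)
  moreover have "dir_deriv v (\<lambda>z. f (z + b)) = (\<lambda>z. dir_deriv v f (z + b))" for v
    by (rule ext) (rule dir_deriv_translate)
  ultimately show ?case using Suc.IH[OF Ck_dir_deriv[OF Suc.prems]] by (intro Ck_SucI) simp_all
qed

lemma laplace_translate: "laplace (\<lambda>z. f (z + b)) z = laplace f (z + b)"
proof -
  have *: "dir_deriv v (\<lambda>z. g (z + b)) = (\<lambda>z. dir_deriv v g (z + b))" for g v
    by (rule ext) (rule dir_deriv_translate)
  show ?thesis unfolding laplace_def *[of _ f] *[of _ "dir_deriv _ f"] ..
qed

text \<open>Finitely many discs whose closed doubles stay inside U cover K. One minus the product of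
  the \<open>1 - bump\<close> is 1 as soon as one bump is 1, and 0 off all the doubles. The value 1
  on an open set W, not only on K, makes all derivatives of \<eta> vanish on K.\<close>

lemma smooth_Urysohn:
  assumes "compact K" "open U" "K \<subseteq> U"
  obtains \<eta> :: "complex \<Rightarrow> real" and W C where "\<And>n. Ck n \<eta>" "\<And>z. 0 \<le> \<eta> z" "\<And>z. \<eta> z \<le> 1"
    "open W" "K \<subseteq> W" "\<And>z. z \<in> W \<Longrightarrow> \<eta> z = 1"
    "compact C" "C \<subseteq> U" "\<And>z. z \<notin> C \<Longrightarrow> \<eta> z = 0"
proof -
  have "\<exists>r>0. cball x (2 * r) \<subseteq> U" if "x \<in> K" for x
  proof -
    have "x \<in> U" using that assms(3) by (rule subsetD[rotated])
    then obtain e where "e > 0" "cball x e \<subseteq> U" using open_contains_cball_eq[OF assms(2)] by metis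
    then show ?thesis by (intro exI[of _ "e/2"] conjI) simp_all
  qed
  then obtain r where r: "\<And>x. x \<in> K \<Longrightarrow> r x > 0" "\<And>x. x \<in> K \<Longrightarrow> cball x (2 * r x) \<subseteq> U" by metis
  have "K \<subseteq> (\<Union>x\<in>K. ball x (r x))" using r(1) by force
  then obtain I where I: "I \<subseteq> K" "finite I" "K \<subseteq> (\<Union>x\<in>I. ball x (r x))"
    using compactE_image[OF assms(1), of K "\<lambda>x. ball x (r x)"] by (metis open_ball)
  define \<eta> where "\<eta> = (\<lambda>z. 1 - (\<Prod>x\<in>I. (1 - bump x (r x) z)))"
  have r0: "r x > 0" if "x \<in> I" for x using r I that by blast
  have p: "0 \<le> (\<Prod>x\<in>I. (1 - bump x (r x) z))" "(\<Prod>x\<in>I. (1 - bump x (r x) z)) \<le> 1" for z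
    using bump[OF r0] by (auto intro!: prod_nonneg prod_le_1)
  show thesis
  proof (rule that[of \<eta> "\<Union>x\<in>I. ball x (r x)" "\<Union>x\<in>I. cball x (2 * r x)"])
    show "Ck n \<eta>" for n unfolding \<eta>_def 
      using bump(5)[OF r0] I(2) by (intro Ck_diff Ck_const Ck_prod) auto
    show "0 \<le> \<eta> z" "\<eta> z \<le> 1" for z using p[of z] by (auto simp: \<eta>_def)
    show "\<eta> z = 1" if "z \<in> (\<Union>x\<in>I. ball x (r x))" for z
    proof -
      obtain x where x: "x \<in> I" "z \<in> ball x (r x)" using \<open>z \<in> _\<close> by blast
      then have "bump x (r x) z = 1" using bump(3)[OF r0] by auto
      then have "(\<Prod>x\<in>I. (1 - bump x (r x) z)) = 0" using x I(2) by (intro prod_zero) auto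
      then show ?thesis by (simp add: \<eta>_def)
    qed
    show "\<eta> z = 0" if "z \<notin> (\<Union>x\<in>I. cball x (2 * r x))" for z
    proof -
      have "bump x (r x) z = 0" if "x \<in> I" for x
        using bump(4)[OF r0[OF that]] \<open>z \<notin> _\<close> that by auto
      then show ?thesis by (simp add: \<eta>_def)
    qed
    show "compact (\<Union>x\<in>I. cball x (2 * r x))" using I by auto
    show "(\<Union>x\<in>I. cball x (2 * r x)) \<subseteq> U" using r I by blast
  qed (use I in auto)
qed


section \<open>Test functions on open sets\<close>

text \<open>Relative to an arbitrary set, because most arguments localize to an open part of the
  disc on which a function is harmonic or two functions agree.\<close>

definition test_on :: "complex set \<Rightarrow> (complex \<Rightarrow> real) \<Rightarrow> bool" where
  "test_on S \<phi> \<longleftrightarrow> (\<forall>n. Ck n \<phi>) \<and> (\<exists>K. compact K \<and> K \<subseteq> S \<and> (\<forall>z. z \<notin> K \<longrightarrow> \<phi> z = 0))"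

lemma test_function_eq: "test_function = test_on unit_disc"
  by (auto simp: fun_eq_iff test_function_def test_on_def)

lemma test_on_mono: "test_on S \<phi> \<Longrightarrow> S \<subseteq> T \<Longrightarrow> test_on T \<phi>"
  unfolding test_on_def by blast

lemma test_onI:
  "(\<And>n. Ck n \<phi>) \<Longrightarrow> compact K \<Longrightarrow> K \<subseteq> S \<Longrightarrow> (\<And>z. z \<notin> K \<Longrightarrow> \<phi> z = 0) \<Longrightarrow> test_on S \<phi>"
  unfolding test_on_def by blast

lemma test_on_Ck: "test_on S \<phi> \<Longrightarrow> Ck n \<phi>"
  by (simp add: test_on_def)

lemma test_on_add:
  assumes "test_on S f" "test_on S g"
  shows "test_on S (\<lambda>z. f z + g z)"
proof -
  obtain K L where "compact K" "K \<subseteq> S" "\<And>z. z \<notin> K \<Longrightarrow> f z = 0" "compact L" "L \<subseteq> S" "\<And>z. z \<notin> L \<Longrightarrow> g z = 0"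
    using assms unfolding test_on_def by metis
  then show ?thesis
    using assms by (intro test_onI[of _ "K \<union> L"] Ck_add) (auto simp: test_on_Ck)
qed

lemma test_on_mult:
  assumes "test_on S f" "\<And>n. Ck n g"
  shows "test_on S (\<lambda>z. f z * g z)" "test_on S (\<lambda>z. g z * f z)"
proof -
  obtain K where "compact K" "K \<subseteq> S" "\<And>z. z \<notin> K \<Longrightarrow> f z = 0"
    using assms unfolding test_on_def by metis
  then show "test_on S (\<lambda>z. f z * g z)" "test_on S (\<lambda>z. g z * f z)"
    using assms by (auto intro!: test_onI[of _ K] Ck_mult simp: test_on_Ck)
qed

lemma test_on_cmult: "test_on S f \<Longrightarrow> test_on S (\<lambda>z. c * f z)"
  by (rule test_on_mult(2)) (assumption, rule Ck_const)

lemma test_on_diff: "test_on S f \<Longrightarrow> test_on S g \<Longrightarrow> test_on S (\<lambda>z. f z - g z)"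
  using test_on_add[of S f "\<lambda>z. (-1) * g z"] test_on_cmult[of S g "-1"] by simp

lemma Ck_dir_deriv_all:
  assumes "\<And>n. Ck n f"
  shows "Ck n (dir_deriv v f)"
proof -
  have "dir_deriv v f = (\<lambda>z. Re v * dir_deriv 1 f z + Im v * dir_deriv \<i> f z)"
    using assms[of "Suc n"] by (intro ext dir_deriv_decompose) auto
  then show ?thesis using assms[of "Suc n"] by (auto intro!: Ck_add Ck_cmult)
qed

lemma test_on_dir_deriv:
  assumes "test_on S f"
  shows "test_on S (dir_deriv v f)"
proof -
  obtain K where K: "compact K" "K \<subseteq> S" "\<And>z. z \<notin> K \<Longrightarrow> f z = 0"
    using assms unfolding test_on_def by metis
  have "dir_deriv v f z = 0" if "z \<notin> K" for z
    using dir_deriv_cong_open[of "- K" z f "\<lambda>_. 0" v] K that by (simp add: open_Compl compact_imp_closed)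
  then show ?thesis using K Ck_dir_deriv_all test_on_Ck[OF assms] by (intro test_onI[of _ K]) auto
qed

lemma test_on_laplace: "test_on S f \<Longrightarrow> test_on S (laplace f)"
  unfolding laplace_def[abs_def] by (intro test_on_add test_on_dir_deriv)

lemma dir_deriv_add_all:
  "(\<And>n. Ck n f) \<Longrightarrow> (\<And>n. Ck n g) \<Longrightarrow> dir_deriv v (\<lambda>z. f z + g z) = (\<lambda>z. dir_deriv v f z + dir_deriv v g z)"
  by (intro ext dir_deriv_add Ck_differentiable)

lemma dir_deriv_cmult_all:
  assumes "\<And>n. Ck n f"
  shows "dir_deriv v (\<lambda>z. c * f z) = (\<lambda>z. c * dir_deriv v f z)"
proof
  fix z show "dir_deriv v (\<lambda>z. c * f z) z = c * dir_deriv v f z"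
    using dir_deriv_mult[of "\<lambda>_. c" z f v] Ck_differentiable[OF assms] by simp
qed

lemma laplace_add:
  assumes "\<And>n. Ck n f" "\<And>n. Ck n g"
  shows "laplace (\<lambda>z. f z + g z) z = laplace f z + laplace g z"
  using assms by (simp add: laplace_def dir_deriv_add_all Ck_dir_deriv_all)

lemma laplace_cmult:
  assumes "\<And>n. Ck n f"
  shows "laplace (\<lambda>z. c * f z) z = c * laplace f z"
  using assms by (simp add: laplace_def dir_deriv_cmult_all Ck_dir_deriv_all algebra_simps)

lemma Ck_borel [measurable_dest]: "Ck n f \<Longrightarrow> f \<in> borel_measurable borel"
  by (intro borel_measurable_continuous_onI Ck_continuous)

lemma test_on_borel: "test_on S f \<Longrightarrow> f \<in> borel_measurable borel"
  using Ck_borel test_on_Ck by blast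

lemma test_on_bounded:
  assumes "test_on S f"
  obtains B where "B > 0" "\<And>z. \<bar>f z\<bar> \<le> B"
proof -
  obtain K where K: "compact K" "K \<subseteq> S" "\<And>z. z \<notin> K \<Longrightarrow> f z = 0"
    using assms unfolding test_on_def by metis
  have "bounded (f ` K)"
    using K Ck_continuous[OF test_on_Ck[OF assms]] by (intro compact_imp_bounded compact_continuous_image)
  then obtain B where "\<And>z. z \<in> K \<Longrightarrow> \<bar>f z\<bar> \<le> B" by (auto simp: bounded_iff)
  then have "\<bar>f z\<bar> \<le> max B 1" for z using K(3)[of z] by (cases "z \<in> K") force+
  then show thesis by (intro that[of "max B 1"]) auto
qed

lemma test_on_support_ball:
  assumes "test_on S f"
  obtains R where "R > 0" "\<And>z. z \<notin> ball 0 R \<Longrightarrow> f z = 0"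
proof -
  obtain K where K: "compact K" "K \<subseteq> S" "\<And>z. z \<notin> K \<Longrightarrow> f z = 0"
    using assms unfolding test_on_def by metis
  then obtain R where "R > 0" "K \<subseteq> ball 0 R"
    using compact_imp_bounded bounded_subset_ballD by blast
  then show thesis using K that by blast
qed

lemma integrable_bounded_support:
  fixes f :: "complex \<Rightarrow> real"
  assumes [measurable]: "f \<in> borel_measurable borel" 
    and "\<And>z. \<bar>f z\<bar> \<le> B" "\<And>z. z \<notin> ball 0 R \<Longrightarrow> f z = 0"
  shows "integrable lborel f"
  by (rule integrableI_bounded_set[where A = "ball 0 R" and B = B])
     (use assms emeasure_bounded_finite[of "ball 0 R"] in \<open>auto simp: bounded_ball\<close>)

lemma test_on_integrable: "test_on S f \<Longrightarrow> integrable lborel f"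
  by (metis integrable_bounded_support test_on_borel test_on_bounded test_on_support_ball)

lemma circle_integrable_continuous:
  fixes f :: "complex \<Rightarrow> 'a :: euclidean_space"
  shows "continuous_on UNIV f \<Longrightarrow> integrable circle_measure f"
  by (rule integral_circle_measure)
     (auto intro: continuous_on_subset borel_measurable_continuous_onI)

section \<open>Subharmonic functions have a positive Laplacian\<close>

lemma dir_deriv_scale:
  assumes "f differentiable (at z)"
  shows "dir_deriv (of_real h * v) f z = h * dir_deriv v f z"
  using linear_scale[OF has_derivative_linear[OF dir_deriv_works[OF assms]], of h v]
  by (simp add: scaleR_conv_of_real)

lemma iterated_dir_deriv_smooth: "(\<And>n. Ck n f) \<Longrightarrow> Ck n ((dir_deriv v ^^ m) f)"
  by (induction m arbitrary: n) (auto intro: Ck_dir_deriv_all)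

text \<open>Supplies a Taylor remainder that is uniform in direction and centre. A derivative along
  a unit vector combines those along 1 and \<i> with coefficients at most 1 in modulus, so the
  constants add up; the induction therefore varies the function.\<close>

lemma iterated_dir_deriv_bounded:
  assumes "test_on S f"
  shows "\<exists>C. \<forall>v z. norm v = 1 \<longrightarrow> \<bar>(dir_deriv v ^^ m) f z\<bar> \<le> C"
  using assms
proof (induction m arbitrary: f)
  case 0
  then show ?case by (metis funpow_0 test_on_bounded)
next
  case (Suc m)
  obtain C D where C: "\<And>v z. norm v = 1 \<Longrightarrow> \<bar>(dir_deriv v ^^ m) (dir_deriv 1 f) z\<bar> \<le> C"
    and D: "\<And>v z. norm v = 1 \<Longrightarrow> \<bar>(dir_deriv v ^^ m) (dir_deriv \<i> f) z\<bar> \<le> D"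
    using Suc.IH[OF test_on_dir_deriv[OF Suc.prems]] by metis
  have lin: "(dir_deriv v ^^ m) (\<lambda>z. a * g z + b * h z) = (\<lambda>z. a * (dir_deriv v ^^ m) g z + b * (dir_deriv v ^^ m) h z)"
    if "\<And>n. Ck n g" "\<And>n. Ck n h" for a b g h v m
    using that
    by (induction m)
       (simp_all add: dir_deriv_add_all dir_deriv_cmult_all iterated_dir_deriv_smooth Ck_cmult)
  have "\<bar>(dir_deriv v ^^ Suc m) f z\<bar> \<le> C + D" if v: "norm v = 1" for v z
  proof -
    have "dir_deriv v f = (\<lambda>z. Re v * dir_deriv 1 f z + Im v * dir_deriv \<i> f z)"
      using test_on_Ck[OF Suc.prems, of 1] by (intro ext dir_deriv_decompose) auto
    then have "(dir_deriv v ^^ Suc m) f z = 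
        Re v * (dir_deriv v ^^ m) (dir_deriv 1 f) z + Im v * (dir_deriv v ^^ m) (dir_deriv \<i> f) z"
      using test_on_Ck[OF test_on_dir_deriv[OF Suc.prems]]
      by (simp add: funpow_Suc_right lin del: funpow.simps)
    also have "\<bar>\<dots>\<bar> \<le> \<bar>Re v\<bar> * \<bar>(dir_deriv v ^^ m) (dir_deriv 1 f) z\<bar> + \<bar>Im v\<bar> * \<bar>(dir_deriv v ^^ m) (dir_deriv \<i> f) z\<bar>"
      by (metis abs_mult abs_triangle_ineq)
    also have "\<dots> \<le> 1 * C + 1 * D"
      using C[OF v] D[OF v] abs_Re_le_cmod[of v] abs_Im_le_cmod[of v] v
      by (intro add_mono mult_mono) auto
    finally show ?thesis by simp
  qed
  then show ?case by blast
qed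

lemma second_dir_deriv:
  assumes "\<And>n. Ck n f"
  shows "dir_deriv v (dir_deriv v f) z = (Re v)\<^sup>2 * dir_deriv 1 (dir_deriv 1 f) z
    + Re v * Im v * (dir_deriv 1 (dir_deriv \<i> f) z + dir_deriv \<i> (dir_deriv 1 f) z)
    + (Im v)\<^sup>2 * dir_deriv \<i> (dir_deriv \<i> f) z"
proof -
  have *: "dir_deriv v g = (\<lambda>z. Re v * dir_deriv 1 g z + Im v * dir_deriv \<i> g z)" 
    if "\<And>n. Ck n g" for v g
    using that[of 1] by (intro ext dir_deriv_decompose) auto
  have "dir_deriv v (dir_deriv v f) z = 
    Re v * dir_deriv 1 (dir_deriv v f) z + Im v * dir_deriv \<i> (dir_deriv v f) z"
    using *[OF Ck_dir_deriv_all[OF assms]] by metis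
  also have "\<dots> = Re v * dir_deriv 1 (\<lambda>z. Re v * dir_deriv 1 f z + Im v * dir_deriv \<i> f z) z + 
      Im v * dir_deriv \<i> (\<lambda>z. Re v * dir_deriv 1 f z + Im v * dir_deriv \<i> f z) z"
    using *[OF assms, of v] by simp
  also have "\<dots> = (Re v)\<^sup>2 * dir_deriv 1 (dir_deriv 1 f) z
    + Re v * Im v * (dir_deriv 1 (dir_deriv \<i> f) z + dir_deriv \<i> (dir_deriv 1 f) z)
    + (Im v)\<^sup>2 * dir_deriv \<i> (dir_deriv \<i> f) z"
    using assms by (simp add: dir_deriv_add_all dir_deriv_cmult_all Ck_dir_deriv_all Ck_cmult)
      (simp add: algebra_simps power2_eq_square)
  finally show ?thesis .
qed

text \<open>Taylor expansion along the radii: the first-order term and the mixed second-order term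
  have mean 0, the squares have mean 1/2, so the second-order coefficient s^2/2 averages to s^2/4
  times the Laplacian.\<close>

lemma circle_mean_laplace:
  assumes "test_on S \<phi>"
  obtains C where "\<And>z s. 0 < s \<Longrightarrow> 
    \<bar>(LINT w|circle_measure. \<phi> (z - of_real s * w)) - \<phi> z - s\<^sup>2 / 4 * laplace \<phi> z\<bar> \<le> C * s ^ 3"
proof -
  obtain C where C: "\<And>v z. norm v = 1 \<Longrightarrow> \<bar>(dir_deriv v ^^ 3) \<phi> z\<bar> \<le> C"
    using iterated_dir_deriv_bounded[OF assms, of 3] by blast
  note sm = test_on_Ck[OF assms]
  have taylor: "\<bar>\<phi> (z - of_real s * w) - \<phi> z - s * dir_deriv (-w) \<phi> z - s\<^sup>2 / 2 * dir_deriv (-w) (dir_deriv (-w) \<phi>) z\<bar> \<le> C * s ^ 3"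
    if "norm w = 1" "s > 0" for w z s
  proof -
    \<comment> \<open>The m-th derivative of t -> \<phi>(z - t w), the data for Maclaurin's formula
      in one variable.\<close>
    define diff where "diff m t = (dir_deriv (-w) ^^ m) \<phi> (z + of_real t * (-w))" for m :: nat and t :: real
    have "(diff m has_real_derivative diff (Suc m) t) (at t)" for m t
    proof -
      have g: "(dir_deriv (-w) ^^ m) \<phi> differentiable at x" for x
        using Ck_differentiable[OF iterated_dir_deriv_smooth[OF sm]] .
      have "((\<lambda>t. z + of_real t * (-w)) has_derivative (\<lambda>h. of_real h * (-w))) (at t)"
        by (auto intro!: derivative_eq_intros)
      from has_derivative_compose[OF this dir_deriv_works[OF g]]
      have "(diff m has_derivative (\<lambda>h. dir_deriv (of_real h * (-w)) ((dir_deriv (-w) ^^ m) \<phi>) (z + of_real t * (-w)))) (at t)"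
        by (simp add: diff_def[abs_def])
      also have "(\<lambda>h. dir_deriv (of_real h * (-w)) ((dir_deriv (-w) ^^ m) \<phi>) (z + of_real t * (-w))) = (*) (diff (Suc m) t)"
        unfolding dir_deriv_scale[OF g] by (simp add: fun_eq_iff diff_def)
      finally show ?thesis by (simp add: has_field_derivative_def)
    qed
    then obtain t where t: "diff 0 s = (\<Sum>m<3. diff m 0 / fact m * s ^ m) + diff 3 t / fact 3 * s ^ 3"
      using Maclaurin_all_le[of diff "diff 0" s 3] by blast
    have "\<phi> (z - of_real s * w) - \<phi> z - s * dir_deriv (-w) \<phi> z - s\<^sup>2 / 2 * dir_deriv (-w) (dir_deriv (-w) \<phi>) z = diff 3 t / 6 * s ^ 3"
      using t by (simp add: diff_def eval_nat_numeral lessThan_Suc fact_reduce)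
    also have "\<bar>\<dots>\<bar> = \<bar>diff 3 t\<bar> * (s ^ 3 / 6)" using that by (simp add: abs_mult)
    also have "\<dots> \<le> C * (s ^ 3 / 1)" using C[of "-w" "z + of_real t * (-w)"] that
      by (intro mult_mono divide_left_mono) (auto simp: diff_def intro: order_trans[OF abs_ge_zero])
    finally show ?thesis by simp
  qed
  have cont: "continuous_on UNIV (\<lambda>w. \<phi> (z - of_real s * w))" for z s
    by (rule continuous_on_compose2[OF Ck_continuous[OF sm[of 0], of UNIV]]) (auto intro!: continuous_intros)
  have "\<bar>(LINT w|circle_measure. \<phi> (z - of_real s * w)) - \<phi> z - s\<^sup>2 / 4 * laplace \<phi> z\<bar> \<le> C * s ^ 3"
    if s: "s > 0" for z s
  proof -
    define d where "d a b = dir_deriv a (dir_deriv b \<phi>) z" for a b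
    have d1: "dir_deriv (-w) \<phi> z = - Re w * dir_deriv 1 \<phi> z - Im w * dir_deriv \<i> \<phi> z" for w
      using dir_deriv_decompose[OF Ck_differentiable[OF sm], of "-w"] by simp
    have d2: "dir_deriv (-w) (dir_deriv (-w) \<phi>) z = (Re w)\<^sup>2 * d 1 1 + Re w * Im w * (d 1 \<i> + d \<i> 1) + (Im w)\<^sup>2 * d \<i> \<i>" for w
      using second_dir_deriv[OF sm, of "-w"] by (simp add: d_def)
    have int: "integrable circle_measure (\<lambda>w. \<phi> (z - of_real s * w))" "integrable circle_measure (\<lambda>w. Re w)"
      "integrable circle_measure (\<lambda>w. Im w)" "integrable circle_measure (\<lambda>w. (Re w)\<^sup>2)" 
      "integrable circle_measure (\<lambda>w. Re w * Im w)" "integrable circle_measure (\<lambda>w. (Im w)\<^sup>2)"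
      by (intro circle_integrable_continuous cont continuous_intros)+
    define E where "E w = \<phi> (z - of_real s * w) - \<phi> z - s * dir_deriv (-w) \<phi> z - s\<^sup>2 / 2 * dir_deriv (-w) (dir_deriv (-w) \<phi>) z" for w
    have E: "E = (\<lambda>w. \<phi> (z - of_real s * w) - \<phi> z + (s * dir_deriv 1 \<phi> z) * Re w + (s * dir_deriv \<i> \<phi> z) * Im w
        - ((s\<^sup>2 / 2 * d 1 1) * (Re w)\<^sup>2 + (s\<^sup>2 / 2 * (d 1 \<i> + d \<i> 1)) * (Re w * Im w) + (s\<^sup>2 / 2 * d \<i> \<i>) * (Im w)\<^sup>2))"
      unfolding E_def d1 d2 by (simp add: fun_eq_iff algebra_simps)
    have "(LINT w|circle_measure. E w) = (LINT w|circle_measure. \<phi> (z - of_real s * w)) - \<phi> z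
        - (s\<^sup>2 / 2 * d 1 1 * (1/2) + s\<^sup>2 / 2 * d \<i> \<i> * (1/2))"
      unfolding E using int circ.prob_space by (simp add: circle_moments)
    then have "(LINT w|circle_measure. \<phi> (z - of_real s * w)) - \<phi> z - s\<^sup>2 / 4 * laplace \<phi> z = (LINT w|circle_measure. E w)"
      by (simp add: laplace_def d_def algebra_simps)
    also have "\<bar>\<dots>\<bar> \<le> C * s ^ 3"
    proof -
      have "norm (LINT w|circle_measure. E w) \<le> (LINT w|circle_measure. norm (E w))"
        by (rule integral_norm_bound)
      also have "\<dots> \<le> (LINT w|circle_measure. C * s ^ 3)"
      proof (rule integral_mono_AE)
        show "integrable circle_measure (\<lambda>w. norm (E w))" unfolding E using int by (intro integrable_norm) auto
        show "AE w in circle_measure. norm (E w) \<le> C * s ^ 3"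
          using taylor s by (intro AE_circleI) (auto simp: E_def)
      qed simp
      finally show ?thesis using circ.prob_space by simp
    qed
    finally show ?thesis .
  qed
  then show thesis using that by blast
qed

lemma lborel_integral_translate:
  fixes f :: "complex \<Rightarrow> real"
  assumes [measurable]: "f \<in> borel_measurable borel"
  shows "(LINT z|lborel. f (z + a)) = (LINT z|lborel. f z)"
proof -
  have "(LINT z|lborel. f z) = (LINT z|distr lborel borel ((+) a). f z)"
    by (simp add: lborel_distr_plus)
  also have "\<dots> = (LINT z|lborel. f (a + z))" by (subst integral_distr) auto
  finally show ?thesis by (simp add: add.commute)
qed

interpretation lbc: pair_sigma_finite "lborel :: complex measure" circle_measure
  by standard

lemma integrable_pair_bounded:
  fixes F :: "complex \<times> complex \<Rightarrow> real"
  assumes [measurable]: "F \<in> borel_measurable (lborel \<Otimes>\<^sub>M circle_measure)" 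
    and "\<And>z w. norm w = 1 \<Longrightarrow> \<bar>F (z, w)\<bar> \<le> B" "\<And>z w. z \<notin> ball 0 R \<Longrightarrow> norm w = 1 \<Longrightarrow> F (z, w) = 0"
  shows "integrable (lborel \<Otimes>\<^sub>M circle_measure) F"
proof -
  have AE: "AE p :: complex \<times> complex in lborel \<Otimes>\<^sub>M circle_measure. norm (snd p) = 1"
  proof (rule lbc.AE_pair_measure)
    show "{p \<in> space (lborel \<Otimes>\<^sub>M circle_measure). norm (snd p) = 1} \<in> sets (lborel \<Otimes>\<^sub>M circle_measure)"
      by measurable
  qed (simp add: AE_circle_norm)
  have fin: "emeasure (lborel \<Otimes>\<^sub>M circle_measure) (ball (0::complex) R \<times> UNIV) < \<infinity>"
    using emeasure_bounded_finite[of "ball 0 R :: complex set"] circ.emeasure_space_1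
    by (subst circ.emeasure_pair_measure_Times) auto
  show ?thesis
  proof (rule integrableI_bounded_set[OF _ assms(1) fin, where B = B])
    show "AE p in lborel \<Otimes>\<^sub>M circle_measure. p \<in> ball 0 R \<times> UNIV \<longrightarrow> norm (F p) \<le> B"
      using AE by eventually_elim (use assms(2) in force)
    show "AE p in lborel \<Otimes>\<^sub>M circle_measure. p \<notin> ball 0 R \<times> UNIV \<longrightarrow> F p = 0"
      using AE by eventually_elim (use assms(3) in force)
  qed auto
qed

text \<open>Averaging over circles of radius s is a symmetric operation, so the nonnegative integral
  of (mean of U - U) \<phi> equals that of U (mean of \<phi> - \<phi>). By Taylor the latter is
  s^2/4 times the integral of U \<Delta>\<phi>, up to O(s^3); divide and let s tend to 0.\<close>

lemma submean_laplace_nonneg: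
  assumes [measurable]: "U \<in> borel_measurable borel" and B: "\<And>z. \<bar>U z\<bar> \<le> B"
    and S: "open S" and sub: "\<And>z s. 0 < s \<Longrightarrow> cball z s \<subseteq> S \<Longrightarrow> U z \<le> (LINT w|circle_measure. U (z + of_real s * w))"
    and \<phi>: "test_on S \<phi>" "\<And>z. \<phi> z \<ge> 0"
  shows "0 \<le> (LINT z|lborel. U z * laplace \<phi> z)"
proof -
  have [measurable]: "\<phi> \<in> borel_measurable borel" "laplace \<phi> \<in> borel_measurable borel"
    using test_on_borel \<phi>(1) test_on_laplace by blast+
  obtain K where K: "compact K" "K \<subseteq> S" "\<And>z. z \<notin> K \<Longrightarrow> \<phi> z = 0"
    using \<phi>(1) unfolding test_on_def by metis
  obtain d where d: "d > 0" "(\<Union>x\<in>K. cball x d) \<subseteq> S"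
    using compact_subset_open_imp_cball_epsilon_subset[OF K(1) S K(2)] by blast
  obtain R0 where R0: "R0 > 0" "\<And>z. z \<notin> ball 0 R0 \<Longrightarrow> \<phi> z = 0"
    using test_on_support_ball[OF \<phi>(1)] by metis
  obtain R1 where R1: "R1 > 0" "\<And>z. z \<notin> ball 0 R1 \<Longrightarrow> laplace \<phi> z = 0"
    using test_on_support_ball[OF test_on_laplace[OF \<phi>(1)]] by metis
  \<comment> \<open>The extra 1 leaves room for shifts by s < 1: off this disc \<phi>, its shifts
    and its Laplacian all vanish.\<close>
  define R where "R = max R0 R1 + 1"
  have R: "\<phi> (z - of_real s * w) = 0" "\<phi> z = 0" "laplace \<phi> z = 0" 
    if "z \<notin> ball 0 R" "norm w = 1" "0 < s" "s < 1" for z w s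
  proof -
    have "norm z \<le> norm (z - of_real s * w) + norm (of_real s * w)" using norm_triangle_ineq[of "z - of_real s * w" "of_real s * w"] by simp
    then have "norm (z - of_real s * w) \<ge> R0" using that by (auto simp: R_def norm_mult)
    then show "\<phi> (z - of_real s * w) = 0" using R0(2) by auto
    show "\<phi> z = 0" "laplace \<phi> z = 0" using R0(2)[of z] R1(2)[of z] that by (auto simp: R_def)
  qed
  obtain P where P: "P > 0" "\<And>z. \<bar>\<phi> z\<bar> \<le> P" using test_on_bounded[OF \<phi>(1)] by metis
  obtain Q where Q: "Q > 0" "\<And>z. \<bar>laplace \<phi> z\<bar> \<le> Q" using test_on_bounded[OF test_on_laplace[OF \<phi>(1)]] by metis
  have B0: "B \<ge> 0" using B[of 0] by linarith
  obtain C where C: "\<And>z s. 0 < s \<Longrightarrow> 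
    \<bar>(LINT w|circle_measure. \<phi> (z - of_real s * w)) - \<phi> z - s\<^sup>2 / 4 * laplace \<phi> z\<bar> \<le> C * s ^ 3"
    using circle_mean_laplace[OF \<phi>(1)] by metis
  define V where "V = measure lborel (ball (0::complex) R)"
  \<comment> \<open>The error term: |U| is at most \<open>B\<close>, the Taylor remainder is at most
    \<open>C * s ^ 3\<close> on a set of area \<open>V\<close>, and everything is divided by
    s^2/4.\<close>
  have key: "- (4 * B * C * V * s) \<le> (LINT z|lborel. U z * laplace \<phi> z)" if s: "0 < s" "s < d" "s < 1" for s
  proof -
    define m where "m z = (LINT w|circle_measure. \<phi> (z - of_real s * w))" for z
    have BP: "\<bar>U x * \<phi> y\<bar> \<le> B * P" for x y
      unfolding abs_mult using B P(2) B0 by (intro mult_mono) auto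
    have i1: "integrable (lborel \<Otimes>\<^sub>M circle_measure) (\<lambda>(z, w). U (z + of_real s * w) * \<phi> z)"
      by (rule integrable_pair_bounded[where B = "B * P" and R = R])
         (use BP R s in auto)
    have i2: "integrable (lborel \<Otimes>\<^sub>M circle_measure) (\<lambda>(z, w). U z * \<phi> (z - of_real s * w))"
      by (rule integrable_pair_bounded[where B = "B * P" and R = R])
         (use BP R s in auto)
    have i3: "integrable lborel (\<lambda>z. U z * \<phi> z)"
      by (rule integrable_bounded_support[where B = "B * P" and R = R]) (use BP R0 in \<open>auto simp: R_def\<close>)
    have i4: "integrable lborel (\<lambda>z. U z * laplace \<phi> z)"
    proof (rule integrable_bounded_support[where B = "B * Q" and R = R])
      show "\<bar>U z * laplace \<phi> z\<bar> \<le> B * Q" for z 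
        unfolding abs_mult using B Q(2) B0 by (intro mult_mono) auto
    qed (use R1 in \<open>auto simp: R_def\<close>)
    have i5: "integrable lborel (\<lambda>z. LINT w|circle_measure. U (z + of_real s * w) * \<phi> z)"
      using lbc.integrable_fst[OF i1] by simp
    have i6: "integrable lborel (\<lambda>z. U z * m z)"
      using lbc.integrable_fst[OF i2] by (simp add: m_def)
    have "0 \<le> (LINT z|lborel. (LINT w|circle_measure. U (z + of_real s * w) * \<phi> z) - U z * \<phi> z)"
    proof (rule Bochner_Integration.integral_nonneg)
      fix z
      show "0 \<le> (LINT w|circle_measure. U (z + of_real s * w) * \<phi> z) - U z * \<phi> z"
      proof (cases "z \<in> K")
        case True
        then have "cball z s \<subseteq> cball z d" using s by auto
        then have "U z \<le> (LINT w|circle_measure. U (z + of_real s * w))"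
          using d(2) True s by (intro sub) auto
        then have "U z * \<phi> z \<le> (LINT w|circle_measure. U (z + of_real s * w)) * \<phi> z"
          by (intro mult_right_mono \<phi>)
        then show ?thesis by simp
      next
        case False
        then show ?thesis using K by simp
      qed
    qed
    also have "\<dots> = (LINT z|lborel. LINT w|circle_measure. U (z + of_real s * w) * \<phi> z) - (LINT z|lborel. U z * \<phi> z)"
      by (rule Bochner_Integration.integral_diff[OF i5 i3])
    also have "(LINT z|lborel. LINT w|circle_measure. U (z + of_real s * w) * \<phi> z) =
        (LINT w|circle_measure. LINT z|lborel. U (z + of_real s * w) * \<phi> z)"
      using lbc.Fubini_integral[OF i1] by simp
    \<comment> \<open>Translation of the inner variable moves the shift from \<open>U\<close> to
      \<phi>; this is the symmetry of circular averaging.\<close>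
    also have "\<dots> = (LINT w|circle_measure. LINT z|lborel. U z * \<phi> (z - of_real s * w))"
    proof (rule Bochner_Integration.integral_cong[OF refl])
      fix w
      show "(LINT z|lborel. U (z + of_real s * w) * \<phi> z) = (LINT z|lborel. U z * \<phi> (z - of_real s * w))"
        using lborel_integral_translate[of "\<lambda>z. U z * \<phi> (z - of_real s * w)" "of_real s * w"] by simp
    qed
    also have "\<dots> = (LINT z|lborel. U z * m z)"
      using lbc.Fubini_integral[OF i2] by (simp add: m_def)
    finally have 1: "0 \<le> (LINT z|lborel. U z * m z) - (LINT z|lborel. U z * \<phi> z)" .
    have e: "(\<lambda>z. U z * (m z - \<phi> z - s\<^sup>2 / 4 * laplace \<phi> z)) =
        (\<lambda>z. U z * m z - U z * \<phi> z - s\<^sup>2 / 4 * (U z * laplace \<phi> z))"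
      by (simp add: fun_eq_iff algebra_simps)
    have 2: "(LINT z|lborel. U z * m z) - (LINT z|lborel. U z * \<phi> z) - s\<^sup>2 / 4 * (LINT z|lborel. U z * laplace \<phi> z)
        = (LINT z|lborel. U z * (m z - \<phi> z - s\<^sup>2 / 4 * laplace \<phi> z))"
      unfolding e using i3 i4 i6 by simp
    also have "\<dots> \<le> (LINT z|lborel. indicator (ball (0::complex) R) z * (B * (C * s ^ 3)))"
    proof (rule Bochner_Integration.integral_mono)
      show "integrable lborel (\<lambda>z. U z * (m z - \<phi> z - s\<^sup>2 / 4 * laplace \<phi> z))"
        unfolding e using i3 i4 i6 by simp
      show "integrable lborel (\<lambda>z. indicator (ball (0::complex) R) z * (B * (C * s ^ 3)))"
        using emeasure_bounded_finite[of "ball 0 R :: complex set"] by auto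
      fix z :: complex
      show "U z * (m z - \<phi> z - s\<^sup>2 / 4 * laplace \<phi> z) \<le> indicator (ball 0 R) z * (B * (C * s ^ 3))"
      proof (cases "z \<in> ball 0 R")
        case True
        have "U z * (m z - \<phi> z - s\<^sup>2 / 4 * laplace \<phi> z) \<le> \<bar>U z\<bar> * \<bar>m z - \<phi> z - s\<^sup>2 / 4 * laplace \<phi> z\<bar>"
          by (metis abs_ge_self abs_mult)
        also have "\<dots> \<le> B * (C * s ^ 3)"
          using B B0 C[OF s(1)] by (intro mult_mono) (auto simp: m_def)
        finally show ?thesis using True by simp
      next
        case False
        have "m z = (LINT w|circle_measure. 0)" unfolding m_def
          using R(1)[OF False _ s(1,3)] by (intro integral_cong_AE AE_circleI) auto
        then show ?thesis using False R(2,3)[OF False, of 1 s] s by simp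
      qed
    qed
    also have "\<dots> = V * (B * (C * s ^ 3))" by (simp add: V_def)
    finally have "(LINT z|lborel. U z * m z) - (LINT z|lborel. U z * \<phi> z) - s\<^sup>2 / 4 * (LINT z|lborel. U z * laplace \<phi> z)
      \<le> V * (B * (C * s ^ 3))" .
    with 1 have "- (V * (B * (C * s ^ 3))) \<le> s\<^sup>2 / 4 * (LINT z|lborel. U z * laplace \<phi> z)" by linarith
    then have "s\<^sup>2 / 4 * (- (4 * B * C * V * s)) \<le> s\<^sup>2 / 4 * (LINT z|lborel. U z * laplace \<phi> z)"
      by (simp add: algebra_simps power2_eq_square power3_eq_cube)
    then show ?thesis by (rule mult_left_le_imp_le) (use s in simp)
  qed
  have "((\<lambda>s. - (4 * B * C * V * s)) \<longlongrightarrow> - (4 * B * C * V * 0)) (at_right 0)"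
    by (intro tendsto_intros)
  moreover have "\<forall>\<^sub>F s in at_right 0. - (4 * B * C * V * s) \<le> (LINT z|lborel. U z * laplace \<phi> z)"
    using d(1) unfolding eventually_at_right_field
    by (intro exI[of _ "min d 1"]) (auto intro: key)
  ultimately show ?thesis
    using tendsto_upperbound[of "\<lambda>s. - (4 * B * C * V * s)" _ "at_right 0"] by simp
qed

section \<open>The Riesz representation theorem for test functions\<close>

text \<open>To be applied to \<phi> -> \<integral> u \<Delta>\<phi> on the disc; the representing
  measure is then the distributional Laplacian of u.\<close>

locale positive_functional =
  fixes D :: "complex set" and L :: "(complex \<Rightarrow> real) \<Rightarrow> real"
  assumes open_D: "open D"
    and L_add: "test_on D f \<Longrightarrow> test_on D g \<Longrightarrow> L (\<lambda>z. f z + g z) = L f + L g"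
    and L_cmult: "test_on D f \<Longrightarrow> L (\<lambda>z. c * f z) = c * L f"
    and L_nonneg: "test_on D f \<Longrightarrow> (\<And>z. f z \<ge> 0) \<Longrightarrow> L f \<ge> 0"
begin

lemma L_diff: "test_on D f \<Longrightarrow> test_on D g \<Longrightarrow> L (\<lambda>z. f z - g z) = L f - L g"
  using L_add[of f "\<lambda>z. (-1) * g z"] L_cmult[of g "-1"] test_on_cmult[of D g "-1"] by simp

lemma L_mono: "test_on D f \<Longrightarrow> test_on D g \<Longrightarrow> (\<And>z. f z \<le> g z) \<Longrightarrow> L f \<le> L g"
  using L_diff[of g f] L_nonneg[OF test_on_diff[of D g f]] by simp

definition cand :: "complex set \<Rightarrow> (complex \<Rightarrow> real) set" where
  "cand U = {\<phi>. test_on (U \<inter> D) \<phi> \<and> (\<forall>z. 0 \<le> \<phi> z \<and> \<phi> z \<le> 1)}"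

definition lam :: "complex set \<Rightarrow> ennreal" where
  "lam U = (SUP \<phi>\<in>cand U. ennreal (L \<phi>))"

definition mu :: "complex set \<Rightarrow> ennreal" where
  "mu E = (INF U\<in>{U. open U \<and> E \<subseteq> U}. lam U)"

lemma cand_D: "\<phi> \<in> cand U \<Longrightarrow> test_on D \<phi>"
  unfolding cand_def using test_on_mono by blast

lemma cand_0: "(\<lambda>z. 0) \<in> cand U"
  unfolding cand_def by (auto intro!: test_onI[of _ "{}"] Ck_const)

lemma L_0: "L (\<lambda>z. 0) = 0"
  using L_cmult[OF cand_D[OF cand_0], of 0] by simp

lemma lam_mono: "U \<subseteq> V \<Longrightarrow> lam U \<le> lam V"
  unfolding lam_def cand_def by (rule SUP_subset_mono) (use test_on_mono in blast)+

lemma mu_open: "open U \<Longrightarrow> mu U = lam U"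
  unfolding mu_def by (rule antisym) (auto intro!: INF_lower INF_greatest lam_mono)

lemma mu_mono: "E \<subseteq> F \<Longrightarrow> mu E \<le> mu F"
  unfolding mu_def by (rule INF_superset_mono) auto

lemma mu_empty: "mu {} = 0"
proof -
  have "cand {} = {\<lambda>z. 0}"
    using cand_0[of "{}"] by (auto simp: cand_def test_on_def fun_eq_iff)
  then show ?thesis using mu_open[of "{}"] by (simp add: lam_def L_0)
qed

text \<open>A weighted form of finite subadditivity: weights 1 give subadditivity of
  \<open>lam\<close>, weights (i + 1) / N give the upper Riemann sums of
  \<open>L_le_integral\<close>. The induction peels off the last set with a smooth cut-off, in place
  of a partition of unity.\<close>

lemma L_le_cover:
  fixes n :: nat
  assumes "test_on D \<phi>" "\<And>z. 0 \<le> \<phi> z" "compact K" "K \<subseteq> D" "\<And>z. z \<notin> K \<Longrightarrow> \<phi> z = 0"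
    and "K \<subseteq> (\<Union>i<n. V i)" "\<And>i. i < n \<Longrightarrow> open (V i)" "\<And>i. i < n \<Longrightarrow> c i > 0"
    and "\<And>i z. i < n \<Longrightarrow> z \<in> V i \<Longrightarrow> \<phi> z \<le> c i"
  shows "ennreal (L \<phi>) \<le> (\<Sum>i<n. ennreal (c i) * lam (V i))"
  using assms
proof (induction n arbitrary: \<phi> K)
  case 0
  then have "\<phi> = (\<lambda>z. 0)" by auto
  then show ?case by (simp add: L_0)
next
  case (Suc n)
  \<comment> \<open>The part of \<open>K\<close> missed by the first n sets lies in
    \<open>V n\<close>. A cut-off \<eta> that is 1 near this part charges \<phi> \<eta> to
    \<open>V n\<close>, while \<phi> (1 - \<eta>) lives on a compact set covered by the first n
    sets.\<close>
  define V' where "V' = (\<Union>i<n. V i)"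
  have V': "open V'" using Suc.prems(7) by (auto simp: V'_def)
  have "compact (K - V')" using Suc.prems(3) V' by (rule compact_diff)
  moreover have "open (V n \<inter> D)" using Suc.prems(7)[of n] open_D by auto
  moreover have "K - V' \<subseteq> V n \<inter> D" using Suc.prems(4,6) by (auto simp: V'_def lessThan_Suc)
  ultimately obtain \<eta> W C where \<eta>: "\<And>m. Ck m \<eta>" "\<And>z. 0 \<le> \<eta> z" "\<And>z. \<eta> z \<le> 1"
    "open W" "K - V' \<subseteq> W" "\<And>z. z \<in> W \<Longrightarrow> \<eta> z = 1"
    "compact C" "C \<subseteq> V n \<inter> D" "\<And>z. z \<notin> C \<Longrightarrow> \<eta> z = 0"
    by (rule smooth_Urysohn) blast
  have c: "c n > 0" using Suc.prems(8) by blast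
  have t1: "test_on D (\<lambda>z. \<phi> z * \<eta> z)" "test_on D (\<lambda>z. \<phi> z * (1 - \<eta> z))"
    using Suc.prems(1) \<eta>(1) by (intro test_on_mult Ck_diff Ck_const; blast)+
  have c1: "(\<lambda>z. (1 / c n) * (\<phi> z * \<eta> z)) \<in> cand (V n)"
  proof -
    have "(1 / c n) * (\<phi> z * \<eta> z) \<le> 1" for z
    proof (cases "z \<in> C")
      case True
      then have "\<phi> z * \<eta> z \<le> c n * 1"
        using \<eta> Suc.prems(2)[of z] Suc.prems(9)[of n z] c by (intro mult_mono) auto
      then show ?thesis using c by simp
    qed (use \<eta> in simp)
    moreover have "test_on (V n \<inter> D) (\<lambda>z. (1 / c n) * (\<phi> z * \<eta> z))"
      using \<eta> by (intro test_onI[of _ C] Ck_cmult Ck_mult test_on_Ck[OF Suc.prems(1)]) auto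
    ultimately show ?thesis using Suc.prems(2) \<eta>(2) c by (auto simp: cand_def)
  qed
  have "ennreal (L \<phi>) = ennreal (L (\<lambda>z. \<phi> z * (1 - \<eta> z)) + L (\<lambda>z. \<phi> z * \<eta> z))"
    using L_add[OF t1(2) t1(1)] by (simp add: algebra_simps)
  also have "\<dots> = ennreal (L (\<lambda>z. \<phi> z * (1 - \<eta> z))) + ennreal (L (\<lambda>z. \<phi> z * \<eta> z))"
    using L_nonneg[OF t1(1)] L_nonneg[OF t1(2)] Suc.prems(2) \<eta>(2,3) by (intro ennreal_plus) auto
  also have "ennreal (L (\<lambda>z. \<phi> z * (1 - \<eta> z))) \<le> (\<Sum>i<n. ennreal (c i) * lam (V i))"
  proof (rule Suc.IH[of _ "K - W"])
    show "K - W \<subseteq> (\<Union>i<n. V i)" using \<eta>(5) by (auto simp: V'_def)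
    show "compact (K - W)" using Suc.prems(3) \<eta>(4) by (rule compact_diff)
    show "\<phi> z * (1 - \<eta> z) \<le> c i" if "i < n" "z \<in> V i" for i z
    proof -
      have "\<phi> z * (1 - \<eta> z) \<le> \<phi> z * 1" 
        using Suc.prems(2)[of z] \<eta>(2)[of z] by (intro mult_left_mono) auto
      also have "\<dots> \<le> c i" using Suc.prems(9)[of i z] that by simp
      finally show ?thesis .
    qed
  qed (use Suc.prems t1 \<eta> in auto)
  also have "ennreal (L (\<lambda>z. \<phi> z * \<eta> z)) = ennreal (c n) * ennreal (L (\<lambda>z. (1 / c n) * (\<phi> z * \<eta> z)))"
  proof -
    have "L (\<lambda>z. \<phi> z * \<eta> z) = c n * L (\<lambda>z. (1 / c n) * (\<phi> z * \<eta> z))"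
      using L_cmult[OF t1(1), of "1 / c n"] c by simp
    then show ?thesis using c by (simp add: ennreal_mult')
  qed
  also have "\<dots> \<le> ennreal (c n) * lam (V n)"
    unfolding lam_def by (intro mult_left_mono SUP_upper c1) simp
  finally show ?case by (simp add: add_mono)
qed

text \<open>The compact support of a candidate meets only finitely many sets of a suitable subcover,
  so the finite estimate suffices.\<close>

lemma lam_countably_subadditive:
  assumes "\<And>i. open (U i)"
  shows "lam (\<Union>i. U i) \<le> (\<Sum>i. lam (U i))"
  unfolding lam_def[of "\<Union>i. U i"]
proof (rule SUP_least)
  fix \<phi> assume \<phi>: "\<phi> \<in> cand (\<Union>i. U i)"
  then obtain K where K: "compact K" "K \<subseteq> (\<Union>i. U i) \<inter> D" "\<And>z. z \<notin> K \<Longrightarrow> \<phi> z = 0"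
    by (auto simp: cand_def test_on_def)
  obtain I where I: "finite I" "K \<subseteq> (\<Union>i\<in>I. U i)"
    using compactE_image[OF K(1), of UNIV U] assms K(2) by (metis inf.boundedE)
  obtain n where n: "I \<subseteq> {..<n}" using finite_nat_iff_bounded[of I] I(1) by blast
  have Kn: "K \<subseteq> (\<Union>i<n. U i)" using I(2) n by blast
  have "ennreal (L \<phi>) \<le> (\<Sum>i<n. ennreal 1 * lam (U i))"
    by (rule L_le_cover[OF cand_D[OF \<phi>] _ K(1) _ K(3) Kn])
       (use \<phi> K(2) assms in \<open>auto simp: cand_def\<close>)
  also have "\<dots> \<le> (\<Sum>i. lam (U i))" using sum_le_suminf[of "\<lambda>i. lam (U i)" "{..<n}"] by simp
  finally show "ennreal (L \<phi>) \<le> (\<Sum>i. lam (U i))" .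
qed

lemma mu_close:
  assumes "mu E < \<infinity>" "0 < (e::real)"
  obtains U where "open U" "E \<subseteq> U" "lam U \<le> mu E + ennreal e"
proof -
  have "mu E < mu E + ennreal e" using assms
    by (cases "mu E" rule: ennreal_cases) (auto simp flip: ennreal_plus simp: ennreal_less_iff)
  then obtain U where "open U" "E \<subseteq> U" "lam U < mu E + ennreal e"
    unfolding mu_def INF_less_iff by auto
  then show thesis using that by (auto intro: less_imp_le)
qed

lemma mu_countably_subadditive: "mu (\<Union>i. A i) \<le> (\<Sum>i. mu (A i))" for A :: "nat \<Rightarrow> complex set"
proof (rule ennreal_le_epsilon)
  fix e :: real assume e: "0 < e" and fin: "(\<Sum>i. mu (A i)) < top"
  have m: "mu (A i) < \<infinity>" for i
    using ennreal_suminf_lessD[OF fin, of i] by simp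
  have "\<exists>U. open U \<and> A i \<subseteq> U \<and> lam U \<le> mu (A i) + ennreal (e * (1/2) ^ Suc i)" for i
    using mu_close[OF m, of "e * (1/2) ^ Suc i"] e by (metis zero_less_divide_iff zero_less_mult_iff zero_less_numeral zero_less_one zero_less_power)
  then obtain U where U: "\<And>i. open (U i)" "\<And>i. A i \<subseteq> U i" "\<And>i. lam (U i) \<le> mu (A i) + ennreal (e * (1/2) ^ Suc i)" by metis
  have "mu (\<Union>i. A i) \<le> mu (\<Union>i. U i)" using U(2) by (intro mu_mono) blast
  also have "\<dots> = lam (\<Union>i. U i)" using U(1) by (intro mu_open) blast
  also have "\<dots> \<le> (\<Sum>i. lam (U i))" by (rule lam_countably_subadditive[OF U(1)])
  also have "\<dots> \<le> (\<Sum>i. mu (A i) + ennreal (e * (1/2) ^ Suc i))" by (intro suminf_le U(3)) auto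
  also have "\<dots> = (\<Sum>i. mu (A i)) + (\<Sum>i. ennreal (e * (1/2) ^ Suc i))" by (intro suminf_add[symmetric]) auto
  also have "(\<Sum>i. ennreal (e * (1/2) ^ Suc i)) = ennreal (e * 1)"
    using sums_mult[OF power_half_series, of e] e by (intro suminf_ennreal_eq) auto
  finally show "mu (\<Union>i. A i) \<le> (\<Sum>i. mu (A i)) + ennreal e" by simp
qed

lemma mu_outer: "outer_measure_space (Pow UNIV) mu"
  unfolding outer_measure_space_def positive_def increasing_def countably_subadditive_def
  using mu_empty mu_mono mu_countably_subadditive by auto

lemma mu_subadditive: "mu (A \<union> B) \<le> mu A + mu B"
proof -
  have "mu (\<Union>i. binaryset A B i) \<le> (\<Sum>i. mu (binaryset A B i))" by (rule mu_countably_subadditive)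
  then show ?thesis using suminf_binaryset_eq[of mu A B] mu_empty by (simp add: UN_binaryset_eq)
qed

text \<open>For the Caratheodory criterion, take a candidate \<phi> in E \<inter> V with support K
  and then a candidate \<psi> in E - K, a set that still contains X - V. Their supports are
  disjoint, so \<phi> + \<psi> is a candidate for E; take suprema over \<psi> and then over
  \<phi>.\<close>

lemma open_lambda_system:
  assumes "open V"
  shows "V \<in> lambda_system UNIV (Pow UNIV) mu"
proof -
  have "mu (V \<inter> X) + mu ((UNIV - V) \<inter> X) \<le> lam E" if E: "open E" "X \<subseteq> E" for X E
  proof -
    have 1: "ennreal (L \<phi>) + mu (X - V) \<le> lam E" if \<phi>: "\<phi> \<in> cand (E \<inter> V)" for \<phi>
    proof -
      obtain K where K: "compact K" "K \<subseteq> E \<inter> V \<inter> D" "\<And>z. z \<notin> K \<Longrightarrow> \<phi> z = 0"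
        using \<phi> by (auto simp: cand_def test_on_def)
      have o: "open (E - K)" using E(1) K(1) by (intro open_Diff compact_imp_closed)
      have 2: "ennreal (L \<phi>) + ennreal (L \<psi>) \<le> lam E" if \<psi>: "\<psi> \<in> cand (E - K)" for \<psi>
      proof -
        obtain K' where K': "compact K'" "K' \<subseteq> (E - K) \<inter> D" "\<And>z. z \<notin> K' \<Longrightarrow> \<psi> z = 0"
          using \<psi> by (auto simp: cand_def test_on_def)
        have \<psi>0: "\<psi> z = 0" if "z \<in> K" for z using K'(2,3) that by blast
        have "test_on (E \<inter> D) (\<lambda>z. \<phi> z + \<psi> z)"
          using \<phi> \<psi> by (intro test_on_add) (auto simp: cand_def intro: test_on_mono)
        moreover have "0 \<le> \<phi> z + \<psi> z \<and> \<phi> z + \<psi> z \<le> 1" for z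
          using \<phi> \<psi> K(3)[of z] \<psi>0[of z] by (cases "z \<in> K") (auto simp: cand_def)
        ultimately have "(\<lambda>z. \<phi> z + \<psi> z) \<in> cand E" by (simp add: cand_def)
        then have "ennreal (L (\<lambda>z. \<phi> z + \<psi> z)) \<le> lam E" unfolding lam_def by (rule SUP_upper)
        moreover have "L \<phi> \<ge> 0" "L \<psi> \<ge> 0"
          using \<phi> \<psi> by (auto intro!: L_nonneg simp: cand_def cand_D[OF \<phi>] cand_D[OF \<psi>])
        ultimately show ?thesis using L_add[OF cand_D[OF \<phi>] cand_D[OF \<psi>]] by simp
      qed
      have "mu (X - V) \<le> lam (E - K)"
        using mu_mono[of "X - V" "E - K"] mu_open[OF o] E(2) K(2) by auto
      then have "ennreal (L \<phi>) + mu (X - V) \<le> ennreal (L \<phi>) + lam (E - K)" by (rule add_left_mono)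
      also have "\<dots> = (SUP \<psi>\<in>cand (E - K). ennreal (L \<phi>) + ennreal (L \<psi>))"
        unfolding lam_def by (rule ennreal_SUP_add_right) (use cand_0 in blast)
      also have "\<dots> \<le> lam E" by (intro SUP_least 2)
      finally show ?thesis .
    qed
    have "mu (V \<inter> X) \<le> lam (E \<inter> V)"
    proof -
      have "V \<inter> X \<subseteq> E \<inter> V" "open (E \<inter> V)" using E assms by auto
      then show ?thesis using mu_mono mu_open by metis
    qed
    then have "mu (V \<inter> X) + mu (X - V) \<le> lam (E \<inter> V) + mu (X - V)" by (rule add_right_mono)
    also have "\<dots> = (SUP \<phi>\<in>cand (E \<inter> V). ennreal (L \<phi>) + mu (X - V))"
      unfolding lam_def by (rule ennreal_SUP_add_left[symmetric]) (use cand_0 in blast)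
    also have "\<dots> \<le> lam E" by (intro SUP_least 1)
    finally show ?thesis by (simp add: Diff_eq Int_commute)
  qed
  then have "mu (V \<inter> X) + mu ((UNIV - V) \<inter> X) \<le> mu X" for X
    unfolding mu_def[of X] by (intro INF_greatest) auto
  moreover have "mu X \<le> mu (V \<inter> X) + mu ((UNIV - V) \<inter> X)" for X
    using mu_subadditive[of "V \<inter> X" "(UNIV - V) \<inter> X"] by (simp add: Int_Un_distrib2[symmetric])
  ultimately show ?thesis unfolding lambda_system_def by (auto intro: antisym)
qed

definition M :: "complex measure" where
  "M = measure_of UNIV (sets borel) mu"

lemma sets_M [measurable_cong, simp]: "sets M = sets borel"
  unfolding M_def using sets.sigma_sets_eq[of borel] by simp

lemma space_M [simp]: "space M = UNIV"
  by (simp add: M_def)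

lemma emeasure_M: "A \<in> sets borel \<Longrightarrow> emeasure M A = mu A"
proof -
  interpret P: sigma_algebra "UNIV :: complex set" "Pow UNIV" by (rule sigma_algebra_Pow)
  have ms: "measure_space UNIV (lambda_system UNIV (Pow UNIV) mu) mu"
    by (rule P.caratheodory_lemma[OF mu_outer])
  then have sa: "sigma_algebra UNIV (lambda_system UNIV (Pow UNIV) mu)"
    by (simp add: measure_space_def)
  have sub: "sets borel \<subseteq> lambda_system UNIV (Pow UNIV) mu"
  proof -
    have "sigma_sets UNIV {S. open S} \<subseteq> lambda_system UNIV (Pow UNIV) mu"
      by (rule sigma_algebra.sigma_sets_subset[OF sa]) (use open_lambda_system in blast)
    then show ?thesis unfolding borel_def by (subst sets_measure_of) auto
  qed
  have "measure_space UNIV (sets borel) mu"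
    by (rule measure_down[OF ms _ sub]) (metis sets.sigma_algebra_axioms space_borel)
  then show "A \<in> sets borel \<Longrightarrow> emeasure M A = mu A"
    unfolding M_def measure_space_def
    by (intro emeasure_measure_of_sigma) auto
qed

text \<open>If \<eta> is a cut-off equal to 1 on W, every candidate for W lies below \<eta>, so
  positivity bounds \<open>lam W\<close> by L \<eta>.\<close>

lemma M_compact_finite:
  assumes "compact K" "K \<subseteq> D"
  obtains W where "open W" "K \<subseteq> W" "lam W < \<infinity>"
proof -
  obtain \<eta> W C where \<eta>: "\<And>m. Ck m \<eta>" "\<And>z. 0 \<le> \<eta> z" "\<And>z. \<eta> z \<le> 1"
    "open W" "K \<subseteq> W" "\<And>z. z \<in> W \<Longrightarrow> \<eta> z = 1"
    "compact C" "C \<subseteq> D" "\<And>z. z \<notin> C \<Longrightarrow> \<eta> z = 0"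
    by (rule smooth_Urysohn[OF assms(1) open_D assms(2)]) blast
  have t: "test_on D \<eta>" using \<eta> by (intro test_onI[of _ C]) auto
  have "lam W \<le> ennreal (L \<eta>)"
    unfolding lam_def
  proof (rule SUP_least)
    fix \<phi> assume \<phi>: "\<phi> \<in> cand W"
    have "\<phi> z \<le> \<eta> z" for z
    proof (cases "z \<in> W")
      case False
      then have "\<phi> z = 0" using \<phi> by (auto simp: cand_def test_on_def)
      then show ?thesis using \<eta> by simp
    qed (use \<phi> \<eta> in \<open>auto simp: cand_def\<close>)
    then show "ennreal (L \<phi>) \<le> ennreal (L \<eta>)"
      by (intro ennreal_leI L_mono cand_D[OF \<phi>] t)
  qed
  then have "lam W < \<infinity>" using le_less_trans by fastforce
  then show thesis using that \<eta> by blast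
qed

lemma M_finite_compact:
  assumes "compact K" "K \<subseteq> D"
  shows "emeasure M K < \<infinity>"
proof -
  obtain W where "open W" "K \<subseteq> W" "lam W < \<infinity>" by (rule M_compact_finite[OF assms])
  then show ?thesis
    using assms mu_mono[of K W] mu_open[of W] by (simp add: emeasure_M borel_compact order_le_less_trans)
qed

lemma test_on_integrable_M:
  assumes "test_on D f"
  shows "integrable M f"
proof -
  obtain K where K: "compact K" "K \<subseteq> D" "\<And>z. z \<notin> K \<Longrightarrow> f z = 0"
    using assms by (auto simp: test_on_def)
  obtain B where B: "\<And>z. \<bar>f z\<bar> \<le> B" using test_on_bounded[OF assms] by blast
  show ?thesis
    by (rule integrableI_bounded_set[where A = K and B = B])
       (use K B M_finite_compact test_on_borel[OF assms] in \<open>auto simp: borel_compact cong: measurable_cong_sets\<close>)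
qed

text \<open>The range of f is sliced at heights i / N. The slices of the support, fattened to open
  sets of almost the same measure, form a cover for \<open>L_le_cover\<close>; the resulting upper
  sum exceeds the integral by at most \<open>measure M K / N\<close>.\<close>

lemma L_le_integral:
  assumes "test_on D f" "\<And>z. f z \<ge> 0"
  shows "L f \<le> (LINT z|M. f z)"
proof -
  have [measurable]: "f \<in> borel_measurable borel" by (rule test_on_borel[OF assms(1)])
  obtain K where K: "compact K" "K \<subseteq> D" "\<And>z. z \<notin> K \<Longrightarrow> f z = 0"
    using assms by (auto simp: test_on_def)
  have [measurable]: "K \<in> sets borel" using K(1) by (rule borel_compact)
  obtain B where B: "B > 0" "\<And>z. \<bar>f z\<bar> \<le> B" using test_on_bounded[OF assms(1)] by metis
  have fin: "emeasure M K < \<infinity>" by (rule M_finite_compact[OF K(1,2)])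
  have step: "L f \<le> (LINT z|M. f z) + measure M K / N" if N: "N > 0" for N :: real
  proof -
    obtain n :: nat where n: "N * B < real n" using reals_Archimedean2 by blast
    define E where "E i = {z \<in> K. real i / N \<le> f z \<and> f z < (real i + 1) / N}" for i :: nat
    have [measurable]: "E i \<in> sets borel" for i unfolding E_def by measurable
    have Efin: "emeasure M (E i) < \<infinity>" for i
      using emeasure_mono[of "E i" K M] fin by (auto simp: E_def intro: order_le_less_trans)
    have KE: "K \<subseteq> (\<Union>i<n. E i)"
    proof
      fix z assume z: "z \<in> K"
      define i where "i = nat \<lfloor>N * f z\<rfloor>"
      have i: "real i \<le> N * f z" "N * f z < real i + 1"
        using N assms(2)[of z] by (auto simp: i_def)
      have "N * f z \<le> N * B" using N B(2)[of z] by (intro mult_left_mono) auto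
      then have "real i < real n" using i(1) n by linarith
      then show "z \<in> (\<Union>i<n. E i)"
        using z i N by (auto simp: E_def field_simps)
    qed
    have le: "L f \<le> (\<Sum>i<n. (real i + 1) / N * (measure M (E i) + \<delta>))" if \<delta>: "\<delta> > 0" for \<delta>
    proof -
      have "\<exists>V. open V \<and> E i \<subseteq> V \<and> lam V \<le> ennreal (measure M (E i) + \<delta>)" for i
      proof -
        have "mu (E i) = ennreal (measure M (E i))"
          using Efin[of i] by (simp add: emeasure_eq_ennreal_measure flip: emeasure_M)
        then show ?thesis
          using mu_close[of "E i" \<delta>] \<delta> by (metis ennreal_less_top ennreal_plus infinity_ennreal_def less_imp_le measure_nonneg)
      qed
      then obtain V where V: "\<And>i. open (V i)" "\<And>i. E i \<subseteq> V i" "\<And>i. lam (V i) \<le> ennreal (measure M (E i) + \<delta>)"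
        by metis
      \<comment> \<open>The fattened slice is cut back so that f stays below the upper height of the
        slice on it.\<close>
      define V' where "V' i = V i \<inter> {z. f z < (real i + 1) / N}" for i
      have oV: "open (V' i)" for i
        unfolding V'_def using V(1) Ck_continuous[OF test_on_Ck[OF assms(1)], of UNIV]
        by (intro open_Int open_Collect_less) auto
      have EV: "E i \<subseteq> V' i" for i using V(2)[of i] by (auto simp: V'_def E_def)
      have KV: "K \<subseteq> (\<Union>i<n. V' i)" using KE EV by blast
      have "ennreal (L f) \<le> (\<Sum>i<n. ennreal ((real i + 1) / N) * lam (V' i))"
        by (rule L_le_cover[OF assms K(1,2,3) KV]) (use oV N in \<open>auto simp: V'_def\<close>)
      also have "\<dots> \<le> (\<Sum>i<n. ennreal ((real i + 1) / N) * ennreal (measure M (E i) + \<delta>))"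
        using V(3) by (intro sum_mono mult_left_mono order_trans[OF lam_mono V(3)]) (auto simp: V'_def)
      also have "\<dots> = ennreal (\<Sum>i<n. (real i + 1) / N * (measure M (E i) + \<delta>))"
      proof -
        have "(\<Sum>i<n. ennreal ((real i + 1) / N) * ennreal (measure M (E i) + \<delta>)) =
            (\<Sum>i<n. ennreal ((real i + 1) / N * (measure M (E i) + \<delta>)))"
          using N \<delta> by (intro sum.cong refl ennreal_mult[symmetric]) auto
        also have "\<dots> = ennreal (\<Sum>i<n. (real i + 1) / N * (measure M (E i) + \<delta>))"
          using N \<delta> by (intro sum_ennreal) auto
        finally show ?thesis .
      qed
      finally show ?thesis
        by (rule ennreal_le_iff[THEN iffD1, rotated]) (use N \<delta> in \<open>auto intro!: sum_nonneg\<close>)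
    qed
    have "L f \<le> (\<Sum>i<n. (real i + 1) / N * (measure M (E i) + 0))"
    proof (rule tendsto_lowerbound)
      show "((\<lambda>\<delta>. \<Sum>i<n. (real i + 1) / N * (measure M (E i) + \<delta>)) \<longlongrightarrow> (\<Sum>i<n. (real i + 1) / N * (measure M (E i) + 0))) (at_right 0)"
        by (intro tendsto_intros)
      show "\<forall>\<^sub>F \<delta> in at_right 0. L f \<le> (\<Sum>i<n. (real i + 1) / N * (measure M (E i) + \<delta>))"
        using eventually_at_right_less by (rule eventually_mono) (rule le)
    qed simp
    also have "\<dots> = (LINT z|M. (\<Sum>i<n. (real i + 1) / N * indicator (E i) z))"
      using Efin by (subst Bochner_Integration.integral_sum) (auto simp: less_top)
    also have "\<dots> \<le> (LINT z|M. f z + indicator K z / N)"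
    proof (rule Bochner_Integration.integral_mono)
      show "integrable M (\<lambda>z. \<Sum>i<n. (real i + 1) / N * indicator (E i) z)"
        using Efin by (intro Bochner_Integration.integrable_sum) (auto simp: less_top)
      show "integrable M (\<lambda>z. f z + indicator K z / N)"
        using fin test_on_integrable_M[OF assms(1)] by auto
      fix z
      show "(\<Sum>i<n. (real i + 1) / N * indicator (E i) z) \<le> f z + indicator K z / N"
      proof (cases "z \<in> K")
        case True
        then obtain i where i: "i < n" "z \<in> E i" using KE by blast
        have uniq: "j = i" if "z \<in> E j" for j
        proof -
          have "real j / N < (real i + 1) / N" "real i / N < (real j + 1) / N"
            using that i(2) by (auto simp: E_def)
          then have "real j < real i + 1" "real i < real j + 1" using N by (auto simp: divide_less_cancel)
          then show ?thesis by linarith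
        qed
        have "(real j + 1) / N * indicator (E j) z = (if j = i then (real i + 1) / N else 0)" for j
          using i(2) uniq[of j] by (cases "z \<in> E j") auto
        then have "(\<Sum>j<n. (real j + 1) / N * indicator (E j) z) = (\<Sum>j<n. if j = i then (real i + 1) / N else 0)"
          by (rule sum.cong[OF refl])
        also have "\<dots> = (real i + 1) / N" using i(1) by simp
        also have "\<dots> = real i / N + 1 / N" by (rule add_divide_distrib)
        also have "\<dots> \<le> f z + 1 / N" using i(2) unfolding E_def by (intro add_right_mono) blast
        finally show ?thesis using True by simp
      next
        case False
        then have "z \<notin> E i" for i by (auto simp: E_def)
        then show ?thesis using False K(3) by simp
      qed
    qed
    also have "\<dots> = (LINT z|M. f z) + measure M K / N"
      using fin test_on_integrable_M[OF assms(1)] by (subst Bochner_Integration.integral_add) (auto simp: less_top)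
    finally show ?thesis .
  qed
  have "((\<lambda>N. (LINT z|M. f z) + measure M K / N) \<longlongrightarrow> (LINT z|M. f z) + 0) at_top"
    by (intro tendsto_intros tendsto_divide_0[OF tendsto_const] filterlim_at_top_imp_at_infinity filterlim_ident)
  moreover have "\<forall>\<^sub>F N in at_top. L f \<le> (LINT z|M. f z) + measure M K / N"
    using eventually_gt_at_top[of 0] by (rule eventually_mono) (rule step)
  ultimately show ?thesis
    using tendsto_lowerbound[of "\<lambda>N. (LINT z|M. f z) + measure M K / N" _ at_top "L f"] by simp
qed

text \<open>The opposite inequality is applied to c \<eta> - f, where \<eta> is a cut-off with L
  \<eta> almost \<open>lam U\<close> while its integral is at most \<open>lam U\<close>; the two
  terms with \<eta> then cancel up to a small error.\<close>

lemma L_ge_integral: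
  assumes "test_on D f" "\<And>z. f z \<ge> 0"
  shows "L f \<ge> (LINT z|M. f z)"
proof -
  obtain K where K: "compact K" "K \<subseteq> D" "\<And>z. z \<notin> K \<Longrightarrow> f z = 0"
    using assms by (auto simp: test_on_def)
  obtain U where U: "open U" "K \<subseteq> U" "lam U < \<infinity>" using M_compact_finite[OF K(1,2)] by blast
  obtain c where c: "c > 0" "\<And>z. \<bar>f z\<bar> \<le> c" using test_on_bounded[OF assms(1)] by metis
  have step: "(LINT z|M. f z) \<le> L f + c * e" if e: "e > 0" for e
  proof -
    obtain u where u: "lam U = ennreal u" "u \<ge> 0" using U(3) by (cases "lam U" rule: ennreal_cases) auto
    have "\<exists>\<psi>\<in>cand U. u - e < L \<psi>"
    proof (rule ccontr)
      assume no: "\<not> ?thesis"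
      then have "lam U \<le> ennreal (u - e)" unfolding lam_def using no by (intro SUP_least ennreal_leI) force
      then have u': "ennreal u \<le> ennreal (u - e)" using u by simp
      have "u - e \<ge> 0" using no cand_0[of U] L_0 by force
      then show False using u' u(2) e by (simp add: ennreal_le_iff)
    qed
    then obtain \<psi> where \<psi>: "\<psi> \<in> cand U" "u - e < L \<psi>" by blast
    obtain K' where K': "compact K'" "K' \<subseteq> U \<inter> D" "\<And>z. z \<notin> K' \<Longrightarrow> \<psi> z = 0"
      using \<psi>(1) by (auto simp: cand_def test_on_def)
    \<comment> \<open>Including the support of \<psi> makes \<eta> dominate \<psi>, so that \<eta>
      inherits the near-optimality of \<psi>; being 1 on \<open>K\<close> makes c \<eta> dominate
      f.\<close>
    have "compact (K \<union> K')" "open (U \<inter> D)" "K \<union> K' \<subseteq> U \<inter> D" using K K' U open_D by auto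
    then obtain \<eta> W C where \<eta>: "\<And>m. Ck m \<eta>" "\<And>z. 0 \<le> \<eta> z" "\<And>z. \<eta> z \<le> 1"
      "open W" "K \<union> K' \<subseteq> W" "\<And>z. z \<in> W \<Longrightarrow> \<eta> z = 1"
      "compact C" "C \<subseteq> U \<inter> D" "\<And>z. z \<notin> C \<Longrightarrow> \<eta> z = 0"
      by (rule smooth_Urysohn) blast
    have t: "test_on D \<eta>" using \<eta> by (intro test_onI[of _ C]) auto
    have \<eta>1: "\<eta> z = 1" if "z \<in> K \<union> K'" for z using \<eta>(5,6) that by blast
    have "\<psi> z \<le> \<eta> z" for z
      using \<psi>(1) K'(3)[of z] \<eta>(2)[of z] \<eta>1[of z] by (cases "z \<in> K'") (auto simp: cand_def)
    then have "L \<psi> \<le> L \<eta>" by (intro L_mono cand_D[OF \<psi>(1)] t)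
    then have 1: "u - e \<le> L \<eta>" using \<psi>(2) by linarith
    have 2: "(LINT z|M. \<eta> z) \<le> u"
    proof -
      have "(LINT z|M. \<eta> z) \<le> (LINT z|M. indicator C z)"
      proof (rule Bochner_Integration.integral_mono)
        show "integrable M (indicator C :: _ \<Rightarrow> real)"
          using \<eta>(7,8) M_finite_compact[of C] by (intro integrable_real_indicator) (auto simp: borel_compact)
        show "\<eta> z \<le> indicator C z" for z using \<eta>(3,9)[of z] by (auto simp: indicator_def)
      qed (rule test_on_integrable_M[OF t])
      also have "\<dots> = measure M C" using \<eta>(7) by (simp add: borel_compact)
      also have "ennreal \<dots> \<le> lam U"
        using mu_mono[of C U] mu_open[OF U(1)] \<eta>(7,8) M_finite_compact[of C]
        by (simp add: emeasure_eq_ennreal_measure[symmetric] emeasure_M borel_compact less_top)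
      then have "measure M C \<le> u" using u by (simp add: ennreal_le_iff)
      finally show ?thesis .
    qed
    have "L (\<lambda>z. c * \<eta> z - f z) \<le> (LINT z|M. c * \<eta> z - f z)"
    proof (rule L_le_integral)
      show "test_on D (\<lambda>z. c * \<eta> z - f z)" using t assms(1) by (intro test_on_diff test_on_cmult)
      show "0 \<le> c * \<eta> z - f z" for z
        using c(1) c(2)[of z] K(3)[of z] \<eta>(2)[of z] \<eta>1[of z] by (cases "z \<in> K") auto
    qed
    then have "c * L \<eta> - L f \<le> c * (LINT z|M. \<eta> z) - (LINT z|M. f z)"
      using L_diff[OF test_on_cmult[OF t] assms(1)] L_cmult[OF t] test_on_integrable_M[OF t] test_on_integrable_M[OF assms(1)] by simp
    moreover have "c * (u - e) \<le> c * L \<eta>" "c * (LINT z|M. \<eta> z) \<le> c * u"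
      using 1 2 c(1) by auto
    ultimately show ?thesis by (simp add: algebra_simps)
  qed
  have "((\<lambda>e. L f + c * e) \<longlongrightarrow> L f + c * 0) (at_right 0)" by (intro tendsto_intros)
  moreover have "\<forall>\<^sub>F e in at_right 0. (LINT z|M. f z) \<le> L f + c * e"
    using eventually_at_right_less by (rule eventually_mono) (rule step)
  ultimately show ?thesis
    using tendsto_lowerbound[of "\<lambda>e. L f + c * e" _ "at_right 0"] by simp
qed

lemma L_eq_integral:
  assumes "test_on D f"
  shows "L f = (LINT z|M. f z)"
proof -
  obtain K where K: "compact K" "K \<subseteq> D" "\<And>z. z \<notin> K \<Longrightarrow> f z = 0"
    using assms by (auto simp: test_on_def)
  obtain c where c: "c > 0" "\<And>z. \<bar>f z\<bar> \<le> c" using test_on_bounded[OF assms(1)] by metis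
  obtain \<eta> W C where \<eta>: "\<And>m. Ck m \<eta>" "\<And>z. 0 \<le> \<eta> z" "\<And>z. \<eta> z \<le> 1"
    "open W" "K \<subseteq> W" "\<And>z. z \<in> W \<Longrightarrow> \<eta> z = 1"
    "compact C" "C \<subseteq> D" "\<And>z. z \<notin> C \<Longrightarrow> \<eta> z = 0"
    by (rule smooth_Urysohn[OF K(1) open_D K(2)]) blast
  have t: "test_on D \<eta>" using \<eta> by (intro test_onI[of _ C]) auto
  have eq: "L g = (LINT z|M. g z)" if "test_on D g" "\<And>z. g z \<ge> 0" for g
    using L_le_integral[OF that] L_ge_integral[OF that] by linarith
  \<comment> \<open>A multiple of a cut-off that is 1 on the support reduces the signed case to the
    nonnegative one.\<close>
  have p: "0 \<le> f z + c * \<eta> z" for z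
    using c(1) c(2)[of z] K(3)[of z] \<eta>(2,6)[of z] \<eta>(5) by (cases "z \<in> K") force+
  have "L (\<lambda>z. f z + c * \<eta> z) = (LINT z|M. f z + c * \<eta> z)"
    by (rule eq) (use assms t p in \<open>auto intro: test_on_add test_on_cmult\<close>)
  moreover have "L \<eta> = (LINT z|M. \<eta> z)" by (rule eq[OF t \<eta>(2)])
  ultimately show ?thesis
    using L_add[OF assms test_on_cmult[OF t, of c]] L_cmult[OF t] test_on_integrable_M[OF t] test_on_integrable_M[OF assms(1)] by simp
qed

end

section \<open>Radon measures on the disc\<close>

lemma sets_disc_iff: "A \<in> sets (restrict_space borel unit_disc) \<longleftrightarrow> A \<in> sets borel \<and> A \<subseteq> unit_disc"
  by (subst sets_restrict_space_iff) auto

lemma radon_sets: "radon_on_disc M \<Longrightarrow> A \<in> sets M \<longleftrightarrow> A \<in> sets borel \<and> A \<subseteq> unit_disc"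
  unfolding radon_on_disc_def using sets_disc_iff by metis

lemma radon_space: "radon_on_disc M \<Longrightarrow> space M = unit_disc"
  unfolding radon_on_disc_def using sets_eq_imp_space_eq[of M "restrict_space borel unit_disc"]
  by (simp add: space_restrict_space)

lemma radon_compact: "radon_on_disc M \<Longrightarrow> compact K \<Longrightarrow> K \<subseteq> unit_disc \<Longrightarrow> emeasure M K < \<infinity>"
  by (simp add: radon_on_disc_def)

lemma radon_measurable:
  assumes "radon_on_disc M" "f \<in> borel_measurable borel"
  shows "f \<in> borel_measurable M"
  using measurable_restrict_space1[OF assms(2), of unit_disc] assms(1)
  by (simp add: radon_on_disc_def cong: measurable_cong_sets)

lemma radon_integrable:
  assumes M: "radon_on_disc M" and \<phi>: "test_on unit_disc \<phi>"
  shows "integrable M \<phi>"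
proof -
  obtain K where K: "compact K" "K \<subseteq> unit_disc" "\<And>z. z \<notin> K \<Longrightarrow> \<phi> z = 0"
    using \<phi> by (auto simp: test_on_def)
  obtain B where B: "\<And>z. \<bar>\<phi> z\<bar> \<le> B" using test_on_bounded[OF \<phi>] by blast
  show ?thesis
    by (rule integrableI_bounded_set[where A = K and B = B])
       (use K B radon_compact[OF M K(1,2)] radon_measurable[OF M test_on_borel[OF \<phi>]] in
        \<open>auto simp: radon_sets[OF M] borel_compact\<close>)
qed

lemma radon_le_integral:
  assumes M: "radon_on_disc M" and \<phi>: "test_on unit_disc \<phi>" "\<And>z. \<phi> z \<ge> 0"
    and K: "compact K" "K \<subseteq> unit_disc" "\<And>z. z \<in> K \<Longrightarrow> \<phi> z \<ge> 1"
  shows "emeasure M K \<le> ennreal (LINT z|M. \<phi> z)"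
proof -
  have "emeasure M K = (\<integral>\<^sup>+ z. indicator K z \<partial>M)"
    using K by (simp add: radon_sets[OF M] borel_compact)
  also have "\<dots> \<le> (\<integral>\<^sup>+ z. ennreal (\<phi> z) \<partial>M)"
    using K(3) \<phi>(2) by (intro nn_integral_mono) (auto simp: indicator_def)
  also have "\<dots> = ennreal (LINT z|M. \<phi> z)"
    using \<phi> by (intro nn_integral_eq_integral radon_integrable M) auto
  finally show ?thesis .
qed

lemma radon_ge_integral:
  assumes M: "radon_on_disc M" and \<phi>: "test_on unit_disc \<phi>" "\<And>z. \<phi> z \<ge> 0" "\<And>z. \<phi> z \<le> 1"
    and K: "K \<in> sets borel" "K \<subseteq> unit_disc" "\<And>z. z \<notin> K \<Longrightarrow> \<phi> z = 0"
  shows "ennreal (LINT z|M. \<phi> z) \<le> emeasure M K"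
proof -
  have "ennreal (LINT z|M. \<phi> z) = (\<integral>\<^sup>+ z. ennreal (\<phi> z) \<partial>M)"
    using \<phi> by (intro nn_integral_eq_integral[symmetric] radon_integrable M) auto
  also have "\<dots> \<le> (\<integral>\<^sup>+ z. indicator K z \<partial>M)"
    using K(3) \<phi>(3) by (intro nn_integral_mono) (auto simp: indicator_def)
  also have "\<dots> = emeasure M K"
    using K by (simp add: radon_sets[OF M])
  finally show ?thesis .
qed

lemma compact_exhaustion:
  fixes S :: "complex set"
  assumes "open S"
  obtains C where "\<And>n. compact (C n)" "\<And>n. C n \<subseteq> interior (C (Suc n))" "incseq C" "(\<Union>n. C n) = S"
proof -
  obtain C where C: "\<And>n. compact (C n)" "\<And>n. C n \<subseteq> S" "\<And>n. C n \<subseteq> interior (C (Suc n))" "\<Union> (range C) = S"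
    using open_Union_compact_subsets[OF assms] by metis
  have "incseq C" using C(3) interior_subset by (intro incseq_SucI) blast
  then show thesis using that C by blast
qed

lemma radon_le_open:
  assumes M: "radon_on_disc M" and N: "radon_on_disc N" and U: "open U" "U \<subseteq> unit_disc"
    and eq: "\<And>\<phi>. test_on U \<phi> \<Longrightarrow> (LINT z|M. \<phi> z) = (LINT z|N. \<phi> z)"
  shows "emeasure M U \<le> emeasure N U"
proof -
  obtain C where C: "\<And>n. compact (C n)" "incseq C" "(\<Union>n. C n) = U"
    using compact_exhaustion[OF U(1)] by metis
  have CU: "C n \<subseteq> U" for n using C(3) by blast
  have "emeasure M (C n) \<le> emeasure N U" for n
  proof -
    obtain \<eta> W K where \<eta>: "\<And>m. Ck m \<eta>" "\<And>z. 0 \<le> \<eta> z" "\<And>z. \<eta> z \<le> 1"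
      "open W" "C n \<subseteq> W" "\<And>z. z \<in> W \<Longrightarrow> \<eta> z = 1"
      "compact K" "K \<subseteq> U" "\<And>z. z \<notin> K \<Longrightarrow> \<eta> z = 0"
      by (rule smooth_Urysohn[OF C(1) U(1) CU]) blast
    have t: "test_on U \<eta>" using \<eta> by (intro test_onI[of _ K]) auto
    have tD: "test_on unit_disc \<eta>" using t U(2) by (rule test_on_mono)
    have \<eta>1: "\<eta> z = 1" if "z \<in> C n" for z using \<eta>(5,6) that by blast
    have "emeasure M (C n) \<le> ennreal (LINT z|M. \<eta> z)"
      by (rule radon_le_integral[OF M tD \<eta>(2) C(1) order_trans[OF CU U(2)]]) (simp add: \<eta>1)
    also have "\<dots> = ennreal (LINT z|N. \<eta> z)" using eq[OF t] by simp
    also have "\<dots> \<le> emeasure N U"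
    proof (rule radon_ge_integral[OF N tD \<eta>(2,3)])
      show "\<eta> z = 0" if "z \<notin> U" for z using \<eta>(8,9) that by blast
    qed (use U in auto)
    finally show ?thesis .
  qed
  moreover have "C n \<in> sets M" for n
    using CU U(2) C(1) unfolding radon_sets[OF M] by (blast intro: borel_compact)
  then have "(SUP n. emeasure M (C n)) = emeasure M U"
    using C by (subst SUP_emeasure_incseq) auto
  ultimately show ?thesis by (metis SUP_least)
qed

lemma radon_eq_open:
  assumes M: "radon_on_disc M" and N: "radon_on_disc N" and U: "open U" "U \<subseteq> unit_disc"
    and eq: "\<And>\<phi>. test_on U \<phi> \<Longrightarrow> (LINT z|M. \<phi> z) = (LINT z|N. \<phi> z)"
  shows "emeasure M U = emeasure N U"
  by (rule antisym; rule radon_le_open) (use assms in auto)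

text \<open>Turns a measure on the sigma-algebra of the disc into a Borel measure on the plane, to
  which uniqueness on open generators and regularity theorems apply.\<close>

definition restr :: "complex measure \<Rightarrow> complex set \<Rightarrow> complex measure" where
  "restr M W = distr (restrict_space M W) borel (\<lambda>z. z)"

lemma sets_restr [simp]: "sets (restr M W) = sets borel"
  by (simp add: restr_def)

lemma emeasure_restr:
  assumes M: "radon_on_disc M" and W: "W \<in> sets borel" "W \<subseteq> unit_disc" and A: "A \<in> sets borel"
  shows "emeasure (restr M W) A = emeasure M (A \<inter> W)"
proof -
  have sp: "space (restrict_space M W) = W"
    using W radon_space[OF M] by (auto simp: space_restrict_space)
  have "(\<lambda>z. z) \<in> restrict_space M W \<rightarrow>\<^sub>M borel"
    by (intro measurable_restrict_space1 radon_measurable[OF M]) auto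
  then have "emeasure (restr M W) A = emeasure (restrict_space M W) (A \<inter> W)"
    unfolding restr_def using A sp by (subst emeasure_distr) (auto simp: Int_def)
  also have "\<dots> = emeasure M (A \<inter> W)"
    using W radon_space[OF M] by (intro emeasure_restrict_space) (auto simp: radon_sets[OF M])
  finally show ?thesis .
qed

text \<open>Open sets form an intersection-stable generator, but uniqueness requires finite
  measures; so the comparison is made on the interiors of an exhausting sequence of compact sets,
  and E is reached by monotone limits.\<close>

lemma radon_eq_on_open:
  assumes M: "radon_on_disc M" and N: "radon_on_disc N" and V: "open V" "V \<subseteq> unit_disc"
    and eq: "\<And>\<phi>. test_on V \<phi> \<Longrightarrow> (LINT z|M. \<phi> z) = (LINT z|N. \<phi> z)"
    and E: "E \<in> sets borel" "E \<subseteq> V"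
  shows "emeasure M E = emeasure N E"
proof -
  obtain C where C: "\<And>n. compact (C n)" "\<And>n. C n \<subseteq> interior (C (Suc n))" "incseq C" "(\<Union>n. C n) = V"
    using compact_exhaustion[OF V(1)] by metis
  define W where "W n = interior (C n)" for n
  have W: "open (W n)" "W n \<subseteq> C n" for n by (auto simp: W_def interior_subset)
  have CV: "C n \<subseteq> unit_disc" "C n \<subseteq> V" for n using C(4) V(2) by blast+
  then have WD: "W n \<subseteq> unit_disc" "W n \<subseteq> V" "W n \<in> sets borel" for n using W[of n] CV(1,2)[of n] by (simp_all add: borel_open order_trans[OF W(2)])
  have "restr M (W n) = restr N (W n)" for n
  proof (rule measure_eqI_generator_eq[where E = "{S. open S}" and \<Omega> = UNIV and A = "\<lambda>_. UNIV"])
    show "Int_stable {S :: complex set. open S}" by (auto simp: Int_stable_def)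
    show "sets (restr M (W n)) = sigma_sets UNIV {S. open S}" "sets (restr N (W n)) = sigma_sets UNIV {S. open S}"
      by (simp_all add: borel_def)
    fix X :: "complex set" assume "X \<in> {S. open S}"
    then have X: "open X" by simp
    have "emeasure M (X \<inter> W n) = emeasure N (X \<inter> W n)"
    proof (rule radon_eq_open[OF M N])
      show "open (X \<inter> W n)" using X W by auto
      show "X \<inter> W n \<subseteq> unit_disc" using WD by blast
      fix \<phi> assume "test_on (X \<inter> W n) \<phi>"
      then have "test_on V \<phi>" by (rule test_on_mono) (use WD in blast)
      then show "(LINT z|M. \<phi> z) = (LINT z|N. \<phi> z)" by (rule eq)
    qed
    then show "emeasure (restr M (W n)) X = emeasure (restr N (W n)) X"
      using X by (simp add: emeasure_restr M N WD borel_open)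
  next
    fix i
    have "emeasure M (W n) \<le> emeasure M (C n)"
      using W CV by (intro emeasure_mono) (auto simp: radon_sets[OF M] borel_compact C)
    also have "\<dots> < \<infinity>" using radon_compact[OF M C(1) CV(1)] .
    finally show "emeasure (restr M (W n)) UNIV \<noteq> \<infinity>"
      by (simp add: emeasure_restr M WD)
  qed auto
  then have "emeasure M (E \<inter> W n) = emeasure N (E \<inter> W n)" for n
    using emeasure_restr[OF M WD(3,1) E(1)] emeasure_restr[OF N WD(3,1) E(1)] by metis
  moreover have E': "(\<Union>n. E \<inter> W n) = E"
  proof -
    have "(\<Union>n. W n) = V" using C(2,4) W(2) unfolding W_def by blast
    then show ?thesis using E(2) by blast
  qed
  moreover have "incseq (\<lambda>n. E \<inter> W n)"
    using C(3) interior_mono unfolding W_def incseq_def by blast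
  moreover have "range (\<lambda>n. E \<inter> W n) \<subseteq> sets M" "range (\<lambda>n. E \<inter> W n) \<subseteq> sets N"
    using E(1) WD by (intro image_subsetI; simp only: radon_sets[OF M] radon_sets[OF N]; blast)+
  ultimately show ?thesis
    using SUP_emeasure_incseq[of "\<lambda>n. E \<inter> W n" M] SUP_emeasure_incseq[of "\<lambda>n. E \<inter> W n" N] by simp
qed

lemma radon_eqI:
  assumes M: "radon_on_disc M" and N: "radon_on_disc N"
    and eq: "\<And>\<phi>. test_on unit_disc \<phi> \<Longrightarrow> (LINT z|M. \<phi> z) = (LINT z|N. \<phi> z)"
  shows "M = N"
proof (rule measure_eqI)
  show "sets M = sets N" using M N by (simp add: radon_on_disc_def)
  show "emeasure M A = emeasure N A" if "A \<in> sets M" for A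
    using that radon_eq_on_open[OF M N _ _ eq] by (auto simp: radon_sets[OF M])
qed

lemma radon_inner_regular:
  assumes M: "radon_on_disc M" and fin: "emeasure M unit_disc < \<infinity>" and E: "E \<in> sets borel" "E \<subseteq> unit_disc"
  shows "emeasure M E = (SUP K\<in>{K. K \<subseteq> E \<and> compact K}. emeasure M K)"
proof -
  have e: "emeasure (restr M unit_disc) A = emeasure M (A \<inter> unit_disc)" if "A \<in> sets borel" for A
    using that by (intro emeasure_restr M) auto
  have sp: "space (restr M unit_disc) = UNIV" by (simp add: restr_def)
  have "emeasure (restr M unit_disc) E = (SUP K\<in>{K. K \<subseteq> E \<and> compact K}. emeasure (restr M unit_disc) K)"
    using fin E sp by (intro inner_regular) (auto simp: e)
  also have "\<dots> = (SUP K\<in>{K. K \<subseteq> E \<and> compact K}. emeasure M K)"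
    using E by (intro SUP_cong refl) (auto simp: e borel_compact Int_absorb2)
  finally show ?thesis using E by (simp add: e Int_absorb2)
qed

lemma radon_total_mass:
  assumes M: "radon_on_disc M" and c: "\<And>K. compact K \<Longrightarrow> K \<subseteq> unit_disc \<Longrightarrow> emeasure M K \<le> c"
  shows "emeasure M unit_disc \<le> c"
proof -
  obtain C where C: "\<And>n. compact (C n)" "incseq C" "(\<Union>n. C n) = unit_disc"
    using compact_exhaustion[of unit_disc] by (metis open_ball)
  have CU: "C n \<subseteq> unit_disc" for n using C(3) by blast
  have "emeasure M unit_disc = (SUP n. emeasure M (C n))"
    using C CU by (subst SUP_emeasure_incseq) (auto simp: radon_sets[OF M] borel_compact)
  also have "\<dots> \<le> c" using c[OF C(1) CU] by (intro SUP_least) auto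
  finally show ?thesis .
qed

section \<open>Laplacians\<close>

text \<open>Extension by 0 turns set integrals over the disc into plain integrals. The value
  -\<infinity> becomes 0, which is harmless once it is known to occur only on a null set.\<close>

definition ru :: "(complex \<Rightarrow> ereal) \<Rightarrow> complex \<Rightarrow> real" where
  "ru u z = (if z \<in> unit_disc then real_of_ereal (u z) else 0)"

lemma has_laplacian_iff:
  "has_laplacian u M \<longleftrightarrow> radon_on_disc M \<and>
     (\<forall>\<phi>. test_on unit_disc \<phi> \<longrightarrow> (LINT z|M. \<phi> z) = (LINT z|lborel. ru u z * laplace \<phi> z))"
proof -
  have "(LINT z:unit_disc|lborel. real_of_ereal (u z) * laplace \<phi> z) = (LINT z|lborel. ru u z * laplace \<phi> z)" for \<phi>
    unfolding set_lebesgue_integral_def by (intro Bochner_Integration.integral_cong) (auto simp: ru_def)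
  then show ?thesis by (simp add: has_laplacian_def test_function_eq)
qed

lemma has_laplacian_unique: "has_laplacian u M \<Longrightarrow> has_laplacian u N \<Longrightarrow> M = N"
  unfolding has_laplacian_iff by (intro radon_eqI) auto

lemma laplacian_eqI: "has_laplacian u M \<Longrightarrow> laplacian u = M"
  unfolding laplacian_def using has_laplacian_unique by blast

lemma has_laplacian_cong_open:
  assumes M: "has_laplacian u M" and N: "has_laplacian v N" and V: "open V" "V \<subseteq> unit_disc"
    and eq: "\<And>z. z \<in> V \<Longrightarrow> ru u z = ru v z"
    and E: "E \<in> sets borel" "E \<subseteq> V"
  shows "emeasure M E = emeasure N E"
proof (rule radon_eq_on_open[OF _ _ V _ E])
  show "radon_on_disc M" "radon_on_disc N" using M N by (auto simp: has_laplacian_iff)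
  fix \<phi> assume \<phi>: "test_on V \<phi>"
  have "laplace \<phi> z = 0" if "z \<notin> V" for z
    using test_on_laplace[OF \<phi>] that unfolding test_on_def by blast
  then have "(LINT z|lborel. ru u z * laplace \<phi> z) = (LINT z|lborel. ru v z * laplace \<phi> z)"
    using eq by (intro Bochner_Integration.integral_cong refl) (metis mult_zero_right)
  then show "(LINT z|M. \<phi> z) = (LINT z|N. \<phi> z)"
    using M N test_on_mono[OF \<phi> V(2)] by (simp add: has_laplacian_iff)
qed

definition loc_integrable :: "(complex \<Rightarrow> real) \<Rightarrow> bool" where
  "loc_integrable g \<longleftrightarrow> (\<forall>\<phi>. test_on unit_disc \<phi> \<longrightarrow> integrable lborel (\<lambda>z. g z * \<phi> z))"

text \<open>The Riesz measure of \<phi> -> \<integral> u \<Delta>\<phi> is a Borel measure on the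
  plane; its restriction to the disc has the sigma-algebra that \<open>radon_on_disc\<close>
  prescribes.\<close>

lemma has_laplacian_exists:
  assumes int: "loc_integrable (ru u)"
    and pos: "\<And>\<phi>. test_on unit_disc \<phi> \<Longrightarrow> (\<And>z. \<phi> z \<ge> 0) \<Longrightarrow> 0 \<le> (LINT z|lborel. ru u z * laplace \<phi> z)"
  obtains M where "has_laplacian u M"
proof -
  define L where "L \<phi> = (LINT z|lborel. ru u z * laplace \<phi> z)" for \<phi>
  have i: "integrable lborel (\<lambda>z. ru u z * laplace \<phi> z)" if "test_on unit_disc \<phi>" for \<phi>
    using int test_on_laplace[OF that] by (simp add: loc_integrable_def)
  interpret P: positive_functional unit_disc L
  proof
    fix f g :: "complex \<Rightarrow> real" and c assume f: "test_on unit_disc f"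
    show "L (\<lambda>z. f z + g z) = L f + L g" if g: "test_on unit_disc g"
      using i[OF f] i[OF g] by (simp add: L_def laplace_add[OF test_on_Ck[OF f] test_on_Ck[OF g]] distrib_left)
    show "L (\<lambda>z. c * f z) = c * L f"
      by (simp add: L_def laplace_cmult[OF test_on_Ck[OF f]] mult.left_commute)
    show "0 \<le> L f" if "\<And>z. 0 \<le> f z" unfolding L_def by (rule pos[OF f that])
  qed auto
  define M where "M = restrict_space P.M unit_disc"
  have sM: "sets M = sets (restrict_space borel unit_disc)"
    unfolding M_def by (intro sets_restrict_space_cong) simp
  have em: "emeasure M A = emeasure P.M A" if "A \<subseteq> unit_disc" for A
    unfolding M_def using that by (intro emeasure_restrict_space) auto
  have "radon_on_disc M"
    unfolding radon_on_disc_def using sM P.M_finite_compact by (simp add: em)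
  moreover have "(LINT z|M. \<phi> z) = L \<phi>" if \<phi>: "test_on unit_disc \<phi>" for \<phi>
  proof -
    have "\<phi> z = 0" if "z \<notin> unit_disc" for z
      using \<phi> that unfolding test_on_def by blast
    then have "(LINT z|M. \<phi> z) = (LINT z|P.M. \<phi> z)"
      unfolding M_def by (subst integral_restrict_space) (auto intro!: Bochner_Integration.integral_cong simp: indicator_def)
    then show ?thesis using P.L_eq_integral[OF \<phi>] by simp
  qed
  ultimately show thesis using that by (auto simp: has_laplacian_iff L_def)
qed

section \<open>Exhaustion functions have a Laplacian\<close>

lemma exhaustions_neg: "u \<in> exhaustions \<Longrightarrow> z \<in> unit_disc \<Longrightarrow> u z < 0"
  by (simp add: exhaustions_def)

lemma exhaustions_near_boundary:
  assumes u: "u \<in> exhaustions" and r: "r < 0"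
  obtains R where "0 < R" "R < 1" "\<And>z. R < norm z \<Longrightarrow> norm z < 1 \<Longrightarrow> ereal r < u z"
proof -
  have "(u \<longlongrightarrow> 0) (filtercomap norm (at_left 1))" using u by (simp add: exhaustions_def)
  then have "\<forall>\<^sub>F z in filtercomap norm (at_left 1). ereal r < u z"
    using r by (intro order_tendstoD) auto
  then obtain Q where Q: "\<forall>\<^sub>F x in at_left (1::real). Q x" "\<And>z. Q (norm z) \<Longrightarrow> ereal r < u z"
    unfolding eventually_filtercomap by blast
  then obtain b where b: "b < 1" "\<And>y. b < y \<Longrightarrow> y < 1 \<Longrightarrow> Q y"
    unfolding eventually_at_left_field by blast
  show thesis
    by (rule that[of "max b (1/2)"]) (use b Q in auto)
qed

lemma ru_measurable:
  assumes "continuous_on unit_disc u"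
  shows "ru u \<in> borel_measurable borel"
proof -
  have "u \<in> borel_measurable (restrict_space borel unit_disc)"
    using assms by (rule borel_measurable_continuous_on_restrict)
  then have "(\<lambda>z. real_of_ereal (u z)) \<in> borel_measurable (restrict_space borel unit_disc)" by measurable
  then have "(\<lambda>z. if z \<in> unit_disc then real_of_ereal (u z) else 0) \<in> borel_measurable borel"
    by (subst measurable_restrict_space_iff[symmetric]) auto
  then show ?thesis by (simp add: ru_def[abs_def])
qed

lemma trunc_continuous: "continuous_on S u \<Longrightarrow> continuous_on S (trunc u r)"
  unfolding trunc_def[abs_def] by (intro continuous_intros)

lemma exhaustions_continuous: "u \<in> exhaustions \<Longrightarrow> continuous_on unit_disc u"
  by (simp add: exhaustions_def)

lemma ru_trunc:
  assumes "u \<in> exhaustions" "r < 0" "z \<in> unit_disc"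
  shows "trunc u r z = ereal (ru (trunc u r) z)" "r \<le> ru (trunc u r) z" "ru (trunc u r) z < 0"
proof -
  have "u z < 0" using assms exhaustions_neg by blast
  then have "trunc u r z < 0" "trunc u r z \<ge> ereal r" using assms by (auto simp: trunc_def)
  then show "trunc u r z = ereal (ru (trunc u r) z)" "r \<le> ru (trunc u r) z" "ru (trunc u r) z < 0"
    using assms by (cases "trunc u r z"; auto simp: ru_def)+
qed

lemma ru_trunc_bound:
  assumes "u \<in> exhaustions" "r < 0"
  shows "\<bar>ru (trunc u r) z\<bar> \<le> - r"
proof (cases "z \<in> unit_disc")
  case True
  then show ?thesis using ru_trunc(2,3)[OF assms] by (simp add: abs_le_iff less_imp_le)
qed (use assms(2) in \<open>simp add: ru_def\<close>)

lemma ru_outside: "z \<notin> unit_disc \<Longrightarrow> ru u z = 0"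
  by (simp add: ru_def)

lemma ru_trunc_le_0: "u \<in> exhaustions \<Longrightarrow> r < 0 \<Longrightarrow> ru (trunc u r) z \<le> 0"
  using ru_trunc(3)[of u r z, THEN less_imp_le] ru_outside[of z] by (metis order_refl)

lemma ru_trunc_measurable: "u \<in> exhaustions \<Longrightarrow> ru (trunc u r) \<in> borel_measurable borel"
  by (intro ru_measurable trunc_continuous exhaustions_continuous)

text \<open>Both u and the constant r are bounded by the mean of the truncation, hence so is their
  maximum. As u < 0, the positive part in \<open>circle_mean\<close> contributes nothing and the
  inequality is one between integrals of negative parts.\<close>

lemma trunc_submean:
  assumes u: "u \<in> exhaustions" and r: "r < 0" and s: "0 < s" "cball z s \<subseteq> unit_disc"
  shows "ru (trunc u r) z \<le> (LINT w|circle_measure. ru (trunc u r) (z + of_real s * w))"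
proof -
  define T where "T = ru (trunc u r)"
  have [measurable]: "T \<in> borel_measurable borel"
    unfolding T_def by (intro ru_measurable trunc_continuous exhaustions_continuous u)
  have inD: "z + of_real s * w \<in> unit_disc" if "norm w = 1" for w
    using s that by (intro subsetD[OF s(2)]) (auto simp: dist_norm norm_mult)
  have Tb: "\<bar>T x\<bar> \<le> - r" for x unfolding T_def by (rule ru_trunc_bound[OF u r])
  have int: "integrable circle_measure (\<lambda>w. T (z + of_real s * w))"
    by (rule circ.integrable_const_bound[where B = "-r"]) (use Tb in auto)
  have z: "z \<in> unit_disc" using s by (intro subsetD[OF s(2)]) auto
  have "u z \<le> circle_mean u z s" using u s by (auto simp: exhaustions_def subharmonic_on_def)
  also have "\<dots> \<le> ereal (LINT w|circle_measure. T (z + of_real s * w))"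
  proof -
    have "(\<integral>\<^sup>+ w. e2ennreal (u (z + of_real s * w)) \<partial>circle_measure) = (\<integral>\<^sup>+ w. 0 \<partial>circle_measure)"
      using exhaustions_neg[OF u inD] by (intro nn_integral_cong_AE AE_circleI e2ennreal_neg) (simp add: less_imp_le)
    then have "circle_mean u z s = - enn2ereal (\<integral>\<^sup>+ w. e2ennreal (- u (z + of_real s * w)) \<partial>circle_measure)"
      by (simp add: circle_mean_def zero_ennreal.rep_eq)
    also have "\<dots> \<le> - enn2ereal (\<integral>\<^sup>+ w. ennreal (- T (z + of_real s * w)) \<partial>circle_measure)"
    proof -
      have "ennreal (- T (z + of_real s * w)) \<le> e2ennreal (- u (z + of_real s * w))" if "norm w = 1" for w
      proof -
        have "u (z + of_real s * w) \<le> ereal (T (z + of_real s * w))"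
          using ru_trunc(1)[OF u r inD[OF that]] unfolding T_def by (metis max.cobounded1 trunc_def)
        then have "ereal (- T (z + of_real s * w)) \<le> - u (z + of_real s * w)"
          by (metis ereal_minus_le_minus uminus_ereal.simps(1))
        then show ?thesis using e2ennreal_mono by (metis e2ennreal_ereal)
      qed
      then have "(\<integral>\<^sup>+ w. ennreal (- T (z + of_real s * w)) \<partial>circle_measure) \<le> (\<integral>\<^sup>+ w. e2ennreal (- u (z + of_real s * w)) \<partial>circle_measure)"
        by (intro nn_integral_mono_AE AE_circleI)
      then show ?thesis by (simp add: less_eq_ennreal.rep_eq)
    qed
    also have "(\<integral>\<^sup>+ w. ennreal (- T (z + of_real s * w)) \<partial>circle_measure) = ennreal (LINT w|circle_measure. - T (z + of_real s * w))"
      using int ru_trunc(3)[OF u r inD] by (intro nn_integral_eq_integral AE_circleI) (auto simp: T_def less_imp_le)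
    also have "- enn2ereal \<dots> = ereal (LINT w|circle_measure. T (z + of_real s * w))"
    proof -
      have "0 \<le> (LINT w|circle_measure. - T (z + of_real s * w))"
        using ru_trunc(3)[OF u r inD] by (intro integral_nonneg_AE AE_circleI) (auto simp: T_def less_imp_le)
      then show ?thesis by (simp add: enn2ereal_ennreal)
    qed
    finally show ?thesis .
  qed
  finally have 1: "u z \<le> ereal (LINT w|circle_measure. T (z + of_real s * w))" .
  have "r = (LINT w|circle_measure. r)" using circ.prob_space by simp
  also have "\<dots> \<le> (LINT w|circle_measure. T (z + of_real s * w))"
    using int ru_trunc(2)[OF u r inD] by (intro integral_mono_AE AE_circleI) (auto simp: T_def)
  finally have "trunc u r z \<le> ereal (LINT w|circle_measure. T (z + of_real s * w))"
    using 1 by (simp add: trunc_def)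
  then show ?thesis using ru_trunc(1)[OF u r z] by (simp add: T_def)
qed

lemma trunc_laplace_nonneg:
  assumes u: "u \<in> exhaustions" and r: "r < 0" and \<phi>: "test_on unit_disc \<phi>" "\<And>z. \<phi> z \<ge> 0"
  shows "0 \<le> (LINT z|lborel. ru (trunc u r) z * laplace \<phi> z)"
  by (rule submean_laplace_nonneg[OF _ ru_trunc_bound[OF u r] open_ball trunc_submean[OF u r] \<phi>])
     (auto intro: ru_measurable trunc_continuous exhaustions_continuous u)

lemma integrable_loc_integrable:
  assumes "integrable lborel g"
  shows "loc_integrable g"
  unfolding loc_integrable_def
proof (intro allI impI)
  fix \<phi> assume \<phi>: "test_on unit_disc \<phi>"
  obtain B where B: "B > 0" "\<And>z. \<bar>\<phi> z\<bar> \<le> B" using test_on_bounded[OF \<phi>] by metis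
  have [measurable]: "g \<in> borel_measurable lborel" "\<phi> \<in> borel_measurable lborel"
    using assms test_on_borel[OF \<phi>] by auto
  show "integrable lborel (\<lambda>z. g z * \<phi> z)"
  proof (rule Bochner_Integration.integrable_bound[OF integrable_mult_left[OF assms, of B]])
    have "\<bar>g z\<bar> * \<bar>\<phi> z\<bar> \<le> \<bar>g z\<bar> * B" for z by (intro mult_left_mono B) simp
    then show "AE z in lborel. norm (g z * \<phi> z) \<le> norm (g z * B)" using B(1) by (simp add: abs_mult)
  qed measurable
qed

lemma trunc_integrable:
  assumes u: "u \<in> exhaustions" and r: "r < 0"
  shows "integrable lborel (ru (trunc u r))"
proof (rule integrable_bounded_support)
  show "ru (trunc u r) \<in> borel_measurable borel" 
    by (intro ru_measurable trunc_continuous exhaustions_continuous u)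
qed (use ru_trunc_bound[OF u r] ru_outside in auto)

lemma trunc_has_laplacian:
  assumes u: "u \<in> exhaustions" and r: "r < 0"
  obtains M where "has_laplacian (trunc u r) M"
  using has_laplacian_exists[OF integrable_loc_integrable[OF trunc_integrable[OF u r]] trunc_laplace_nonneg[OF u r]]
  by metis

lemma laplace_norm_sq: "laplace (\<lambda>z. (Re z)\<^sup>2 + (Im z)\<^sup>2) z = 4"
proof -
  have 1: "dir_deriv v (\<lambda>z. (Re z)\<^sup>2 + (Im z)\<^sup>2) = (\<lambda>z. 2 * Re z * Re v + 2 * Im z * Im v)" for v
    by (rule ext, rule dir_deriv_eq) (auto intro!: derivative_eq_intros)
  have 2: "dir_deriv w (\<lambda>z. 2 * Re z * Re v + 2 * Im z * Im v) z = 2 * Re w * Re v + 2 * Im w * Im v" for v w z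
    by (rule dir_deriv_eq) (auto intro!: derivative_eq_intros)
  show ?thesis unfolding laplace_def 1 2 by simp
qed

text \<open>Testing against a function that is \<open>|z|\<^sup>2\<close> on a large disc bounds the integrals of
  the truncations of an exhaustion function, uniformly in the truncation level.\<close>

lemma square_test_function:
  assumes "0 < R" "R < 1"
  obtains \<psi> where "test_on unit_disc \<psi>" "\<And>z. \<psi> z \<ge> 0" "\<And>z. z \<in> cball 0 R \<Longrightarrow> laplace \<psi> z = 4"
proof -
  have "cball (0::complex) R \<subseteq> unit_disc" using assms by auto
  then obtain \<eta> W C where \<eta>: "\<And>m. Ck m \<eta>" "\<And>z. 0 \<le> \<eta> z" "\<And>z. \<eta> z \<le> 1"
      "open W" "cball 0 R \<subseteq> W" "\<And>z. z \<in> W \<Longrightarrow> \<eta> z = 1"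
      "compact C" "C \<subseteq> unit_disc" "\<And>z. z \<notin> C \<Longrightarrow> \<eta> z = 0"
    by (rule smooth_Urysohn[OF compact_cball open_ball]) blast
  define \<psi> where "\<psi> z = \<eta> z * ((Re z)\<^sup>2 + (Im z)\<^sup>2)" for z
  show thesis
  proof (rule that)
    show "test_on unit_disc \<psi>" unfolding \<psi>_def[abs_def] using \<eta>
      by (intro test_onI[of _ C] Ck_mult Ck_add Ck_power Ck_Re Ck_Im) auto
    show "\<psi> z \<ge> 0" for z using \<eta>(2)[of z] by (simp add: \<psi>_def)
    show "laplace \<psi> z = 4" if "z \<in> cball 0 R" for z
    proof -
      have "laplace \<psi> z = laplace (\<lambda>z. (Re z)\<^sup>2 + (Im z)\<^sup>2) z"
        by (rule laplace_cong_open[OF \<eta>(4)]) (use that \<eta> in \<open>auto simp: \<psi>_def\<close>)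
      then show ?thesis by (simp add: laplace_norm_sq)
    qed
  qed
qed

text \<open>Off a disc K all truncations are bounded by 1. On K the test function \<psi> has
  Laplacian 4, so nonnegativity of the pairing gives -4 \<integral> U over K at most Q times the
  area of the disc, uniformly in the truncation level. Monotone convergence does the rest.\<close>

lemma exhaustion_integrable:
  assumes u: "u \<in> exhaustions"
  shows "integrable lborel (ru u)" "AE z in lborel. z \<in> unit_disc \<longrightarrow> u z \<noteq> -\<infinity>"
proof -
  define U where "U n = ru (trunc u (- real (Suc n)))" for n
  have U: "U n \<in> borel_measurable borel" "\<And>z. \<bar>U n z\<bar> \<le> real (Suc n)" "\<And>z. U n z \<le> 0" for n
    unfolding U_def using ru_trunc_bound[OF u, of "- real (Suc n)"] ru_trunc_le_0[OF u, of "- real (Suc n)"]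
      ru_trunc_measurable[OF u] by (simp_all add: add.commute)
  note [measurable] = U(1) ru_measurable[OF exhaustions_continuous[OF u]]
  obtain R where R: "0 < R" "R < 1" "\<And>z. R < norm z \<Longrightarrow> norm z < 1 \<Longrightarrow> ereal (-1) < u z"
    using exhaustions_near_boundary[OF u, of "-1"] by auto
  define K where "K = cball (0::complex) R"
  have [measurable]: "K \<in> sets borel" by (simp add: K_def)
  have KD: "K \<subseteq> unit_disc" using R by (auto simp: K_def)
  have U1: "\<bar>U n z\<bar> \<le> 1" if "z \<notin> K" for n z
  proof (cases "z \<in> unit_disc")
    case True
    then have "ereal (-1) < u z" using that R(3) by (auto simp: K_def)
    then have "ereal (-1) < trunc u (- real (Suc n)) z" by (simp add: trunc_def less_max_iff_disj)
    then show ?thesis using ru_trunc[OF u _ True, of "- real (Suc n)"] by (simp add: U_def)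
  qed (simp add: U_def ru_def)
  obtain \<psi> where \<psi>: "test_on unit_disc \<psi>" "\<And>z. \<psi> z \<ge> 0" "\<And>z. z \<in> K \<Longrightarrow> laplace \<psi> z = 4"
    unfolding K_def using square_test_function[OF R(1,2)] by metis
  obtain Q where Q: "Q > 0" "\<And>z. \<bar>laplace \<psi> z\<bar> \<le> Q" using test_on_bounded[OF test_on_laplace[OF \<psi>(1)]] by metis
  have intU: "integrable lborel (U n)" for n unfolding U_def by (intro trunc_integrable u) auto
  have intUK: "integrable lborel (\<lambda>z. indicator K z * U n z)" for n
    by (rule integrable_bounded_support[where R = 1 and B = "real (Suc n)"])
       (use U KD in \<open>auto simp: indicator_def\<close>)
  have intB: "integrable lborel (indicator unit_disc :: complex \<Rightarrow> real)"
    using emeasure_bounded_finite[of "unit_disc :: complex set"] by auto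
  define c where "c = Q * measure lborel (unit_disc :: complex set) / 4"
  have c: "- (LINT z|lborel. indicator K z * U n z) \<le> c" for n
  proof -
    have "0 \<le> (LINT z|lborel. U n z * laplace \<psi> z)"
      unfolding U_def by (rule trunc_laplace_nonneg[OF u _ \<psi>(1,2)]) auto
    also have "\<dots> \<le> (LINT z|lborel. 4 * (indicator K z * U n z) + Q * indicator unit_disc z)"
    proof (rule Bochner_Integration.integral_mono)
      show "integrable lborel (\<lambda>z. U n z * laplace \<psi> z)"
        using integrable_loc_integrable[OF intU] test_on_laplace[OF \<psi>(1)] by (simp add: loc_integrable_def)
      show "integrable lborel (\<lambda>z. 4 * (indicator K z * U n z) + Q * indicator unit_disc z)"
        using intUK intB by auto
      fix z
      show "U n z * laplace \<psi> z \<le> 4 * (indicator K z * U n z) + Q * indicator unit_disc z"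
      proof (cases "z \<in> K")
        case True
        then show ?thesis using \<psi>(3) Q(1) by (simp add: indicator_def)
      next
        case False
        have "U n z * laplace \<psi> z \<le> \<bar>U n z\<bar> * \<bar>laplace \<psi> z\<bar>" by (metis abs_ge_self abs_mult)
        also have "\<dots> \<le> 1 * Q" using U1[OF False] Q(2) by (intro mult_mono) auto
        finally show ?thesis using False by (cases "z \<in> unit_disc") (auto simp: U_def ru_def)
      qed
    qed
    also have "\<dots> = 4 * (LINT z|lborel. indicator K z * U n z) + 4 * c"
      using intUK intB by (simp add: c_def)
    finally show ?thesis by linarith
  qed
  have Udec: "U (Suc n) z \<le> U n z" for n z
  proof (cases "z \<in> unit_disc")
    case True
    have "trunc u (- real (Suc (Suc n))) z \<le> trunc u (- real (Suc n)) z" unfolding trunc_def by (intro max.mono) auto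
    then show ?thesis using ru_trunc(1)[OF u _ True] by (simp add: U_def)
  qed (simp add: U_def ru_def)
  \<comment> \<open>The supremum is taken in \<open>ennreal\<close> so that poles of u show up as
    \<infinity>; \<open>ru u\<close>, which is 0 there, would not detect them.\<close>
  define h where "h z = (SUP n. ennreal (- (indicator K z * U n z)))" for z
  have "(\<integral>\<^sup>+ z. h z \<partial>lborel) = (SUP n. \<integral>\<^sup>+ z. ennreal (- (indicator K z * U n z)) \<partial>lborel)"
    unfolding h_def
  proof (rule nn_integral_monotone_convergence_SUP)
    show "incseq (\<lambda>n z. ennreal (- (indicator K z * U n z)))"
      using Udec by (intro incseq_SucI le_funI ennreal_leI) (auto simp: indicator_def)
  qed measurable
  also have "\<dots> \<le> ennreal c"
  proof (rule SUP_least)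
    fix n
    have "(\<integral>\<^sup>+ z. ennreal (- (indicator K z * U n z)) \<partial>lborel) = ennreal (LINT z|lborel. - (indicator K z * U n z))"
      using U(3) intUK by (intro nn_integral_eq_integral) (auto simp: indicator_def)
    also have "\<dots> \<le> ennreal c" using c[of n] by (intro ennreal_leI) simp
    finally show "(\<integral>\<^sup>+ z. ennreal (- (indicator K z * U n z)) \<partial>lborel) \<le> ennreal c" .
  qed
  finally have hfin: "(\<integral>\<^sup>+ z. h z \<partial>lborel) \<le> ennreal c" .
  have [measurable]: "h \<in> borel_measurable lborel" unfolding h_def[abs_def] by measurable
  have hAE: "AE z in lborel. h z \<noteq> \<infinity>"
    using hfin by (intro nn_integral_PInf_AE) (auto simp: top_unique)
  have hinf: "h z = \<infinity>" if "z \<in> K" "u z = -\<infinity>" for z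
  proof -
    have zD: "z \<in> unit_disc" using that KD by blast
    have "ennreal (real n) \<le> h z" for n
    proof -
      have "U n z = - real (Suc n)" using that zD by (simp add: U_def ru_def trunc_def)
      then have "ennreal (real n) \<le> ennreal (- (indicator K z * U n z))" using that by (intro ennreal_leI) simp
      also have "\<dots> \<le> h z" unfolding h_def by (rule SUP_upper) simp
      finally show ?thesis .
    qed
    then show ?thesis by (metis ennreal_SUP_of_nat_eq_top ennreal_of_nat_eq_real_of_nat SUP_least top_unique infinity_ennreal_def)
  qed
  from hAE show "AE z in lborel. z \<in> unit_disc \<longrightarrow> u z \<noteq> -\<infinity>"
  proof eventually_elim
    case (elim z)
    show ?case
    proof (cases "z \<in> K")
      case True
      then show ?thesis using elim hinf by blast
    next
      case False
      then show ?thesis using R(3)[of z] by (auto simp: K_def)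
    qed
  qed
  have hb: "ennreal \<bar>indicator K z * ru u z\<bar> \<le> h z" for z
  proof (cases "z \<in> K \<and> u z \<noteq> -\<infinity>")
    case True
    then have zD: "z \<in> unit_disc" using KD by blast
    then obtain x where x: "u z = ereal x" using True exhaustions_neg[OF u zD] by (cases "u z") auto
    then have x0: "x < 0" using exhaustions_neg[OF u zD] by simp
    obtain n where n: "- x < real n" using reals_Archimedean2 by blast
    have "U n z = x" using zD x n by (simp add: U_def ru_def trunc_def max_def)
    then have "ennreal \<bar>indicator K z * ru u z\<bar> = ennreal (- (indicator K z * U n z))"
      using x x0 zD True by (simp add: ru_def)
    also have "\<dots> \<le> h z" unfolding h_def by (rule SUP_upper) simp
    finally show ?thesis .
  qed (auto simp: ru_def)
  have "integrable lborel (\<lambda>z. indicator K z * ru u z)"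
  proof (rule integrableI_bounded)
    have "(\<integral>\<^sup>+ z. ennreal (norm (indicator K z * ru u z)) \<partial>lborel) \<le> (\<integral>\<^sup>+ z. h z \<partial>lborel)"
      using hb by (intro nn_integral_mono) simp
    also have "\<dots> < \<infinity>" using hfin by (auto simp: le_less_trans)
    finally show "(\<integral>\<^sup>+ z. ennreal (norm (indicator K z * ru u z)) \<partial>lborel) < \<infinity>" .
  qed measurable
  moreover have "integrable lborel (\<lambda>z. indicator (- K) z * ru u z)"
  proof (rule integrable_bounded_support[where R = 1 and B = 1])
    fix z
    show "\<bar>indicator (- K) z * ru u z\<bar> \<le> 1"
    proof (cases "z \<in> unit_disc - K")
      case True
      then have "ereal (-1) < u z" "u z < 0" using R(3) exhaustions_neg[OF u] by (auto simp: K_def)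
      then show ?thesis using True by (cases "u z") (auto simp: ru_def)
    qed (auto simp: ru_def)
    show "indicator (- K) z * ru u z = 0" if "z \<notin> ball 0 1" for z
      using that by (simp add: ru_outside)
  qed measurable
  ultimately have "integrable lborel (\<lambda>z. indicator K z * ru u z + indicator (- K) z * ru u z)" by (rule Bochner_Integration.integrable_add)
  moreover have "(\<lambda>z. indicator K z * ru u z + indicator (- K) z * ru u z) = ru u"
    by (auto simp: indicator_def)
  ultimately show "integrable lborel (ru u)" by simp
qed

text \<open>The submean argument is for bounded functions, so the inequality is proved for
  truncations and carried over by dominated convergence, with the integrable majorant |u| times a
  bound of \<Delta>\<phi>.\<close>

lemma exhaustion_laplace_nonneg:
  assumes u: "u \<in> exhaustions" and \<phi>: "test_on unit_disc \<phi>" "\<And>z. \<phi> z \<ge> 0"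
  shows "0 \<le> (LINT z|lborel. ru u z * laplace \<phi> z)"
proof -
  define U where "U n = ru (trunc u (- real (Suc n)))" for n
  obtain Q where Q: "Q > 0" "\<And>z. \<bar>laplace \<phi> z\<bar> \<le> Q" using test_on_bounded[OF test_on_laplace[OF \<phi>(1)]] by metis
  have [measurable]: "U n \<in> borel_measurable borel" "ru u \<in> borel_measurable borel" "laplace \<phi> \<in> borel_measurable borel" for n
    unfolding U_def using test_on_borel[OF test_on_laplace[OF \<phi>(1)]] ru_trunc_measurable[OF u]
      ru_measurable[OF exhaustions_continuous[OF u]] by simp_all
  have fin: "AE z in lborel. \<bar>u z\<bar> \<noteq> \<infinity> \<or> z \<notin> unit_disc"
    using exhaustion_integrable(2)[OF u] by eventually_elim (use exhaustions_neg[OF u] in fastforce)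
  have "(\<lambda>n. LINT z|lborel. U n z * laplace \<phi> z) \<longlonglongrightarrow> (LINT z|lborel. ru u z * laplace \<phi> z)"
  proof (rule integral_dominated_convergence[where w = "\<lambda>z. \<bar>ru u z\<bar> * Q"])
    show "integrable lborel (\<lambda>z. \<bar>ru u z\<bar> * Q)" using exhaustion_integrable(1)[OF u] by simp
    show "AE z in lborel. (\<lambda>n. U n z * laplace \<phi> z) \<longlonglongrightarrow> ru u z * laplace \<phi> z"
      using fin
    proof eventually_elim
      case (elim z)
      show ?case
      proof (cases "z \<in> unit_disc")
        case True
        then obtain x where x: "u z = ereal x" using elim by (cases "u z") auto
        obtain N where N: "- x < real N" using reals_Archimedean2 by blast
        have "U n z = ru u z" if "n \<ge> N" for n
          using True x N that by (auto simp: U_def ru_def trunc_def max_def)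
        then have "\<forall>\<^sub>F n in sequentially. U n z * laplace \<phi> z = ru u z * laplace \<phi> z"
          unfolding eventually_sequentially by (intro exI[of _ N]) auto
        then show ?thesis by (rule tendsto_eventually)
      qed (simp add: U_def ru_def)
    qed
    show "AE z in lborel. norm (U n z * laplace \<phi> z) \<le> \<bar>ru u z\<bar> * Q" for n
      using fin
    proof eventually_elim
      case (elim z)
      have "\<bar>U n z\<bar> \<le> \<bar>ru u z\<bar>"
      proof (cases "z \<in> unit_disc")
        case True
        then obtain x where x: "u z = ereal x" using elim by (cases "u z") auto
        moreover have "x < 0" using x exhaustions_neg[OF u True] by simp
        ultimately show ?thesis using True by (auto simp: U_def ru_def trunc_def max_def)
      qed (simp add: U_def ru_def)
      then show ?case using Q(2)[of z] by (auto simp: abs_mult intro!: mult_mono)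
    qed
  qed measurable
  moreover have "0 \<le> (LINT z|lborel. U n z * laplace \<phi> z)" for n
    unfolding U_def by (rule trunc_laplace_nonneg[OF u _ \<phi>]) auto
  ultimately show ?thesis by (intro LIMSEQ_le_const) auto
qed

lemma exhaustion_has_laplacian:
  assumes u: "u \<in> exhaustions"
  shows "has_laplacian u (laplacian u)"
proof -
  obtain M where "has_laplacian u M"
    using has_laplacian_exists[OF integrable_loc_integrable[OF exhaustion_integrable(1)[OF u]] exhaustion_laplace_nonneg[OF u]]
    by metis
  then show ?thesis using laplacian_eqI by metis
qed

lemma trunc_has_laplacian':
  assumes u: "u \<in> exhaustions" and r: "r < 0"
  shows "has_laplacian (trunc u r) (laplacian (trunc u r))"
  using trunc_has_laplacian[OF assms] laplacian_eqI by metis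

section \<open>Level measures\<close>

text \<open>A cut-off that is 1 near K has a Laplacian vanishing on K, so it pairs equally with u
  and v. Total mass thus depends only on the behaviour near the boundary, as in Green's
  formula.\<close>

lemma laplacian_mass_le:
  assumes M: "has_laplacian u M" and N: "has_laplacian v N"
    and K: "compact K" "K \<subseteq> unit_disc" "\<And>z. z \<notin> K \<Longrightarrow> ru u z = ru v z"
  shows "emeasure M unit_disc \<le> emeasure N unit_disc"
proof (rule radon_total_mass)
  show rM: "radon_on_disc M" using M by (simp add: has_laplacian_iff)
  have rN: "radon_on_disc N" using N by (simp add: has_laplacian_iff)
  fix K' assume K': "compact K'" "K' \<subseteq> unit_disc"
  have "compact (K \<union> K')" "K \<union> K' \<subseteq> unit_disc" using K K' by auto
  then obtain \<eta> W C where \<eta>: "\<And>m. Ck m \<eta>" "\<And>z. 0 \<le> \<eta> z" "\<And>z. \<eta> z \<le> 1"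
      "open W" "K \<union> K' \<subseteq> W" "\<And>z. z \<in> W \<Longrightarrow> \<eta> z = 1"
      "compact C" "C \<subseteq> unit_disc" "\<And>z. z \<notin> C \<Longrightarrow> \<eta> z = 0"
    by (rule smooth_Urysohn[OF _ open_ball]) blast
  have t: "test_on unit_disc \<eta>" using \<eta> by (intro test_onI[of _ C]) auto
  have "laplace \<eta> z = 0" if "z \<in> K" for z
  proof -
    have "laplace \<eta> z = laplace (\<lambda>z. 1) z"
      by (rule laplace_cong_open[OF \<eta>(4)]) (use that \<eta> in auto)
    then show ?thesis by (simp add: laplace_def)
  qed
  then have e: "(\<lambda>z. ru u z * laplace \<eta> z) = (\<lambda>z. ru v z * laplace \<eta> z)"
    using K(3) by (metis mult_zero_right)
  have eq: "(LINT z|M. \<eta> z) = (LINT z|N. \<eta> z)"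
    using M N t e by (simp add: has_laplacian_iff)
  have "emeasure M K' \<le> ennreal (LINT z|M. \<eta> z)"
  proof (rule radon_le_integral[OF rM t \<eta>(2) K'])
    show "1 \<le> \<eta> z" if "z \<in> K'" for z using \<eta>(5) \<eta>(6)[of z] that by auto
  qed
  also have "\<dots> = ennreal (LINT z|N. \<eta> z)" using eq by simp
  also have "\<dots> \<le> emeasure N unit_disc"
  proof (rule radon_ge_integral[OF rN t \<eta>(2,3)])
    show "\<eta> z = 0" if "z \<notin> unit_disc" for z using \<eta>(8,9) that by blast
  qed auto
  finally show "emeasure M K' \<le> emeasure N unit_disc" .
qed

lemma exhaustion_sublevel_compact:
  assumes u: "u \<in> exhaustions" and r: "r < 0"
  obtains K where "compact K" "K \<subseteq> unit_disc" "\<And>z. z \<in> unit_disc \<Longrightarrow> u z \<le> ereal r \<Longrightarrow> z \<in> K"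
proof -
  obtain R where R: "0 < R" "R < 1" "\<And>z. R < norm z \<Longrightarrow> norm z < 1 \<Longrightarrow> ereal r < u z"
    using exhaustions_near_boundary[OF u r] by metis
  show thesis
  proof (rule that[of "cball 0 R"])
    show "z \<in> cball 0 R" if "z \<in> unit_disc" "u z \<le> ereal r" for z
      using R(3)[of z] that by force
  qed (use R in auto)
qed

lemma trunc_eq_above: "u z \<ge> ereal r \<Longrightarrow> ru (trunc u r) z = ru u z"
  by (simp add: ru_def trunc_def max_def)

lemma trunc_mass:
  assumes u: "u \<in> exhaustions" and r: "r < 0"
  shows "emeasure (laplacian (trunc u r)) unit_disc = emeasure (laplacian u) unit_disc"
proof -
  obtain K where K: "compact K" "K \<subseteq> unit_disc" "\<And>z. z \<in> unit_disc \<Longrightarrow> u z \<le> ereal r \<Longrightarrow> z \<in> K"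
    using exhaustion_sublevel_compact[OF assms] by metis
  have eq: "ru (trunc u r) z = ru u z" if "z \<notin> K" for z
    using K(3)[of z] that trunc_eq_above[of r u z] ru_outside[of z] by (metis linear)
  show ?thesis
    using laplacian_mass_le[OF trunc_has_laplacian'[OF u r] exhaustion_has_laplacian[OF u] K(1,2) eq]
      laplacian_mass_le[OF exhaustion_has_laplacian[OF u] trunc_has_laplacian'[OF u r] K(1,2) eq[symmetric]]
    by (rule antisym)
qed

lemma open_superlevel:
  assumes "u \<in> exhaustions"
  shows "open {z \<in> unit_disc. ereal r < u z}" "open (sublevel u r)"
proof -
  have "open (unit_disc \<inter> u -` {ereal r<..})" "open (unit_disc \<inter> u -` {..<ereal r})"
    using exhaustions_continuous[OF assms] by (auto intro!: continuous_open_preimage)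
  then show "open {z \<in> unit_disc. ereal r < u z}" "open (sublevel u r)"
    by (simp_all add: vimage_def Int_def sublevel_def)
qed

text \<open>Near a compact subset of \<open>{u \<ge> r}\<close> the function \<open>u\<close> coincides with its truncation at
  \<open>r - \<epsilon>\<close>, and these truncations converge uniformly to the truncation at \<open>r\<close>.\<close>

lemma laplacian_le_trunc_compact:
  assumes u: "u \<in> exhaustions" and r: "r < 0" and fin: "emeasure (laplacian u) unit_disc < \<infinity>"
    and K: "compact K" "K \<subseteq> unit_disc - sublevel u r"
  shows "emeasure (laplacian u) K \<le> emeasure (laplacian (trunc u r)) K"
proof -
  define M where "M r = laplacian (trunc u r)" for r
  have M: "has_laplacian (trunc u r) (M r)" if "r < 0" for r
    unfolding M_def using that by (rule trunc_has_laplacian'[OF u])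
  then have rM: "radon_on_disc (M r)" if "r < 0" for r using that by (simp add: has_laplacian_iff)
  have KD: "K \<subseteq> unit_disc" using K by blast
  have 1: "emeasure (laplacian u) K \<le> ennreal (LINT z|M r. \<phi> z)"
    if \<phi>: "test_on unit_disc \<phi>" "\<And>z. \<phi> z \<ge> 0" "\<And>z. z \<in> K \<Longrightarrow> \<phi> z \<ge> 1" for \<phi>
  proof -
    define I where "I = (LINT z|lborel. \<bar>laplace \<phi> z\<bar>)"
    have iL: "integrable lborel (\<lambda>z. \<bar>laplace \<phi> z\<bar>)"
      using test_on_integrable[OF test_on_laplace[OF \<phi>(1)]] by simp
    have step: "emeasure (laplacian u) K \<le> ennreal ((LINT z|M r. \<phi> z) + e * I)" if e: "0 < e" for e
    proof -
      have r': "r - e < 0" using r e by simp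
      have "emeasure (laplacian u) K = emeasure (M (r - e)) K"
      proof (rule has_laplacian_cong_open[OF exhaustion_has_laplacian[OF u] M[OF r']])
        show "open {z \<in> unit_disc. ereal (r - e) < u z}" using open_superlevel[OF u] by blast
        show "ru u z = ru (trunc u (r - e)) z" if "z \<in> {z \<in> unit_disc. ereal (r - e) < u z}" for z
          using that trunc_eq_above[of "r - e" u z] by auto
        show "K \<subseteq> {z \<in> unit_disc. ereal (r - e) < u z}"
        proof
          fix z assume "z \<in> K"
          then have "z \<in> unit_disc" "ereal r \<le> u z" using K by (auto simp: sublevel_def)
          moreover have "ereal (r - e) < ereal r" using e by simp
          ultimately have "ereal (r - e) < u z" by (metis less_le_trans)
          with \<open>z \<in> unit_disc\<close> show "z \<in> {z \<in> unit_disc. ereal (r - e) < u z}" by blast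
        qed
      qed (use K in \<open>auto simp: borel_compact\<close>)
      also have "\<dots> \<le> ennreal (LINT z|M (r - e). \<phi> z)"
        by (rule radon_le_integral[OF rM[OF r'] \<phi>(1,2) K(1) KD \<phi>(3)])
      also have "\<dots> \<le> ennreal ((LINT z|M r. \<phi> z) + e * I)"
      proof (rule ennreal_leI)
        have i: "integrable lborel (\<lambda>z. ru (trunc u r) z * laplace \<phi> z)" if "r < 0" for r
          using integrable_loc_integrable[OF trunc_integrable[OF u that]] test_on_laplace[OF \<phi>(1)] by (simp add: loc_integrable_def)
        have "(LINT z|M (r - e). \<phi> z) - (LINT z|M r. \<phi> z) =
            (LINT z|lborel. ru (trunc u (r - e)) z * laplace \<phi> z - ru (trunc u r) z * laplace \<phi> z)"
          using M[OF r'] M[OF r] \<phi>(1) i[OF r'] i[OF r] by (simp add: has_laplacian_iff)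
        also have "\<dots> \<le> (LINT z|lborel. e * \<bar>laplace \<phi> z\<bar>)"
        proof (rule Bochner_Integration.integral_mono)
          fix z
          have "\<bar>ru (trunc u (r - e)) z - ru (trunc u r) z\<bar> \<le> e"
          proof (cases "z \<in> unit_disc")
            case True
            have "u z < 0" by (rule exhaustions_neg[OF u True])
            then show ?thesis using True e r by (cases "u z") (auto simp: ru_def trunc_def max_def)
          qed (use e in \<open>simp add: ru_outside\<close>)
          then have "\<bar>ru (trunc u (r - e)) z - ru (trunc u r) z\<bar> * \<bar>laplace \<phi> z\<bar> \<le> e * \<bar>laplace \<phi> z\<bar>"
            by (rule mult_right_mono) simp
          then show "ru (trunc u (r - e)) z * laplace \<phi> z - ru (trunc u r) z * laplace \<phi> z \<le> e * \<bar>laplace \<phi> z\<bar>"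
            unfolding left_diff_distrib[symmetric] by (metis abs_ge_self abs_mult order_trans)
        qed (use i[OF r'] i[OF r] iL in auto)
        also have "\<dots> = e * I" by (simp add: I_def)
        finally show "(LINT z|M (r - e). \<phi> z) \<le> (LINT z|M r. \<phi> z) + e * I" by linarith
      qed
      finally show ?thesis .
    qed
    have "((\<lambda>e. ennreal ((LINT z|M r. \<phi> z) + e * I)) \<longlongrightarrow> ennreal ((LINT z|M r. \<phi> z) + 0 * I)) (at_right 0)"
      by (intro tendsto_intros tendsto_ennrealI)
    moreover have "\<forall>\<^sub>F e in at_right 0. emeasure (laplacian u) K \<le> ennreal ((LINT z|M r. \<phi> z) + e * I)"
      using eventually_at_right_less by (rule eventually_mono) (rule step)
    ultimately show ?thesis
      using tendsto_lowerbound[of "\<lambda>e. ennreal ((LINT z|M r. \<phi> z) + e * I)" _ "at_right 0"] by simp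
  qed
  have e: "emeasure (restr (M r) unit_disc) A = emeasure (M r) (A \<inter> unit_disc)" if "A \<in> sets borel" for A
    using that by (intro emeasure_restr rM r) auto
  have sp: "space (restr (M r) unit_disc) = UNIV" by (simp add: restr_def)
  have fin': "emeasure (M r) unit_disc < \<infinity>" using trunc_mass[OF u r] fin by (simp add: M_def)
  \<comment> \<open>The bounds so far are by integrals of test functions; choosing these with
    supports in neighbourhoods of \<open>K\<close>, outer regularity turns them into a bound by the
    measure of \<open>K\<close> itself.\<close>
  have "emeasure (laplacian u) K \<le> (INF U\<in>{U. K \<subseteq> U \<and> open U}. emeasure (restr (M r) unit_disc) U)"
  proof (rule INF_greatest)
    fix U assume "U \<in> {U. K \<subseteq> U \<and> open U}"
    then have U: "open (U \<inter> unit_disc)" "K \<subseteq> U \<inter> unit_disc" "open U" using KD by auto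
    obtain \<eta> W C where \<eta>: "\<And>m. Ck m \<eta>" "\<And>z. 0 \<le> \<eta> z" "\<And>z. \<eta> z \<le> 1"
      "open W" "K \<subseteq> W" "\<And>z. z \<in> W \<Longrightarrow> \<eta> z = 1"
      "compact C" "C \<subseteq> U \<inter> unit_disc" "\<And>z. z \<notin> C \<Longrightarrow> \<eta> z = 0"
      by (rule smooth_Urysohn[OF K(1) U(1,2)]) blast
    have t: "test_on unit_disc \<eta>" using \<eta> by (intro test_onI[of _ C]) auto
    have "emeasure (laplacian u) K \<le> ennreal (LINT z|M r. \<eta> z)"
    proof (rule 1[OF t \<eta>(2)])
      show "1 \<le> \<eta> z" if "z \<in> K" for z using \<eta>(5) \<eta>(6)[of z] that by auto
    qed
    also have "\<dots> \<le> emeasure (M r) (U \<inter> unit_disc)"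
    proof (rule radon_ge_integral[OF rM[OF r] t \<eta>(2,3)])
      show "\<eta> z = 0" if "z \<notin> U \<inter> unit_disc" for z using \<eta>(8,9) that by blast
    qed (use U in auto)
    finally show "emeasure (laplacian u) K \<le> emeasure (restr (M r) unit_disc) U" using U by (simp add: e)
  qed
  also have "\<dots> = emeasure (restr (M r) unit_disc) K"
    using fin' K(1) sp by (intro outer_regular[symmetric]) (auto simp: e borel_compact)
  finally show ?thesis
    unfolding e[OF borel_compact[OF K(1)]] Int_absorb2[OF KD] by (simp only: M_def)
qed

text \<open>This is the nonnegativity of \<mu> = \<Delta>u_r - \<chi> \<Delta>u, obtained from
  compact sets by inner regularity.\<close>

lemma laplacian_le_trunc:
  assumes u: "u \<in> exhaustions" and r: "r < 0" and fin: "emeasure (laplacian u) unit_disc < \<infinity>"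
    and E: "E \<in> sets borel" "E \<subseteq> unit_disc"
  shows "emeasure (laplacian u) (E - sublevel u r) \<le> emeasure (laplacian (trunc u r)) E"
proof -
  have rM: "radon_on_disc (laplacian u)" "radon_on_disc (laplacian (trunc u r))"
    using exhaustion_has_laplacian[OF u] trunc_has_laplacian'[OF u r] by (auto simp: has_laplacian_iff)
  have "E - sublevel u r \<in> sets borel" using E open_superlevel(2)[OF u] by (auto simp: borel_open)
  then have "emeasure (laplacian u) (E - sublevel u r) = (SUP K\<in>{K. K \<subseteq> E - sublevel u r \<and> compact K}. emeasure (laplacian u) K)"
    using E by (intro radon_inner_regular rM fin) auto
  also have "\<dots> \<le> emeasure (laplacian (trunc u r)) E"
  proof (rule SUP_least)
    fix K assume "K \<in> {K. K \<subseteq> E - sublevel u r \<and> compact K}"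
    then have K: "K \<subseteq> E - sublevel u r" "compact K" by auto
    then have "emeasure (laplacian u) K \<le> emeasure (laplacian (trunc u r)) K"
      using E by (intro laplacian_le_trunc_compact u r fin) auto
    also have "\<dots> \<le> emeasure (laplacian (trunc u r)) E"
      using K E by (intro emeasure_mono) (auto simp: radon_sets[OF rM(2)])
    finally show "emeasure (laplacian u) K \<le> emeasure (laplacian (trunc u r)) E" .
  qed
  finally show ?thesis .
qed

text \<open>\<chi> \<Delta>u is realized as a density of \<Delta>u and lies below \<Delta>u_r. As
  the masses are finite, the difference is a measure, and cancellation makes it the only solution of
  the defining equation, so the definite description denotes it.\<close>

lemma level_measure:
  assumes u: "u \<in> exhaustions" and r: "r < 0" and fin: "emeasure (laplacian u) unit_disc < \<infinity>"
  shows "radon_on_disc (level_measure u r)"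
    and "\<And>E. E \<in> sets borel \<Longrightarrow> E \<subseteq> unit_disc \<Longrightarrow>
      emeasure (level_measure u r) E + emeasure (laplacian u) (E - sublevel u r) = emeasure (laplacian (trunc u r)) E"
proof -
  define A where "A = laplacian (trunc u r)"
  define P where "P M \<longleftrightarrow> radon_on_disc M \<and>
     (\<forall>E\<in>sets (restrict_space borel unit_disc).
        emeasure M E + emeasure (laplacian u) (E - sublevel u r) = emeasure A E)" for M
  have ru: "radon_on_disc (laplacian u)" and rA: "radon_on_disc A"
    using exhaustion_has_laplacian[OF u] trunc_has_laplacian'[OF u r] by (auto simp: has_laplacian_iff A_def)
  have finA: "emeasure A unit_disc < \<infinity>" using trunc_mass[OF u r] fin by (simp add: A_def)
  have [measurable]: "sublevel u r \<in> sets borel" using open_superlevel(2)[OF u] by (simp add: borel_open)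
  have sd: "unit_disc - sublevel u r \<in> sets (laplacian u)" by (subst radon_sets[OF ru]) auto
  define N where "N = density (laplacian u) (indicator (unit_disc - sublevel u r))"
  have sN: "sets N = sets A" using ru rA by (simp add: N_def radon_on_disc_def)
  have eN: "emeasure N E = emeasure (laplacian u) (E - sublevel u r)" if "E \<in> sets A" for E
  proof -
    have E: "E \<in> sets borel" "E \<subseteq> unit_disc" using that by (auto simp: radon_sets[OF rA])
    have "emeasure N E = (\<integral>\<^sup>+ x. indicator (unit_disc - sublevel u r) x * indicator E x \<partial>laplacian u)"
      unfolding N_def
    proof (rule emeasure_density)
      show "indicator (unit_disc - sublevel u r) \<in> borel_measurable (laplacian u)"
        using sd by (rule borel_measurable_indicator)
      show "E \<in> sets (laplacian u)" using E by (simp add: radon_sets[OF ru])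
    qed
    also have "\<dots> = (\<integral>\<^sup>+ x. indicator (E - sublevel u r) x \<partial>laplacian u)"
      using E by (intro nn_integral_cong) (auto simp: indicator_def)
    also have "\<dots> = emeasure (laplacian u) (E - sublevel u r)"
      using E by (intro nn_integral_indicator) (auto simp: radon_sets[OF ru])
    finally show ?thesis .
  qed
  have le: "emeasure N E \<le> emeasure A E" if "E \<in> sets A" for E
  proof -
    have "E \<in> sets borel" "E \<subseteq> unit_disc" using that radon_sets[OF rA] by blast+
    then show ?thesis unfolding eN[OF that] unfolding A_def by (rule laplacian_le_trunc[OF u r fin])
  qed
  have fA: "finite_measure A" using finA by (intro finite_measureI) (simp add: radon_space[OF rA])
  have spA: "space A \<in> sets A" by simp
  have fN: "finite_measure N"
    using le[OF spA] finA by (intro finite_measureI) (auto simp: radon_space[OF rA] sets_eq_imp_space_eq[OF sN])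
  have ex: "P (diff_measure A N)"
  proof -
    have eq: "emeasure (diff_measure A N) E + emeasure (laplacian u) (E - sublevel u r) = emeasure A E" if "E \<in> sets A" for E
      using emeasure_diff_measure[OF fA fN sN[symmetric] le that] le[OF that] eN[OF that]
      by (simp add: diff_add_cancel_ennreal)
    have sA: "sets A = sets (restrict_space borel unit_disc)" using rA by (simp add: radon_on_disc_def)
    have "emeasure (diff_measure A N) K < \<infinity>" if "compact K" "K \<subseteq> unit_disc" for K
    proof -
      have "K \<in> sets A" using that by (simp add: radon_sets[OF rA] borel_compact)
      then have "emeasure (diff_measure A N) K \<le> emeasure A K" using eq by (metis add_increasing2 order_refl zero_le)
      then show ?thesis using radon_compact[OF rA that] by simp
    qed
    then show ?thesis using eq sA by (simp add: P_def radon_on_disc_def)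
  qed
  have uniq: "M = M'" if "P M" "P M'" for M M'
  proof (rule measure_eqI)
    have r: "radon_on_disc M" "radon_on_disc M'" using that by (auto simp: P_def)
    then show "sets M = sets M'" by (simp add: radon_on_disc_def)
    fix E assume "E \<in> sets M"
    then have E: "E \<in> sets (restrict_space borel unit_disc)" using r by (simp add: radon_on_disc_def)
    then have EA: "E \<in> sets A" using rA by (simp add: radon_on_disc_def)
    have "emeasure A E < \<infinity>" using finite_measure.emeasure_finite[OF fA, of E] by (simp add: less_top)
    then have "emeasure (laplacian u) (E - sublevel u r) < \<infinity>" using le[OF EA] eN[OF EA] by simp
    moreover have "emeasure M E + emeasure (laplacian u) (E - sublevel u r) = emeasure M' E + emeasure (laplacian u) (E - sublevel u r)"
      using that E by (simp add: P_def)
    ultimately show "emeasure M E = emeasure M' E" by (metis add.commute ennreal_add_left_cancel infinity_ennreal_def less_irrefl)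
  qed
  have "level_measure u r = (THE M. P M)" unfolding level_measure_def P_def A_def ..
  moreover have "P (THE M. P M)" using theI[of P, OF ex uniq[OF _ ex]] .
  ultimately have PL: "P (level_measure u r)" by simp
  then show "radon_on_disc (level_measure u r)" by (simp add: P_def)
  show "emeasure (level_measure u r) E + emeasure (laplacian u) (E - sublevel u r) = emeasure (laplacian (trunc u r)) E"
    if "E \<in> sets borel" "E \<subseteq> unit_disc" for E
    using PL that unfolding P_def A_def by (simp add: sets_disc_iff)
qed

lemma level_measure_mass:
  assumes u: "u \<in> exhaustions1" and r: "r < 0"
  shows "emeasure (level_measure u r) (space (level_measure u r)) \<le> 1"
proof -
  have u': "u \<in> exhaustions" and m: "emeasure (laplacian u) unit_disc = 1" using u by (auto simp: exhaustions1_def)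
  have fin: "emeasure (laplacian u) unit_disc < \<infinity>" by (simp add: m)
  have "emeasure (level_measure u r) unit_disc + emeasure (laplacian u) (unit_disc - sublevel u r) = 1"
    using level_measure(2)[OF u' r fin, of unit_disc] trunc_mass[OF u' r] m by simp
  then have "emeasure (level_measure u r) unit_disc \<le> 1" by (metis add_increasing2 order_refl zero_le)
  then show ?thesis by (simp add: radon_space[OF level_measure(1)[OF u' r fin]])
qed

lemma PS_limsup_le_Hinf:
  assumes u: "u \<in> exhaustions1" and f: "f \<in> Hinf_space" and p: "p > 0"
  shows "PS_limsup u p f \<le> ennreal (Hinf_norm f powr p)"
  unfolding PS_limsup_def
proof (rule Limsup_bounded)
  have bd: "norm (f z) \<le> Hinf_norm f" if "z \<in> unit_disc" for z
    unfolding Hinf_norm_def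
  proof (rule cSUP_upper[OF that])
    obtain B where "\<And>z. z \<in> unit_disc \<Longrightarrow> norm (f z) \<le> B" using f unfolding Hinf_space_def bounded_iff by blast
    then show "bdd_above ((\<lambda>z. norm (f z)) ` unit_disc)" by (intro bdd_aboveI2[where M = B])
  qed
  have *: "(\<integral>\<^sup>+ z\<in>level u r. ennreal (norm (f z) powr p) \<partial>level_measure u r) \<le> ennreal (Hinf_norm f powr p)" if r: "r < 0" for r
  proof -
    have "(\<integral>\<^sup>+ z\<in>level u r. ennreal (norm (f z) powr p) \<partial>level_measure u r) \<le> (\<integral>\<^sup>+ z. ennreal (Hinf_norm f powr p) \<partial>level_measure u r)"
    proof (rule nn_integral_mono)
      fix z
      show "ennreal (norm (f z) powr p) * indicator (level u r) z \<le> ennreal (Hinf_norm f powr p)"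
      proof (cases "z \<in> level u r")
        case True
        then have "norm (f z) powr p \<le> Hinf_norm f powr p"
          using p bd by (intro powr_mono2) (auto simp: level_def)
        then show ?thesis using True by (simp add: ennreal_leI)
      qed simp
    qed
    also have "\<dots> = ennreal (Hinf_norm f powr p) * emeasure (level_measure u r) (space (level_measure u r))" by simp
    also have "\<dots> \<le> ennreal (Hinf_norm f powr p) * 1" by (intro mult_left_mono level_measure_mass u r) simp
    finally show ?thesis by simp
  qed
  show "\<forall>\<^sub>F r in at_left 0. (\<integral>\<^sup>+ z\<in>level u r. ennreal (norm (f z) powr p) \<partial>level_measure u r) \<le> ennreal (Hinf_norm f powr p)"
    unfolding eventually_at_left_field using * by (intro exI[of _ "-1"]) auto
qed

lemma Hinf_ball_subset_PS_ball:
  fixes u :: "'k::finite \<Rightarrow> complex \<Rightarrow> ereal"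
  assumes u: "\<And>j. u j \<in> exhaustions1" and p: "p > 0"
  shows "Hinf_ball R \<subseteq> PS_ball u p R"
proof
  fix f :: "'k \<Rightarrow> complex \<Rightarrow> complex" assume f: "f \<in> Hinf_ball R"
  have le: "PS_limsup (u j) p (f j) \<le> ennreal (Hinf_norm (f j) powr p)" for j
    using f by (intro PS_limsup_le_Hinf u p) (auto simp: Hinf_ball_def)
  have pos: "Hinf_norm (f j) \<ge> 0" for j
  proof -
    have "f j \<in> Hinf_space" using f by (auto simp: Hinf_ball_def)
    then obtain B where "\<And>z. z \<in> unit_disc \<Longrightarrow> norm (f j z) \<le> B" unfolding Hinf_space_def bounded_iff by blast
    then have "bdd_above ((\<lambda>z. norm (f j z)) ` unit_disc)" by (intro bdd_aboveI2[where M = B])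
    from cSUP_upper[OF _ this, of 0] show ?thesis unfolding Hinf_norm_def by (simp add: order_trans[OF norm_ge_zero])
  qed
  have "PS_norm (u j) p (f j) \<le> Hinf_norm (f j)" for j
  proof -
    have "enn2real (PS_limsup (u j) p (f j)) \<le> Hinf_norm (f j) powr p"
      using le[of j] by (intro enn2real_leI) auto
    then have "PS_norm (u j) p (f j) \<le> (Hinf_norm (f j) powr p) powr (1 / p)"
      unfolding PS_norm_def using p by (intro powr_mono2) auto
    also have "\<dots> = Hinf_norm (f j)" using p pos[of j] by (simp add: powr_powr)
    finally show ?thesis .
  qed
  then have "(\<Sum>j\<in>UNIV. PS_norm (u j) p (f j)) \<le> (\<Sum>j\<in>UNIV. Hinf_norm (f j))" by (intro sum_mono)
  moreover have "f j \<in> PS_space (u j) p" for j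
    using f le[of j] by (auto simp: Hinf_ball_def Hinf_space_def PS_space_def intro: le_less_trans)
  ultimately show "f \<in> PS_ball u p R" using f by (auto simp: PS_ball_def Hinf_ball_def)
qed

section \<open>Green functions\<close>

text \<open>ln |1 + c w| is the real part of Ln (1 + c w), which is holomorphic on the disc of
  radius 1 / |c| > 1 because 1 + c w has positive real part there; its value at 0 is 0.\<close>

lemma mean_ln_aux:
  assumes "norm c < 1"
  shows "(LINT w|circle_measure. ln (norm (1 + c * w))) = 0"
proof (cases "c = 0")
  case True
  then show ?thesis by simp
next
  case False
  define S where "S = ball (0::complex) (1 / norm c)"
  have "1 < 1 / norm c" using assms False by simp
  then have S: "open S" "cball 0 1 \<subseteq> S" by (auto simp: S_def)
  have pos: "Re (1 + c * w) > 0" if "w \<in> S" for w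
  proof -
    have "norm (c * w) < 1" using that False by (simp add: S_def norm_mult field_simps)
    then show ?thesis using abs_Re_le_cmod[of "c * w"] by auto
  qed
  \<comment> \<open>Extension by 0 makes the logarithm measurable on the whole plane, as
    \<open>circle_mean_value\<close> demands.\<close>
  define f where "f w = (if w \<in> S then Ln (1 + c * w) else 0)" for w
  have h: "(\<lambda>w. Ln (1 + c * w)) holomorphic_on S"
    by (intro holomorphic_intros) (use pos in \<open>auto simp: complex_nonpos_Reals_iff dest!: pos\<close>)
  have hf: "f holomorphic_on S" using h by (rule holomorphic_transform) (simp add: f_def)
  have meas: "f \<in> borel_measurable borel"
    unfolding f_def using S(1) holomorphic_on_imp_continuous_on[OF h]
    by (intro borel_measurable_continuous_on_if) (auto simp: borel_open)
  have "(LINT w|circle_measure. f (0 + of_real 1 * w)) = f 0"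
    by (rule circle_mean_value[OF hf S _ meas]) simp
  then have m: "(LINT w|circle_measure. f w) = 0" using False by (simp add: f_def S_def)
  have cf: "continuous_on (sphere 0 1) f"
    using holomorphic_on_imp_continuous_on[OF hf] by (rule continuous_on_subset) (use S in auto)
  have "integrable circle_measure f" by (rule integral_circle_measure(1)[OF cf meas])
  then have "(LINT w|circle_measure. Re (f w)) = 0" using m by simp
  moreover have "(LINT w|circle_measure. ln (norm (1 + c * w))) = (LINT w|circle_measure. Re (f w))"
  proof (rule integral_cong_AE)
    show "AE w in circle_measure. ln (norm (1 + c * w)) = Re (f w)"
    proof (rule AE_circleI)
      fix w :: complex assume "norm w = 1"
      then have "w \<in> S" using S by auto
      moreover from pos[OF this] have "1 + c * w \<noteq> 0" by (metis less_irrefl zero_complex.simps(1))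
      ultimately show "ln (norm (1 + c * w)) = Re (f w)" by (simp add: f_def)
    qed
  qed (use meas in measurable)
  ultimately show ?thesis by simp
qed

text \<open>The coefficient of larger modulus is factored out. When it is \<gamma>, the identity w
  cnj(w) = 1 on the circle gives |\<beta> + \<gamma> w| = |\<gamma>| |1 + cnj(\<beta>/\<gamma>) w|,
  again the situation of \<open>mean_ln_aux\<close>.\<close>

lemma mean_ln_affine:
  shows "norm \<gamma> < norm \<beta> \<Longrightarrow> (LINT w|circle_measure. ln (norm (\<beta> + \<gamma> * w))) = ln (norm \<beta>)"
    and "norm \<beta> < norm \<gamma> \<Longrightarrow> (LINT w|circle_measure. ln (norm (\<beta> + \<gamma> * w))) = ln (norm \<gamma>)"
proof -
  have i: "integrable circle_measure (\<lambda>w. ln (norm (1 + c * w)))" if "norm c < 1" for c :: complex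
  proof (rule integral_circle_measure(1))
    have "1 + c * w \<noteq> 0" if "norm w = 1" for w
    proof
      assume "1 + c * w = 0"
      then have "c * w = - 1" by (simp add: eq_neg_iff_add_eq_0 add.commute)
      then have "norm c * norm w = 1" by (metis norm_minus_cancel norm_mult norm_one)
      then show False using \<open>norm c < 1\<close> that by simp
    qed
    then show "continuous_on (sphere 0 1) (\<lambda>w. ln (norm (1 + c * w)))" by (auto intro!: continuous_intros)
  qed measurable
  show "(LINT w|circle_measure. ln (norm (\<beta> + \<gamma> * w))) = ln (norm \<beta>)" if "norm \<gamma> < norm \<beta>"
  proof -
    have b: "\<beta> \<noteq> 0" using that by auto
    define c where "c = \<gamma> / \<beta>"
    have c: "norm c < 1" using that b by (simp add: c_def norm_divide)
    have "(LINT w|circle_measure. ln (norm (\<beta> + \<gamma> * w))) = (LINT w|circle_measure. ln (norm \<beta>) + ln (norm (1 + c * w)))"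
    proof (rule integral_cong_AE)
      show "AE w in circle_measure. ln (norm (\<beta> + \<gamma> * w)) = ln (norm \<beta>) + ln (norm (1 + c * w))"
      proof (rule AE_circleI)
        fix w :: complex assume w: "norm w = 1"
        have "norm (c * w) < 1" using c w by (simp add: norm_mult)
        then have "1 + c * w \<noteq> 0" by (metis add_eq_0_iff norm_minus_cancel norm_one less_irrefl)
        moreover have "\<beta> + \<gamma> * w = \<beta> * (1 + c * w)" using b by (simp add: c_def field_simps)
        ultimately show "ln (norm (\<beta> + \<gamma> * w)) = ln (norm \<beta>) + ln (norm (1 + c * w))"
          using b by (simp add: norm_mult ln_mult)
      qed
    qed measurable
    also have "\<dots> = ln (norm \<beta>)" using i[OF c] mean_ln_aux[OF c] circ.prob_space by simp
    finally show ?thesis .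
  qed
  show "(LINT w|circle_measure. ln (norm (\<beta> + \<gamma> * w))) = ln (norm \<gamma>)" if "norm \<beta> < norm \<gamma>"
  proof -
    have b: "\<gamma> \<noteq> 0" using that by auto
    define c where "c = cnj (\<beta> / \<gamma>)"
    have c: "norm c < 1" using that b by (simp add: c_def norm_divide)
    have "(LINT w|circle_measure. ln (norm (\<beta> + \<gamma> * w))) = (LINT w|circle_measure. ln (norm \<gamma>) + ln (norm (1 + c * w)))"
    proof (rule integral_cong_AE)
      show "AE w in circle_measure. ln (norm (\<beta> + \<gamma> * w)) = ln (norm \<gamma>) + ln (norm (1 + c * w))"
      proof (rule AE_circleI)
        fix w :: complex assume w: "norm w = 1"
        have "norm (c * w) < 1" using c w by (simp add: norm_mult)
        then have n0: "1 + c * w \<noteq> 0" by (metis add_eq_0_iff norm_minus_cancel norm_one less_irrefl)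
        have ww: "w * cnj w = 1" using complex_norm_square[of w] w by simp
        have "\<beta> + \<gamma> * w = \<gamma> * (w + \<beta> / \<gamma>)" using b by (simp add: field_simps)
        also have "\<dots> = \<gamma> * w * cnj (1 + c * w)" using ww by (simp add: c_def algebra_simps)
        finally have "norm (\<beta> + \<gamma> * w) = norm \<gamma> * norm (1 + c * w)"
          using w by (simp add: norm_mult del: complex_cnj_add)
        then show "ln (norm (\<beta> + \<gamma> * w)) = ln (norm \<gamma>) + ln (norm (1 + c * w))"
          using b n0 by (simp add: ln_mult)
      qed
    qed measurable
    also have "\<dots> = ln (norm \<gamma>)" using i[OF c] mean_ln_aux[OF c] circ.prob_space by simp
    finally show ?thesis .
  qed
qed

section \<open>Green functions as exhaustion functions\<close>

text \<open>The Green function of the disc with pole a, with the sign that makes it positive: minus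
  the logarithm of the modulus of the Moebius map. Its value at the pole is a mere convention of
  \<open>ln\<close>, corrected in \<open>Gr\<close>.\<close>

definition gf :: "complex \<Rightarrow> complex \<Rightarrow> real" where
  "gf a z = ln (norm (1 - cnj a * z)) - ln (norm (z - a))"

text \<open>Values in \<open>ennreal\<close> allow the pole to be infinite, so that continuity on
  the disc and the supermean inequality make sense on circles through or around it.\<close>

definition Gr :: "complex \<Rightarrow> complex \<Rightarrow> ennreal" where
  "Gr a z = (if z = a then top else ennreal (gf a z))"

lemma cnj_mult_less_1: "norm a < 1 \<Longrightarrow> norm z \<le> 1 \<Longrightarrow> norm (cnj a * z) < 1"
  using mult_left_mono[of "norm z" 1 "norm a"] by (simp add: norm_mult)

lemma one_minus_cnj_nz: "norm a < 1 \<Longrightarrow> norm z \<le> 1 \<Longrightarrow> 1 - cnj a * z \<noteq> 0"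
  using cnj_mult_less_1[of a z] by force

lemma moebius_norm_identity:
  "(norm (1 - cnj a * z))\<^sup>2 - (norm (z - a))\<^sup>2 = (1 - (norm a)\<^sup>2) * (1 - (norm z)\<^sup>2)"
  unfolding cmod_power2 by (simp add: algebra_simps power2_eq_square)

lemma moebius_norm_less:
  assumes "norm a < 1" "norm z < 1"
  shows "norm (z - a) < norm (1 - cnj a * z)"
proof -
  have "0 < (1 - (norm a)\<^sup>2) * (1 - (norm z)\<^sup>2)"
    using assms by (intro mult_pos_pos) (auto simp: abs_square_less_1)
  then have "(norm (z - a))\<^sup>2 < (norm (1 - cnj a * z))\<^sup>2" using moebius_norm_identity[of a z] by linarith
  then show ?thesis by (rule power2_less_imp_less) simp
qed

lemma gf_pos: "norm a < 1 \<Longrightarrow> norm z < 1 \<Longrightarrow> z \<noteq> a \<Longrightarrow> 0 < gf a z"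
  unfolding gf_def using ln_less_cancel_iff[of "norm (z - a)" "norm (1 - cnj a * z)"] moebius_norm_less[of a z]
  by (smt (verit) right_minus_eq zero_less_norm_iff)

lemma Gr_pos: "norm a < 1 \<Longrightarrow> norm z < 1 \<Longrightarrow> 0 < Gr a z"
  using gf_pos[of a z] by (auto simp: Gr_def)

lemma gf_isCont:
  assumes "norm a < 1" "norm z < 1" "z \<noteq> a"
  shows "isCont (gf a) z"
  unfolding gf_def[abs_def] using assms one_minus_cnj_nz[of a z] by (intro continuous_intros) auto

lemma Gr_continuous:
  assumes a: "norm a < 1"
  shows "continuous_on unit_disc (Gr a)"
proof (rule continuous_at_imp_continuous_on, rule ballI)
  fix z assume z: "z \<in> unit_disc"
  show "isCont (Gr a) z"
  proof (cases "z = a")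
    case False
    have "isCont (\<lambda>z. ennreal (gf a z)) z"
      using gf_isCont[OF a _ False] z unfolding isCont_def by (intro tendsto_ennrealI) auto
    moreover have "\<forall>\<^sub>F x in nhds z. Gr a x = ennreal (gf a x)"
      using t1_space_nhds[OF False] by eventually_elim (simp add: Gr_def)
    ultimately show ?thesis using isCont_cong[of "Gr a" "\<lambda>x. ennreal (gf a x)" z] by simp
  next
    case True
    have n: "filterlim (\<lambda>z. norm (z - a)) (at_right 0) (at a)"
      unfolding filterlim_at
      by (intro conjI tendsto_eq_intros refl eventually_at_filter[THEN iffD2]) (auto intro!: tendsto_eq_intros)
    have "filterlim (\<lambda>z. ln (norm (z - a))) at_bot (at a)"
      by (rule filterlim_compose[OF ln_at_0 n])
    then have 1: "filterlim (\<lambda>z. - ln (norm (z - a))) at_top (at a)"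
      by (simp add: filterlim_uminus_at_top)
    have "isCont (\<lambda>z. ln (norm (1 - cnj a * z))) a"
      using one_minus_cnj_nz[of a a] a by (intro continuous_intros) auto
    then have 2: "((\<lambda>z. ln (norm (1 - cnj a * z))) \<longlongrightarrow> ln (norm (1 - cnj a * a))) (at a)"
      by (simp add: isCont_def)
    have "filterlim (\<lambda>z. ln (norm (1 - cnj a * z)) + - ln (norm (z - a))) at_top (at a)"
      by (rule filterlim_tendsto_add_at_top[OF 2 1])
    then have "((\<lambda>z. ennreal (gf a z)) \<longlongrightarrow> top) (at a)"
      unfolding ennreal_tendsto_top_eq_at_top by (simp add: gf_def)
    then have "(Gr a \<longlongrightarrow> top) (at a)"
      by (rule Lim_transform_eventually) (auto simp: eventually_at_filter Gr_def)
    then show ?thesis using True by (simp add: isCont_def Gr_def)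
  qed
qed

lemma Gr_measurable [measurable]: "Gr a \<in> borel_measurable borel"
  unfolding Gr_def[abs_def] gf_def by measurable

text \<open>As a function of w the argument of the logarithm is affine and has no zero for |w| at
  most 1, so its constant coefficient dominates and the first case of \<open>mean_ln_affine\<close>
  applies.\<close>

lemma mean_ln_one_minus:
  assumes a: "norm a < 1" and s: "0 < s" "cball z s \<subseteq> unit_disc"
  shows "(LINT w|circle_measure. ln (norm (1 - cnj a * (z + of_real s * w)))) = ln (norm (1 - cnj a * z))"
proof -
  have inD: "norm (z + of_real s * w) < 1" if "norm w \<le> 1" for w
  proof -
    have "z + of_real s * w \<in> cball z s" using s(1) that by (simp add: dist_norm norm_mult)
    then show ?thesis using s(2) by auto
  qed
  have z1: "norm z < 1" using inD[of 0] by simp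
  show ?thesis
  proof -
    have "norm (- cnj a * of_real s) < norm (1 - cnj a * z)"
    proof (rule ccontr)
      assume no: "\<not> ?thesis"
      have nz0: "1 - cnj a * z \<noteq> 0" using one_minus_cnj_nz[OF a] z1 by simp
      then have "cnj a * of_real s \<noteq> 0" using no by auto
      define w where "w = (1 - cnj a * z) / (cnj a * of_real s)"
      have "norm w \<le> 1" using no nz0 \<open>cnj a * of_real s \<noteq> 0\<close> by (simp add: w_def norm_divide field_simps)
      then have "1 - cnj a * (z + of_real s * w) \<noteq> 0" using one_minus_cnj_nz[OF a] inD[of w] by simp
      moreover have "1 - cnj a * (z + of_real s * w) = 0"
        using \<open>cnj a * of_real s \<noteq> 0\<close> by (simp add: w_def field_simps)
      ultimately show False by contradiction
    qed
    then have "(LINT w|circle_measure. ln (norm ((1 - cnj a * z) + (- cnj a * of_real s) * w))) = ln (norm (1 - cnj a * z))"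
      by (rule mean_ln_affine(1))
    moreover have e: "1 - cnj a * (z + of_real s * w) = (1 - cnj a * z) + (- cnj a * of_real s) * w" for w
      by (simp add: algebra_simps)
    ultimately show ?thesis unfolding e by blast
  qed
qed

lemma gf_mean_value:
  assumes a: "norm a < 1" and s: "0 < s" "cball z s \<subseteq> unit_disc" and d: "s \<noteq> dist z a"
  shows "integrable circle_measure (\<lambda>w. gf a (z + of_real s * w))"
    and "(LINT w|circle_measure. gf a (z + of_real s * w)) = 
      (if s < dist z a then gf a z else ln (norm (1 - cnj a * z)) - ln s)"
proof -
  have inD: "norm (z + of_real s * w) < 1" if "norm w \<le> 1" for w
  proof -
    have "z + of_real s * w \<in> cball z s" using s(1) that by (simp add: dist_norm norm_mult)
    then show ?thesis using s(2) by auto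
  qed
  have nz: "z + of_real s * w \<noteq> a" if "norm w = 1" for w
  proof
    assume "z + of_real s * w = a"
    then have "dist z a = norm (of_real s * w)" by (auto simp: dist_norm)
    then show False using d s(1) that by (simp add: norm_mult)
  qed
  have z1: "norm z < 1" using inD[of 0] by simp
  have i1: "integrable circle_measure (\<lambda>w. ln (norm (1 - cnj a * (z + of_real s * w))))"
  proof (rule integral_circle_measure(1))
    show "continuous_on (sphere 0 1) (\<lambda>w. ln (norm (1 - cnj a * (z + of_real s * w))))"
      using one_minus_cnj_nz[OF a] inD by (intro continuous_intros) (auto simp: less_imp_le)
  qed measurable
  have i2: "integrable circle_measure (\<lambda>w. ln (norm (z + of_real s * w - a)))"
  proof (rule integral_circle_measure(1))
    show "continuous_on (sphere 0 1) (\<lambda>w. ln (norm (z + of_real s * w - a)))"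
      using nz by (intro continuous_intros) auto
  qed measurable
  show "integrable circle_measure (\<lambda>w. gf a (z + of_real s * w))"
    unfolding gf_def using i1 i2 by (rule Bochner_Integration.integrable_diff)
  note m1 = mean_ln_one_minus[OF a s]
  have m2: "(LINT w|circle_measure. ln (norm (z + of_real s * w - a))) = (if s < dist z a then ln (norm (z - a)) else ln s)"
  proof -
    have e: "z + of_real s * w - a = (z - a) + of_real s * w" for w by simp
    show ?thesis
      using mean_ln_affine[of "of_real s" "z - a"] mean_ln_affine(2)[of "z - a" "of_real s"] s(1) d
      unfolding e by (auto simp: dist_norm)
  qed
  show "(LINT w|circle_measure. gf a (z + of_real s * w)) = 
      (if s < dist z a then gf a z else ln (norm (1 - cnj a * z)) - ln s)"
    unfolding gf_def using i1 i2 m1 m2 by simp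
qed

text \<open>On circles through the pole the inequality follows from that on smaller circles by Fatou's lemma.\<close>

lemma Gr_supermean:
  assumes a: "norm a < 1" and s: "0 < s" "cball z s \<subseteq> unit_disc"
  shows "(\<integral>\<^sup>+ w. Gr a (z + of_real s * w) \<partial>circle_measure) \<le> Gr a z"
proof (cases "z = a")
  case True
  then show ?thesis by (simp add: Gr_def)
next
  case False
  have gen: "(\<integral>\<^sup>+ w. Gr a (z + of_real t * w) \<partial>circle_measure) \<le> Gr a z"
    if t: "0 < t" "t \<le> s" "t \<noteq> dist z a" for t
  proof -
    have c: "cball z t \<subseteq> unit_disc" using s(2) t by (meson order_trans subset_cball)
    have inD: "norm (z + of_real t * w) < 1" if "norm w = 1" for w
    proof -
      have "z + of_real t * w \<in> cball z t" using t(1) that by (simp add: dist_norm norm_mult)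
      then show ?thesis using c by auto
    qed
    have nz: "z + of_real t * w \<noteq> a" if "norm w = 1" for w
    proof
      assume "z + of_real t * w = a"
      then have "dist z a = norm (of_real t * w)" by (auto simp: dist_norm)
      then show False using t that by (simp add: norm_mult)
    qed
    have "(\<integral>\<^sup>+ w. Gr a (z + of_real t * w) \<partial>circle_measure) = (\<integral>\<^sup>+ w. ennreal (gf a (z + of_real t * w)) \<partial>circle_measure)"
      using nz by (intro nn_integral_cong_AE AE_circleI) (simp add: Gr_def)
    also have "\<dots> = ennreal (LINT w|circle_measure. gf a (z + of_real t * w))"
      using gf_mean_value(1)[OF a t(1) c t(3)] gf_pos[OF a inD nz]
      by (intro nn_integral_eq_integral AE_circleI) (auto simp: less_imp_le)
    also have "\<dots> \<le> ennreal (gf a z)"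
    proof (rule ennreal_leI)
      have "ln (norm (1 - cnj a * z)) - ln t \<le> gf a z" if "\<not> t < dist z a"
        using that False t by (simp add: gf_def dist_norm)
      then show "(LINT w|circle_measure. gf a (z + of_real t * w)) \<le> gf a z"
        using gf_mean_value(2)[OF a t(1) c t(3)] by simp
    qed
    finally show ?thesis using False by (simp add: Gr_def)
  qed
  show ?thesis
  proof (cases "s = dist z a")
    case False
    then show ?thesis using gen[of s] s by simp
  next
    case True
    \<comment> \<open>The shift by 2 keeps every radius strictly between 0 and s, so the
      approximating circles avoid the pole.\<close>
    define t where "t n = s * (1 - 1 / real (n + 2))" for n :: nat
    have t: "0 < t n" "t n < s" for n
    proof -
      have "0 < 1 / real (n + 2)" "1 / real (n + 2) < 1" by auto
      then show "0 < t n" "t n < s" using s(1) unfolding t_def by (simp_all add: mult_less_cancel_left2)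
    qed
    have "(\<lambda>n. s * (1 - 1 / real (n + 2))) \<longlonglongrightarrow> s * (1 - 0)"
      by (intro tendsto_intros LIMSEQ_ignore_initial_segment[OF lim_1_over_n])
    then have tl: "t \<longlonglongrightarrow> s" by (simp add: t_def[abs_def])
    have "(\<integral>\<^sup>+ w. Gr a (z + of_real s * w) \<partial>circle_measure) \<le> (\<integral>\<^sup>+ w. liminf (\<lambda>n. Gr a (z + of_real (t n) * w)) \<partial>circle_measure)"
    proof (rule nn_integral_mono_AE, rule AE_circleI)
      fix w :: complex assume w: "norm w = 1"
      have "z + of_real s * w \<in> cball z s" using s(1) w by (simp add: dist_norm norm_mult)
      then have "z + of_real s * w \<in> unit_disc" using s(2) by blast
      then have "isCont (Gr a) (z + of_real s * w)"
        using Gr_continuous[OF a] continuous_on_eq_continuous_at[OF open_ball] by blast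
      moreover have "(\<lambda>n. z + of_real (t n) * w) \<longlonglongrightarrow> z + of_real s * w"
        by (intro tendsto_intros tl)
      ultimately have "(\<lambda>n. Gr a (z + of_real (t n) * w)) \<longlonglongrightarrow> Gr a (z + of_real s * w)"
        by (rule isCont_tendsto_compose)
      then show "Gr a (z + of_real s * w) \<le> liminf (\<lambda>n. Gr a (z + of_real (t n) * w))"
        by (simp add: lim_imp_Liminf)
    qed
    also have "\<dots> \<le> liminf (\<lambda>n. \<integral>\<^sup>+ w. Gr a (z + of_real (t n) * w) \<partial>circle_measure)"
      by (intro nn_integral_liminf) measurable
    also have "\<dots> \<le> Gr a z"
    proof -
      have "(\<integral>\<^sup>+ w. Gr a (z + of_real (t n) * w) \<partial>circle_measure) \<le> Gr a z" for n
        using gen[of "t n"] t[of n] True by simp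
      then have "liminf (\<lambda>n. \<integral>\<^sup>+ w. Gr a (z + of_real (t n) * w) \<partial>circle_measure) \<le> liminf (\<lambda>n. Gr a z)"
        by (intro Liminf_mono) auto
      then show ?thesis by (simp add: Liminf_const)
    qed
    finally show ?thesis .
  qed
qed

text \<open>By the Moebius identity the squared ratio is 1 - (1 - |a|^2) (1 - |z|^2) / q^2 with q =
  |1 - cnj(a) z|, and q is at least 1 - |a|. The resulting majorant depends on |z| only, which fits
  the filter pulled back along the norm.\<close>

lemma Gr_boundary:
  assumes a: "norm a < 1"
  shows "(Gr a \<longlongrightarrow> 0) (filtercomap norm (at_left 1))"
proof -
  define C where "C = (1 - (norm a)\<^sup>2) / (1 - norm a)\<^sup>2"
  define b where "b x = - (1/2) * ln (1 - C * (1 - x\<^sup>2))" for x :: real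
  have C: "C > 0" using a by (auto simp: C_def abs_square_less_1)
  have "((\<lambda>x. b x) \<longlongrightarrow> - (1/2) * ln (1 - C * (1 - 1\<^sup>2))) (at_left 1)"
    unfolding b_def by (intro tendsto_intros) auto
  then have "((\<lambda>x. ennreal (b x)) \<longlongrightarrow> ennreal 0) (at_left 1)" by (intro tendsto_ennrealI) simp
  then have up: "((\<lambda>z. ennreal (b (norm z))) \<longlongrightarrow> 0) (filtercomap norm (at_left 1))"
    using filterlim_compose[OF _ filterlim_filtercomap] by fastforce
  have "((\<lambda>x. 1 - C * (1 - x\<^sup>2)) \<longlongrightarrow> 1 - C * (1 - 1\<^sup>2)) (at_left (1::real))" by (intro tendsto_intros)
  then have "\<forall>\<^sub>F x in at_left 1. 0 < 1 - C * (1 - x\<^sup>2)" by (intro order_tendstoD(1)[where y="1 - C * (1 - 1\<^sup>2)"]) auto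
  moreover have "\<forall>\<^sub>F x in at_left (1::real). x < 1 \<and> norm a < x"
    using a eventually_at_left_field[of "\<lambda>x. x < 1 \<and> norm a < x" 1] by blast
  ultimately have "\<forall>\<^sub>F x in at_left 1. 0 < 1 - C * (1 - x\<^sup>2) \<and> x < 1 \<and> norm a < x" by eventually_elim auto
  then have ev: "\<forall>\<^sub>F z in filtercomap norm (at_left 1). 0 < 1 - C * (1 - (norm z)\<^sup>2) \<and> norm z < 1 \<and> norm a < norm z"
    by (rule eventually_filtercomapI)
  have le: "Gr a z \<le> ennreal (b (norm z))" if z: "0 < 1 - C * (1 - (norm z)\<^sup>2)" "norm z < 1" "norm a < norm z" for z
  proof -
    have za: "z \<noteq> a" using z by auto
    define q where "q = norm (1 - cnj a * z)"
    define t where "t = norm (z - a)"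
    have q0: "q > 0" using one_minus_cnj_nz[OF a, of z] z by (auto simp: q_def)
    have t0: "t > 0" using za by (simp add: t_def)
    have "norm (cnj a * z) \<le> norm a" using z mult_left_mono[of "norm z" 1 "norm a"] by (simp add: norm_mult)
    then have "1 - norm a \<le> q" using norm_triangle_ineq2[of 1 "cnj a * z"] by (simp add: q_def)
    then have q2: "(1 - norm a)\<^sup>2 \<le> q\<^sup>2" using a by (intro power_mono) auto
    have "t\<^sup>2 = q\<^sup>2 - (1 - (norm a)\<^sup>2) * (1 - (norm z)\<^sup>2)"
      using moebius_norm_identity[of a z] by (simp add: q_def t_def)
    then have e: "t\<^sup>2 / q\<^sup>2 = 1 - (1 - (norm a)\<^sup>2) * (1 - (norm z)\<^sup>2) / q\<^sup>2"
      using q0 by (simp add: field_simps)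
    have "(1 - (norm a)\<^sup>2) * (1 - (norm z)\<^sup>2) / q\<^sup>2 \<le> (1 - (norm a)\<^sup>2) * (1 - (norm z)\<^sup>2) / (1 - norm a)\<^sup>2"
      using q2 a z by (intro divide_left_mono mult_nonneg_nonneg mult_pos_pos) (auto simp: abs_square_le_1 q0)
    then have "1 - C * (1 - (norm z)\<^sup>2) \<le> t\<^sup>2 / q\<^sup>2" unfolding e by (simp add: C_def)
    then have "ln (1 - C * (1 - (norm z)\<^sup>2)) \<le> ln (t\<^sup>2 / q\<^sup>2)" using z(1) by simp
    also have "\<dots> = 2 * (ln t - ln q)" using q0 t0 by (simp add: ln_div ln_realpow)
    finally have "gf a z \<le> b (norm z)" by (simp add: gf_def b_def q_def t_def)
    then show ?thesis using za by (simp add: Gr_def ennreal_leI)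
  qed
  show ?thesis
  proof (rule tendsto_sandwich[OF _ _ tendsto_const up])
    show "\<forall>\<^sub>F z in filtercomap norm (at_left 1). Gr a z \<le> ennreal (b (norm z))"
      using ev by eventually_elim (use le in blast)
  qed auto
qed

text \<open>The positive potential is summed in \<open>ennreal\<close>, where poles cause no
  indeterminate sums; the sign is changed only at the end, in \<open>mix\<close>.\<close>

definition pot :: "'i set \<Rightarrow> ('i \<Rightarrow> real) \<Rightarrow> ('i \<Rightarrow> complex) \<Rightarrow> complex \<Rightarrow> ennreal" where
  "pot I c a z = (\<Sum>i\<in>I. ennreal (c i) * Gr (a i) z)"

definition mix :: "'i set \<Rightarrow> ('i \<Rightarrow> real) \<Rightarrow> ('i \<Rightarrow> complex) \<Rightarrow> complex \<Rightarrow> ereal" where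
  "mix I c a z = - enn2ereal (pot I c a z)"

lemma mix_exhaustion:
  assumes I: "finite I" and c: "\<And>i. i \<in> I \<Longrightarrow> c i \<ge> 0" "\<exists>i\<in>I. c i > 0" and a: "\<And>i. i \<in> I \<Longrightarrow> norm (a i) < 1"
  shows "mix I c a \<in> exhaustions"
proof -
  have ps: "continuous_on unit_disc (pot I c a)"
    unfolding pot_def[abs_def] using a
    by (intro continuous_on_sum ennreal_continuous_on_cmult Gr_continuous) auto
  then have cont: "continuous_on unit_disc (mix I c a)"
    unfolding mix_def[abs_def] continuous_on_def
    by (intro ballI tendsto_uminus_ereal tendsto_enn2erealI) blast
  have [measurable]: "pot I c a \<in> borel_measurable borel" unfolding pot_def[abs_def] by measurable
  have neg: "mix I c a z < 0" if "z \<in> unit_disc" for z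
  proof -
    obtain i where i: "i \<in> I" "c i > 0" using c(2) by blast
    have "0 < ennreal (c i) * Gr (a i) z" using i Gr_pos[OF a[OF i(1)], of z] that
      by (simp add: ennreal_zero_less_mult_iff)
    also have "\<dots> \<le> pot I c a z" unfolding pot_def using I i(1) by (intro member_le_sum) auto
    finally have "0 < enn2ereal (pot I c a z)" by (simp add: less_ennreal.rep_eq zero_ennreal.rep_eq)
    then show ?thesis unfolding mix_def by (cases "enn2ereal (pot I c a z)") auto
  qed
  have sub: "mix I c a z \<le> circle_mean (mix I c a) z s" if s: "0 < s" "cball z s \<subseteq> unit_disc" for z s
  proof -
    have "(\<integral>\<^sup>+ w. e2ennreal (mix I c a (z + of_real s * w)) \<partial>circle_measure) = 0"
    proof -
      have "e2ennreal (mix I c a x) = 0" for x by (simp add: mix_def e2ennreal_neg)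
      then show ?thesis by simp
    qed
    then have "circle_mean (mix I c a) z s = - enn2ereal (\<integral>\<^sup>+ w. pot I c a (z + of_real s * w) \<partial>circle_measure)"
      by (simp add: circle_mean_def mix_def zero_ennreal.rep_eq)
    moreover have "(\<integral>\<^sup>+ w. pot I c a (z + of_real s * w) \<partial>circle_measure) \<le> pot I c a z"
    proof -
      have "(\<integral>\<^sup>+ w. pot I c a (z + of_real s * w) \<partial>circle_measure) = (\<Sum>i\<in>I. ennreal (c i) * (\<integral>\<^sup>+ w. Gr (a i) (z + of_real s * w) \<partial>circle_measure))"
        unfolding pot_def by (subst nn_integral_sum) (auto simp: nn_integral_cmult)
      also have "\<dots> \<le> pot I c a z" unfolding pot_def using a
        by (intro sum_mono mult_left_mono Gr_supermean s) auto
      finally show ?thesis .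
    qed
    ultimately show ?thesis by (simp add: mix_def less_eq_ennreal.rep_eq)
  qed
  have "(pot I c a \<longlongrightarrow> (\<Sum>i\<in>I. ennreal (c i) * 0)) (filtercomap norm (at_left 1))"
    unfolding pot_def[abs_def] using a by (intro tendsto_sum ennreal_tendsto_cmult Gr_boundary) auto
  then have "((\<lambda>z. enn2ereal (pot I c a z)) \<longlongrightarrow> enn2ereal 0) (filtercomap norm (at_left 1))"
    by (intro tendsto_enn2erealI) simp
  then have lim: "(mix I c a \<longlongrightarrow> 0) (filtercomap norm (at_left 1))"
    unfolding mix_def[abs_def] using tendsto_uminus_ereal by (fastforce simp: zero_ennreal.rep_eq)
  have "openin (top_of_set unit_disc) {z \<in> unit_disc. mix I c a z < k}" for k
  proof -
    have "openin (top_of_set unit_disc) (unit_disc \<inter> mix I c a -` {..<k})"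
      using cont by (intro continuous_openin_preimage_gen) auto
    then show ?thesis by (simp add: vimage_def Int_def)
  qed
  moreover have "mix I c a z < \<infinity>" if "z \<in> unit_disc" for z using neg[OF that] by (rule less_trans) simp
  ultimately show ?thesis unfolding exhaustions_def subharmonic_on_def using cont sub neg lim by auto
qed

lemma ball_borel [measurable]: "ball (x :: complex) e \<in> sets borel"
  by (simp add: borel_open)

section \<open>The Laplacian of a Green function is a point mass\<close>

text \<open>Both U and -U satisfy the submean inequality.\<close>

lemma harmonic_laplace_zero:
  assumes [measurable]: "U \<in> borel_measurable borel" and B: "\<And>z. \<bar>U z\<bar> \<le> B"
    and S: "open S" and mean: "\<And>z s. 0 < s \<Longrightarrow> cball z s \<subseteq> S \<Longrightarrow> (LINT w|circle_measure. U (z + of_real s * w)) = U z"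
    and \<phi>: "test_on S \<phi>" "\<And>z. \<phi> z \<ge> 0"
  shows "(LINT z|lborel. U z * laplace \<phi> z) = 0"
proof -
  have "0 \<le> (LINT z|lborel. U z * laplace \<phi> z)"
    by (rule submean_laplace_nonneg[OF _ B S _ \<phi>]) (simp_all add: mean)
  moreover have "0 \<le> (LINT z|lborel. - U z * laplace \<phi> z)"
    by (rule submean_laplace_nonneg[OF _ _ S _ \<phi>, where B = B]) (simp_all add: mean B)
  ultimately show ?thesis by simp
qed

text \<open>If the mass vanished, then \<open>u\<close> and its truncations would have equal integrals against a
  test function whose Laplacian is constant on the set where they differ.\<close>

lemma exhaustion_mass_pos:
  assumes u: "u \<in> exhaustions"
  shows "emeasure (laplacian u) unit_disc > 0"
proof (rule ccontr)
  assume "\<not> ?thesis"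
  then have m0: "emeasure (laplacian u) unit_disc = 0" by simp
  have "u 0 < 0" using exhaustions_neg[OF u, of 0] by simp
  \<comment> \<open>Any level above \<open>u 0\<close> makes the open set
    \<open>sublevel u r\<close> contain 0; the contradiction will be that this set is null.\<close>
  then obtain r where r: "u 0 < ereal r" "r < 0" using ereal_dense2[of "u 0" 0] by auto
  have m0': "emeasure (laplacian (trunc u r)) unit_disc = 0" using trunc_mass[OF u r(2)] m0 by simp
  obtain R where R: "0 < R" "R < 1" "\<And>z. R < norm z \<Longrightarrow> norm z < 1 \<Longrightarrow> ereal r < u z"
    using exhaustions_near_boundary[OF u r(2)] by metis
  obtain \<psi> where \<psi>: "test_on unit_disc \<psi>" "\<And>z. \<psi> z \<ge> 0" "\<And>z. z \<in> cball 0 R \<Longrightarrow> laplace \<psi> z = 4"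
    using square_test_function[OF R(1,2)] by metis
  have zero: "(LINT z|M. \<psi> z) = 0" if "has_laplacian v M" "emeasure M unit_disc = 0" for v M
  proof -
    have "radon_on_disc M" using that(1) by (simp add: has_laplacian_iff)
    then have "space M \<in> null_sets M" using that(2) radon_space[of M] by (metis sets.top null_setsI)
    then have "AE z in M. False" by (rule AE_I') blast
    then have "AE z in M. \<psi> z = 0" by eventually_elim simp
    then show ?thesis by (rule integral_eq_zero_AE)
  qed
  have eq: "(LINT z|lborel. ru u z * laplace \<psi> z) = 0" "(LINT z|lborel. ru (trunc u r) z * laplace \<psi> z) = 0"
    using exhaustion_has_laplacian[OF u] trunc_has_laplacian'[OF u r(2)] zero[OF _ m0] zero[OF _ m0'] \<psi>(1)
    by (auto simp: has_laplacian_iff)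
  have i: "integrable lborel (\<lambda>z. ru u z * laplace \<psi> z)" "integrable lborel (\<lambda>z. ru (trunc u r) z * laplace \<psi> z)"
    using integrable_loc_integrable[OF exhaustion_integrable(1)[OF u]] integrable_loc_integrable[OF trunc_integrable[OF u r(2)]]
      test_on_laplace[OF \<psi>(1)] by (auto simp: loc_integrable_def)
  define d where "d z = ru (trunc u r) z - ru u z" for z
  have id: "integrable lborel d" unfolding d_def by (intro Bochner_Integration.integrable_diff trunc_integrable exhaustion_integrable u r)
  have "ru (trunc u r) z * laplace \<psi> z - ru u z * laplace \<psi> z = 4 * d z" for z
  proof (cases "z \<in> cball 0 R")
    case True
    then show ?thesis using \<psi>(3) by (simp add: d_def algebra_simps)
  next
    case False
    have "ru (trunc u r) z = ru u z"
      using False R(3)[of z] trunc_eq_above[of r u z] by (cases "z \<in> unit_disc") (auto simp: ru_outside less_imp_le)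
    then show ?thesis by (simp add: d_def)
  qed
  then have "(LINT z|lborel. 4 * d z) = 0"
    using eq Bochner_Integration.integral_diff[OF i(2,1)] by simp
  then have d0: "(LINT z|lborel. d z) = 0" by simp
  have fin: "AE z in lborel. z \<in> unit_disc \<longrightarrow> u z \<noteq> -\<infinity>" by (rule exhaustion_integrable(2)[OF u])
  then have "AE z in lborel. 0 \<le> d z"
  proof eventually_elim
    case (elim z)
    show ?case
    proof (cases "z \<in> unit_disc")
      case True
      then have "u z < 0" "u z \<noteq> -\<infinity>" using elim exhaustions_neg[OF u] by auto
      then show ?thesis using True by (cases "u z") (auto simp: d_def ru_def trunc_def max_def)
    qed (simp add: d_def ru_outside)
  qed
  then have "AE z in lborel. d z = 0"
    using integral_nonneg_eq_0_iff_AE[OF id] d0 by simp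
  with fin have ae: "AE z in lborel. z \<notin> sublevel u r"
  proof eventually_elim
    case (elim z)
    show ?case
    proof
      assume z: "z \<in> sublevel u r"
      then have zD: "z \<in> unit_disc" "u z < ereal r" by (auto simp: sublevel_def)
      then have "u z \<noteq> -\<infinity>" using elim(1) by blast
      then obtain x where x: "u z = ereal x" using zD(2) by (cases "u z") auto
      then have xr: "x < r" using zD(2) by simp
      then have "trunc u r z = ereal r" by (simp add: trunc_def x max_def)
      then have "d z = r - x" using zD(1) x by (simp add: d_def ru_def)
      then show False using elim(2) xr by simp
    qed
  qed
  have o: "open (sublevel u r)" using open_superlevel(2)[OF u] .
  then have "sublevel u r \<in> sets lborel" by (simp add: borel_open)
  then have "sublevel u r \<in> null_sets lborel" using AE_iff_null_sets[of "sublevel u r" lborel] ae by blast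
  then have "negligible (sublevel u r)"
    unfolding negligible_iff_null_sets by (rule null_sets_completionI)
  then have "sublevel u r = {}" using open_not_negligible[OF o] by metis
  moreover have "0 \<in> sublevel u r" using r(1) by (simp add: sublevel_def)
  ultimately show False by simp
qed

abbreviation green :: "complex \<Rightarrow> complex \<Rightarrow> ereal" where
  "green a \<equiv> mix {()} (\<lambda>_. 1) (\<lambda>_. a)"

lemma ru_mix:
  assumes "finite I" "\<And>i. i \<in> I \<Longrightarrow> c i \<ge> 0" "\<And>i. i \<in> I \<Longrightarrow> norm (a i) < 1" "z \<in> unit_disc" "z \<notin> a ` I"
  shows "ru (mix I c a) z = - (\<Sum>i\<in>I. c i * gf (a i) z)"
proof -
  have g: "gf (a i) z > 0" if "i \<in> I" for i using gf_pos[of "a i" z] assms that by auto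
  have "pot I c a z = (\<Sum>i\<in>I. ennreal (c i * gf (a i) z))"
    unfolding pot_def using assms g by (intro sum.cong refl) (auto simp: Gr_def ennreal_mult less_imp_le)
  also have "\<dots> = ennreal (\<Sum>i\<in>I. c i * gf (a i) z)"
    using assms g by (intro sum_ennreal) (auto simp: less_imp_le)
  finally have "mix I c a z = ereal (- (\<Sum>i\<in>I. c i * gf (a i) z))"
    using assms g by (simp add: mix_def enn2ereal_ennreal sum_nonneg less_imp_le)
  then show ?thesis using assms(4) by (simp add: ru_def)
qed

lemma ru_green: "norm a < 1 \<Longrightarrow> z \<in> unit_disc \<Longrightarrow> z \<noteq> a \<Longrightarrow> ru (green a) z = - gf a z"
  using ru_mix[of "{()}" "\<lambda>_. 1" "\<lambda>_. a" z] by simp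

lemma green_exhaustion: "norm a < 1 \<Longrightarrow> green a \<in> exhaustions"
  by (rule mix_exhaustion) auto

lemma gf_measurable [measurable]: "gf a \<in> borel_measurable borel"
  unfolding gf_def[abs_def] by measurable

lemma radon_null_open:
  assumes rM: "radon_on_disc M" and V: "open V" "V \<subseteq> unit_disc"
    and zero: "\<And>\<eta>. test_on V \<eta> \<Longrightarrow> (\<And>z. \<eta> z \<ge> 0) \<Longrightarrow> (LINT z|M. \<eta> z) = 0"
  shows "emeasure M V = 0"
proof -
  have K0: "emeasure M K = 0" if K: "compact K" "K \<subseteq> V" for K
  proof -
    obtain \<eta> W C where \<eta>: "\<And>m. Ck m \<eta>" "\<And>z. 0 \<le> \<eta> z" "\<And>z. \<eta> z \<le> 1"
      "open W" "K \<subseteq> W" "\<And>z. z \<in> W \<Longrightarrow> \<eta> z = 1"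
      "compact C" "C \<subseteq> V" "\<And>z. z \<notin> C \<Longrightarrow> \<eta> z = 0"
      by (rule smooth_Urysohn[OF K(1) V(1) K(2)]) blast
    have t: "test_on V \<eta>" using \<eta> by (intro test_onI[of _ C]) auto
    have "emeasure M K \<le> ennreal (LINT z|M. \<eta> z)"
    proof (rule radon_le_integral[OF rM test_on_mono[OF t V(2)] \<eta>(2) K(1) order_trans[OF K(2) V(2)]])
      show "1 \<le> \<eta> z" if "z \<in> K" for z using \<eta>(5) \<eta>(6)[of z] that by auto
    qed
    then show ?thesis using zero[OF t \<eta>(2)] by simp
  qed
  obtain C where C: "\<And>n. compact (C n)" "incseq C" "(\<Union>n. C n) = V"
    using compact_exhaustion[OF V(1)] by metis
  have CU: "C n \<subseteq> V" for n using C(3) by blast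
  have CM: "C n \<in> sets M" for n using order_trans[OF CU V(2)] C(1) unfolding radon_sets[OF rM] by (auto intro: borel_compact)
  have "emeasure M (\<Union>n. C n) = 0"
    using CM K0[OF C(1) CU] by (intro emeasure_UN_eq_0) auto
  then show ?thesis using C(3) by simp
qed

text \<open>Away from its pole the Green function is harmonic. A test function supported off the
  pole vanishes on a small disc around it; excising that disc leaves a bounded function, as
  \<open>harmonic_laplace_zero\<close> requires.\<close>

lemma green_laplacian_off_pole:
  assumes a: "norm a < 1"
  shows "emeasure (laplacian (green a)) (unit_disc - {a}) = 0"
proof -
  let ?M = "laplacian (green a)"
  have hl: "has_laplacian (green a) ?M" by (rule exhaustion_has_laplacian[OF green_exhaustion[OF a]])
  then have rM: "radon_on_disc ?M" by (simp add: has_laplacian_iff)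
  have oV: "open (unit_disc - {a})" by auto
  show ?thesis
  proof (rule radon_null_open[OF rM oV])
    fix \<eta> assume tV: "test_on (unit_disc - {a}) \<eta>" and \<eta>0: "\<And>z. \<eta> z \<ge> 0"
    obtain C where C: "compact C" "C \<subseteq> unit_disc - {a}" "\<And>z. z \<notin> C \<Longrightarrow> \<eta> z = 0"
      using tV unfolding test_on_def by metis
    have "open (- C)" "a \<in> - C" using C(1,2) by (auto simp: open_Compl compact_imp_closed)
    then obtain d where d: "d > 0" "cball a d \<subseteq> - C" using open_contains_cball by blast
    define S where "S = unit_disc - cball a d"
    have S: "open S" unfolding S_def by (intro open_Diff) auto
    have CS: "C \<subseteq> S" using C(2) d(2) unfolding S_def by blast
    have tS: "test_on S \<eta>" using C CS test_on_Ck[OF tV] by (intro test_onI[of _ C]) auto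
    have t: "test_on unit_disc \<eta>" using tS by (rule test_on_mono) (auto simp: S_def)
    define U where "U z = (if z \<in> S then - gf a z else 0)" for z
    have [measurable]: "S \<in> sets borel" using S by (rule borel_open)
    have "(LINT z|lborel. U z * laplace \<eta> z) = 0"
    proof (rule harmonic_laplace_zero[OF _ _ S _ tS \<eta>0])
      show "U \<in> borel_measurable borel" unfolding U_def[abs_def] by measurable
      show "\<bar>U z\<bar> \<le> \<bar>ln 2 - ln d\<bar>" for z
      proof (cases "z \<in> S")
        case True
        then have z: "norm z < 1" "norm (z - a) > d" by (auto simp: S_def dist_norm norm_minus_commute)
        then have za: "z \<noteq> a" using d by auto
        have "norm (1 - cnj a * z) \<le> 2"
          using norm_triangle_ineq4[of 1 "cnj a * z"] cnj_mult_less_1[OF a, of z] z by simp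
        moreover have "norm (1 - cnj a * z) > 0" using one_minus_cnj_nz[OF a, of z] z by simp
        ultimately have "ln (norm (1 - cnj a * z)) \<le> ln 2" by (subst ln_le_cancel_iff) auto
        moreover have "ln d \<le> ln (norm (z - a))"
          using z(2) d(1) by (subst ln_le_cancel_iff) auto
        ultimately show ?thesis using gf_pos[OF a z(1) za] True by (simp add: U_def gf_def)
      qed (simp add: U_def)
      fix z s assume s: "0 < (s::real)" "cball z s \<subseteq> S"
      then have c: "cball z s \<subseteq> unit_disc" by (auto simp: S_def)
      have "a \<notin> cball z s" using s d unfolding S_def by (metis DiffD2 centre_in_cball less_imp_le subsetD)
      then have ds: "s < dist z a" by simp
      have "z \<in> S" using s by (metis centre_in_cball less_imp_le subsetD)
      have "(LINT w|circle_measure. U (z + of_real s * w)) = (LINT w|circle_measure. - gf a (z + of_real s * w))"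
      proof (rule integral_cong_AE)
        show "AE w in circle_measure. U (z + of_real s * w) = - gf a (z + of_real s * w)"
        proof (rule AE_circleI)
          fix w :: complex assume "norm w = 1"
          then have "z + of_real s * w \<in> cball z s" using s by (simp add: dist_norm norm_mult)
          then show "U (z + of_real s * w) = - gf a (z + of_real s * w)" using s by (auto simp: U_def)
        qed
      qed (auto simp: U_def[abs_def])
      also have "\<dots> = U z" using gf_mean_value(2)[OF a s(1) c] ds \<open>z \<in> S\<close> by (simp add: U_def)
      finally show "(LINT w|circle_measure. U (z + of_real s * w)) = U z" .
    qed
    moreover have e: "ru (green a) z * laplace \<eta> z = U z * laplace \<eta> z" for z
    proof (cases "z \<in> S")
      case True
      then have "z \<in> unit_disc" "z \<noteq> a" using d by (auto simp: S_def)
      then show ?thesis using ru_green[OF a] True by (simp add: U_def)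
    next
      case False
      then have "laplace \<eta> z = 0" using test_on_laplace[OF tS] unfolding test_on_def by blast
      then show ?thesis by simp
    qed
    ultimately have "(LINT z|lborel. ru (green a) z * laplace \<eta> z) = 0" by (simp only:)
    then show "(LINT z|?M. \<eta> z) = 0" using hl t by (simp add: has_laplacian_iff)
  qed auto
qed

text \<open>Classically 2 pi. What is established about it is that it is positive and the same for
  all poles.\<close>

definition kap :: "complex \<Rightarrow> real" where
  "kap a = measure (laplacian (green a)) {a}"

text \<open>The Laplacian has positive total mass and none off a, so it is a positive point mass at
  a, and integrating against it evaluates at a.\<close>

lemma green_pairing_kap:
  assumes a: "norm a < 1"
  shows "kap a > 0" 
    and "\<And>\<phi>. test_on unit_disc \<phi> \<Longrightarrow> (LINT z|lborel. ru (green a) z * laplace \<phi> z) = kap a * \<phi> a"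
proof -
  let ?M = "laplacian (green a)"
  have hl: "has_laplacian (green a) ?M" by (rule exhaustion_has_laplacian[OF green_exhaustion[OF a]])
  then have rM: "radon_on_disc ?M" by (simp add: has_laplacian_iff)
  have s: "{a} \<in> sets ?M" "unit_disc - {a} \<in> sets ?M" using a by (auto simp: radon_sets[OF rM])
  have "emeasure ?M unit_disc = emeasure ?M {a} + emeasure ?M (unit_disc - {a})"
    using s a by (subst plus_emeasure) (auto simp: insert_absorb)
  then have "emeasure ?M {a} > 0"
    using exhaustion_mass_pos[OF green_exhaustion[OF a]] green_laplacian_off_pole[OF a] by simp
  moreover have fin: "emeasure ?M {a} < \<infinity>" using a by (intro radon_compact[OF rM]) auto
  ultimately show "kap a > 0" unfolding kap_def measure_def by (simp add: enn2real_positive_iff)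
  fix \<phi> assume \<phi>: "test_on unit_disc \<phi>"
  have "AE z in ?M. z = a"
    by (rule AE_I[OF _ green_laplacian_off_pole[OF a] s(2)]) (auto simp: radon_space[OF rM])
  then have "(LINT z|?M. \<phi> z) = (LINT z|?M. indicator {a} z * \<phi> a)"
    using s radon_measurable[OF rM test_on_borel[OF \<phi>]]
    by (intro integral_cong_AE) auto
  also have "\<dots> = kap a * \<phi> a" using s by (simp add: kap_def)
  finally show "(LINT z|lborel. ru (green a) z * laplace \<phi> z) = kap a * \<phi> a"
    using hl \<phi> by (simp add: has_laplacian_iff)
qed

text \<open>Up to a null set the negative Green function is \<open>lg - lh\<close> on the disc. The
  second term is harmonic, and the first is a translate of ln |z|, which makes different poles
  comparable.\<close>

definition lg :: "complex \<Rightarrow> complex \<Rightarrow> real" where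
  "lg b z = indicator unit_disc z * ln (norm (z - b))"

definition lh :: "complex \<Rightarrow> complex \<Rightarrow> real" where
  "lh b z = indicator unit_disc z * ln (norm (1 - cnj b * z))"

lemma lg_lh_measurable [measurable]: "lg b \<in> borel_measurable borel" "lh b \<in> borel_measurable borel"
  unfolding lg_def[abs_def] lh_def[abs_def] by measurable

lemma lh_bound:
  assumes "norm b < 1"
  shows "\<bar>lh b z\<bar> \<le> \<bar>ln 2\<bar> + \<bar>ln (1 - norm b)\<bar>"
proof (cases "z \<in> unit_disc")
  case True
  have n: "norm (cnj b * z) \<le> norm b" using True mult_left_mono[of "norm z" 1 "norm b"] by (simp add: norm_mult)
  have "norm (1 - cnj b * z) \<le> 2" using norm_triangle_ineq4[of 1 "cnj b * z"] n assms by simp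
  moreover have "1 - norm b \<le> norm (1 - cnj b * z)" using norm_triangle_ineq2[of 1 "cnj b * z"] n by simp
  ultimately have "ln (1 - norm b) \<le> ln (norm (1 - cnj b * z))" "ln (norm (1 - cnj b * z)) \<le> ln 2"
    using assms ln_le_cancel_iff[of "1 - norm b" "norm (1 - cnj b * z)"] ln_le_cancel_iff[of "norm (1 - cnj b * z)" 2]
    by linarith+
  moreover have "ln 2 \<ge> (0::real)" by simp
  ultimately have "\<bar>ln (norm (1 - cnj b * z))\<bar> \<le> \<bar>ln 2\<bar> + \<bar>ln (1 - norm b)\<bar>" by linarith
  then show ?thesis using True by (simp add: lh_def)
qed (simp add: lh_def)

lemma lh_integrable: "norm b < 1 \<Longrightarrow> integrable lborel (lh b)"
  by (rule integrable_bounded_support[OF _ lh_bound, where R = 1]) (auto simp: lh_def)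

text \<open>\<open>harmonic_laplace_zero\<close> treats nonnegative test functions; a general one
  becomes nonnegative after adding a multiple of a cut-off that is 1 on its support.\<close>

lemma lh_pairing:
  assumes b: "norm b < 1" and \<phi>: "test_on unit_disc \<phi>"
  shows "(LINT z|lborel. lh b z * laplace \<phi> z) = 0"
proof -
  have nn: "(LINT z|lborel. lh b z * laplace \<phi> z) = 0" if \<phi>: "test_on unit_disc \<phi>" "\<And>z. \<phi> z \<ge> 0" for \<phi>
  proof (rule harmonic_laplace_zero[OF _ lh_bound[OF b] open_ball _ \<phi>])
    fix z s assume s: "0 < (s::real)" "cball z s \<subseteq> unit_disc"
    then have z: "z \<in> unit_disc" by (metis centre_in_cball less_imp_le subsetD)
    have "(LINT w|circle_measure. lh b (z + of_real s * w)) = (LINT w|circle_measure. ln (norm (1 - cnj b * (z + of_real s * w))))"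
    proof (rule integral_cong_AE)
      show "AE w in circle_measure. lh b (z + of_real s * w) = ln (norm (1 - cnj b * (z + of_real s * w)))"
      proof (rule AE_circleI)
        fix w :: complex assume "norm w = 1"
        then have "z + of_real s * w \<in> cball z s" using s by (simp add: dist_norm norm_mult)
        then have "z + of_real s * w \<in> unit_disc" using s by blast
        then show "lh b (z + of_real s * w) = ln (norm (1 - cnj b * (z + of_real s * w)))" by (simp add: lh_def)
      qed
    qed auto
    also have "\<dots> = lh b z" using mean_ln_one_minus[OF b s] z by (simp add: lh_def)
    finally show "(LINT w|circle_measure. lh b (z + of_real s * w)) = lh b z" .
  qed auto
  obtain K where K: "compact K" "K \<subseteq> unit_disc" "\<And>z. z \<notin> K \<Longrightarrow> \<phi> z = 0"
    using \<phi> by (auto simp: test_on_def)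
  obtain B where B: "B > 0" "\<And>z. \<bar>\<phi> z\<bar> \<le> B" using test_on_bounded[OF \<phi>] by metis
  obtain \<eta> W C where \<eta>: "\<And>m. Ck m \<eta>" "\<And>z. 0 \<le> \<eta> z" "\<And>z. \<eta> z \<le> 1"
    "open W" "K \<subseteq> W" "\<And>z. z \<in> W \<Longrightarrow> \<eta> z = 1"
    "compact C" "C \<subseteq> unit_disc" "\<And>z. z \<notin> C \<Longrightarrow> \<eta> z = 0"
    by (rule smooth_Urysohn[OF K(1) open_ball K(2)]) blast
  have t: "test_on unit_disc \<eta>" using \<eta> by (intro test_onI[of _ C]) auto
  have \<eta>1: "\<eta> z = 1" if "z \<in> K" for z using \<eta>(5,6) that by blast
  have p: "0 \<le> \<phi> z + B * \<eta> z" for z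
    using B(1) B(2)[of z] K(3)[of z] \<eta>(2)[of z] \<eta>1[of z] by (cases "z \<in> K") auto
  have t': "test_on unit_disc (\<lambda>z. B * \<eta> z)" by (rule test_on_cmult[OF t])
  have i: "integrable lborel (\<lambda>z. lh b z * laplace \<psi> z)" if "test_on unit_disc \<psi>" for \<psi>
    using integrable_loc_integrable[OF lh_integrable[OF b]] test_on_laplace[OF that] by (simp add: loc_integrable_def)
  have "(LINT z|lborel. lh b z * laplace (\<lambda>z. \<phi> z + B * \<eta> z) z) = 0"
    by (rule nn[OF test_on_add[OF \<phi> t'] p])
  moreover have "(LINT z|lborel. lh b z * laplace (\<lambda>z. B * \<eta> z) z) = 0"
    by (rule nn[OF t']) (use B \<eta> in auto)
  ultimately show ?thesis
    using i[OF \<phi>] i[OF t'] by (simp add: laplace_add[OF test_on_Ck[OF \<phi>] test_on_Ck[OF t']] distrib_left)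
qed

lemma lg_eq_AE: "norm b < 1 \<Longrightarrow> AE z in lborel. lg b z = ru (green b) z + lh b z"
proof -
  assume b: "norm b < 1"
  have "AE z in lborel. z \<noteq> b" by (rule AE_lborel_singleton)
  then show ?thesis
  proof eventually_elim
    case (elim z)
    then show ?case using ru_green[OF b _ elim]
      by (cases "z \<in> unit_disc") (auto simp: lg_def lh_def gf_def ru_outside)
  qed
qed

lemma lg_integrable:
  assumes b: "norm b < 1"
  shows "integrable lborel (lg b)"
proof -
  have i: "integrable lborel (\<lambda>z. ru (green b) z + lh b z)"
    by (intro Bochner_Integration.integrable_add exhaustion_integrable green_exhaustion lh_integrable b)
  show ?thesis
    by (rule integrable_cong_AE_imp[OF i]) (use lg_eq_AE[OF b] in \<open>auto elim: eventually_mono\<close>)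
qed

lemma lg_pairing_kap:
  assumes b: "norm b < 1" and \<phi>: "test_on unit_disc \<phi>"
  shows "(LINT z|lborel. lg b z * laplace \<phi> z) = kap b * \<phi> b"
proof -
  have i: "integrable lborel (\<lambda>z. ru (green b) z * laplace \<phi> z)" "integrable lborel (\<lambda>z. lh b z * laplace \<phi> z)"
    using integrable_loc_integrable[OF lh_integrable[OF b]] test_on_laplace[OF \<phi>]
      integrable_loc_integrable[OF exhaustion_integrable(1)[OF green_exhaustion[OF b]]] by (auto simp: loc_integrable_def)
  have [measurable]: "ru (green b) \<in> borel_measurable borel" "laplace \<phi> \<in> borel_measurable borel"
    using ru_measurable[OF exhaustions_continuous[OF green_exhaustion[OF b]]] test_on_borel[OF test_on_laplace[OF \<phi>]] by auto
  have "(LINT z|lborel. lg b z * laplace \<phi> z) = (LINT z|lborel. ru (green b) z * laplace \<phi> z + lh b z * laplace \<phi> z)"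
    using lg_eq_AE[OF b] by (intro integral_cong_AE) (auto elim!: eventually_mono simp: algebra_simps)
  also have "\<dots> = kap b * \<phi> b"
    using i lh_pairing[OF b \<phi>] green_pairing_kap(2)[OF b \<phi>] by simp
  finally show ?thesis .
qed

text \<open>The mass of the Laplacian of a Green function does not depend on the pole, because the
  logarithms are translates of each other.\<close>

lemma kap_eq:
  assumes b: "norm b < 1"
  shows "kap b = kap 0"
proof -
  \<comment> \<open>With this radius the disc around 0 and its translate by b both stay inside the
    unit disc.\<close>
  define \<rho> where "\<rho> = 1 - norm b"
  have 0: "{0} \<subseteq> ball (0::complex) \<rho>" using b by (auto simp: \<rho>_def)
  obtain \<eta> W C where \<eta>: "\<And>m. Ck m \<eta>" "\<And>z. 0 \<le> \<eta> z" "\<And>z. \<eta> z \<le> 1"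
    "open W" "{0} \<subseteq> W" "\<And>z. z \<in> W \<Longrightarrow> \<eta> z = 1"
    "compact C" "C \<subseteq> ball 0 \<rho>" "\<And>z. z \<notin> C \<Longrightarrow> \<eta> z = 0"
    by (rule smooth_Urysohn[OF _ open_ball 0]) auto
  have t: "test_on (ball 0 \<rho>) \<eta>" using \<eta> by (intro test_onI[of _ C]) auto
  have tD: "test_on unit_disc \<eta>" using t by (rule test_on_mono) (intro subset_ball, simp add: \<rho>_def)
  have tb: "test_on unit_disc (\<lambda>z. \<eta> (z + (- b)))"
  proof (rule test_onI[of _ "(+) b ` C"])
    show "Ck n (\<lambda>z. \<eta> (z + - b))" for n using \<eta>(1) by (rule Ck_translate)
    show "compact ((+) b ` C)" using \<eta>(7) by (rule compact_translation)
    show "(+) b ` C \<subseteq> unit_disc"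
    proof
      fix z assume "z \<in> (+) b ` C"
      then obtain c where c: "c \<in> C" "z = b + c" by auto
      then have "norm c < \<rho>" using \<eta>(8) by auto
      then show "z \<in> unit_disc" using c norm_triangle_ineq[of b c] by (simp add: \<rho>_def)
    qed
    show "\<eta> (z + - b) = 0" if "z \<notin> (+) b ` C" for z
    proof (rule \<eta>(9))
      show "z + - b \<notin> C" using that by (metis add.commute diff_add_cancel image_eqI uminus_add_conv_diff)
    qed
  qed
  have lap0: "laplace \<eta> z = 0" if "z \<notin> ball 0 \<rho>" for z
    using test_on_laplace[OF t] that unfolding test_on_def by blast
  have [measurable]: "laplace \<eta> \<in> borel_measurable borel" by (rule test_on_borel[OF test_on_laplace[OF t]])
  have "kap b * \<eta> (b + - b) = (LINT z|lborel. lg b z * laplace (\<lambda>z. \<eta> (z + - b)) z)"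
    using lg_pairing_kap[OF b tb] by simp
  also have "\<dots> = (LINT z|lborel. ln (norm (z + - b)) * laplace \<eta> (z + - b))"
  proof (rule Bochner_Integration.integral_cong[OF refl])
    fix z
    have lt: "laplace (\<lambda>z. \<eta> (z + - b)) z = laplace \<eta> (z + - b)" by (rule laplace_translate)
    show "lg b z * laplace (\<lambda>z. \<eta> (z + - b)) z = ln (norm (z + - b)) * laplace \<eta> (z + - b)"
    proof (cases "z \<in> unit_disc")
      case False
      then have "1 \<le> norm z" by simp
      moreover have "norm z \<le> norm b + norm (z - b)" by (rule norm_triangle_sub)
      ultimately have "z + - b \<notin> ball 0 \<rho>" by (simp add: \<rho>_def)
      then have "laplace \<eta> (z + - b) = 0" by (rule lap0)
      with lt show ?thesis by (simp only: mult_zero_right)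
    next
      case True
      then have "lg b z = ln (norm (z + - b))" by (simp add: lg_def)
      with lt show ?thesis by (simp only:)
    qed
  qed
  also have "\<dots> = (LINT z|lborel. ln (norm z) * laplace \<eta> z)"
    using lborel_integral_translate[of "\<lambda>z. ln (norm z) * laplace \<eta> z" "- b"] by simp
  also have "\<dots> = (LINT z|lborel. lg 0 z * laplace \<eta> z)"
  proof (rule Bochner_Integration.integral_cong[OF refl])
    fix z
    show "ln (norm z) * laplace \<eta> z = lg 0 z * laplace \<eta> z"
    proof (cases "z \<in> unit_disc")
      case False
      have "ball 0 \<rho> \<subseteq> unit_disc" by (intro subset_ball) (simp add: \<rho>_def)
      then have "laplace \<eta> z = 0" using False by (intro lap0) blast
      then show ?thesis by (simp only: mult_zero_right)
    qed (simp add: lg_def)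
  qed
  also have "\<dots> = kap 0 * \<eta> 0" using lg_pairing_kap[OF _ tD, of 0] by simp
  finally have "kap b * \<eta> (b + - b) = kap 0 * \<eta> 0" .
  moreover have "\<eta> 0 = 1" using \<eta>(5,6) by blast
  ultimately show ?thesis by simp
qed

definition \<kappa> :: real where "\<kappa> = kap 0"

lemma \<kappa>_pos: "\<kappa> > 0"
  using green_pairing_kap(1)[of 0] by (simp add: \<kappa>_def)

lemma lg_pairing: "norm b < 1 \<Longrightarrow> test_on unit_disc \<phi> \<Longrightarrow> (LINT z|lborel. lg b z * laplace \<phi> z) = \<kappa> * \<phi> b"
  using lg_pairing_kap[of b \<phi>] kap_eq[of b] by (simp add: \<kappa>_def)

lemma mix_pairing:
  assumes I: "finite I" and c: "\<And>i. i \<in> I \<Longrightarrow> c i \<ge> 0" and a: "\<And>i. i \<in> I \<Longrightarrow> norm (a i) < 1"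
    and \<phi>: "test_on unit_disc \<phi>"
  shows "(LINT z|lborel. ru (mix I c a) z * laplace \<phi> z) = (\<Sum>i\<in>I. \<kappa> * c i * \<phi> (a i))"
proof -
  have i: "integrable lborel (\<lambda>z. ru (green (a i)) z * laplace \<phi> z)" if "i \<in> I" for i
    using integrable_loc_integrable[OF exhaustion_integrable(1)[OF green_exhaustion[OF a[OF that]]]] test_on_laplace[OF \<phi>]
    by (simp add: loc_integrable_def)
  have [measurable]: "laplace \<phi> \<in> borel_measurable borel"
    by (rule test_on_borel[OF test_on_laplace[OF \<phi>]])
  have [measurable]: "ru (green (a i)) \<in> borel_measurable borel" if "i \<in> I" for i
    using ru_measurable[OF exhaustions_continuous[OF green_exhaustion[OF a[OF that]]]] .
  have m: "ru (mix I c a) \<in> borel_measurable borel"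
  proof -
    have "mix I c a \<in> borel_measurable borel" unfolding mix_def[abs_def] pot_def[abs_def] by measurable
    then show ?thesis unfolding ru_def[abs_def] by measurable
  qed
  have "AE z in lborel. \<forall>i\<in>I. z \<noteq> a i"
    using I AE_lborel_singleton by (intro AE_finite_allI) auto
  then have "AE z in lborel. ru (mix I c a) z * laplace \<phi> z = (\<Sum>i\<in>I. c i * (ru (green (a i)) z * laplace \<phi> z))"
  proof eventually_elim
    case (elim z)
    show ?case
    proof (cases "z \<in> unit_disc")
      case True
      then have "ru (mix I c a) z = - (\<Sum>i\<in>I. c i * gf (a i) z)"
        using elim by (intro ru_mix I c a) auto
      also have "\<dots> = (\<Sum>i\<in>I. c i * ru (green (a i)) z)"
        using True elim ru_green[OF a] by (simp add: sum_negf)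
      finally show ?thesis by (simp add: sum_distrib_right mult.assoc)
    qed (simp add: ru_outside)
  qed
  then have "(LINT z|lborel. ru (mix I c a) z * laplace \<phi> z) = (LINT z|lborel. (\<Sum>i\<in>I. c i * (ru (green (a i)) z * laplace \<phi> z)))"
  proof (rule integral_cong_AE[rotated 2])
    show "(\<lambda>z. ru (mix I c a) z * laplace \<phi> z) \<in> borel_measurable lborel" using m by measurable
    show "(\<lambda>z. \<Sum>i\<in>I. c i * (ru (green (a i)) z * laplace \<phi> z)) \<in> borel_measurable lborel"
      using i by (intro borel_measurable_sum borel_measurable_times borel_measurable_const) auto
  qed
  also have "\<dots> = (\<Sum>i\<in>I. c i * (LINT z|lborel. ru (green (a i)) z * laplace \<phi> z))"
    using i by simp
  also have "\<dots> = (\<Sum>i\<in>I. \<kappa> * c i * \<phi> (a i))"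
    using green_pairing_kap(2)[OF a \<phi>] kap_eq[OF a] by (intro sum.cong refl) (simp add: \<kappa>_def)
  finally show ?thesis .
qed

text \<open>The measure is realized as the image under \<open>a\<close> of a weighted counting
  measure on \<open>I\<close>, which adds up the weights of coinciding poles.\<close>

lemma mix_laplacian:
  assumes I: "finite I" and c: "\<And>i. i \<in> I \<Longrightarrow> c i \<ge> 0" and a: "\<And>i. i \<in> I \<Longrightarrow> norm (a i) < 1"
    and E: "E \<in> sets borel" "E \<subseteq> unit_disc"
  shows "emeasure (laplacian (mix I c a)) E = (\<Sum>i | i \<in> I \<and> a i \<in> E. ennreal (\<kappa> * c i))"
proof -
  define M where "M = distr (point_measure I (\<lambda>i. ennreal (\<kappa> * c i))) (restrict_space borel unit_disc) a"
  have meas: "a \<in> point_measure I (\<lambda>i. ennreal (\<kappa> * c i)) \<rightarrow>\<^sub>M restrict_space borel unit_disc"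
    unfolding measurable_def using a by (auto simp: space_restrict_space space_point_measure sets_point_measure)
  have em: "emeasure M E = (\<Sum>i | i \<in> I \<and> a i \<in> E. ennreal (\<kappa> * c i))" if "E \<in> sets borel" "E \<subseteq> unit_disc" for E
  proof -
    have "emeasure M E = emeasure (point_measure I (\<lambda>i. ennreal (\<kappa> * c i))) (a -` E \<inter> I)"
      unfolding M_def using that by (subst emeasure_distr[OF meas]) (auto simp: sets_disc_iff space_point_measure)
    also have "\<dots> = (\<Sum>i\<in>a -` E \<inter> I. ennreal (\<kappa> * c i))"
      using I by (intro emeasure_point_measure_finite) auto
    also have "a -` E \<inter> I = {i. i \<in> I \<and> a i \<in> E}" by auto
    finally show ?thesis .
  qed
  have "emeasure M K < \<infinity>" if "compact K" "K \<subseteq> unit_disc" for K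
  proof -
    have "emeasure M K = (\<Sum>i | i \<in> I \<and> a i \<in> K. ennreal (\<kappa> * c i))"
      using that by (intro em borel_compact)
    also have "\<dots> = ennreal (\<Sum>i | i \<in> I \<and> a i \<in> K. \<kappa> * c i)"
      using c \<kappa>_pos by (intro sum_ennreal) auto
    finally show ?thesis by simp
  qed
  then have "radon_on_disc M"
    unfolding radon_on_disc_def by (simp add: M_def)
  moreover have "(LINT z|M. \<phi> z) = (LINT z|lborel. ru (mix I c a) z * laplace \<phi> z)" if \<phi>: "test_on unit_disc \<phi>" for \<phi>
  proof -
    have "(LINT z|M. \<phi> z) = (LINT i|point_measure I (\<lambda>i. ennreal (\<kappa> * c i)). \<phi> (a i))"
      unfolding M_def using test_on_borel[OF \<phi>]
      by (intro integral_distr[OF meas] measurable_restrict_space1) auto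
    also have "\<dots> = (\<Sum>i\<in>I. \<kappa> * c i * \<phi> (a i))"
      using I c \<kappa>_pos by (subst lebesgue_integral_point_measure_finite) auto
    finally show ?thesis using mix_pairing[OF I c a \<phi>] by simp
  qed
  ultimately have "laplacian (mix I c a) = M" by (intro laplacian_eqI) (simp add: has_laplacian_iff)
  then show ?thesis using em[OF E] by simp
qed

section \<open>Balayage\<close>

text \<open>Radius 2, because the logarithm will be evaluated at differences z - s w of two points
  of the disc.\<close>

lemma ln_norm_ball_integrable: "integrable lborel (\<lambda>z::complex. indicator (ball 0 2) z * \<bar>ln (norm z)\<bar>)"
proof (rule Bochner_Integration.integrable_bound)
  show "integrable lborel (\<lambda>z. \<bar>lg 0 z\<bar> + indicator (ball (0::complex) 2) z * ln 2)"
    using lg_integrable[of 0] emeasure_bounded_finite[of "ball 0 2 :: complex set"] by auto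
  have "\<bar>indicator (ball 0 2) z * \<bar>ln (norm z)\<bar>\<bar> \<le> \<bar>lg 0 z\<bar> + indicator (ball 0 2) z * ln 2" for z :: complex
  proof (cases "norm z < 1")
    case True
    then show ?thesis by (simp add: lg_def indicator_def)
  next
    case False
    have "\<bar>ln (norm z)\<bar> \<le> ln 2" if "norm z < 2"
    proof -
      have "1 \<le> norm z" "0 < norm z" using False by linarith+
      then have "0 \<le> ln (norm z)" "ln (norm z) \<le> ln 2" using that ln_le_cancel_iff[of "norm z" 2] by simp_all
      then show ?thesis by simp
    qed
    then show ?thesis using False by (auto simp: indicator_def lg_def)
  qed
  then show "AE z in lborel. norm (indicator (ball (0::complex) 2) z * \<bar>ln (norm z)\<bar>) \<le> norm (\<bar>lg 0 z\<bar> + indicator (ball 0 2) z * ln 2)"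
    by (intro AE_I2) (simp add: order_trans[OF _ abs_ge_self])
qed measurable

interpretation cbl: pair_sigma_finite circle_measure "lborel :: complex measure"
  by standard

definition lmax :: "real \<Rightarrow> complex \<Rightarrow> real" where
  "lmax s z = indicator unit_disc z * max (ln (norm z)) (ln s)"

lemma lmax_measurable [measurable]: "lmax s \<in> borel_measurable borel"
  unfolding lmax_def[abs_def] by measurable

text \<open>The function \<open>max (ln |z|) (ln s)\<close> is the mean of \<open>ln |z - s w|\<close> over the unit circle.\<close>

lemma lmax_pairing:
  assumes s: "0 < s" "s < 1" and \<phi>: "test_on unit_disc \<phi>"
  shows "(LINT z|lborel. lmax s z * laplace \<phi> z) = \<kappa> * (LINT w|circle_measure. \<phi> (of_real s * w))"
proof -
  obtain Q where Q: "Q > 0" "\<And>z. \<bar>laplace \<phi> z\<bar> \<le> Q" using test_on_bounded[OF test_on_laplace[OF \<phi>]] by metis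
  have [measurable]: "laplace \<phi> \<in> borel_measurable borel" by (rule test_on_borel[OF test_on_laplace[OF \<phi>]])
  define L where "L z = indicator (ball 0 2) z * \<bar>ln (norm z)\<bar>" for z :: complex
  have [measurable]: "L \<in> borel_measurable borel" unfolding L_def[abs_def] by measurable
  define F where "F = (\<lambda>(w, z). lg (of_real s * w) z * laplace \<phi> z)"
  have [measurable]: "F \<in> borel_measurable (circle_measure \<Otimes>\<^sub>M lborel)"
    unfolding F_def lg_def[abs_def] by measurable
  \<comment> \<open>The majorant is a translate of one integrable function, so the inner integrals
    are bounded independently of w; this gives the joint integrability behind Fubini's
    theorem.\<close>
  have Fle: "ennreal \<bar>F (w, z)\<bar> \<le> ennreal (Q * L (z - of_real s * w))" if w: "norm w = 1" for w z
  proof (rule ennreal_leI)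
    show "\<bar>F (w, z)\<bar> \<le> Q * L (z - of_real s * w)"
    proof (cases "z \<in> unit_disc")
      case True
      have "norm (z - of_real s * w) \<le> norm z + norm (of_real s * w)" by (rule norm_triangle_ineq4)
      also have "\<dots> < 2" using True s w by (simp add: norm_mult)
      finally have "\<bar>F (w, z)\<bar> = \<bar>laplace \<phi> z\<bar> * L (z - of_real s * w)"
        using True by (simp add: F_def lg_def L_def abs_mult)
      also have "\<dots> \<le> Q * L (z - of_real s * w)" using Q by (intro mult_right_mono) (auto simp: L_def)
      finally show ?thesis .
    next
      case False
      then show ?thesis using Q(1) by (simp add: F_def lg_def L_def)
    qed
  qed
  have Lfin: "(\<integral>\<^sup>+ z. ennreal (Q * L z) \<partial>lborel) < \<infinity>"
  proof -
    have "integrable lborel (\<lambda>z. Q * L z)" using ln_norm_ball_integrable by (simp add: L_def)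
    then have "(\<integral>\<^sup>+ z. ennreal (norm (Q * L z)) \<partial>lborel) < \<infinity>"
      unfolding integrable_iff_bounded by blast
    moreover have "norm (Q * L z) = Q * L z" for z using Q(1) by (simp add: L_def)
    ultimately show ?thesis by simp
  qed
  have trans: "(\<integral>\<^sup>+ z. ennreal (Q * L (z - b)) \<partial>lborel) = (\<integral>\<^sup>+ z. ennreal (Q * L z) \<partial>lborel)" for b
  proof -
    have "(\<integral>\<^sup>+ z. ennreal (Q * L z) \<partial>lborel) = (\<integral>\<^sup>+ z. ennreal (Q * L z) \<partial>distr lborel borel ((+) (- b)))"
      by (simp add: lborel_distr_plus)
    also have "\<dots> = (\<integral>\<^sup>+ z. ennreal (Q * L (- b + z)) \<partial>lborel)" by (subst nn_integral_distr) auto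
    finally show ?thesis by (simp add: algebra_simps)
  qed
  have intF: "integrable (circle_measure \<Otimes>\<^sub>M lborel) F"
  proof (rule integrableI_bounded)
    have "(\<integral>\<^sup>+ x. ennreal (norm (F x)) \<partial>(circle_measure \<Otimes>\<^sub>M lborel)) = (\<integral>\<^sup>+ w. \<integral>\<^sup>+ z. ennreal (norm (F (w, z))) \<partial>lborel \<partial>circle_measure)"
      by (rule lborel.nn_integral_fst[symmetric]) measurable
    also have "\<dots> \<le> (\<integral>\<^sup>+ w. (\<integral>\<^sup>+ z. ennreal (Q * L z) \<partial>lborel) \<partial>circle_measure)"
    proof (rule nn_integral_mono_AE, rule AE_circleI)
      fix w :: complex assume w: "norm w = 1"
      have "(\<integral>\<^sup>+ z. ennreal (norm (F (w, z))) \<partial>lborel) \<le> (\<integral>\<^sup>+ z. ennreal (Q * L (z - of_real s * w)) \<partial>lborel)"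
        using Fle[OF w] by (intro nn_integral_mono) simp
      then show "(\<integral>\<^sup>+ z. ennreal (norm (F (w, z))) \<partial>lborel) \<le> (\<integral>\<^sup>+ z. ennreal (Q * L z) \<partial>lborel)" using trans by simp
    qed
    also have "\<dots> = (\<integral>\<^sup>+ z. ennreal (Q * L z) \<partial>lborel)" using circ.emeasure_space_1 by simp
    also have "\<dots> < \<infinity>" by (rule Lfin)
    finally show "(\<integral>\<^sup>+ x. ennreal (norm (F x)) \<partial>(circle_measure \<Otimes>\<^sub>M lborel)) < \<infinity>" .
  qed measurable
  \<comment> \<open>On |z| = s the two coefficients in \<open>mean_ln_affine\<close> have equal
    modulus, and at 0 the logarithm is singular; both sets are null.\<close>
  have ae: "AE z :: complex in lborel. z \<noteq> 0 \<and> norm z \<noteq> s"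
  proof -
    have "negligible (sphere (0::complex) s)" by (rule negligible_sphere)
    then have "sphere (0::complex) s \<in> null_sets lborel"
      unfolding negligible_iff_null_sets by (subst (asm) null_sets_completion_iff) (auto intro: borel_closed)
    then have "AE z :: complex in lborel. z \<notin> sphere 0 s" by (rule AE_not_in)
    moreover have "AE z :: complex in lborel. z \<noteq> 0" by (rule AE_lborel_singleton)
    ultimately show ?thesis by eventually_elim auto
  qed
  have "(LINT z|lborel. lmax s z * laplace \<phi> z) = (LINT z|lborel. LINT w|circle_measure. F (w, z))"
  proof (rule integral_cong_AE)
    show "AE z in lborel. lmax s z * laplace \<phi> z = (LINT w|circle_measure. F (w, z))"
      using ae
    proof eventually_elim
      case (elim z)
      have "(LINT w|circle_measure. ln (norm (z + (- of_real s) * w))) = max (ln (norm z)) (ln s)"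
      proof (cases "s < norm z")
        case True
        then have "ln s < ln (norm z)" using s by (subst ln_less_cancel_iff) auto
        then show ?thesis using True mean_ln_affine(1)[of "- of_real s" z] s by (simp add: max_def)
      next
        case False
        then have "norm z < s" using elim by simp
        then have "ln (norm z) \<le> ln s" using elim s by (subst ln_le_cancel_iff) auto
        then show ?thesis using \<open>norm z < s\<close> mean_ln_affine(2)[of z "- of_real s"] s by (simp add: max_def)
      qed
      then show ?case by (simp add: F_def lg_def lmax_def)
    qed
    show "(\<lambda>z. LINT w|circle_measure. F (w, z)) \<in> borel_measurable lborel" by measurable
  qed measurable
  also have "\<dots> = (LINT w|circle_measure. LINT z|lborel. F (w, z))"
    using cbl.Fubini_integral[of "\<lambda>w z. F (w, z)"] intF by simp
  also have "\<dots> = (LINT w|circle_measure. \<kappa> * \<phi> (of_real s * w))"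
  proof (rule integral_cong_AE)
    show "AE w in circle_measure. (LINT z|lborel. F (w, z)) = \<kappa> * \<phi> (of_real s * w)"
      using lg_pairing[OF _ \<phi>] s by (intro AE_circleI) (simp add: F_def norm_mult)
    show "(\<lambda>w. LINT z|lborel. F (w, z)) \<in> borel_measurable circle_measure" by measurable
    show "(\<lambda>w. \<kappa> * \<phi> (of_real s * w)) \<in> borel_measurable circle_measure"
      using test_on_borel[OF \<phi>] by measurable
  qed
  finally show ?thesis by simp
qed

lemma lmax_integrable:
  assumes "0 < s"
  shows "integrable lborel (lmax s)"
proof (rule integrable_bounded_support[where R = 1 and B = "\<bar>ln s\<bar>"])
  show "\<bar>lmax s z\<bar> \<le> \<bar>ln s\<bar>" for z
  proof (cases "z \<in> unit_disc")
    case True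
    have "ln (norm z) \<le> 0" using True by (cases "z = 0") auto
    then show ?thesis using True by (auto simp: lmax_def max_def)
  qed (simp add: lmax_def)
qed (auto simp: lmax_def)

lemma pairing_integrable: "integrable lborel g \<Longrightarrow> test_on unit_disc \<phi> \<Longrightarrow> integrable lborel (\<lambda>z. g z * laplace \<phi> z)"
  using integrable_loc_integrable test_on_laplace loc_integrable_def by blast

text \<open>Functions that agree near the boundary are compared by testing with a smooth subharmonic function
  that is cut off there.\<close>

lemma pairing_mono:
  assumes v: "\<And>n. Ck n v" "\<And>z. laplace v z \<ge> 0"
    and R: "R < 1"
    and g: "integrable lborel g" and h: "integrable lborel h"
    and le: "AE z in lborel. h z \<le> g z" and eq: "\<And>z. norm z > R \<Longrightarrow> h z = g z"
    and \<eta>: "test_on unit_disc \<eta>" "open W" "cball 0 R \<subseteq> W" "\<And>z. z \<in> W \<Longrightarrow> \<eta> z = 1"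
  shows "(LINT z|lborel. h z * laplace (\<lambda>z. v z * \<eta> z) z) \<le> (LINT z|lborel. g z * laplace (\<lambda>z. v z * \<eta> z) z)"
proof -
  have t: "test_on unit_disc (\<lambda>z. v z * \<eta> z)" by (rule test_on_mult(2)[OF \<eta>(1) v(1)])
  have L: "laplace (\<lambda>z. v z * \<eta> z) z = laplace v z" if "z \<in> cball 0 R" for z
    by (rule laplace_cong_open[OF \<eta>(2)]) (use that \<eta>(3,4) in auto)
  show ?thesis
  proof (rule integral_mono_AE[OF pairing_integrable[OF h t] pairing_integrable[OF g t]])
    show "AE z in lborel. h z * laplace (\<lambda>z. v z * \<eta> z) z \<le> g z * laplace (\<lambda>z. v z * \<eta> z) z"
      using le
    proof eventually_elim
      case (elim z)
      show ?case
      proof (cases "norm z > R")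
        case True
        then show ?thesis using eq by simp
      next
        case False
        then show ?thesis using elim v(2) by (simp add: L mult_right_mono)
      qed
    qed
  qed
qed

lemma cutoff:
  assumes "R < 1"
  obtains \<eta> W where "test_on unit_disc \<eta>" "open W" "cball 0 R \<subseteq> W" "\<And>z. z \<in> W \<Longrightarrow> \<eta> z = 1" "\<And>z. \<eta> z \<ge> 0"
proof -
  have "cball (0::complex) R \<subseteq> unit_disc" using assms by auto
  then obtain \<eta> W C where \<eta>: "\<And>m. Ck m \<eta>" "\<And>z. 0 \<le> \<eta> z" "\<And>z. \<eta> z \<le> 1"
      "open W" "cball 0 R \<subseteq> W" "\<And>z. z \<in> W \<Longrightarrow> \<eta> z = 1"
      "compact C" "C \<subseteq> unit_disc" "\<And>z. z \<notin> C \<Longrightarrow> \<eta> z = 0"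
    by (rule smooth_Urysohn[OF compact_cball open_ball]) blast
  then show thesis by (intro that[of \<eta> W] test_onI[of _ C]) auto
qed

text \<open>\<open>lmax s\<close> lies below \<open>lmax t\<close> and agrees with it for |z| > t,
  so pairing with the cut-off of a smooth subharmonic v is monotone; the pairings are \<kappa> times
  the circular means.\<close>

lemma circle_mean_mono_smooth:
  assumes v: "\<And>n. Ck n v" "\<And>z. laplace v z \<ge> 0" and s: "0 < s" "s \<le> t" "t < 1"
  shows "(LINT w|circle_measure. v (of_real s * w)) \<le> (LINT w|circle_measure. v (of_real t * w))"
proof -
  obtain \<eta> W where \<eta>: "test_on unit_disc \<eta>" "open W" "cball 0 t \<subseteq> W" "\<And>z. z \<in> W \<Longrightarrow> \<eta> z = 1"
    using cutoff[OF s(3)] by metis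
  have t0: "0 < t" "s < 1" using s by auto
  have t: "test_on unit_disc (\<lambda>z. v z * \<eta> z)" by (rule test_on_mult(2)[OF \<eta>(1) v(1)])
  have "(LINT z|lborel. lmax s z * laplace (\<lambda>z. v z * \<eta> z) z) \<le> (LINT z|lborel. lmax t z * laplace (\<lambda>z. v z * \<eta> z) z)"
  proof (rule pairing_mono[OF v s(3) lmax_integrable[OF t0(1)] lmax_integrable[OF s(1)] _ _ \<eta>])
    have "ln s \<le> ln t" using s by simp
    then have "lmax s z \<le> lmax t z" for z by (auto simp: lmax_def indicator_def)
    then show "AE z in lborel. lmax s z \<le> lmax t z" by simp
    show "lmax s z = lmax t z" if "norm z > t" for z
    proof -
      have "0 < norm z" "s \<le> norm z" "t \<le> norm z" using that s t0 by linarith+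
      then have "ln s \<le> ln (norm z)" "ln t \<le> ln (norm z)"
        using s(1) t0(1) ln_le_cancel_iff[of s "norm z"] ln_le_cancel_iff[of t "norm z"] by auto
      then show ?thesis by (simp add: lmax_def max_def)
    qed
  qed
  then have "\<kappa> * (LINT w|circle_measure. v (of_real s * w) * \<eta> (of_real s * w)) \<le> \<kappa> * (LINT w|circle_measure. v (of_real t * w) * \<eta> (of_real t * w))"
    unfolding lmax_pairing[OF s(1) t0(2) t] lmax_pairing[OF t0(1) s(3) t] .
  moreover have "(LINT w|circle_measure. v (of_real x * w) * \<eta> (of_real x * w)) = (LINT w|circle_measure. v (of_real x * w))"
    if "0 < x" "x \<le> t" for x
  proof (rule integral_cong_AE)
    show "AE w in circle_measure. v (of_real x * w) * \<eta> (of_real x * w) = v (of_real x * w)"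
    proof (rule AE_circleI)
      fix w :: complex assume "norm w = 1"
      then have "of_real x * w \<in> cball 0 t" using that by (simp add: norm_mult)
      then show "v (of_real x * w) * \<eta> (of_real x * w) = v (of_real x * w)" using \<eta>(3,4) by auto
    qed
    have [measurable]: "v \<in> borel_measurable borel" "\<eta> \<in> borel_measurable borel"
      using Ck_borel[OF v(1)] test_on_borel[OF \<eta>(1)] by auto
    show "(\<lambda>w. v (of_real x * w) * \<eta> (of_real x * w)) \<in> borel_measurable circle_measure"
      "(\<lambda>w. v (of_real x * w)) \<in> borel_measurable circle_measure" by measurable
  qed
  ultimately show ?thesis using s t0 \<kappa>_pos by simp
qed

text \<open>u is -\<infinity> at the poles, so all mass of \<Delta>u lies in the sublevel set and
  nothing is subtracted from \<Delta>u_r. Above the level u_r equals u, whose mass is elsewhere;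
  below it u_r is constant. Hence the mass sits on the level set.\<close>

lemma level_measure_mix:
  assumes I: "finite I" and c: "\<And>i. i \<in> I \<Longrightarrow> c i > 0" "I \<noteq> {}" and a: "\<And>i. i \<in> I \<Longrightarrow> norm (a i) < 1"
    and r: "r < 0"
  defines "u \<equiv> mix I c a"
  shows "level_measure u r = laplacian (trunc u r)"
    and "AE z in laplacian (trunc u r). z \<in> level u r"
    and "emeasure (laplacian (trunc u r)) unit_disc < \<infinity>"
proof -
  have u: "u \<in> exhaustions" unfolding u_def using c by (intro mix_exhaustion I a) (auto simp: less_imp_le)
  let ?M = "laplacian (trunc u r)"
  have um: "emeasure (laplacian u) E = (\<Sum>i | i \<in> I \<and> a i \<in> E. ennreal (\<kappa> * c i))" if "E \<in> sets borel" "E \<subseteq> unit_disc" for E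
    unfolding u_def using c by (intro mix_laplacian I a that) (auto simp: less_imp_le)
  have "emeasure (laplacian u) unit_disc = ennreal (\<Sum>i | i \<in> I \<and> a i \<in> unit_disc. \<kappa> * c i)"
    using c \<kappa>_pos by (subst um) (auto intro!: sum_ennreal simp: less_imp_le)
  then have fin: "emeasure (laplacian u) unit_disc < \<infinity>" by simp
  then show "emeasure ?M unit_disc < \<infinity>" using trunc_mass[OF u r] by simp
  have hl: "has_laplacian (trunc u r) ?M" "has_laplacian u (laplacian u)"
    using trunc_has_laplacian'[OF u r] exhaustion_has_laplacian[OF u] by auto
  then have rM: "radon_on_disc ?M" by (simp add: has_laplacian_iff)
  have low: "u (a i) < ereal x" if "i \<in> I" for i x
  proof -
    have "ennreal (c i) * Gr (a i) (a i) \<le> pot I c a (a i)" unfolding pot_def using I that by (intro member_le_sum) auto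
    moreover have "ennreal (c i) * Gr (a i) (a i) = top" using c(1)[OF that] by (simp add: Gr_def ennreal_mult_top)
    ultimately have "pot I c a (a i) = top" by (simp add: top_unique)
    then show ?thesis by (simp add: u_def mix_def)
  qed
  have off: "emeasure (laplacian u) (E - sublevel u r) = 0" if "E \<in> sets borel" "E \<subseteq> unit_disc" for E
  proof -
    have "E - sublevel u r \<in> sets borel" using that open_superlevel(2)[OF u] by (auto simp: borel_open)
    moreover have "a i \<notin> E - sublevel u r" if "i \<in> I" for i
      using low[OF that] a[OF that] by (simp add: sublevel_def)
    then have e: "{i. i \<in> I \<and> a i \<in> E - sublevel u r} = {}" by blast
    have "E - sublevel u r \<subseteq> unit_disc" using that by blast
    ultimately show ?thesis using um[of "E - sublevel u r"] unfolding e by simp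
  qed
  show "level_measure u r = ?M"
  proof (rule measure_eqI)
    have rL: "radon_on_disc (level_measure u r)" by (rule level_measure(1)[OF u r fin])
    then show "sets (level_measure u r) = sets ?M" using rM by (simp add: radon_on_disc_def)
    show "emeasure (level_measure u r) E = emeasure ?M E" if "E \<in> sets (level_measure u r)" for E
      using that level_measure(2)[OF u r fin, of E] off[of E] by (simp add: radon_sets[OF rL])
  qed
  define V where "V = {z \<in> unit_disc. ereal r < u z}"
  have V: "open V" "V \<subseteq> unit_disc" "V \<in> sets borel" using open_superlevel(1)[OF u] by (auto simp: V_def borel_open)
  have "emeasure ?M V = emeasure (laplacian u) V"
    by (rule has_laplacian_cong_open[OF hl V(1,2) _ V(3)]) (auto simp: V_def trunc_eq_above less_imp_le)
  also have "V - sublevel u r = V" by (auto simp: V_def sublevel_def)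
  then have "emeasure (laplacian u) V = 0" using off[OF V(3,2)] by simp
  finally have nV: "emeasure ?M V = 0" .
  define B where "B = sublevel u r"
  have B: "open B" "B \<subseteq> unit_disc" "B \<in> sets borel" using open_superlevel(2)[OF u] by (auto simp: B_def sublevel_def borel_open)
  have nB: "emeasure ?M B = 0"
  proof (rule radon_null_open[OF rM B(1,2)])
    fix \<eta> assume \<eta>: "test_on B \<eta>" "\<And>z. (\<eta> z :: real) \<ge> 0"
    have lap0: "laplace \<eta> z = 0" if "z \<notin> B" for z
      using test_on_laplace[OF \<eta>(1)] that unfolding test_on_def by blast
    have tr: "ru (trunc u r) z = r" if "z \<in> B" for z
    proof -
      have "z \<in> unit_disc" "u z \<le> ereal r" using that by (auto simp: B_def sublevel_def less_imp_le)
      then show ?thesis by (simp add: ru_def trunc_def max_def)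
    qed
    have "(LINT z|lborel. ru (trunc u r) z * laplace \<eta> z) = (LINT z|lborel. (indicator B z * r) * laplace \<eta> z)"
      using lap0 tr by (intro Bochner_Integration.integral_cong refl) (auto simp: indicator_def)
    also have "\<dots> = 0"
    proof (rule harmonic_laplace_zero[OF _ _ B(1) _ \<eta>, where B = "\<bar>r\<bar>"])
      show "(\<lambda>z. indicator B z * r) \<in> borel_measurable borel" using B(3) by measurable
      show "\<bar>indicator B z * r\<bar> \<le> \<bar>r\<bar>" for z by (simp add: indicator_def)
      fix z s assume s: "0 < (s::real)" "cball z s \<subseteq> B"
      then have z: "z \<in> B" by (metis centre_in_cball less_imp_le subsetD)
      have "(LINT w|circle_measure. indicator B (z + of_real s * w) * r) = (LINT w|circle_measure. r)"
      proof (rule integral_cong_AE)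
        show "AE w in circle_measure. indicator B (z + of_real s * w) * r = r"
        proof (rule AE_circleI)
          fix w :: complex assume "norm w = 1"
          then have "z + of_real s * w \<in> cball z s" using s by (simp add: dist_norm norm_mult)
          then show "indicator B (z + of_real s * w) * r = r" using s by (simp add: subsetD)
        qed
      qed (use B(3) in measurable)
      then show "(LINT w|circle_measure. indicator B (z + of_real s * w) * r) = indicator B z * r"
        using circ.prob_space z by simp
    qed
    finally show "(LINT z|?M. \<eta> z) = 0" using hl(1) test_on_mono[OF \<eta>(1) B(2)] by (simp add: has_laplacian_iff)
  qed
  have "V \<union> B \<in> null_sets ?M" using V B nV nB radon_sets[OF rM] by (intro null_sets.Un) auto
  then have "AE z in ?M. z \<notin> V \<union> B" by (rule AE_not_in)
  moreover have "AE z in ?M. z \<in> unit_disc" using AE_space[of ?M] radon_space[OF rM] by simp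
  ultimately show "AE z in ?M. z \<in> level u r"
    by eventually_elim (auto simp: V_def B_def sublevel_def level_def)
qed

text \<open>In u the term c ln |z| of the pole 0 is replaced by c max (ln |z|, ln s), which moves
  its mass to the circle of radius s. The result h lies below u_r: for |z| >= s it equals u, and for
  |z| < s it is at most c ln s, hence at most r. Near the unit circle both agree, so
  \<open>pairing_mono\<close> applies.\<close>

lemma balayage_smooth:
  assumes v: "\<And>n. Ck n v" "\<And>z. laplace v z \<ge> 0" "\<And>z. v z \<ge> 0"
    and I: "finite I" and c: "\<And>i. i \<in> I \<Longrightarrow> c i > 0" and i0: "i0 \<in> I" "a i0 = 0"
    and a: "\<And>i. i \<in> I \<Longrightarrow> norm (a i) < 1" and s: "0 < s" "s < 1" 
    and r: "r < 0" "c i0 * ln s \<le> r"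
  defines "u \<equiv> mix I c a"
  shows "ennreal (\<kappa> * ((\<Sum>i\<in>I - {i0}. c i * v (a i)) + c i0 * (LINT w|circle_measure. v (of_real s * w))))
     \<le> (\<integral>\<^sup>+ z\<in>level u r. ennreal (v z) \<partial>level_measure u r)"
proof -
  have ne: "I \<noteq> {}" using i0 by blast
  have u: "u \<in> exhaustions" unfolding u_def using c i0 by (intro mix_exhaustion I a) (auto simp: less_imp_le)
  let ?M = "laplacian (trunc u r)"
  have LM: "level_measure u r = ?M" "AE z in ?M. z \<in> level u r"
    unfolding u_def using level_measure_mix[of I c a r] I c ne a r(1) by blast+
  have hl: "has_laplacian (trunc u r) ?M" by (rule trunc_has_laplacian'[OF u r(1)])
  then have rM: "radon_on_disc ?M" by (simp add: has_laplacian_iff)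
  obtain R0 where R0: "0 < R0" "R0 < 1" "\<And>z. R0 < norm z \<Longrightarrow> norm z < 1 \<Longrightarrow> ereal r < u z"
    using exhaustions_near_boundary[OF u r(1)] by metis
  \<comment> \<open>The radius must exceed that of the level set, of the circle of radius s and of
    all poles, so that the cut-off is 1 wherever a measure carries mass.\<close>
  define R where "R = Max ({R0, s} \<union> (\<lambda>i. norm (a i)) ` I)"
  have fR: "finite ({R0, s} \<union> (\<lambda>i. norm (a i)) ` I)" using I by auto
  have R: "R0 \<le> R" "s \<le> R" "\<And>i. i \<in> I \<Longrightarrow> norm (a i) \<le> R" "R < 1"
  proof -
    show "R0 \<le> R" "s \<le> R" unfolding R_def by (rule Max_ge[OF fR], simp)+
    show "norm (a i) \<le> R" if "i \<in> I" for i unfolding R_def by (rule Max_ge[OF fR]) (use that in simp)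
    show "R < 1" unfolding R_def by (subst Max_less_iff[OF fR]) (use R0(2) s(2) a in auto)
  qed
  obtain \<eta> W where \<eta>: "test_on unit_disc \<eta>" "open W" "cball 0 R \<subseteq> W" "\<And>z. z \<in> W \<Longrightarrow> \<eta> z = 1" "\<And>z. \<eta> z \<ge> 0"
    using cutoff[OF R(4)] by metis
  have \<eta>1: "\<eta> z = 1" if "norm z \<le> R" for z using \<eta>(3,4) that by auto
  have t: "test_on unit_disc (\<lambda>z. v z * \<eta> z)" by (rule test_on_mult(2)[OF \<eta>(1) v(1)])
  define h where "h z = ru u z + c i0 * (lmax s z - lg 0 z)" for z
  have hint: "integrable lborel h"
    unfolding h_def using exhaustion_integrable(1)[OF u] lmax_integrable[OF s(1)] lg_integrable[of 0] by auto
  have heq: "h z = ru u z" if "norm z \<ge> s" for z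
  proof -
    have "ln s \<le> ln (norm z)" using that s(1) by (subst ln_le_cancel_iff) auto
    then have "lmax s z = lg 0 z" by (simp add: lmax_def lg_def max_def)
    then show ?thesis by (simp add: h_def)
  qed
  have fin: "AE z in lborel. z \<in> unit_disc \<longrightarrow> u z \<noteq> -\<infinity>" by (rule exhaustion_integrable(2)[OF u])
  have nota: "AE z in lborel. \<forall>i\<in>I. z \<noteq> a i"
    using I AE_lborel_singleton by (intro AE_finite_allI) auto
  have le: "AE z in lborel. h z \<le> ru (trunc u r) z"
    using fin nota
  proof eventually_elim
    case (elim z)
    show ?case
    proof (cases "z \<in> unit_disc")
      case False
      then show ?thesis by (simp add: h_def ru_outside lmax_def lg_def)
    next
      case zD: True
      show ?thesis
      proof (cases "s \<le> norm z")
        case True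
        have "u z < 0" "u z \<noteq> -\<infinity>" using zD elim exhaustions_neg[OF u] by auto
        then have "ru u z \<le> ru (trunc u r) z" using zD by (cases "u z") (auto simp: ru_def trunc_def max_def)
        then show ?thesis using heq[OF True] by simp
      next
        case False
        have g0: "gf (a i) z \<ge> 0" if "i \<in> I" for i using gf_pos[OF a[OF that]] zD elim(2) that by (simp add: less_imp_le)
        have z0: "z \<noteq> 0" using elim(2) i0 by metis
        have "ru u z = - (\<Sum>i\<in>I. c i * gf (a i) z)"
          unfolding u_def using zD elim(2) c by (intro ru_mix I a) (auto simp: less_imp_le)
        also have "\<dots> = - (\<Sum>i\<in>I - {i0}. c i * gf (a i) z) - c i0 * gf 0 z"
          using I i0 by (simp add: sum.remove)
        also have "gf 0 z = - lg 0 z" using zD by (simp add: gf_def lg_def)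
        finally have "h z = - (\<Sum>i\<in>I - {i0}. c i * gf (a i) z) + c i0 * lmax s z"
          by (simp add: h_def algebra_simps)
        also have "lmax s z = ln s"
        proof -
          have "ln (norm z) \<le> ln s" using False z0 s(1) by (subst ln_le_cancel_iff) auto
          then show ?thesis using zD by (simp add: lmax_def)
        qed
        finally have "h z = - (\<Sum>i\<in>I - {i0}. c i * gf (a i) z) + c i0 * ln s" .
        moreover have "0 \<le> (\<Sum>i\<in>I - {i0}. c i * gf (a i) z)"
          using g0 c by (intro sum_nonneg mult_nonneg_nonneg) (auto simp: less_imp_le)
        ultimately have "h z \<le> c i0 * ln s" by linarith
        also have "\<dots> \<le> r" by (rule r(2))
        also have "\<dots> \<le> ru (trunc u r) z" using ru_trunc(2)[OF u r(1) zD] .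
        finally show ?thesis .
      qed
    qed
  qed
  have eq: "h z = ru (trunc u r) z" if "norm z > R" for z
  proof (cases "z \<in> unit_disc")
    case True
    have "ru (trunc u r) z = ru u z"
      using that R(1) R0(3)[of z] True by (intro trunc_eq_above) (auto simp: less_imp_le)
    then show ?thesis using heq[of z] that R(2) by simp
  next
    case False
    then show ?thesis by (simp add: h_def ru_outside lmax_def lg_def)
  qed
  have "(LINT z|lborel. h z * laplace (\<lambda>z. v z * \<eta> z) z) \<le> (LINT z|lborel. ru (trunc u r) z * laplace (\<lambda>z. v z * \<eta> z) z)"
    by (rule pairing_mono[OF v(1,2) R(4) trunc_integrable[OF u r(1)] hint le eq \<eta>(1-4)])
  also have "\<dots> = (LINT z|?M. v z * \<eta> z)" using hl t by (simp add: has_laplacian_iff)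
  finally have 1: "(LINT z|lborel. h z * laplace (\<lambda>z. v z * \<eta> z) z) \<le> (LINT z|?M. v z * \<eta> z)" .
  define L where "L = laplace (\<lambda>z. v z * \<eta> z)"
  have iL: "integrable lborel (\<lambda>z. ru u z * L z)" "integrable lborel (\<lambda>z. lmax s z * L z)" "integrable lborel (\<lambda>z. lg 0 z * L z)"
    unfolding L_def by (intro pairing_integrable t exhaustion_integrable(1)[OF u] lmax_integrable[OF s(1)] lg_integrable; simp)+
  have "(LINT z|lborel. h z * L z) = (LINT z|lborel. ru u z * L z + c i0 * (lmax s z * L z - lg 0 z * L z))"
    by (intro Bochner_Integration.integral_cong refl) (simp add: h_def algebra_simps)
  also have "\<dots> = (LINT z|lborel. ru u z * L z) + c i0 * ((LINT z|lborel. lmax s z * L z) - (LINT z|lborel. lg 0 z * L z))"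
    using iL by simp
  also have "(LINT z|lborel. ru u z * L z) = (\<Sum>i\<in>I. \<kappa> * c i * (v (a i) * \<eta> (a i)))"
    unfolding L_def u_def using c by (intro mix_pairing I a t) (auto simp: less_imp_le)
  also have "\<dots> = (\<Sum>i\<in>I. \<kappa> * c i * v (a i))"
    using R(3) \<eta>1 by (intro sum.cong refl) simp
  also have "\<dots> = (\<Sum>i\<in>I - {i0}. \<kappa> * c i * v (a i)) + \<kappa> * c i0 * v 0"
    using I i0 by (simp add: sum.remove)
  also have "(LINT z|lborel. lmax s z * L z) = \<kappa> * (LINT w|circle_measure. v (of_real s * w) * \<eta> (of_real s * w))"
    unfolding L_def by (rule lmax_pairing[OF s t])
  also have "(LINT w|circle_measure. v (of_real s * w) * \<eta> (of_real s * w)) = (LINT w|circle_measure. v (of_real s * w))"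
  proof (rule integral_cong_AE)
    show "AE w in circle_measure. v (of_real s * w) * \<eta> (of_real s * w) = v (of_real s * w)"
      using \<eta>1 R(2) s by (intro AE_circleI) (simp add: norm_mult)
    have [measurable]: "v \<in> borel_measurable borel" "\<eta> \<in> borel_measurable borel"
      using Ck_borel[OF v(1)] test_on_borel[OF \<eta>(1)] by auto
    show "(\<lambda>w. v (of_real s * w) * \<eta> (of_real s * w)) \<in> borel_measurable circle_measure"
      "(\<lambda>w. v (of_real s * w)) \<in> borel_measurable circle_measure" by measurable
  qed
  also have "(LINT z|lborel. lg 0 z * L z) = \<kappa> * (v 0 * \<eta> 0)"
    unfolding L_def by (rule lg_pairing[OF _ t]) simp
  also have "\<eta> 0 = 1" using \<eta>1[of 0] R(2) s by simp
  finally have "\<kappa> * ((\<Sum>i\<in>I - {i0}. c i * v (a i)) + c i0 * (LINT w|circle_measure. v (of_real s * w))) = (LINT z|lborel. h z * L z)"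
    by (simp add: algebra_simps sum_distrib_left)
  then have "\<kappa> * ((\<Sum>i\<in>I - {i0}. c i * v (a i)) + c i0 * (LINT w|circle_measure. v (of_real s * w))) \<le> (LINT z|?M. v z * \<eta> z)"
    using 1 by (simp add: L_def)
  then have "ennreal (\<kappa> * ((\<Sum>i\<in>I - {i0}. c i * v (a i)) + c i0 * (LINT w|circle_measure. v (of_real s * w)))) \<le> ennreal (LINT z|?M. v z * \<eta> z)"
    by (rule ennreal_leI)
  also have "\<dots> = (\<integral>\<^sup>+ z. ennreal (v z * \<eta> z) \<partial>?M)"
    using v(3) \<eta>(5) by (intro nn_integral_eq_integral[symmetric] radon_integrable[OF rM t]) auto
  also have "\<dots> = (\<integral>\<^sup>+ z\<in>level u r. ennreal (v z) \<partial>?M)"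
  proof (rule nn_integral_cong_AE)
    show "AE z in ?M. ennreal (v z * \<eta> z) = ennreal (v z) * indicator (level u r) z"
      using LM(2)
    proof eventually_elim
      case (elim z)
      then have "norm z \<le> R" using R0(3)[of z] R(1) by (force simp: level_def)
      then show ?case using elim \<eta>1 by simp
    qed
  qed
  finally show ?thesis by (simp only: LM(1))
qed

section \<open>Smooth subharmonic approximations of powers of holomorphic functions\<close>

definition csmooth :: "(complex \<Rightarrow> complex) \<Rightarrow> bool" where
  "csmooth q \<longleftrightarrow> (\<forall>n. Ck n (\<lambda>z. Re (q z)) \<and> Ck n (\<lambda>z. Im (q z)))"

lemma csmooth_const: "csmooth (\<lambda>z. c)"
  by (simp add: csmooth_def Ck_const)

lemma csmooth_id: "csmooth (\<lambda>z. z)"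
  using Ck_Re Ck_Im by (simp add: csmooth_def)

lemma csmooth_add: "csmooth f \<Longrightarrow> csmooth g \<Longrightarrow> csmooth (\<lambda>z. f z + g z)"
  by (simp add: csmooth_def Ck_add)

lemma csmooth_mult:
  assumes "csmooth f" "csmooth g"
  shows "csmooth (\<lambda>z. f z * g z)"
proof -
  have *: "Ck n (\<lambda>z. Re (f z))" "Ck n (\<lambda>z. Im (f z))" "Ck n (\<lambda>z. Re (g z))" "Ck n (\<lambda>z. Im (g z))" for n
    using assms by (simp_all add: csmooth_def)
  show ?thesis
    unfolding csmooth_def times_complex.sel
    by (intro allI conjI Ck_diff[OF Ck_mult[OF *(1,3)] Ck_mult[OF *(2,4)]] Ck_add[OF Ck_mult[OF *(1,4)] Ck_mult[OF *(2,3)]])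
qed

lemma csmooth_power: "csmooth f \<Longrightarrow> csmooth (\<lambda>z. f z ^ n)"
proof (induction n)
  case (Suc n)
  then show ?case using csmooth_mult[of f "\<lambda>z. f z ^ n"] by simp
qed (simp add: csmooth_const)

lemma csmooth_poly: "csmooth (\<lambda>z. \<Sum>k<n. a k * z ^ k)" for n :: nat
proof (induction n)
  case (Suc n)
  have "csmooth (\<lambda>z. (\<Sum>k<n. a k * z ^ k) + a n * z ^ n)"
    by (intro csmooth_add Suc.IH csmooth_mult csmooth_const csmooth_power csmooth_id)
  then show ?case by simp
qed (simp add: csmooth_const)

text \<open>A smooth substitute for |q|^p with \<alpha> = p/2: the constant e > 0 keeps the base of
  the power away from 0 at the zeros of q.\<close>

definition psh :: "real \<Rightarrow> real \<Rightarrow> (complex \<Rightarrow> complex) \<Rightarrow> complex \<Rightarrow> real" where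
  "psh \<alpha> e q z = ((Re (q z))\<^sup>2 + (Im (q z))\<^sup>2 + e) powr \<alpha>"

lemma Ck_psh: "csmooth q \<Longrightarrow> e > 0 \<Longrightarrow> Ck n (psh \<alpha> e q)"
  unfolding psh_def[abs_def] csmooth_def
  by (intro Ck_powr Ck_add Ck_power Ck_const) (simp_all add: add_nonneg_pos)

text \<open>With S = |q|^2 + e the Laplacian equals 4 \<alpha> S^(\<alpha> - 2) |q'|^2 (e + \<alpha>
  |q|^2). In the computation \<open>T\<close> and \<open>T2\<close> are the first and second
  derivatives of S in a direction w.\<close>

lemma laplace_psh_nonneg:
  assumes q: "q holomorphic_on UNIV" "csmooth q" and e: "e > 0" and \<alpha>: "\<alpha> > 0"
  shows "laplace (psh \<alpha> e q) z \<ge> 0"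
proof -
  define q1 where "q1 = deriv q"
  define q2 where "q2 = deriv q1"
  have h1: "q1 holomorphic_on UNIV" unfolding q1_def by (rule holomorphic_deriv[OF q(1)]) auto
  have d1: "(q has_derivative (*) (q1 z)) (at z)" for z
    using holomorphic_derivI[OF q(1), of z] by (simp add: q1_def has_field_derivative_def)
  have d2: "(q1 has_derivative (*) (q2 z)) (at z)" for z
    using holomorphic_derivI[OF h1, of z] by (simp add: q2_def has_field_derivative_def)
  define S where "S z = (Re (q z))\<^sup>2 + (Im (q z))\<^sup>2 + e" for z
  define T where "T w z = 2 * (Re (q z) * Re (q1 z * w) + Im (q z) * Im (q1 z * w))" for w z
  define T2 where "T2 w z = 2 * ((Re (q1 z * w))\<^sup>2 + (Im (q1 z * w))\<^sup>2 + Re (q z) * Re (q2 z * w * w) + Im (q z) * Im (q2 z * w * w))" for w z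
  have S0: "S z > 0" for z using e by (simp add: S_def add_nonneg_pos)
  have rq: "((\<lambda>z. Re (q z)) has_derivative (\<lambda>h. Re (q1 z * h))) (at z)"
    and iq: "((\<lambda>z. Im (q z)) has_derivative (\<lambda>h. Im (q1 z * h))) (at z)" for z
    by (rule bounded_linear.has_derivative[OF bounded_linear_Re d1] bounded_linear.has_derivative[OF bounded_linear_Im d1])+
  have d2w: "((\<lambda>z. q1 z * w) has_derivative (\<lambda>h. q2 z * h * w)) (at z)" for z w
    by (rule has_derivative_mult_left[OF d2])
  have rq1: "((\<lambda>z. Re (q1 z * w)) has_derivative (\<lambda>h. Re (q2 z * h * w))) (at z)"
    and iq1: "((\<lambda>z. Im (q1 z * w)) has_derivative (\<lambda>h. Im (q2 z * h * w))) (at z)" for z w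
    by (rule bounded_linear.has_derivative[OF bounded_linear_Re d2w] bounded_linear.has_derivative[OF bounded_linear_Im d2w])+
  have dS': "(S has_derivative (\<lambda>w. T w z)) (at z)" for z
    unfolding S_def[abs_def]
    by (rule has_derivative_eq_rhs[OF has_derivative_add[OF has_derivative_add[OF has_derivative_power[OF rq] has_derivative_power[OF iq]] has_derivative_const]])
       (simp add: T_def fun_eq_iff algebra_simps)
  have dS: "dir_deriv w S z = T w z" "S differentiable (at z)" for w z
    using dir_deriv_eq[OF dS'] dS' differentiable_def by blast+
  have dT': "(T w has_derivative (\<lambda>h. 2 * (Re (q1 z * h) * Re (q1 z * w) + Re (q z) * Re (q2 z * h * w)
      + Im (q1 z * h) * Im (q1 z * w) + Im (q z) * Im (q2 z * h * w)))) (at z)" for w z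
    unfolding T_def[abs_def]
    by (rule has_derivative_eq_rhs[OF has_derivative_mult_right[OF has_derivative_add[OF has_derivative_mult[OF rq rq1] has_derivative_mult[OF iq iq1]]]])
       (simp add: fun_eq_iff algebra_simps)
  have dT: "dir_deriv w (T w) z = T2 w z" "T w differentiable (at z)" for w z
  proof -
    show "T w differentiable (at z)" using dT' differentiable_def by blast
    show "dir_deriv w (T w) z = T2 w z" using dir_deriv_eq[OF dT'[of w z], of w] by (simp add: T2_def power2_eq_square algebra_simps)
  qed
  have P: "psh \<alpha> e q = (\<lambda>z. S z powr \<alpha>)" by (simp add: psh_def[abs_def] S_def)
  have pw: "((\<lambda>x. x powr b) has_real_derivative b * S z powr (b - 1)) (at (S z))" for b z
    using S0[of z] by (auto intro!: derivative_eq_intros)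
  have D1: "dir_deriv w (psh \<alpha> e q) = (\<lambda>z. (\<alpha> * S z powr (\<alpha> - 1)) * T w z)" for w
    unfolding P using dir_deriv_compose(2)[OF pw dS(2)] dS(1) by (simp add: fun_eq_iff)
  have pw': "((\<lambda>x. \<alpha> * x powr (\<alpha> - 1)) has_real_derivative \<alpha> * ((\<alpha> - 1) * S z powr (\<alpha> - 2))) (at (S z))" for z
    using DERIV_cmult[OF pw[of "\<alpha> - 1" z], of \<alpha>] by (simp add: algebra_simps)
  have D2: "dir_deriv w (dir_deriv w (psh \<alpha> e q)) z = 
      (\<alpha> * S z powr (\<alpha> - 1)) * T2 w z + \<alpha> * ((\<alpha> - 1) * S z powr (\<alpha> - 2)) * T w z * T w z" for w
    unfolding D1
    using dir_deriv_mult[OF dir_deriv_compose(1)[where h = "\<lambda>x. \<alpha> * x powr (\<alpha> - 1)", OF pw' dS(2)] dT(2)]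
      dir_deriv_compose(2)[where h = "\<lambda>x. \<alpha> * x powr (\<alpha> - 1)", OF pw' dS(2)] dT(1) dS(1) by simp
  define m where "m = (Re (q z))\<^sup>2 + (Im (q z))\<^sup>2"
  define n where "n = (Re (q1 z))\<^sup>2 + (Im (q1 z))\<^sup>2"
  \<comment> \<open>The terms with q'' cancel because w^2 is 1 and -1 for the two directions; this
    is the harmonicity of Re q and Im q.\<close>
  have sT2: "T2 1 z + T2 \<i> z = 4 * n" by (simp add: T2_def n_def power2_eq_square algebra_simps)
  have sT: "T 1 z * T 1 z + T \<i> z * T \<i> z = 4 * m * n"
    by (simp add: T_def m_def n_def power2_eq_square algebra_simps)
  have Sm: "S z = m + e" by (simp add: S_def m_def)
  have "S z powr (\<alpha> - 1) = S z powr (\<alpha> - 2) * S z"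
    using powr_mult_base[of "S z" "\<alpha> - 2"] S0[of z] by (simp add: mult.commute)
  then have "laplace (psh \<alpha> e q) z = \<alpha> * S z powr (\<alpha> - 2) * (S z * (T2 1 z + T2 \<i> z) + (\<alpha> - 1) * (T 1 z * T 1 z + T \<i> z * T \<i> z))"
    unfolding laplace_def D2 by (simp add: algebra_simps)
  also have "\<dots> = \<alpha> * S z powr (\<alpha> - 2) * (4 * n * (e + \<alpha> * m))"
    unfolding sT2 sT Sm by (simp add: algebra_simps)
  also have "\<dots> \<ge> 0" using \<alpha> e by (simp add: m_def n_def)
  finally show ?thesis .
qed

text \<open>Taylor polynomials of f are entire, so the approximants are smooth and subharmonic on
  the whole plane, as required of the functions that get multiplied by cut-offs.\<close>

lemma psh_approximation:
  assumes f: "f holomorphic_on unit_disc" and R: "0 < R" "R < 1" and p: "p > 0"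
  obtains v :: "nat \<Rightarrow> complex \<Rightarrow> real" and B where 
    "\<And>n k. Ck k (v n)" "\<And>n z. laplace (v n) z \<ge> 0" "\<And>n z. v n z \<ge> 0"
    "\<And>n z. norm z \<le> R \<Longrightarrow> v n z \<le> B" "\<And>z. norm z \<le> R \<Longrightarrow> (\<lambda>n. v n z) \<longlonglongrightarrow> norm (f z) powr p"
proof -
  define a where "a k = (deriv ^^ k) f 0 / fact k" for k
  \<comment> \<open>Convergence of the Taylor series at \<open>R'\<close> gives absolute convergence
    at the smaller radius \<open>R\<close>, hence the bound \<open>A\<close> on all partial
    sums.\<close>
  define R' where "R' = (R + 1) / 2"
  have R': "R < R'" "R' < 1" using R by (auto simp: R'_def)
  have sums: "(\<lambda>k. a k * z ^ k) sums f z" if "norm z < 1" for z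
    using holomorphic_power_series[OF f, of z] that by (simp add: a_def)
  have "summable (\<lambda>k. a k * of_real R' ^ k)"
    using sums[of "of_real R'"] R R' by (auto simp: sums_iff)
  then have sb: "summable (\<lambda>k. norm (a k * of_real R ^ k))"
    using powser_insidea[of a "of_real R'" "of_real R"] R R' by simp
  define A where "A = (\<Sum>k. norm (a k * of_real R ^ k))"
  define q where "q n z = (\<Sum>k<n. a k * z ^ k)" for n z
  have qb: "norm (q n z) \<le> A" if "norm z \<le> R" for n z
  proof -
    have "norm (q n z) \<le> (\<Sum>k<n. norm (a k * z ^ k))" unfolding q_def by (rule norm_sum)
    also have "\<dots> \<le> (\<Sum>k<n. norm (a k * of_real R ^ k))"
      using that R by (intro sum_mono) (auto simp: norm_mult norm_power intro!: mult_left_mono power_mono)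
    also have "\<dots> \<le> A" unfolding A_def using sb by (intro sum_le_suminf) auto
    finally show ?thesis .
  qed
  have A0: "A \<ge> 0" unfolding A_def by (rule suminf_nonneg[OF sb]) simp
  define v where "v n = psh (p / 2) (1 / real (Suc n)) (q n)" for n
  have veq: "v n z = ((norm (q n z))\<^sup>2 + 1 / real (Suc n)) powr (p / 2)" for n z
    by (simp add: v_def psh_def cmod_power2)
  have qh: "q n holomorphic_on UNIV" for n unfolding q_def[abs_def] by (intro holomorphic_intros)
  have qs: "csmooth (q n)" for n unfolding q_def[abs_def] by (rule csmooth_poly)
  show thesis
  proof (rule that[of v "(A\<^sup>2 + 1) powr (p / 2)"])
    show "Ck k (v n)" for n k unfolding v_def by (intro Ck_psh qs) simp
    show "laplace (v n) z \<ge> 0" for n z unfolding v_def using p by (intro laplace_psh_nonneg qh qs) auto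
    show "v n z \<ge> 0" for n z by (simp add: veq)
    show "v n z \<le> (A\<^sup>2 + 1) powr (p / 2)" if "norm z \<le> R" for n z
      unfolding veq using p qb[OF that, of n] by (intro powr_mono2 add_mono power_mono) auto
    show "(\<lambda>n. v n z) \<longlonglongrightarrow> norm (f z) powr p" if "norm z \<le> R" for z
    proof -
      have "(\<lambda>n. q n z) \<longlonglongrightarrow> f z" using sums[of z] that R by (simp add: sums_def q_def)
      then have "(\<lambda>n. (norm (q n z))\<^sup>2 + 1 / real (Suc n)) \<longlonglongrightarrow> (norm (f z))\<^sup>2 + 0"
        by (intro tendsto_intros LIMSEQ_Suc[OF lim_1_over_n])
      then have "(\<lambda>n. v n z) \<longlonglongrightarrow> ((norm (f z))\<^sup>2 + 0) powr (p / 2)"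
        unfolding veq using p by (intro tendsto_powr2 tendsto_const) (auto intro!: always_eventually add_nonneg_nonneg)
      also have "((norm (f z))\<^sup>2 + 0) powr (p / 2) = norm (f z) powr p"
        by (cases "f z = 0") (simp_all add: powr_powr flip: powr_numeral)
      finally show ?thesis .
    qed
  qed
qed

definition cmean :: "real \<Rightarrow> (complex \<Rightarrow> complex) \<Rightarrow> real \<Rightarrow> real" where
  "cmean p f s = (LINT w|circle_measure. norm (f (of_real s * w)) powr p)"

lemma disc_holomorphic_measurable:
  assumes "f \<in> disc_holomorphic"
  shows "f \<in> borel_measurable borel"
proof -
  have "continuous_on unit_disc f" using assms by (auto simp: disc_holomorphic_def intro: holomorphic_on_imp_continuous_on)
  then have "(\<lambda>z. if z \<in> unit_disc then f z else 0) \<in> borel_measurable borel"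
    by (intro borel_measurable_continuous_on_if) auto
  moreover have "(\<lambda>z. if z \<in> unit_disc then f z else 0) = f" using assms by (auto simp: disc_holomorphic_def)
  ultimately show ?thesis by simp
qed

lemma cmean_integrable:
  assumes f: "f \<in> disc_holomorphic" and s: "0 \<le> s" "s < 1" and p: "p > 0"
  shows "integrable circle_measure (\<lambda>w. norm (f (of_real s * w)) powr p)"
proof (rule integral_circle_measure(1))
  have "continuous_on unit_disc f" using f by (auto simp: disc_holomorphic_def intro: holomorphic_on_imp_continuous_on)
  then have "continuous_on (sphere 0 1) (\<lambda>w. f (of_real s * w))"
    by (rule continuous_on_compose2) (use s in \<open>auto intro!: continuous_intros simp: norm_mult\<close>)
  then show "continuous_on (sphere 0 1) (\<lambda>w. norm (f (of_real s * w)) powr p)"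
    using p by (intro continuous_on_powr' continuous_intros) auto
  show "(\<lambda>w. norm (f (of_real s * w)) powr p) \<in> borel_measurable borel"
    using disc_holomorphic_measurable[OF f] by measurable
qed

lemma cmean_nonneg: "cmean p f s \<ge> 0"
  unfolding cmean_def by (rule Bochner_Integration.integral_nonneg) simp

lemma cmean_approx:
  assumes v: "\<And>n k. Ck k (v n)" "\<And>n z. v n z \<ge> 0" "\<And>n z. norm z \<le> R \<Longrightarrow> v n z \<le> B"
    "\<And>z. norm z \<le> R \<Longrightarrow> (\<lambda>n. v n z) \<longlonglongrightarrow> norm (f z) powr p"
    and s: "0 < s" "s \<le> R" and f: "f \<in> disc_holomorphic"
  shows "(\<lambda>n. LINT w|circle_measure. v n (of_real s * w)) \<longlonglongrightarrow> cmean p f s"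
  unfolding cmean_def
proof (rule integral_dominated_convergence[where w = "\<lambda>_. B"])
  have [measurable]: "v n \<in> borel_measurable borel" for n using Ck_borel[OF v(1)] .
  have [measurable]: "f \<in> borel_measurable borel" by (rule disc_holomorphic_measurable[OF f])
  show "(\<lambda>w. v n (of_real s * w)) \<in> borel_measurable circle_measure" for n by measurable
  show "(\<lambda>w. norm (f (of_real s * w)) powr p) \<in> borel_measurable circle_measure" by measurable
  show "AE w in circle_measure. (\<lambda>n. v n (of_real s * w)) \<longlonglongrightarrow> norm (f (of_real s * w)) powr p"
    using s by (intro AE_circleI v(4)) (simp add: norm_mult)
  show "AE w in circle_measure. norm (v n (of_real s * w)) \<le> B" for n
    using s v(2,3) by (intro AE_circleI) (simp add: norm_mult)
qed simp

text \<open>Hardy's monotonicity of means, inherited from the smooth subharmonic approximants by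
  passing to the limit on both circles.\<close>

lemma cmean_mono:
  assumes f: "f \<in> disc_holomorphic" and p: "p > 0" and s: "0 < s" "s \<le> t" "t < 1"
  shows "cmean p f s \<le> cmean p f t"
proof -
  have fh: "f holomorphic_on unit_disc" using f by (simp add: disc_holomorphic_def)
  have t0: "0 < t" using s by linarith
  obtain v :: "nat \<Rightarrow> complex \<Rightarrow> real" and B where v: "\<And>n k. Ck k (v n)" "\<And>n z. laplace (v n) z \<ge> 0" "\<And>n z. v n z \<ge> 0"
    "\<And>n z. norm z \<le> t \<Longrightarrow> v n z \<le> B" "\<And>z. norm z \<le> t \<Longrightarrow> (\<lambda>n. v n z) \<longlonglongrightarrow> norm (f z) powr p"
    using psh_approximation[OF fh t0 s(3) p] by metis
  have lim: "(\<lambda>n. LINT w|circle_measure. v n (of_real x * w)) \<longlonglongrightarrow> cmean p f x" if "0 < x" "x \<le> t" for x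
    by (rule cmean_approx[of v t B f p x]) (fact v f that)+
  show ?thesis
    by (rule LIMSEQ_le[OF lim[OF s(1,2)] lim[OF t0 order_refl]])
       (intro exI allI impI circle_mean_mono_smooth[OF v(1,2) s])
qed

text \<open>For fixed s the balayage bound holds at every level r with c ln s <= r < 0, so it holds
  for the lower limit as r tends to 0. Smooth approximants are exchanged for |f|^p by dominated
  convergence, the level measure being finite.\<close>

lemma PS_limsup_lower_bound:
  assumes I: "finite I" and c: "\<And>i. i \<in> I \<Longrightarrow> c i > 0" and i0: "i0 \<in> I" "a i0 = 0"
    and a: "\<And>i. i \<in> I \<Longrightarrow> norm (a i) < 1" and s: "0 < s" "s < 1" 
    and f: "f \<in> disc_holomorphic" and p: "p > 0"
  shows "ennreal (\<kappa> * ((\<Sum>i\<in>I - {i0}. c i * norm (f (a i)) powr p) + c i0 * cmean p f s)) \<le> PS_limsup (mix I c a) p f"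
proof -
  let ?u = "mix I c a"
  let ?C = "\<kappa> * ((\<Sum>i\<in>I - {i0}. c i * norm (f (a i)) powr p) + c i0 * cmean p f s)"
  have ne: "I \<noteq> {}" using i0 by blast
  have u: "?u \<in> exhaustions" using c i0 by (intro mix_exhaustion I a) (auto simp: less_imp_le)
  have [measurable]: "f \<in> borel_measurable borel" by (rule disc_holomorphic_measurable[OF f])
  have key: "ennreal ?C \<le> (\<integral>\<^sup>+ z\<in>level ?u r. ennreal (norm (f z) powr p) \<partial>level_measure ?u r)"
    if r: "r < 0" "c i0 * ln s \<le> r" for r
  proof -
    let ?M = "laplacian (trunc ?u r)"
    have LM: "level_measure ?u r = ?M" "emeasure ?M unit_disc < \<infinity>"
      using level_measure_mix[of I c a r] I c ne a r(1) by blast+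
    have rM: "radon_on_disc ?M" using trunc_has_laplacian'[OF u r(1)] by (simp add: has_laplacian_iff)
    obtain R0 where R0: "0 < R0" "R0 < 1" "\<And>z. R0 < norm z \<Longrightarrow> norm z < 1 \<Longrightarrow> ereal r < ?u z"
      using exhaustions_near_boundary[OF u r(1)] by metis
    define R where "R = Max ({R0, s} \<union> (\<lambda>i. norm (a i)) ` I)"
    have fR: "finite ({R0, s} \<union> (\<lambda>i. norm (a i)) ` I)" using I by auto
    have R: "R0 \<le> R" "s \<le> R" "\<And>i. i \<in> I \<Longrightarrow> norm (a i) \<le> R" "R < 1"
    proof -
      show "R0 \<le> R" "s \<le> R" unfolding R_def by (rule Max_ge[OF fR], simp)+
      show "norm (a i) \<le> R" if "i \<in> I" for i unfolding R_def by (rule Max_ge[OF fR]) (use that in simp)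
      show "R < 1" unfolding R_def by (subst Max_less_iff[OF fR]) (use R0(2) s(2) a in auto)
    qed
    have Rpos: "0 < R" using R(1) R0(1) by linarith
    have fh: "f holomorphic_on unit_disc" using f by (simp add: disc_holomorphic_def)
    obtain v :: "nat \<Rightarrow> complex \<Rightarrow> real" and B where v: "\<And>n k. Ck k (v n)" "\<And>n z. laplace (v n) z \<ge> 0" "\<And>n z. v n z \<ge> 0"
      "\<And>n z. norm z \<le> R \<Longrightarrow> v n z \<le> B" "\<And>z. norm z \<le> R \<Longrightarrow> (\<lambda>n. v n z) \<longlonglongrightarrow> norm (f z) powr p"
      using psh_approximation[OF fh Rpos R(4) p] by metis
    have lvl: "norm z \<le> R" if "z \<in> level ?u r" for z
      using that R0(3)[of z] R(1) by (force simp: level_def)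
    have "level ?u r = unit_disc - sublevel ?u r - {z \<in> unit_disc. ereal r < ?u z}"
      by (auto simp: level_def sublevel_def)
    then have lm: "level ?u r \<in> sets borel" using open_superlevel[OF u, of r] by (auto simp: borel_open)
    have lM: "level ?u r \<in> sets ?M" using lm by (simp add: radon_sets[OF rM] level_def subset_iff)
    have "(\<lambda>n. \<kappa> * ((\<Sum>i\<in>I - {i0}. c i * v n (a i)) + c i0 * (LINT w|circle_measure. v n (of_real s * w)))) \<longlonglongrightarrow> ?C"
    proof -
      have "(\<lambda>n. LINT w|circle_measure. v n (of_real s * w)) \<longlonglongrightarrow> cmean p f s"
        by (rule cmean_approx[of v R B f p s]) (fact v f s(1) R(2))+
      then show ?thesis using R(3) by (intro tendsto_intros v(5)) auto
    qed
    then have 1: "(\<lambda>n. ennreal (\<kappa> * ((\<Sum>i\<in>I - {i0}. c i * v n (a i)) + c i0 * (LINT w|circle_measure. v n (of_real s * w))))) \<longlonglongrightarrow> ennreal ?C"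
      by (rule tendsto_ennrealI)
    have 2: "(\<lambda>n. \<integral>\<^sup>+ z\<in>level ?u r. ennreal (v n z) \<partial>?M) \<longlonglongrightarrow> (\<integral>\<^sup>+ z\<in>level ?u r. ennreal (norm (f z) powr p) \<partial>?M)"
    proof (rule nn_integral_dominated_convergence[where w = "\<lambda>z. ennreal B"])
      show "(\<lambda>z. ennreal (v n z) * indicator (level ?u r) z) \<in> borel_measurable ?M" for n
        using radon_measurable[OF rM Ck_borel[OF v(1)]] lM by measurable
      show "(\<lambda>z. ennreal (norm (f z) powr p) * indicator (level ?u r) z) \<in> borel_measurable ?M"
      proof -
        have "(\<lambda>z. ennreal (norm (f z) powr p)) \<in> borel_measurable ?M"
          by (intro radon_measurable[OF rM]) measurable
        then show ?thesis using lM by (intro borel_measurable_times_ennreal borel_measurable_indicator)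
      qed
      show "AE z in ?M. ennreal (v n z) * indicator (level ?u r) z \<le> ennreal B" for n
      proof (rule AE_I2)
        fix z
        show "ennreal (v n z) * indicator (level ?u r) z \<le> ennreal B"
        proof (cases "z \<in> level ?u r")
          case True
          then have "v n z \<le> B" by (intro v(4) lvl)
          then show ?thesis using True by (simp add: ennreal_leI)
        qed simp
      qed
      show "(\<integral>\<^sup>+ z. ennreal B \<partial>?M) < \<infinity>"
        using LM(2) by (simp add: radon_space[OF rM] ennreal_mult_less_top)
      show "AE z in ?M. (\<lambda>n. ennreal (v n z) * indicator (level ?u r) z) \<longlonglongrightarrow> ennreal (norm (f z) powr p) * indicator (level ?u r) z"
      proof (rule AE_I2)
        fix z
        show "(\<lambda>n. ennreal (v n z) * indicator (level ?u r) z) \<longlonglongrightarrow> ennreal (norm (f z) powr p) * indicator (level ?u r) z"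
        proof (cases "z \<in> level ?u r")
          case True
          then have "(\<lambda>n. ennreal (v n z)) \<longlonglongrightarrow> ennreal (norm (f z) powr p)"
            by (intro tendsto_ennrealI v(5) lvl)
          then show ?thesis using True by simp
        qed simp
      qed
    qed simp
    have "ennreal (\<kappa> * ((\<Sum>i\<in>I - {i0}. c i * v n (a i)) + c i0 * (LINT w|circle_measure. v n (of_real s * w))))
        \<le> (\<integral>\<^sup>+ z\<in>level ?u r. ennreal (v n z) \<partial>level_measure ?u r)" for n
      by (rule balayage_smooth[of "v n" I c i0 a s r, OF v(1) v(2) v(3) I _ i0 _ s r]) (fact c a)+
    then have "ennreal ?C \<le> (\<integral>\<^sup>+ z\<in>level ?u r. ennreal (norm (f z) powr p) \<partial>?M)"
      unfolding LM(1) by (intro LIMSEQ_le[OF 1 2] exI allI impI)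
    then show ?thesis by (simp only: LM(1))
  qed
  have "ln s < 0" using s by simp
  then have neg: "c i0 * ln s < 0" using c[OF i0(1)] by (simp add: mult_pos_neg)
  have "ennreal ?C \<le> Liminf (at_left 0) (\<lambda>r. \<integral>\<^sup>+ z\<in>level ?u r. ennreal (norm (f z) powr p) \<partial>level_measure ?u r)"
  proof (rule Liminf_bounded)
    show "\<forall>\<^sub>F r in at_left 0. ennreal ?C \<le> (\<integral>\<^sup>+ z\<in>level ?u r. ennreal (norm (f z) powr p) \<partial>level_measure ?u r)"
      unfolding eventually_at_left_field using neg key by (intro exI[of _ "c i0 * ln s"]) auto
  qed
  also have "\<dots> \<le> PS_limsup ?u p f" unfolding PS_limsup_def by (rule Liminf_le_Limsup) simp
  finally show ?thesis .
qed

section \<open>Convexity of powers\<close>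

lemma powr_tangent_strict:
  fixes p :: real
  assumes p: "p > 1" and m: "m > 0" and t: "t \<ge> 0" "t \<noteq> m"
  shows "m powr p + p * m powr (p - 1) * (t - m) < t powr p"
proof -
  have d: "((\<lambda>x. x powr p) has_real_derivative p * x powr (p - 1)) (at x)" if "x > 0" for x
    using that by (auto intro!: derivative_eq_intros)
  consider "t = 0" | "0 < t" "t < m" | "m < t" using t by linarith
  then show ?thesis
  proof cases
    case 1
    have "m powr (p - 1) * m = m powr p" using powr_mult_base[of m "p - 1"] m by (simp add: mult.commute)
    then have "m powr p + p * m powr (p - 1) * (t - m) = (1 - p) * m powr p" using 1 by (simp add: algebra_simps)
    also have "\<dots> < 0" using p m by (intro mult_neg_pos) auto
    finally show ?thesis using 1 by simp
  next
    case 2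
    obtain x where x: "t < x" "x < m" "m powr p - t powr p = (m - t) * (p * x powr (p - 1))"
      using MVT2[OF 2(2), of "\<lambda>x. x powr p" "\<lambda>x. p * x powr (p - 1)"] d 2 by force
    have "x powr (p - 1) < m powr (p - 1)" using x 2 p by (intro powr_less_mono2) auto
    then have "(m - t) * (p * x powr (p - 1)) < (m - t) * (p * m powr (p - 1))"
      using 2 p by (intro mult_strict_left_mono) auto
    then show ?thesis using x(3) by (simp add: algebra_simps)
  next
    case 3
    obtain x where x: "m < x" "x < t" "t powr p - m powr p = (t - m) * (p * x powr (p - 1))"
      using MVT2[OF 3, of "\<lambda>x. x powr p" "\<lambda>x. p * x powr (p - 1)"] d m by force
    have "m powr (p - 1) < x powr (p - 1)" using x m p by (intro powr_less_mono2) auto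
    then have "(t - m) * (p * m powr (p - 1)) < (t - m) * (p * x powr (p - 1))"
      using 3 p by (intro mult_strict_left_mono) auto
    then show ?thesis using x(3) by (simp add: algebra_simps)
  qed
qed

lemma powr_tangent:
  fixes p :: real
  assumes p: "p > 1" and m: "m \<ge> 0" and t: "t \<ge> 0"
  shows "m powr p + p * m powr (p - 1) * (t - m) \<le> t powr p"
proof (cases "m = 0 \<or> t = m")
  case False
  then show ?thesis using powr_tangent_strict[OF p _ t, of m] m by simp
qed (use p in auto)

lemma powr_convex_comb:
  fixes p :: real
  assumes p: "p > 1" and "x \<ge> 0" "y \<ge> 0" "0 \<le> l" "l \<le> 1"
  shows "((1 - l) * x + l * y) powr p \<le> (1 - l) * x powr p + l * y powr p"
proof -
  define m where "m = (1 - l) * x + l * y"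
  have m: "m \<ge> 0" using assms by (simp add: m_def)
  have "m powr p + p * m powr (p - 1) * ((1 - l) * (x - m) + l * (y - m)) =
      (1 - l) * (m powr p + p * m powr (p - 1) * (x - m)) + l * (m powr p + p * m powr (p - 1) * (y - m))"
    by (simp add: algebra_simps)
  also have "\<dots> \<le> (1 - l) * x powr p + l * y powr p"
    using assms m by (intro add_mono mult_left_mono powr_tangent) auto
  also have "(1 - l) * (x - m) + l * (y - m) = 0" by (simp add: m_def algebra_simps)
  finally show ?thesis by (simp add: m_def)
qed

text \<open>The tangent inequality at the weighted mean is summed; the linear terms cancel
  there.\<close>

lemma powr_sum_jensen:
  fixes p :: real
  assumes p: "p > 1" and I: "finite I" and l: "\<And>i. i \<in> I \<Longrightarrow> l i \<ge> 0" "(\<Sum>i\<in>I. l i) = 1" and x: "\<And>i. i \<in> I \<Longrightarrow> x i \<ge> 0"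
  shows "(\<Sum>i\<in>I. l i * x i) powr p \<le> (\<Sum>i\<in>I. l i * x i powr p)"
proof -
  define m where "m = (\<Sum>i\<in>I. l i * x i)"
  have m: "m \<ge> 0" using l x by (auto simp: m_def intro!: sum_nonneg)
  have "(\<Sum>i\<in>I. l i * (m powr p + p * m powr (p - 1) * (x i - m))) \<le> (\<Sum>i\<in>I. l i * x i powr p)"
    using l x m by (intro sum_mono mult_left_mono powr_tangent p) auto
  also have "(\<Sum>i\<in>I. l i * (m powr p + p * m powr (p - 1) * (x i - m))) =
      (\<Sum>i\<in>I. l i) * m powr p + p * m powr (p - 1) * ((\<Sum>i\<in>I. l i * x i) - (\<Sum>i\<in>I. l i) * m)"
    by (simp add: algebra_simps sum.distrib sum_subtractf sum_distrib_left sum_distrib_right)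
  also have "\<dots> = m powr p" using l(2) by (simp add: m_def)
  finally show ?thesis by (simp add: m_def)
qed

lemma powr_integral_jensen:
  fixes p :: real and X :: "complex \<Rightarrow> real"
  assumes p: "p > 1" and X: "integrable circle_measure X" "\<And>w. X w \<ge> 0" "integrable circle_measure (\<lambda>w. X w powr p)"
  shows "(LINT w|circle_measure. X w) powr p \<le> (LINT w|circle_measure. X w powr p)"
proof -
  define m where "m = (LINT w|circle_measure. X w)"
  have m: "m \<ge> 0" unfolding m_def using X by (intro Bochner_Integration.integral_nonneg) auto
  have "(LINT w|circle_measure. m powr p + p * m powr (p - 1) * (X w - m)) \<le> (LINT w|circle_measure. X w powr p)"
    using X m by (intro Bochner_Integration.integral_mono powr_tangent p) auto
  also have "(LINT w|circle_measure. m powr p + p * m powr (p - 1) * (X w - m)) = m powr p"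
    using X(1) circ.prob_space by (simp add: m_def)
  finally show ?thesis by (simp add: m_def)
qed

text \<open>If the moduli differ, strict convexity of t^p is enough; if they agree, the
  parallelogram law makes the midpoint strictly shorter.\<close>

lemma midpoint_strict:
  fixes a b :: complex
  assumes p: "p > 1" and ab: "a \<noteq> b"
  shows "norm ((a + b) / 2) powr p < (norm a powr p + norm b powr p) / 2"
proof -
  define m where "m = (norm a + norm b) / 2"
  have m: "m > 0" using ab by (cases "a = 0") (auto simp: m_def add_pos_nonneg)
  have le: "norm ((a + b) / 2) \<le> m" using norm_triangle_ineq[of a b] by (simp add: m_def norm_divide)
  show ?thesis
  proof (cases "norm a = norm b")
    case False
    have "norm ((a + b) / 2) powr p \<le> m powr p" using le p by (intro powr_mono2) auto
    also have "m powr p = ((m powr p + p * m powr (p - 1) * (norm a - m)) + (m powr p + p * m powr (p - 1) * (norm b - m))) / 2"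
      by (simp add: m_def algebra_simps add_divide_distrib)
    also have "\<dots> < (norm a powr p + norm b powr p) / 2"
      using powr_tangent_strict[OF p m, of "norm a"] powr_tangent_strict[OF p m, of "norm b"] False
      by (auto simp: m_def)
    finally show ?thesis .
  next
    case True
    have "(norm (a + b))\<^sup>2 + (norm (a - b))\<^sup>2 = 2 * (norm a)\<^sup>2 + 2 * (norm b)\<^sup>2"
      unfolding cmod_power2 by (simp add: power2_eq_square algebra_simps)
    moreover have "(norm (a - b))\<^sup>2 > 0" using ab by simp
    moreover have "(2 * norm a)\<^sup>2 = 2 * (norm a)\<^sup>2 + 2 * (norm b)\<^sup>2" using True by (simp add: power_mult_distrib)
    ultimately have "(norm (a + b))\<^sup>2 < (2 * norm a)\<^sup>2" by linarith
    then have "norm (a + b) < 2 * norm a" by (rule power2_less_imp_less) simp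
    then have "norm ((a + b) / 2) < norm a" by (simp add: norm_divide)
    then have "norm ((a + b) / 2) powr p < norm a powr p" using p by (intro powr_less_mono2) auto
    then show ?thesis using True by simp
  qed
qed

text \<open>A pointwise inequality that survives integration. All terms are homogeneous of degree p,
  so one may normalize N = 1; on the compact set where E is at least e the two points differ, so the
  midpoint defect D has a positive minimum \<delta> there. Otherwise e N already bounds E.\<close>

lemma uniform_convexity:
  assumes p: "p > (1::real)" and e: "e > 0"
  obtains C where "C > 0" "\<And>a b :: complex. norm (a - b) powr p \<le> 
    e * (norm a powr p + norm b powr p) + C * ((norm a powr p + norm b powr p) / 2 - norm ((a + b) / 2) powr p)"
proof -
  define N where "N x = norm (fst x) powr p + norm (snd x) powr p" for x :: "complex \<times> complex"
  define D where "D x = N x / 2 - norm ((fst x + snd x) / 2) powr p" for x :: "complex \<times> complex"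
  define E where "E x = norm (fst x - snd x) powr p" for x :: "complex \<times> complex"
  define K where "K = {x. N x = 1 \<and> e \<le> E x}"
  have cN: "continuous_on UNIV N" and cD: "continuous_on UNIV D" and cE: "continuous_on UNIV E"
    unfolding N_def[abs_def] D_def[abs_def] E_def[abs_def] using p by (auto intro!: continuous_intros continuous_on_powr')
  have D0: "D x \<ge> 0" for x
    using midpoint_strict[OF p, of "fst x" "snd x"] by (cases "fst x = snd x") (auto simp: D_def N_def)
  have "\<exists>\<delta>>0. \<forall>x\<in>K. \<delta> \<le> D x"
  proof (cases "K = {}")
    case False
    have "closed K" unfolding K_def
      using cN cE by (intro closed_Collect_conj closed_Collect_eq closed_Collect_le continuous_on_const) auto
    moreover have "bounded K"
    proof (rule boundedI[where B = 2])
      fix x assume "x \<in> K"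
      then have "N x = 1" by (simp add: K_def)
      then have "norm (fst x) powr p \<le> 1 powr p" "norm (snd x) powr p \<le> 1 powr p"
        unfolding N_def using powr_ge_zero[of "norm (fst x)" p] powr_ge_zero[of "norm (snd x)" p] by (simp_all del: powr_ge_zero)
      then have "norm (fst x) \<le> 1" "norm (snd x) \<le> 1"
        using p powr_less_mono2[of p 1 "norm (fst x)"] powr_less_mono2[of p 1 "norm (snd x)"] by fastforce+
      then show "norm x \<le> 2" using norm_Pair_le[of "fst x" "snd x"] by simp
    qed
    ultimately have "compact K" by (simp add: compact_eq_bounded_closed)
    then obtain x where x: "x \<in> K" "\<And>y. y \<in> K \<Longrightarrow> D x \<le> D y"
      using continuous_attains_inf[OF _ False] continuous_on_subset[OF cD] by (metis subset_UNIV)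
    have "fst x \<noteq> snd x" using x(1) e by (auto simp: K_def E_def)
    then have "D x > 0" using midpoint_strict[OF p, of "fst x" "snd x"] by (simp add: D_def N_def)
    then show ?thesis using x by blast
  qed (auto intro: exI[of _ 1])
  then obtain \<delta> where \<delta>: "\<delta> > 0" "\<And>x. x \<in> K \<Longrightarrow> \<delta> \<le> D x" by blast
  have ENle: "E x \<le> 2 powr p * N x" for x
  proof -
    define M where "M = max (norm (fst x)) (norm (snd x))"
    have "E x \<le> (2 * M) powr p"
      unfolding E_def using p norm_triangle_ineq4[of "fst x" "snd x"] by (intro powr_mono2) (auto simp: M_def)
    also have "\<dots> = 2 powr p * M powr p" by (simp add: powr_mult M_def)
    also have "M powr p \<le> N x" by (auto simp: M_def N_def max_def)
    finally show ?thesis by simp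
  qed
  \<comment> \<open>The constant comes from E <= 2^p N and, on the normalized compact set, N = 1 <=
    D / \<delta>.\<close>
  have main: "E x \<le> e * N x + (2 powr p / \<delta>) * D x" for x
  proof (cases "E x \<le> e * N x")
    case True
    then show ?thesis using D0[of x] \<delta>(1) by (simp add: add_increasing2)
  next
    case False
    have Nn: "N x \<ge> 0" by (simp add: N_def)
    then have "e * N x \<ge> 0" using e by simp
    then have "E x > 0" using False by linarith
    then have "N x \<noteq> 0" using ENle[of x] by auto
    then have N0: "N x > 0" using Nn by linarith
    \<comment> \<open>The scaling factor that makes \<open>N\<close> equal to 1.\<close>
    define s where "s = N x powr (- 1 / p)"
    have s: "s > 0" using N0 by (simp add: s_def)
    have sp: "s powr p = 1 / N x" 
    proof -
      have "s powr p = N x powr (- 1 / p * p)" unfolding s_def by (rule powr_powr)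
      also have "- 1 / p * p = - 1" using p by simp
      also have "N x powr (- 1) = 1 / N x" using N0 by (simp add: powr_minus_divide[of _ 1])
      finally show ?thesis .
    qed
    have nm: "norm (s *\<^sub>R y) powr p = s powr p * norm y powr p" for y :: complex
      unfolding norm_scaleR using s by (simp add: powr_mult)
    have hN: "N (s *\<^sub>R x) = s powr p * N x"
      unfolding N_def fst_scaleR snd_scaleR nm by (rule distrib_left[symmetric])
    have hE: "E (s *\<^sub>R x) = s powr p * E x"
      unfolding E_def fst_scaleR snd_scaleR scaleR_diff_right[symmetric] nm by (rule refl)
    have "(fst (s *\<^sub>R x) + snd (s *\<^sub>R x)) / 2 = s *\<^sub>R ((fst x + snd x) / 2)"
      unfolding fst_scaleR snd_scaleR scaleR_add_right[symmetric] by (simp only: scaleR_conv_of_real times_divide_eq_right)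
    then have hD: "D (s *\<^sub>R x) = s powr p * D x"
      unfolding D_def hN by (simp only: nm right_diff_distrib times_divide_eq_right)
    note hom = hN hE hD
    have "N (s *\<^sub>R x) = 1" unfolding hN sp using N0 by simp
    moreover have "e \<le> E (s *\<^sub>R x)" unfolding hE sp using N0 False by (simp add: field_simps)
    ultimately have "s *\<^sub>R x \<in> K" by (simp add: K_def)
    then have "\<delta> \<le> s powr p * D x" using \<delta>(2)[of "s *\<^sub>R x"] unfolding hD by blast
    then have "\<delta> * N x \<le> D x" using N0 by (simp add: sp field_simps)
    then have "N x \<le> D x / \<delta>" using \<delta>(1) by (simp add: field_simps)
    then have "2 powr p * N x \<le> 2 powr p * (D x / \<delta>)" by (intro mult_left_mono) auto
    then have "E x \<le> (2 powr p / \<delta>) * D x" using ENle[of x] by simp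
    moreover have "0 \<le> e * N x" using e N0 by simp
    ultimately show ?thesis by linarith
  qed
  show thesis
  proof (rule that)
    show "2 powr p / \<delta> > 0" using \<delta>(1) by simp
    fix a b :: complex
    show "norm (a - b) powr p \<le> e * (norm a powr p + norm b powr p) + 2 powr p / \<delta> * ((norm a powr p + norm b powr p) / 2 - norm ((a + b) / 2) powr p)"
      using main[of "(a, b)"] by (simp add: E_def N_def D_def)
  qed
qed

section \<open>Hardy spaces\<close>

lemma disc_holomorphic_lincomb:
  "f \<in> disc_holomorphic \<Longrightarrow> g \<in> disc_holomorphic \<Longrightarrow> (\<lambda>z. a * f z + b * g z) \<in> disc_holomorphic"
  unfolding disc_holomorphic_def by (auto intro!: holomorphic_intros)

lemma disc_holomorphic_diff:
  "f \<in> disc_holomorphic \<Longrightarrow> g \<in> disc_holomorphic \<Longrightarrow> (\<lambda>z. f z - g z) \<in> disc_holomorphic"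
  using disc_holomorphic_lincomb[of f g 1 "-1"] by simp

lemma cmean_nn:
  assumes "f \<in> disc_holomorphic" "0 \<le> s" "s < 1" "p > 0"
  shows "(\<integral>\<^sup>+ w. ennreal (norm (f (of_real s * w)) powr p) \<partial>circle_measure) = ennreal (cmean p f s)"
  unfolding cmean_def by (intro nn_integral_eq_integral cmean_integrable assms) auto

text \<open>Cauchy's formula on the circle of radius s, whose kernel is at most s / (s - |a|) in
  modulus, followed by Jensen's inequality. At a = 0 the constant is 1.\<close>

lemma point_bound:
  assumes f: "f \<in> disc_holomorphic" and p: "p > 1" and a: "norm a < s" "s < 1"
  shows "norm (f a) powr p \<le> (s / (s - norm a)) powr p * cmean p f s"
proof -
  have s0: "0 < s" using a norm_ge_zero[of a] by linarith
  have [measurable]: "f \<in> borel_measurable borel" by (rule disc_holomorphic_measurable[OF f])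
  have fh: "f holomorphic_on unit_disc" using f by (simp add: disc_holomorphic_def)
  have cf: "continuous_on (sphere 0 1) (\<lambda>w. f (of_real s * w))"
    by (rule continuous_on_compose2[OF holomorphic_on_imp_continuous_on[OF fh]])
       (use s0 a in \<open>auto intro!: continuous_intros simp: norm_mult\<close>)
  have i1: "integrable circle_measure (\<lambda>w. norm (f (of_real s * w)))"
    using cf by (intro integral_circle_measure(1) continuous_on_norm) auto
  define q where "q = s / (s - norm a)"
  have q: "q > 0" using a s0 by (simp add: q_def)
  have "f a = (LINT w|circle_measure. f (0 + of_real s * w) * (of_real s * w) / (0 + of_real s * w - a))"
    by (rule circle_Cauchy_formula[symmetric, OF fh open_ball]) (use a s0 in auto)
  then have "norm (f a) \<le> (LINT w|circle_measure. norm (f (of_real s * w) * (of_real s * w) / (of_real s * w - a)))"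
    using integral_norm_bound[of circle_measure "\<lambda>w. f (of_real s * w) * (of_real s * w) / (of_real s * w - a)"] by simp
  also have "\<dots> \<le> (LINT w|circle_measure. q * norm (f (of_real s * w)))"
  proof (rule integral_mono_AE')
    show "integrable circle_measure (\<lambda>w. q * norm (f (of_real s * w)))" using i1 by simp
    show "AE w in circle_measure. norm (f (of_real s * w) * (of_real s * w) / (of_real s * w - a)) \<le> q * norm (f (of_real s * w))"
    proof (rule AE_circleI)
      fix w :: complex assume w: "norm w = 1"
      have ge: "s - norm a \<le> norm (of_real s * w - a)"
        using norm_triangle_ineq2[of "of_real s * w" a] w s0 by (simp add: norm_mult)
      moreover have "norm (of_real s * w) = s" using w s0 by (simp add: norm_mult)
      ultimately have "norm (of_real s * w) / norm (of_real s * w - a) \<le> q"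
        using s0 a unfolding q_def by (intro frac_le) linarith+
      then have "norm (f (of_real s * w)) * (norm (of_real s * w) / norm (of_real s * w - a)) \<le> norm (f (of_real s * w)) * q"
        by (rule mult_left_mono) simp
      then show "norm (f (of_real s * w) * (of_real s * w) / (of_real s * w - a)) \<le> q * norm (f (of_real s * w))"
        by (simp add: norm_mult norm_divide mult.commute)
    qed
  qed (use q in simp)
  finally have "norm (f a) \<le> q * (LINT w|circle_measure. norm (f (of_real s * w)))" by simp
  then have "norm (f a) powr p \<le> (q * (LINT w|circle_measure. norm (f (of_real s * w)))) powr p"
    using p by (intro powr_mono2) auto
  also have "\<dots> = q powr p * (LINT w|circle_measure. norm (f (of_real s * w))) powr p"
    by (rule powr_mult)
  also have "\<dots> \<le> q powr p * cmean p f s"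
    unfolding cmean_def using p s0 a
    by (intro mult_left_mono powr_integral_jensen i1 cmean_integrable[OF f]) auto
  finally show ?thesis by (simp add: q_def)
qed

text \<open>The p-th power of the norm; unlike the norm itself it interacts linearly with integrals
  and with the uniform convexity inequality.\<close>

definition hval :: "real \<Rightarrow> (complex \<Rightarrow> complex) \<Rightarrow> real" where
  "hval p f = enn2real (hardy_sup p f)"

lemma hardy_sup_cmean:
  assumes "f \<in> disc_holomorphic" "p > 0"
  shows "hardy_sup p f = (SUP s\<in>{0..<1}. ennreal (cmean p f s))"
  unfolding hardy_sup_def using assms by (intro SUP_cong refl cmean_nn) auto

text \<open>\<open>hardy_sup\<close> also ranges over the radius 0; the mean there is |f(0)|^p,
  which \<open>point_bound\<close> estimates by the mean at radius 1/2 with constant 1.\<close>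

lemma hardy_space_I:
  assumes f: "f \<in> disc_holomorphic" and p: "p > 1" and le: "\<And>s. 0 < s \<Longrightarrow> s < 1 \<Longrightarrow> cmean p f s \<le> c"
  shows "f \<in> hardy_space p" "hval p f \<le> c"
proof -
  have c0: "c \<ge> 0" using le[of "1/2"] cmean_nonneg[of p f "1/2"] by simp
  have "cmean p f s \<le> c" if "0 \<le> s" "s < 1" for s
  proof (cases "s = 0")
    case True
    have "cmean p f 0 = norm (f 0) powr p" using circ.prob_space by (simp add: cmean_def)
    also have "\<dots> \<le> cmean p f (1/2)" using point_bound[OF f p, of 0 "1/2"] by simp
    also have "\<dots> \<le> c" by (rule le) auto
    finally show ?thesis using True by simp
  qed (use that le in auto)
  then have "hardy_sup p f \<le> ennreal c"
    using f p by (simp add: hardy_sup_cmean) (intro SUP_least ennreal_leI, auto)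
  then show "f \<in> hardy_space p" "hval p f \<le> c"
    using f c0 by (auto simp: hardy_space_def hval_def intro: le_less_trans enn2real_leI)
qed

lemma hardy_space_disc: "f \<in> hardy_space p \<Longrightarrow> f \<in> disc_holomorphic"
  by (simp add: hardy_space_def)

lemma cmean_le_hval:
  assumes f: "f \<in> hardy_space p" and p: "p > 1" and s: "0 \<le> s" "s < 1"
  shows "cmean p f s \<le> hval p f"
proof -
  have "ennreal (cmean p f s) \<le> hardy_sup p f"
    using f p s by (simp add: hardy_sup_cmean hardy_space_disc) (intro SUP_upper, auto)
  also have "\<dots> = ennreal (hval p f)" using f by (simp add: hval_def hardy_space_def)
  finally show ?thesis using cmean_nonneg[of p f s] by (simp add: hval_def)
qed

lemma hval_nonneg: "hval p f \<ge> 0"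
  by (simp add: hval_def)

text \<open>Means increase with the radius, so the supremum is a limit at 1. A limit can be
  subtracted, which the midpoint term in \<open>hardy_uniform_convexity\<close> requires.\<close>

lemma cmean_tendsto_hval:
  assumes f: "f \<in> hardy_space p" and p: "p > 1"
  shows "(cmean p f \<longlongrightarrow> hval p f) (at_left 1)"
proof (rule order_tendstoI)
  fix y assume y: "y < hval p f"
  have "\<exists>s. 0 < s \<and> s < 1 \<and> y < cmean p f s"
  proof (rule ccontr)
    assume no: "\<not> ?thesis"
    then have "hval p f \<le> y" by (intro hardy_space_I(2)[OF hardy_space_disc[OF f] p]) force
    then show False using y by simp
  qed
  then obtain s where s: "0 < s" "s < 1" "y < cmean p f s" by blast
  have "y < cmean p f t" if "s < t" "t < 1" for t
    using cmean_mono[OF hardy_space_disc[OF f] _ s(1), of p t] p that s(3) by simp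
  then show "\<forall>\<^sub>F t in at_left 1. y < cmean p f t"
    unfolding eventually_at_left_field using s(2) by blast
next
  fix y assume y: "hval p f < y"
  have "cmean p f t < y" if "0 < t" "t < 1" for t
    using cmean_le_hval[OF f p, of t] y that by simp
  then show "\<forall>\<^sub>F t in at_left 1. cmean p f t < y"
    unfolding eventually_at_left_field by (intro exI[of _ 0]) auto
qed

lemma hardy_point_bound:
  assumes f: "f \<in> hardy_space p" and p: "p > 1" and a: "norm a < s" "s < 1"
  shows "norm (f a) powr p \<le> (s / (s - norm a)) powr p * hval p f"
proof -
  have "0 \<le> s" using a norm_ge_zero[of a] by linarith
  then have "(s / (s - norm a)) powr p * cmean p f s \<le> (s / (s - norm a)) powr p * hval p f"
    using a by (intro mult_left_mono cmean_le_hval[OF f p]) auto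
  then show ?thesis using point_bound[OF hardy_space_disc[OF f] p a] by linarith
qed

lemma hval_eq_0:
  assumes f: "f \<in> hardy_space p" and p: "p > 1" and h: "hval p f = 0"
  shows "f = (\<lambda>z. 0)"
proof
  fix z show "f z = 0"
  proof (cases "norm z < 1")
    case True
    then obtain s where "norm z < s" "s < 1" using dense by blast
    then show ?thesis using hardy_point_bound[OF f p, of z s] h powr_ge_zero[of "norm (f z)" p] by simp
  qed (use f in \<open>simp add: hardy_space_def disc_holomorphic_def\<close>)
qed

text \<open>The midpoint mean enters with a minus sign and cannot be replaced by its supremum at a
  fixed radius. So the mean of the difference at radius t is first raised to radius s > t, the means
  of f and g to their suprema, and only then s tends to 1.\<close>

lemma hardy_uniform_convexity:
  assumes f: "f \<in> hardy_space p" and g: "g \<in> hardy_space p" and p: "p > 1" and e: "e \<ge> 0" and C: "C \<ge> 0"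
    and mid: "(\<lambda>z. (f z + g z) / 2) \<in> hardy_space p"
    and ineq: "\<And>a b :: complex. norm (a - b) powr p \<le> 
    e * (norm a powr p + norm b powr p) + C * ((norm a powr p + norm b powr p) / 2 - norm ((a + b) / 2) powr p)"
  shows "(\<lambda>z. f z - g z) \<in> hardy_space p"
    and "hval p (\<lambda>z. f z - g z) \<le> e * (hval p f + hval p g) + C * ((hval p f + hval p g) / 2 - hval p (\<lambda>z. (f z + g z) / 2))"
proof -
  let ?m = "\<lambda>z. (f z + g z) / 2" and ?d = "\<lambda>z. f z - g z"
  have D: "f \<in> disc_holomorphic" "g \<in> disc_holomorphic" "?m \<in> disc_holomorphic" "?d \<in> disc_holomorphic"
    using f g mid by (auto intro: hardy_space_disc disc_holomorphic_diff)
  have p0: "p > 0" using p by simp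
  have pt: "cmean p ?d s \<le> e * (cmean p f s + cmean p g s) + C * ((cmean p f s + cmean p g s) / 2 - cmean p ?m s)"
    if s: "0 < s" "s < 1" for s
  proof -
    have i: "integrable circle_measure (\<lambda>w. norm (h (of_real s * w)) powr p)" if "h \<in> disc_holomorphic" for h
      using s p0 that by (intro cmean_integrable) auto
    have "cmean p ?d s \<le> (LINT w|circle_measure. e * (norm (f (of_real s * w)) powr p + norm (g (of_real s * w)) powr p)
      + C * ((norm (f (of_real s * w)) powr p + norm (g (of_real s * w)) powr p) / 2 - norm (?m (of_real s * w)) powr p))"
      unfolding cmean_def
      using i[OF D(1)] i[OF D(2)] i[OF D(3)] i[OF D(4)] by (intro Bochner_Integration.integral_mono ineq) auto
    also have "\<dots> = e * (cmean p f s + cmean p g s) + C * ((cmean p f s + cmean p g s) / 2 - cmean p ?m s)"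
      unfolding cmean_def using i[OF D(1)] i[OF D(2)] i[OF D(3)] by simp
    finally show ?thesis .
  qed
  let ?B = "e * (hval p f + hval p g) + C * ((hval p f + hval p g) / 2 - hval p ?m)"
  have "((\<lambda>s. e * (hval p f + hval p g) + C * ((hval p f + hval p g) / 2 - cmean p ?m s)) \<longlongrightarrow> ?B) (at_left 1)"
    by (intro tendsto_intros cmean_tendsto_hval[OF mid p])
  moreover have "cmean p ?d t \<le> e * (hval p f + hval p g) + C * ((hval p f + hval p g) / 2 - cmean p ?m s)"
    if "0 < t" "t < s" "s < 1" for t s
  proof -
    have "cmean p ?d t \<le> cmean p ?d s" using that by (intro cmean_mono D p0) auto
    also have "\<dots> \<le> e * (cmean p f s + cmean p g s) + C * ((cmean p f s + cmean p g s) / 2 - cmean p ?m s)"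
      using that by (intro pt) auto
    also have "\<dots> \<le> e * (hval p f + hval p g) + C * ((hval p f + hval p g) / 2 - cmean p ?m s)"
      using that e C cmean_le_hval[OF f p, of s] cmean_le_hval[OF g p, of s]
      by (intro add_mono mult_left_mono diff_right_mono divide_right_mono) auto
    finally show ?thesis .
  qed
  ultimately have le: "cmean p ?d t \<le> ?B" if "0 < t" "t < 1" for t
    using that by (intro tendsto_lowerbound[where F = "at_left (1::real)"])
      (auto simp: eventually_at_left_field intro!: exI[of _ t])
  show "?d \<in> hardy_space p" "hval p ?d \<le> ?B"
    using hardy_space_I[OF D(4) p le] by auto
qed

lemma hardy_norm_hval: "hardy_norm p f = hval p f powr (1 / p)"
  by (simp add: hardy_norm_def hval_def)

lemma hval_hardy_norm: "p > 0 \<Longrightarrow> hval p f = hardy_norm p f powr p"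
  by (simp add: hardy_norm_hval powr_powr hval_nonneg)

lemma hardy_norm_nonneg: "hardy_norm p f \<ge> 0"
  by (simp add: hardy_norm_hval)

lemma hardy_scale:
  assumes f: "f \<in> hardy_space p" and p: "p > 1"
  shows "(\<lambda>z. c * f z) \<in> hardy_space p" "hardy_norm p (\<lambda>z. c * f z) \<le> norm c * hardy_norm p f"
proof -
  have D: "(\<lambda>z. c * f z) \<in> disc_holomorphic"
    using disc_holomorphic_lincomb[of f f c 0] hardy_space_disc[OF f] by simp
  have "cmean p (\<lambda>z. c * f z) s \<le> norm c powr p * hval p f" if "0 < s" "s < 1" for s
  proof -
    have "cmean p (\<lambda>z. c * f z) s = norm c powr p * cmean p f s"
      unfolding cmean_def by (simp add: norm_mult powr_mult)
    also have "\<dots> \<le> norm c powr p * hval p f"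
      using that by (intro mult_left_mono cmean_le_hval[OF f p]) auto
    finally show ?thesis .
  qed
  note * = hardy_space_I[OF D p this]
  show "(\<lambda>z. c * f z) \<in> hardy_space p" by (rule *(1))
  have "hardy_norm p (\<lambda>z. c * f z) \<le> (norm c powr p * hval p f) powr (1 / p)"
    unfolding hardy_norm_hval using p *(2) by (intro powr_mono2) (auto simp: hval_nonneg)
  also have "\<dots> = norm c * hardy_norm p f"
    using p by (simp add: hardy_norm_hval powr_mult powr_powr hval_nonneg)
  finally show "hardy_norm p (\<lambda>z. c * f z) \<le> norm c * hardy_norm p f" .
qed

lemma hardy_norm_0: "p > 1 \<Longrightarrow> (\<lambda>z. 0) \<in> hardy_space p" "p > 1 \<Longrightarrow> hardy_norm p (\<lambda>z. 0) = 0"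
proof -
  assume p: "p > 1"
  have D: "(\<lambda>z. 0) \<in> disc_holomorphic" by (simp add: disc_holomorphic_def)
  have "cmean p (\<lambda>z. 0) s \<le> 0" for s by (simp add: cmean_def)
  note * = hardy_space_I[OF D p this]
  show "(\<lambda>z. 0) \<in> hardy_space p" by (rule *(1))
  show "hardy_norm p (\<lambda>z. 0) = 0" using *(2) hval_nonneg[of p "\<lambda>z. 0"] by (simp add: hardy_norm_hval)
qed

text \<open>Minkowski's inequality from convexity of the p-th power, with weights proportional to
  the two norms. They degenerate when a norm is 0, but then the function itself vanishes.\<close>

lemma hardy_add:
  assumes f: "f \<in> hardy_space p" and g: "g \<in> hardy_space p" and p: "p > 1"
  shows "(\<lambda>z. f z + g z) \<in> hardy_space p" "hardy_norm p (\<lambda>z. f z + g z) \<le> hardy_norm p f + hardy_norm p g"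
proof -
  let ?A = "hardy_norm p f" and ?B = "hardy_norm p g"
  have "(\<lambda>z. f z + g z) \<in> hardy_space p \<and> hardy_norm p (\<lambda>z. f z + g z) \<le> ?A + ?B"
  proof (cases "?A = 0 \<or> ?B = 0")
    case True
    then have "hval p f = 0 \<or> hval p g = 0" using p by (auto simp: hardy_norm_hval)
    then have "f = (\<lambda>z. 0) \<or> g = (\<lambda>z. 0)" using hval_eq_0[OF f p] hval_eq_0[OF g p] by blast
    then show ?thesis using f g hardy_norm_nonneg[of p f] hardy_norm_nonneg[of p g] by auto
  next
    case False
    then have AB: "?A > 0" "?B > 0" using hardy_norm_nonneg[of p f] hardy_norm_nonneg[of p g] by auto
    define l where "l = ?B / (?A + ?B)"
    have l: "0 < l" "l < 1" "1 - l = ?A / (?A + ?B)" using AB by (auto simp: l_def field_simps)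
    have Fd: "f \<in> disc_holomorphic" "g \<in> disc_holomorphic" using f g hardy_space_disc by auto
    have D: "(\<lambda>z. f z + g z) \<in> disc_holomorphic" using disc_holomorphic_lincomb[OF Fd, of 1 1] by simp
    let ?K = "(?A + ?B) powr p"
    have pt: "norm (a + b) powr p \<le> (1 - l) * (norm a / (1 - l)) powr p + l * (norm b / l) powr p" for a b :: complex
    proof -
      have "norm (a + b) powr p \<le> (norm a + norm b) powr p" using p norm_triangle_ineq by (intro powr_mono2) auto
      also have "norm a + norm b = (1 - l) * (norm a / (1 - l)) + l * (norm b / l)" using l(1,2) by simp
      also have "\<dots> powr p \<le> (1 - l) * (norm a / (1 - l)) powr p + l * (norm b / l) powr p"
        using l(1,2) by (intro powr_convex_comb p) auto
      finally show ?thesis .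
    qed
    have "cmean p (\<lambda>z. f z + g z) s \<le> ?K" if s: "0 < s" "s < 1" for s
    proof -
      have i: "integrable circle_measure (\<lambda>w. norm (h (of_real s * w)) powr p)" if "h \<in> disc_holomorphic" for h
        using s p that by (intro cmean_integrable) auto
      have sc: "(norm a / c) powr p = norm a powr p / c powr p" if "c > 0" for a :: complex and c
        using that by (simp add: powr_divide)
      have "cmean p (\<lambda>z. f z + g z) s \<le> (LINT w|circle_measure. (1 - l) * (norm (f (of_real s * w)) powr p / (1 - l) powr p) + l * (norm (g (of_real s * w)) powr p / l powr p))"
        unfolding cmean_def
      proof (rule Bochner_Integration.integral_mono[OF i[OF D]])
        show "integrable circle_measure (\<lambda>w. (1 - l) * (norm (f (of_real s * w)) powr p / (1 - l) powr p) + l * (norm (g (of_real s * w)) powr p / l powr p))"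
          using i[OF Fd(1)] i[OF Fd(2)] by auto
        show "norm (f (of_real s * w) + g (of_real s * w)) powr p \<le> (1 - l) * (norm (f (of_real s * w)) powr p / (1 - l) powr p) + l * (norm (g (of_real s * w)) powr p / l powr p)" for w
          using pt[of "f (of_real s * w)" "g (of_real s * w)"] l(1,2) by (simp add: sc)
      qed
      also have "\<dots> = (1 - l) * (cmean p f s / (1 - l) powr p) + l * (cmean p g s / l powr p)"
        unfolding cmean_def using i[OF Fd(1)] i[OF Fd(2)] by simp
      also have "\<dots> \<le> (1 - l) * (?A powr p / (1 - l) powr p) + l * (?B powr p / l powr p)"
        using l(1,2) s cmean_le_hval[OF f p, of s] cmean_le_hval[OF g p, of s] p
        by (intro add_mono mult_left_mono divide_right_mono) (auto simp: hval_hardy_norm)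
      also have "?A powr p / (1 - l) powr p = ?K" using AB by (simp add: l(3) powr_divide)
      also have "?B powr p / l powr p = ?K" using AB by (simp add: l_def powr_divide)
      also have "(1 - l) * ?K + l * ?K = ?K" by (simp add: algebra_simps)
      finally show ?thesis .
    qed
    note * = hardy_space_I[OF D p this]
    have "hardy_norm p (\<lambda>z. f z + g z) \<le> ?K powr (1 / p)"
      unfolding hardy_norm_hval[of p "\<lambda>z. f z + g z"] using p *(2) by (intro powr_mono2) (auto simp: hval_nonneg)
    also have "\<dots> = ?A + ?B" using p AB by (simp add: powr_powr)
    finally show ?thesis using *(1) by blast
  qed
  then show "(\<lambda>z. f z + g z) \<in> hardy_space p" "hardy_norm p (\<lambda>z. f z + g z) \<le> ?A + ?B" by auto
qed

lemma hardy_diff: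
  assumes "f \<in> hardy_space p" "g \<in> hardy_space p" "p > 1"
  shows "(\<lambda>z. f z - g z) \<in> hardy_space p"
  using hardy_add(1)[OF assms(1) hardy_scale(1)[OF assms(2,3), of "-1"] assms(3)] by simp

text \<open>\<open>Metric_space.mtopology\<close> in \<open>hardy_topology\<close> has its intended
  meaning only under these axioms; definiteness comes from the point evaluation bound.\<close>

lemma Metric_space_hardy:
  assumes p: "p > 1"
  shows "Metric_space (hardy_power p :: ('k::finite \<Rightarrow> complex \<Rightarrow> complex) set) (hardy_dist p)"
proof
  fix f g h :: "'k \<Rightarrow> complex \<Rightarrow> complex"
  show "0 \<le> hardy_dist p f g" unfolding hardy_dist_def by (intro sum_nonneg hardy_norm_nonneg)
  have "hardy_norm p (\<lambda>z. a z - b z) = hardy_norm p (\<lambda>z. b z - a z)" for a b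
    by (simp add: hardy_norm_def hardy_sup_def norm_minus_commute)
  then show "hardy_dist p f g = hardy_dist p g f" unfolding hardy_dist_def by (intro sum.cong refl)
  assume f: "f \<in> hardy_power p" and g: "g \<in> hardy_power p"
  then have fg: "(\<lambda>z. f j z - g j z) \<in> hardy_space p" for j using p by (auto simp: hardy_power_def intro: hardy_diff)
  show "hardy_dist p f g = 0 \<longleftrightarrow> f = g"
  proof
    assume "hardy_dist p f g = 0"
    then have n: "hardy_norm p (\<lambda>z. f j z - g j z) = 0" for j
      unfolding hardy_dist_def by (subst (asm) sum_nonneg_eq_0_iff) (auto simp: hardy_norm_nonneg)
    have z: "(\<lambda>z. f j z - g j z) = (\<lambda>z. 0)" for j
      using n[of j] p by (intro hval_eq_0[OF fg p]) (simp add: hval_hardy_norm)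
    show "f = g"
    proof (intro ext)
      fix j z show "f j z = g j z" using fun_cong[OF z[of j], of z] by simp
    qed
  qed (simp add: hardy_dist_def hardy_norm_0[OF p])
  assume h: "h \<in> hardy_power p"
  then have gh: "(\<lambda>z. g j z - h j z) \<in> hardy_space p" for j using g p by (auto simp: hardy_power_def intro: hardy_diff)
  show "hardy_dist p f h \<le> hardy_dist p f g + hardy_dist p g h"
    unfolding hardy_dist_def sum.distrib[symmetric]
  proof (intro sum_mono)
    fix j
    show "hardy_norm p (\<lambda>z. f j z - h j z) \<le> hardy_norm p (\<lambda>z. f j z - g j z) + hardy_norm p (\<lambda>z. g j z - h j z)"
      using hardy_add(2)[OF fg[of j] gh[of j] p] by simp
  qed
qed

lemma hardy_closed_sequence:
  assumes p: "p > 1" and A: "closedin (hardy_topology p) A" and f: "\<And>n. f n \<in> A" and g: "g \<in> hardy_power p"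
    and lim: "(\<lambda>n. hardy_dist p g (f n)) \<longlonglongrightarrow> 0"
  shows "g \<in> A"
proof (rule ccontr)
  interpret M: Metric_space "hardy_power p :: ('a \<Rightarrow> complex \<Rightarrow> complex) set" "hardy_dist p" by (rule Metric_space_hardy[OF p])
  assume "g \<notin> A"
  have AM: "A \<subseteq> hardy_power p" and o: "openin M.mtopology (hardy_power p - A)"
    using A by (auto simp: hardy_topology_def closedin_def)
  then obtain r where r: "r > 0" "M.mball g r \<subseteq> hardy_power p - A"
    using \<open>g \<notin> A\<close> g unfolding M.openin_mtopology by blast
  have "\<forall>\<^sub>F n in sequentially. hardy_dist p g (f n) < r" using lim r(1) by (rule order_tendstoD(2))
  then obtain n where "hardy_dist p g (f n) < r" by (auto simp: eventually_sequentially)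
  then have "f n \<in> M.mball g r" using g f AM by auto
  then show False using r(2) f by blast
qed

lemma hardy_closed_subset: "p > 1 \<Longrightarrow> closedin (hardy_topology p) A \<Longrightarrow> A \<subseteq> hardy_power p"
  using Metric_space.topspace_mtopology[OF Metric_space_hardy] closedin_subset
  unfolding hardy_topology_def by metis

section \<open>A minimax principle\<close>

text \<open>\<open>cmb t f g\<close> plays the role of (1 - t) f + t g, since tuples of functions
  carry no vector space structure here; the minimax argument uses nothing else about it.\<close>

definition mixing_closed :: "(real \<Rightarrow> 'a \<Rightarrow> 'a \<Rightarrow> 'a) \<Rightarrow> 'a set \<Rightarrow> bool" where
  "mixing_closed cmb A \<longleftrightarrow> (\<forall>f\<in>A. \<forall>g\<in>A. \<forall>t\<in>{0..1}. cmb t f g \<in> A)"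

definition mixing_convex :: "(real \<Rightarrow> 'a \<Rightarrow> 'a \<Rightarrow> 'a) \<Rightarrow> 'a set \<Rightarrow> ('a \<Rightarrow> real) \<Rightarrow> bool" where
  "mixing_convex cmb A F \<longleftrightarrow> (\<forall>f\<in>A. \<forall>g\<in>A. \<forall>t\<in>{0..1}. F (cmb t f g) \<le> (1 - t) * F f + t * F g)"

text \<open>If no f works, the convex set of points above some (F f, G f) is disjoint from the
  quadrant below (c + e, c + e). A separating normal has nonnegative entries because the quadrant is
  unbounded below; normalized, it is a weight t that contradicts the hypothesis.\<close>

lemma minimax_two:
  assumes A: "mixing_closed cmb A" and F: "mixing_convex cmb A F" and G: "mixing_convex cmb A G"
    and h: "\<And>t. 0 \<le> t \<Longrightarrow> t \<le> 1 \<Longrightarrow> \<exists>f\<in>A. (1 - t) * F f + t * G f \<le> c" and e: "e > 0"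
  shows "\<exists>f\<in>A. F f \<le> c + e \<and> G f \<le> c + e"
proof (rule ccontr)
  assume no: "\<not> ?thesis"
  define S where "S = {z :: real \<times> real. \<exists>f\<in>A. F f \<le> fst z \<and> G f \<le> snd z}"
  define T where "T = {z :: real \<times> real. fst z \<le> c + e \<and> snd z \<le> c + e}"
  have cS: "convex S" unfolding convex_alt
  proof (intro ballI allI impI)
    fix x y t assume xy: "x \<in> S" "y \<in> S" and "(0::real) \<le> t \<and> t \<le> 1"
    then have t: "0 \<le> t" "t \<le> 1" by auto
    obtain f g where fg: "f \<in> A" "F f \<le> fst x" "G f \<le> snd x" "g \<in> A" "F g \<le> fst y" "G g \<le> snd y"
      using xy unfolding S_def by blast
    have m: "cmb t f g \<in> A" "F (cmb t f g) \<le> (1 - t) * F f + t * F g" "G (cmb t f g) \<le> (1 - t) * G f + t * G g"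
      using A F G fg t unfolding mixing_closed_def mixing_convex_def by auto
    have "(1 - t) * F f + t * F g \<le> (1 - t) * fst x + t * fst y" "(1 - t) * G f + t * G g \<le> (1 - t) * snd x + t * snd y"
      using fg t by (auto intro!: add_mono mult_left_mono)
    then show "(1 - t) *\<^sub>R x + t *\<^sub>R y \<in> S"
      unfolding S_def using m by (intro CollectI bexI[of _ "cmb t f g"]) auto
  qed
  have cT: "convex T" unfolding convex_alt
  proof (intro ballI allI impI)
    fix x y t assume xy: "x \<in> T" "y \<in> T" and "(0::real) \<le> t \<and> t \<le> 1"
    then have t: "0 \<le> t" "t \<le> 1" by auto
    have "(1 - t) * fst x + t * fst y \<le> (1 - t) * (c + e) + t * (c + e)" "(1 - t) * snd x + t * snd y \<le> (1 - t) * (c + e) + t * (c + e)"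
      using xy t by (auto intro!: add_mono mult_left_mono simp: T_def)
    then show "(1 - t) *\<^sub>R x + t *\<^sub>R y \<in> T" by (simp add: T_def algebra_simps)
  qed
  obtain f0 where "f0 \<in> A" using h[of 0] by auto
  then have "(F f0, G f0) \<in> S" by (auto simp: S_def)
  moreover have c0: "(c + e, c + e) \<in> T" by (simp add: T_def)
  moreover have "T \<inter> S = {}" using no by (force simp: S_def T_def)
  ultimately obtain v b where v: "v \<noteq> 0" "\<And>x. x \<in> T \<Longrightarrow> v \<bullet> x \<le> b" "\<And>x. x \<in> S \<Longrightarrow> v \<bullet> x \<ge> b"
    using separating_hyperplane_sets[OF cT cS] by (metis empty_iff)
  obtain \<alpha> \<beta> where ab: "v = (\<alpha>, \<beta>)" by (cases v)
  have T': "\<alpha> * (c + e - x) + \<beta> * (c + e - y) \<le> b" if "x \<ge> 0" "y \<ge> 0" for x y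
    using v(2)[of "(c + e - x, c + e - y)"] that by (simp add: T_def ab)
  define M where "M = \<alpha> * (c + e) + \<beta> * (c + e)"
  have pos: "\<alpha> \<ge> 0" "\<beta> \<ge> 0"
  proof -
    have "- \<alpha> * x \<le> b - M" if "x \<ge> 0" for x using T'[OF that, of 0] by (simp add: M_def algebra_simps)
    moreover have "- \<beta> * x \<le> b - M" if "x \<ge> 0" for x using T'[of 0 x] that by (simp add: M_def algebra_simps)
    \<comment> \<open>A linear function bounded above on the half-line has nonpositive slope; used
      with slopes -\<alpha> and -\<beta>.\<close>
    moreover have unb: "\<gamma> \<le> 0" if u: "\<And>x. x \<ge> 0 \<Longrightarrow> \<gamma> * x \<le> b - M" for \<gamma> :: real
    proof (rule ccontr)
      assume "\<not> \<gamma> \<le> 0"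
      then have g: "\<gamma> > 0" by simp
      have "\<gamma> * ((\<bar>b - M\<bar> + 1) / \<gamma>) \<le> b - M" using g by (intro u) auto
      then show False using g by simp
    qed
    ultimately show "\<alpha> \<ge> 0" "\<beta> \<ge> 0" using unb[of "- \<alpha>"] unb[of "- \<beta>"] by auto
  qed
  have ne: "\<alpha> + \<beta> > 0" using v(1) pos ab by (auto simp: zero_prod_def add_nonneg_eq_0_iff less_le)
  define t where "t = \<beta> / (\<alpha> + \<beta>)"
  have t: "0 \<le> t" "t \<le> 1" "(\<alpha> + \<beta>) * t = \<beta>" "(\<alpha> + \<beta>) * (1 - t) = \<alpha>"
    using pos ne by (auto simp: t_def field_simps)
  obtain f where f: "f \<in> A" "(1 - t) * F f + t * G f \<le> c" using h[OF t(1,2)] by blast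
  have "b \<le> \<alpha> * F f + \<beta> * G f" using v(3)[of "(F f, G f)"] f(1) by (auto simp: S_def ab)
  also have "\<dots> = (\<alpha> + \<beta>) * (1 - t) * F f + (\<alpha> + \<beta>) * t * G f" using t by simp
  also have "\<dots> = (\<alpha> + \<beta>) * ((1 - t) * F f + t * G f)" by (simp only: distrib_left mult.assoc)
  also have "\<dots> \<le> (\<alpha> + \<beta>) * c" using f(2) ne by (intro mult_left_mono) auto
  also have "\<dots> < (\<alpha> + \<beta>) * (c + e)" using e ne by simp
  also have "\<dots> = M" by (simp add: M_def algebra_simps)
  also have "\<dots> \<le> b" using T'[of 0 0] by (simp add: M_def)
  finally show False by simp
qed

lemma mixing_convex_sum:
  fixes F :: "'i \<Rightarrow> 'a \<Rightarrow> real"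
  assumes F: "\<And>i. i \<in> I \<Longrightarrow> mixing_convex cmb A (F i)" and l: "\<And>i. i \<in> I \<Longrightarrow> l i \<ge> 0"
  shows "mixing_convex cmb A (\<lambda>f. \<Sum>i\<in>I. l i * F i f)"
  unfolding mixing_convex_def
proof (intro ballI)
  fix f g and t :: real assume *: "f \<in> A" "g \<in> A" "t \<in> {0..1}"
  have "(\<Sum>i\<in>I. l i * F i (cmb t f g)) \<le> (\<Sum>i\<in>I. l i * ((1 - t) * F i f + t * F i g))"
    using F l * by (intro sum_mono mult_left_mono) (auto simp: mixing_convex_def)
  also have "\<dots> = (1 - t) * (\<Sum>i\<in>I. l i * F i f) + t * (\<Sum>i\<in>I. l i * F i g)"
    by (simp add: distrib_left sum.distrib sum_distrib_left mult.left_commute)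
  finally show "(\<Sum>i\<in>I. l i * F i (cmb t f g)) \<le> (1 - t) * (\<Sum>i\<in>I. l i * F i f) + t * (\<Sum>i\<in>I. l i * F i g)" .
qed

lemma mixing_sublevel:
  assumes A: "mixing_closed cmb A" and G: "mixing_convex cmb A G"
  shows "mixing_closed cmb {f\<in>A. G f \<le> c}"
  unfolding mixing_closed_def
proof (intro ballI CollectI conjI)
  fix f g and t :: real assume *: "f \<in> {f\<in>A. G f \<le> c}" "g \<in> {f\<in>A. G f \<le> c}" "t \<in> {0..1}"
  then show "cmb t f g \<in> A" using A by (simp add: mixing_closed_def)
  have "G (cmb t f g) \<le> (1 - t) * G f + t * G g" using G * by (simp add: mixing_convex_def)
  also have "\<dots> \<le> (1 - t) * c + t * c" using * by (intro add_mono mult_left_mono) auto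
  finally show "G (cmb t f g) \<le> c" by (simp add: algebra_simps)
qed

lemma mixing_convex_subset: "mixing_convex cmb A F \<Longrightarrow> B \<subseteq> A \<Longrightarrow> mixing_convex cmb B F"
  unfolding mixing_convex_def by blast

text \<open>The last functional is absorbed into the set: on its sublevel set with slack e/2 the
  induction hypothesis applies, and the weighted condition it needs is \<open>minimax_two\<close>
  for the weighted sum of the other functionals against the last one.\<close>

lemma minimax:
  fixes F :: "nat \<Rightarrow> 'a \<Rightarrow> real"
  assumes "mixing_closed cmb A" "\<And>i. i \<le> n \<Longrightarrow> mixing_convex cmb A (F i)"
    and "\<And>l. (\<And>i. i \<le> n \<Longrightarrow> l i \<ge> 0) \<Longrightarrow> (\<Sum>i\<le>n. l i) = 1 \<Longrightarrow> \<exists>f\<in>A. (\<Sum>i\<le>n. l i * F i f) \<le> c" and "e > 0"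
  shows "\<exists>f\<in>A. \<forall>i\<le>n. F i f \<le> c + e"
  using assms
proof (induction n arbitrary: A c e)
  case 0
  have "\<exists>f\<in>A. (\<Sum>i\<le>0. 1 * F i f) \<le> c" by (rule "0.prems"(3)) auto
  then obtain f where "f \<in> A" "F 0 f \<le> c" by auto
  then show ?case using 0 by force
next
  case (Suc n)
  define B where "B = {f\<in>A. F (Suc n) f \<le> c + e / 2}"
  have sub: "B \<subseteq> A" by (auto simp: B_def)
  have "\<exists>f\<in>B. \<forall>i\<le>n. F i f \<le> (c + e / 2) + e / 2"
  proof (rule Suc.IH)
    show "mixing_closed cmb B" unfolding B_def by (intro mixing_sublevel Suc.prems) simp
    show "mixing_convex cmb B (F i)" if "i \<le> n" for i using Suc.prems(2)[of i] that sub mixing_convex_subset by auto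
    fix l :: "nat \<Rightarrow> real" assume l: "\<And>i. i \<le> n \<Longrightarrow> l i \<ge> 0" "(\<Sum>i\<le>n. l i) = 1"
    have "\<exists>f\<in>A. (\<Sum>i\<le>n. l i * F i f) \<le> c + e / 2 \<and> F (Suc n) f \<le> c + e / 2"
    proof (rule minimax_two)
      show "mixing_closed cmb A" by fact
      show "mixing_convex cmb A (\<lambda>f. \<Sum>i\<le>n. l i * F i f)" using Suc.prems(2) l by (intro mixing_convex_sum) auto
      show "mixing_convex cmb A (F (Suc n))" by (intro Suc.prems) simp
      show "e / 2 > 0" using Suc.prems by simp
      fix t :: real assume t: "0 \<le> t" "t \<le> 1"
      \<comment> \<open>A weight t between the sum and the last functional becomes a system of
        weights on all of them.\<close>
      define k where "k i = (if i \<le> n then (1 - t) * l i else t)" for i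
      have "\<exists>f\<in>A. (\<Sum>i\<le>Suc n. k i * F i f) \<le> c"
      proof (rule Suc.prems(3))
        show "k i \<ge> 0" for i using t l by (simp add: k_def)
        show "(\<Sum>i\<le>Suc n. k i) = 1" using l(2) by (simp add: k_def flip: sum_distrib_left)
      qed
      moreover have "(\<Sum>i\<le>Suc n. k i * F i f) = (1 - t) * (\<Sum>i\<le>n. l i * F i f) + t * F (Suc n) f" for f
        by (simp add: k_def sum_distrib_left mult.assoc)
      ultimately show "\<exists>f\<in>A. (1 - t) * (\<Sum>i\<le>n. l i * F i f) + t * F (Suc n) f \<le> c" by simp
    qed
    then show "\<exists>f\<in>B. (\<Sum>i\<le>n. l i * F i f) \<le> c + e / 2" by (auto simp: B_def)
  qed (use Suc.prems in simp)
  then obtain f where f: "f \<in> B" "\<forall>i\<le>n. F i f \<le> c + e" by (auto simp: add.commute)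
  have "F (Suc n) f \<le> c + e" using f(1) Suc.prems(4) by (simp add: B_def)
  then have "\<forall>i\<le>Suc n. F i f \<le> c + e" using f(2) by (metis le_Suc_eq)
  then show ?case using f(1) sub by blast
qed

section \<open>Testing against finitely many points\<close>

abbreviation tuple_mix :: "real \<Rightarrow> ('k \<Rightarrow> complex \<Rightarrow> complex) \<Rightarrow> ('k \<Rightarrow> complex \<Rightarrow> complex) \<Rightarrow> 'k \<Rightarrow> complex \<Rightarrow> complex" where
  "tuple_mix t f g \<equiv> (\<lambda>j z. of_real (1 - t) * f j z + of_real t * g j z)"

lemma mixing_closed_tuples: "convex_tuples A \<longleftrightarrow> mixing_closed tuple_mix A"
  by (simp add: convex_tuples_def mixing_closed_def)

text \<open>The index shift mirrors the poles in \<open>PS_ball_weighted_test\<close>: pole 0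
  accounts for the Hardy norm, pole i + 1 for evaluation at \<open>e i\<close>.\<close>

definition test_fun :: "real \<Rightarrow> (nat \<Rightarrow> 'k \<Rightarrow> complex) \<Rightarrow> nat \<Rightarrow> ('k::finite \<Rightarrow> complex \<Rightarrow> complex) \<Rightarrow> real" where
  "test_fun p e i f = (case i of 0 \<Rightarrow> (\<Sum>j\<in>UNIV. hardy_norm p (f j)) | Suc i \<Rightarrow> (\<Sum>j\<in>UNIV. norm (f j (e i j))))"

lemma test_fun_nonneg: "test_fun p e i f \<ge> 0"
  by (cases i) (auto simp: test_fun_def hardy_norm_nonneg intro!: sum_nonneg)

lemma test_fun_convex:
  assumes p: "p > 1" and A: "A \<subseteq> hardy_power p"
  shows "mixing_convex tuple_mix A (test_fun p e i)"
  unfolding mixing_convex_def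
proof (intro ballI)
  fix f g and t :: real assume *: "f \<in> A" "g \<in> A" "t \<in> {0..1}"
  have H: "f j \<in> hardy_space p" "g j \<in> hardy_space p" for j using * A by (auto simp: hardy_power_def)
  let ?s = "of_real (1 - t) :: complex" and ?t = "of_real t :: complex"
  have nt: "norm ?s = 1 - t" "norm ?t = t" using *(3) by (simp_all add: norm_of_real del: of_real_diff)
  show "test_fun p e i (tuple_mix t f g) \<le> (1 - t) * test_fun p e i f + t * test_fun p e i g"
  proof (cases i)
    case 0
    have "hardy_norm p (\<lambda>z. ?s * f j z + ?t * g j z) \<le> (1 - t) * hardy_norm p (f j) + t * hardy_norm p (g j)" for j
    proof -
      have "hardy_norm p (\<lambda>z. ?s * f j z + ?t * g j z) \<le> hardy_norm p (\<lambda>z. ?s * f j z) + hardy_norm p (\<lambda>z. ?t * g j z)"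
        by (intro hardy_add(2) hardy_scale(1) H p)
      also have "\<dots> \<le> norm ?s * hardy_norm p (f j) + norm ?t * hardy_norm p (g j)"
        by (intro add_mono hardy_scale(2) H p)
      finally show ?thesis unfolding nt .
    qed
    then show ?thesis unfolding 0 test_fun_def nat.case sum_distrib_left sum.distrib[symmetric] by (intro sum_mono)
  next
    case (Suc n)
    have "norm (?s * x + ?t * y) \<le> (1 - t) * norm x + t * norm y" for x y
      using norm_triangle_ineq[of "?s * x" "?t * y"] unfolding norm_mult nt .
    then show ?thesis unfolding Suc test_fun_def nat.case sum_distrib_left sum.distrib[symmetric] by (intro sum_mono)
  qed
qed

lemma PS_ball_weighted_test:
  fixes A :: "('k::finite \<Rightarrow> complex \<Rightarrow> complex) set"
  assumes p: "p > 1" and e: "\<And>i j. norm (e i j) < 1"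
    and H: "\<And>u :: 'k \<Rightarrow> complex \<Rightarrow> ereal. (\<And>j. u j \<in> exhaustions1) \<Longrightarrow> A \<inter> PS_ball u p 1 \<noteq> {}"
    and l: "\<And>i. i \<le> n \<Longrightarrow> l i \<ge> 0" "(\<Sum>i\<le>n. l i) = 1" "l 0 > 0"
  shows "\<exists>f\<in>A. (\<Sum>i\<le>n. l i * test_fun p e i f) \<le> 1"
proof -
  \<comment> \<open>Indices of weight 0 are dropped because the balayage estimate wants positive
    weights; 0 remains since \<open>l 0 > 0\<close>.\<close>
  define I where "I = {i. i \<le> n \<and> l i > 0}"
  \<comment> \<open>Division by \<kappa> gives the combination of Green functions Laplacian mass
    exactly 1.\<close>
  define c where "c i = l i / \<kappa>" for i
  define a where "a j i = (case i of 0 \<Rightarrow> 0 | Suc i \<Rightarrow> e i j)" for j i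
  define u where "u j = mix I c (a j)" for j
  have I: "finite I" "0 \<in> I" using l(3) by (auto simp: I_def)
  have c: "c i > 0" if "i \<in> I" for i using that \<kappa>_pos by (auto simp: I_def c_def)
  have kc: "\<kappa> * c i = l i" for i using \<kappa>_pos by (simp add: c_def)
  have a: "norm (a j i) < 1" for i j using e by (cases i) (auto simp: a_def)
  have sumI: "(\<Sum>i\<le>n. l i * x i) = (\<Sum>i\<in>I. l i * x i)" for x
  proof (rule sum.mono_neutral_right)
    show "\<forall>i\<in>{..n} - I. l i * x i = 0" using l(1) by (force simp: I_def)
  qed (auto simp: I_def)
  have sl: "(\<Sum>i\<in>I. l i) = 1" using sumI[of "\<lambda>_. 1"] l(2) by simp
  have l0: "l i \<ge> 0" if "i \<in> I" for i using that by (simp add: I_def)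
  have u: "u j \<in> exhaustions1" for j
  proof -
    have "u j \<in> exhaustions" unfolding u_def
      using I c a by (intro mix_exhaustion) (auto intro: less_imp_le)
    moreover have "emeasure (laplacian (u j)) unit_disc = (\<Sum>i | i \<in> I \<and> a j i \<in> unit_disc. ennreal (\<kappa> * c i))"
      unfolding u_def using I(1) c a by (intro mix_laplacian) (auto intro: less_imp_le)
    moreover have "{i. i \<in> I \<and> a j i \<in> unit_disc} = I" using a by auto
    moreover have "(\<Sum>i\<in>I. ennreal (\<kappa> * c i)) = ennreal (\<Sum>i\<in>I. l i)"
      unfolding kc using l0 by (rule sum_ennreal)
    ultimately show ?thesis using sl by (simp add: exhaustions1_def)
  qed
  obtain f where f: "f \<in> A" "f \<in> PS_ball u p 1" using H[of u] u by blast
  define x where "x j i = (case i of 0 \<Rightarrow> hardy_norm p (f j) | Suc i \<Rightarrow> norm (f j (e i j)))" for j i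
  have x0: "x j i \<ge> 0" for i j by (cases i) (auto simp: x_def hardy_norm_nonneg)
  have "(\<Sum>i\<in>I. l i * x j i) \<le> PS_norm (u j) p (f j)" for j
  proof -
    have fd: "f j \<in> disc_holomorphic" and fin: "PS_limsup (u j) p (f j) < \<infinity>"
      using f(2) by (auto simp: PS_ball_def PS_space_def)
    define P where "P = enn2real (PS_limsup (u j) p (f j))"
    have P: "PS_limsup (u j) p (f j) = ennreal P" using fin by (simp add: P_def)
    have P0: "P \<ge> 0" by (simp add: P_def)
    define R where "R = (\<Sum>i\<in>I - {0}. l i * x j i powr p)"
    have xa: "norm (f j (a j i)) = x j i" if "i \<noteq> 0" for i
      using that by (cases i) (auto simp: x_def a_def)
    \<comment> \<open>Isolating the pole 0 bounds the circular means uniformly in s, so its positive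
      weight yields a finite Hardy norm of \<open>f j\<close>.\<close>
    have le: "l 0 * cmean p (f j) s \<le> P - R" if "0 < s" "s < 1" for s
    proof -
      have "ennreal (\<kappa> * ((\<Sum>i\<in>I - {0}. c i * norm (f j (a j i)) powr p) + c 0 * cmean p (f j) s)) \<le> ennreal P"
        unfolding P[symmetric] u_def
        using I c a that fd p by (intro PS_limsup_lower_bound) (auto simp: a_def[of j 0])
      then have "\<kappa> * ((\<Sum>i\<in>I - {0}. c i * norm (f j (a j i)) powr p) + c 0 * cmean p (f j) s) \<le> P"
        using P0 by (simp add: ennreal_le_iff)
      also have "\<kappa> * ((\<Sum>i\<in>I - {0}. c i * norm (f j (a j i)) powr p) + c 0 * cmean p (f j) s) =
          (\<Sum>i\<in>I - {0}. (\<kappa> * c i) * norm (f j (a j i)) powr p) + (\<kappa> * c 0) * cmean p (f j) s"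
        by (simp only: distrib_left sum_distrib_left mult.assoc)
      also have "\<dots> = R + l 0 * cmean p (f j) s" unfolding kc R_def using xa by simp
      finally show ?thesis by simp
    qed
    have "cmean p (f j) s \<le> (P - R) / l 0" if "0 < s" "s < 1" for s
      using le[OF that] l(3) by (simp add: field_simps)
    then have "hval p (f j) \<le> (P - R) / l 0" by (intro hardy_space_I(2) fd p) auto
    then have "l 0 * hval p (f j) + R \<le> P" using l(3) by (simp add: field_simps)
    moreover have "hval p (f j) = x j 0 powr p" using p by (simp add: x_def hval_hardy_norm)
    ultimately have S: "(\<Sum>i\<in>I. l i * x j i powr p) \<le> P"
      using I by (simp add: R_def sum.remove)
    \<comment> \<open>Jensen's inequality passes from p-th powers to an expression linear in the
      functionals, which can be summed over j and fed into the minimax argument.\<close>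
    have "(\<Sum>i\<in>I. l i * x j i) powr p \<le> P"
      using powr_sum_jensen[OF p I(1) l0 sl, of "x j"] x0 S by simp
    then have "((\<Sum>i\<in>I. l i * x j i) powr p) powr (1 / p) \<le> P powr (1 / p)" using p by (intro powr_mono2) auto
    moreover have "(\<Sum>i\<in>I. l i * x j i) \<ge> 0" using l0 x0 by (intro sum_nonneg mult_nonneg_nonneg) auto
    ultimately show ?thesis using p by (simp add: powr_powr PS_norm_def P_def)
  qed
  then have "(\<Sum>j\<in>UNIV. \<Sum>i\<in>I. l i * x j i) \<le> (\<Sum>j\<in>UNIV. PS_norm (u j) p (f j))" by (intro sum_mono)
  also have "\<dots> \<le> 1" using f(2) by (simp add: PS_ball_def)
  also have "(\<Sum>j\<in>UNIV. \<Sum>i\<in>I. l i * x j i) = (\<Sum>i\<in>I. l i * (\<Sum>j\<in>UNIV. x j i))"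
    by (subst sum.swap) (simp add: sum_distrib_left)
  also have "\<dots> = (\<Sum>i\<in>I. l i * test_fun p e i f)"
    by (intro sum.cong arg_cong2[where f = "(*)"] refl) (auto simp: x_def test_fun_def split: nat.splits)
  finally show ?thesis using f(1) sumI by auto
qed

lemma PS_ball_test:
  fixes A :: "('k::finite \<Rightarrow> complex \<Rightarrow> complex) set"
  assumes p: "p > 1" and A: "A \<subseteq> hardy_power p" "convex_tuples A" and e: "\<And>i j. norm (e i j) < 1"
    and H: "\<And>u :: 'k \<Rightarrow> complex \<Rightarrow> ereal. (\<And>j. u j \<in> exhaustions1) \<Longrightarrow> A \<inter> PS_ball u p 1 \<noteq> {}"
    and \<eta>: "\<eta> > 0"
  shows "\<exists>f\<in>A. \<forall>i\<le>n. test_fun p e i f \<le> 1 + \<eta>"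
proof -
  \<comment> \<open>Solves 1 / (1 - d) = 1 + \<eta>/2. One half of \<eta> pays for shifting the
    weight d to the pole 0, the other half is the slack in \<open>minimax\<close>.\<close>
  define d where "d = (\<eta> / 2) / (1 + \<eta> / 2)"
  have d: "0 < d" "d < 1" "1 / (1 - d) = 1 + \<eta> / 2" using \<eta> by (auto simp: d_def field_simps)
  have "\<exists>f\<in>A. \<forall>i\<le>n. test_fun p e i f \<le> (1 + \<eta> / 2) + \<eta> / 2"
  proof (rule minimax)
    show "mixing_closed tuple_mix A" using A(2) by (simp add: mixing_closed_tuples)
    show "mixing_convex tuple_mix A (test_fun p e i)" for i by (rule test_fun_convex[OF p A(1)])
    show "\<eta> / 2 > 0" using \<eta> by simp
    fix l :: "nat \<Rightarrow> real" assume l: "\<And>i. i \<le> n \<Longrightarrow> l i \<ge> 0" "(\<Sum>i\<le>n. l i) = 1"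
    define k where "k i = (1 - d) * l i + d * (if i = 0 then 1 else 0)" for i
    have sk: "(\<Sum>i\<le>n. k i * x i) = (1 - d) * (\<Sum>i\<le>n. l i * x i) + d * x 0" for x
    proof -
      have "(\<Sum>i\<le>n. k i * x i) = (\<Sum>i\<le>n. (1 - d) * (l i * x i)) + (\<Sum>i\<le>n. if i = 0 then d * x i else 0)"
        unfolding sum.distrib[symmetric] by (intro sum.cong) (auto simp: k_def algebra_simps)
      then show ?thesis by (simp add: sum_distrib_left)
    qed
    have "\<exists>f\<in>A. (\<Sum>i\<le>n. k i * test_fun p e i f) \<le> 1"
    proof (rule PS_ball_weighted_test[OF p e H])
      show "k i \<ge> 0" if "i \<le> n" for i using l(1)[OF that] d by (simp add: k_def)
      show "(\<Sum>i\<le>n. k i) = 1" using sk[of "\<lambda>_. 1"] l(2) by simp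
      show "k 0 > 0" using d l(1)[of 0] by (simp add: k_def add_nonneg_pos)
    qed
    then obtain f where f: "f \<in> A" "(\<Sum>i\<le>n. k i * test_fun p e i f) \<le> 1" by blast
    have "(1 - d) * (\<Sum>i\<le>n. l i * test_fun p e i f) \<le> 1"
      using f(2) d test_fun_nonneg[of p e 0 f] mult_nonneg_nonneg[of d "test_fun p e 0 f"] unfolding sk by linarith
    then have "(\<Sum>i\<le>n. l i * test_fun p e i f) \<le> 1 / (1 - d)" using d by (simp add: field_simps)
    then show "\<exists>f\<in>A. (\<Sum>i\<le>n. l i * test_fun p e i f) \<le> 1 + \<eta> / 2" using f(1) d(3) by auto
  qed
  then show ?thesis by (simp add: add.commute)
qed

section \<open>Passage to the limit\<close>

text \<open>The point evaluation bound makes a norm-Cauchy sequence locally uniformly Cauchy, so the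
  limit is holomorphic; norm estimates pass to it circle by circle through dominated convergence.
  Off the disc all functions are 0, so pointwise convergence holds on the whole plane.\<close>

lemma hardy_complete:
  fixes h :: "nat \<Rightarrow> complex \<Rightarrow> complex"
  assumes h: "\<And>n. h n \<in> hardy_space p" and p: "p > 1"
    and cauchy: "\<And>\<eta>. \<eta> > 0 \<Longrightarrow> \<exists>N. \<forall>n\<ge>N. \<forall>m\<ge>n. hval p (\<lambda>z. h n z - h m z) \<le> \<eta>"
  obtains g where "g \<in> hardy_space p" "\<And>z. (\<lambda>n. h n z) \<longlonglongrightarrow> g z" "(\<lambda>n. hval p (\<lambda>z. g z - h n z)) \<longlonglongrightarrow> 0"
proof -
  have hd: "h n \<in> disc_holomorphic" for n using h by (rule hardy_space_disc)
  have hd2: "(\<lambda>z. h n z - h m z) \<in> hardy_space p" for n m using h p by (intro hardy_diff)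
  have unif: "uniformly_Cauchy_on (cball 0 r) h" if r: "0 \<le> r" "r < 1" for r
    unfolding uniformly_Cauchy_on_def
  proof (intro allI impI)
    fix e :: real assume e: "e > 0"
    define s where "s = (1 + r) / 2"
    have s: "r < s" "s < 1" using r by (auto simp: s_def)
    define q where "q = s / (s - r)"
    have q: "q > 0" using s r by (simp add: q_def)
    \<comment> \<open>Chosen so that the point evaluation constant \<open>q powr p\<close> times
      \<eta> is (e/2)^p, which is below e^p.\<close>
    define \<eta> where "\<eta> = (e / 2) powr p / q powr p"
    have "\<eta> > 0" using e q by (simp add: \<eta>_def)
    then obtain N where N: "\<And>n m. n \<ge> N \<Longrightarrow> m \<ge> n \<Longrightarrow> hval p (\<lambda>z. h n z - h m z) \<le> \<eta>" using cauchy by blast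
    have lt: "dist (h n z) (h m z) < e" if "N \<le> n" "n \<le> m" "z \<in> cball 0 r" for n m and z :: complex
    proof -
      have z: "norm z \<le> r" using that by simp
      have "norm (h n z - h m z) powr p \<le> (s / (s - norm z)) powr p * hval p (\<lambda>z. h n z - h m z)"
        using z s by (intro hardy_point_bound hd2 p) auto
      also have "\<dots> \<le> q powr p * \<eta>"
        using z s r p N that unfolding q_def
        by (intro mult_mono powr_mono2 divide_left_mono) (auto simp: hval_nonneg)
      also have "\<dots> = (e / 2) powr p" using q by (simp add: \<eta>_def)
      also have "\<dots> < e powr p" using e p by (intro powr_less_mono2) auto
      finally have "norm (h n z - h m z) < e"
        using powr_mono2[of p e "norm (h n z - h m z)"] e p by (cases "norm (h n z - h m z) < e") auto
      then show ?thesis by (simp add: dist_norm)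
    qed
    show "\<exists>M. \<forall>x\<in>cball 0 r. \<forall>m\<ge>M. \<forall>n\<ge>M. dist (h m x) (h n x) < e"
    proof (intro exI[of _ N] ballI allI impI)
      fix z :: complex and n m assume "z \<in> cball 0 r" "N \<le> n" "N \<le> m"
      then show "dist (h n z) (h m z) < e"
        using lt[of n m z] lt[of m n z] by (cases "n \<le> m") (auto simp: dist_commute)
    qed
  qed
  define g where "g z = lim (\<lambda>n. h n z)" for z
  have ul: "uniform_limit (cball 0 r) h g sequentially" if r: "0 \<le> r" "r < 1" for r
  proof -
    have "uniformly_convergent_on (cball 0 r) h"
      by (rule Cauchy_uniformly_convergent[OF unif[OF r]])
    then show ?thesis unfolding uniformly_convergent_uniform_limit_iff g_def .
  qed
  have off: "h n z = 0" if "\<not> norm z < 1" for n and z :: complex using hd[of n] that by (simp add: disc_holomorphic_def)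
  have pw: "(\<lambda>n. h n z) \<longlonglongrightarrow> g z" for z
  proof (cases "norm z < 1")
    case True
    then show ?thesis using tendsto_uniform_limitI[OF ul[of "norm z"], of z] by simp
  qed (simp add: off g_def)
  have "g holomorphic_on unit_disc"
  proof (rule holomorphic_uniform_sequence)
    show "h n holomorphic_on unit_disc" for n using hd[of n] by (simp add: disc_holomorphic_def)
    fix x :: complex assume "x \<in> unit_disc"
    then have x: "norm x < 1" by simp
    define d where "d = (1 - norm x) / 2"
    have d: "0 < d" "norm x + d < 1" using x by (auto simp: d_def field_simps)
    have sub: "cball x d \<subseteq> cball 0 (norm x + d)"
    proof
      fix y assume "y \<in> cball x d"
      then show "y \<in> cball 0 (norm x + d)" using norm_triangle_ineq2[of y x] by (simp add: dist_norm norm_minus_commute)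
    qed
    have "uniform_limit (cball x d) h g sequentially"
      using uniform_limit_on_subset[OF ul[of "norm x + d"] sub] d by simp
    moreover have "cball x d \<subseteq> unit_disc" using sub d by (force simp: subset_iff)
    ultimately show "\<exists>d>0. cball x d \<subseteq> unit_disc \<and> uniform_limit (cball x d) h g sequentially" using d(1) by blast
  qed simp
  then have gd: "g \<in> disc_holomorphic" by (simp add: disc_holomorphic_def g_def off)
  have conv: "(\<lambda>z. g z - h n z) \<in> hardy_space p \<and> hval p (\<lambda>z. g z - h n z) \<le> \<eta>"
    if N: "\<forall>n\<ge>N. \<forall>m\<ge>n. hval p (\<lambda>z. h n z - h m z) \<le> \<eta>" "n \<ge> N" for n N \<eta>
  proof -
    have D: "(\<lambda>z. g z - h n z) \<in> disc_holomorphic" by (intro disc_holomorphic_diff gd hd)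
    have "cmean p (\<lambda>z. g z - h n z) s \<le> \<eta>" if s: "0 < s" "s < 1" for s
    proof -
      define k where "k = (1 + s) / 2"
      have k: "s < k" "k < 1" using s by (auto simp: k_def)
      have m: "norm (h n z - h m z) powr p \<le> (k / (k - norm z)) powr p * hval p (\<lambda>z. h n z - h m z)" if "norm z = s" for m and z :: complex
        using that k by (intro hardy_point_bound hd2 p) auto
      have meas: "(\<lambda>w. norm (F (of_real s * w)) powr p) \<in> borel_measurable circle_measure" if "F \<in> disc_holomorphic" for F
        using cmean_integrable[OF that, of s p] s p by (intro borel_measurable_integrable) auto
      \<comment> \<open>The index m + n keeps the second term at or beyond n, where the Cauchy
        estimate applies.\<close>
      have "(\<lambda>m. cmean p (\<lambda>z. h n z - h (m + n) z) s) \<longlonglongrightarrow> cmean p (\<lambda>z. h n z - g z) s"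
        unfolding cmean_def
      proof (rule integral_dominated_convergence[where w = "\<lambda>_. (k / (k - s)) powr p * \<eta>"])
        show "(\<lambda>w. norm (h n (of_real s * w) - g (of_real s * w)) powr p) \<in> borel_measurable circle_measure"
          by (rule meas[OF disc_holomorphic_diff[OF hd gd]])
        show "(\<lambda>w. norm (h n (of_real s * w) - h (m + n) (of_real s * w)) powr p) \<in> borel_measurable circle_measure" for m
          by (rule meas[OF disc_holomorphic_diff[OF hd hd]])
        show "AE w in circle_measure. (\<lambda>m. norm (h n (of_real s * w) - h (m + n) (of_real s * w)) powr p)
            \<longlonglongrightarrow> norm (h n (of_real s * w) - g (of_real s * w)) powr p"
          using p by (intro AE_I2 tendsto_powr' tendsto_norm tendsto_diff tendsto_const LIMSEQ_ignore_initial_segment[OF pw]) auto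
        show "AE w in circle_measure. norm (norm (h n (of_real s * w) - h (m + n) (of_real s * w)) powr p) \<le> (k / (k - s)) powr p * \<eta>" for m
        proof (rule AE_circleI)
          fix w :: complex assume "norm w = 1"
          then have "norm (of_real s * w) = s" using s by (simp add: norm_mult)
          then have "norm (h n (of_real s * w) - h (m + n) (of_real s * w)) powr p \<le> (k / (k - s)) powr p * hval p (\<lambda>z. h n z - h (m + n) z)"
            using m[of "of_real s * w" "m + n"] by simp
          also have "\<dots> \<le> (k / (k - s)) powr p * \<eta>" using N by (intro mult_left_mono) auto
          finally show "norm (norm (h n (of_real s * w) - h (m + n) (of_real s * w)) powr p) \<le> (k / (k - s)) powr p * \<eta>" by simp
        qed
      qed simp
      moreover have "cmean p (\<lambda>z. h n z - h (m + n) z) s \<le> \<eta>" for m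
      proof -
        have "cmean p (\<lambda>z. h n z - h (m + n) z) s \<le> hval p (\<lambda>z. h n z - h (m + n) z)"
          using s by (intro cmean_le_hval hd2 p) auto
        also have "\<dots> \<le> \<eta>" using N by simp
        finally show ?thesis .
      qed
      ultimately have "cmean p (\<lambda>z. h n z - g z) s \<le> \<eta>" by (intro LIMSEQ_le_const2) auto
      then show ?thesis by (simp add: cmean_def norm_minus_commute)
    qed
    from hardy_space_I[OF D p this] show ?thesis by blast
  qed
  show thesis
  proof (rule that)
    obtain N where "\<forall>n\<ge>N. \<forall>m\<ge>n. hval p (\<lambda>z. h n z - h m z) \<le> 1" using cauchy[of 1] by auto
    then have "(\<lambda>z. g z - h N z) \<in> hardy_space p" using conv by blast
    from hardy_add(1)[OF this h[of N] p] show "g \<in> hardy_space p" by simp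
    show "(\<lambda>n. h n z) \<longlonglongrightarrow> g z" for z by (rule pw)
    show "(\<lambda>n. hval p (\<lambda>z. g z - h n z)) \<longlonglongrightarrow> 0"
    proof (rule LIMSEQ_I)
      fix r :: real assume "r > 0"
      then obtain N where "\<forall>n\<ge>N. \<forall>m\<ge>n. hval p (\<lambda>z. h n z - h m z) \<le> r / 2" using cauchy[of "r / 2"] by auto
      then have "\<forall>n\<ge>N. hval p (\<lambda>z. g z - h n z) \<le> r / 2" using conv by blast
      then show "\<exists>N. \<forall>n\<ge>N. norm (hval p (\<lambda>z. g z - h n z) - 0) < r"
        using \<open>r > 0\<close> by (intro exI[of _ N]) (auto simp: hval_nonneg intro: le_less_trans)
    qed
  qed
qed

text \<open>A nearly norm-minimizing sequence in a decreasing sequence of convex sets converges by uniform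
  convexity, so no weak compactness is needed.\<close>

lemma nested_mixing_limit:
  fixes C :: "nat \<Rightarrow> ('k::finite \<Rightarrow> complex \<Rightarrow> complex) set"
  assumes p: "p > 1" and sub: "\<And>n. C n \<subseteq> hardy_power p" and ne: "\<And>n. C n \<noteq> {}" and dec: "decseq C"
    and mix: "\<And>n. mixing_closed tuple_mix (C n)" and bd: "\<And>f j. f \<in> C 0 \<Longrightarrow> hval p (f j) \<le> K"
  obtains f g where "\<And>n. f n \<in> C n" "g \<in> hardy_power p" "\<And>j z. (\<lambda>n. f n j z) \<longlonglongrightarrow> g j z"
    "(\<lambda>n. hardy_dist p g (f n)) \<longlonglongrightarrow> 0"
proof -
  \<comment> \<open>Sums of p-th powers rather than of norms are minimized, because the uniform
    convexity inequality is additive in them.\<close>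
  define \<Phi> where "\<Phi> f = (\<Sum>j\<in>UNIV. hval p (f j))" for f :: "'k \<Rightarrow> complex \<Rightarrow> complex"
  define L where "L = real CARD('k) * K"
  have mono: "C m \<subseteq> C n" if "n \<le> m" for n m using decseqD[OF dec that] .
  have \<Phi>0: "\<Phi> f \<ge> 0" for f by (simp add: \<Phi>_def hval_nonneg sum_nonneg)
  have \<Phi>L: "\<Phi> f \<le> L" if "f \<in> C n" for f n
  proof -
    have "f \<in> C 0" using that mono[of 0 n] by auto
    then have "\<Phi> f \<le> (\<Sum>j\<in>(UNIV::'k set). K)" unfolding \<Phi>_def by (intro sum_mono bd)
    then show ?thesis by (simp add: L_def)
  qed
  have L0: "L \<ge> 0" using ne[of 0] \<Phi>L[of _ 0] \<Phi>0 by (metis all_not_in_conv order_trans)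
  \<comment> \<open>Infima over shrinking sets increase and stay bounded, so they converge; this
    stands in for minimizing over the intersection, which is not yet known to be nonempty.\<close>
  define d where "d n = Inf (\<Phi> ` C n)" for n
  have bb: "bdd_below (\<Phi> ` C n)" for n using \<Phi>0 by (intro bdd_belowI[of _ 0]) auto
  have dle: "d n \<le> \<Phi> f" if "f \<in> C n" for f n unfolding d_def using that bb by (intro cInf_lower) auto
  have "incseq d" unfolding incseq_def d_def
    using ne bb by (intro allI impI cInf_superset_mono image_mono mono) auto
  moreover have "d n \<le> L" for n using ne[of n] dle \<Phi>L by (meson all_not_in_conv order_trans)
  ultimately obtain D where D: "d \<longlonglongrightarrow> D" "\<And>n. d n \<le> D" using incseq_convergent by metis
  have "\<exists>f\<in>C n. \<Phi> f < d n + 1 / real (Suc n)" for n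
  proof -
    have "Inf (\<Phi> ` C n) < d n + 1 / real (Suc n)" by (simp add: d_def)
    then show ?thesis using cInf_lessD[of "\<Phi> ` C n"] ne by blast
  qed
  then obtain f where f: "\<And>n. f n \<in> C n" "\<And>n. \<Phi> (f n) < d n + 1 / real (Suc n)" by metis
  have fH: "f n j \<in> hardy_space p" for n j using f(1)[of n] sub[of n] by (auto simp: hardy_power_def)
  have lim0: "(\<lambda>n. (D - d n) / 2 + 1 / real (Suc n)) \<longlonglongrightarrow> 0"
  proof -
    have "(\<lambda>n. (D - d n) / 2 + 1 / real (Suc n)) \<longlonglongrightarrow> (D - D) / 2 + 0"
      by (intro tendsto_add tendsto_divide tendsto_diff tendsto_const D lim_1_over_n[THEN LIMSEQ_Suc]) auto
    then show ?thesis by simp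
  qed
  have cauchy: "\<exists>N. \<forall>n\<ge>N. \<forall>m\<ge>n. \<forall>j. hval p (\<lambda>z. f n j z - f m j z) \<le> \<eta>" if \<eta>: "\<eta> > 0" for \<eta>
  proof -
    \<comment> \<open>The denominator is positive even for L = 0, and makes the first term of the
      convexity estimate at most \<eta>/2.\<close>
    define e where "e = \<eta> / (4 * L + 4)"
    have e: "e > 0" "e * (2 * L) \<le> \<eta> / 2" using \<eta> L0 by (auto simp: e_def field_simps)
    obtain B where B: "B > 0" and uc: "\<And>a b :: complex. norm (a - b) powr p \<le> 
      e * (norm a powr p + norm b powr p) + B * ((norm a powr p + norm b powr p) / 2 - norm ((a + b) / 2) powr p)"
      using uniform_convexity[OF p e(1)] by metis
    \<comment> \<open>This makes the midpoint defect, after multiplication by \<open>B\<close>, the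
      other half of \<eta>.\<close>
    have "\<forall>\<^sub>F n in sequentially. (D - d n) / 2 + 1 / real (Suc n) < \<eta> / (2 * B)"
      using lim0 \<eta> B by (intro order_tendstoD(2)) auto
    then obtain N where N: "\<And>n. n \<ge> N \<Longrightarrow> (D - d n) / 2 + 1 / real (Suc n) < \<eta> / (2 * B)"
      unfolding eventually_sequentially by blast
    show ?thesis
    proof (intro exI[of _ N] allI impI)
      fix n m j assume nm: "N \<le> n" "n \<le> m"
      have fC: "f n \<in> C n" "f m \<in> C n" using f(1) mono[OF nm(2)] by auto
      \<comment> \<open>The midpoint stays in the convex set \<open>C n\<close>, so \<Phi> is at
        least \<open>d n\<close> there, while the two ends exceed \<open>d n\<close> and
        \<open>d m\<close> by at most 1/(n + 1). As \<open>d m\<close> is at most \<open>D\<close>,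
        the defect is at most (D - d n)/2 + 1/(n + 1).\<close>
      define M where "M = (\<lambda>j z. (f n j z + f m j z) / 2)"
      have "(1/2::real) \<in> {0..1}" by simp
      then have "tuple_mix (1/2) (f n) (f m) \<in> C n" using mix[of n] fC unfolding mixing_closed_def by blast
      moreover have "tuple_mix (1/2) (f n) (f m) = M" by (simp add: M_def fun_eq_iff add_divide_distrib)
      ultimately have MC: "M \<in> C n" by simp
      then have MH: "M i \<in> hardy_space p" for i using sub[of n] by (auto simp: hardy_power_def)
      have "hval p (\<lambda>z. f n j z - f m j z) \<le> (\<Sum>i\<in>UNIV. hval p (\<lambda>z. f n i z - f m i z))"
        by (rule member_le_sum) (auto simp: hval_nonneg)
      also have "\<dots> \<le> (\<Sum>i\<in>UNIV. e * (hval p (f n i) + hval p (f m i)) + B * ((hval p (f n i) + hval p (f m i)) / 2 - hval p (M i)))"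
        using hardy_uniform_convexity(2)[OF fH fH p less_imp_le[OF e(1)] less_imp_le[OF B] _ uc] MH
        unfolding M_def by (intro sum_mono) auto
      also have "\<dots> = e * (\<Phi> (f n) + \<Phi> (f m)) + B * ((\<Phi> (f n) + \<Phi> (f m)) / 2 - \<Phi> M)"
        by (simp add: \<Phi>_def sum.distrib sum_subtractf flip: sum_distrib_left sum_divide_distrib)
      also have "\<dots> \<le> e * (2 * L) + B * (\<eta> / (2 * B))"
      proof (intro add_mono mult_left_mono)
        show "\<Phi> (f n) + \<Phi> (f m) \<le> 2 * L" using \<Phi>L[OF fC(1)] \<Phi>L[OF fC(2)] by simp
        have "1 / real (Suc m) \<le> 1 / real (Suc n)" using nm by (intro divide_left_mono) auto
        then show "(\<Phi> (f n) + \<Phi> (f m)) / 2 - \<Phi> M \<le> \<eta> / (2 * B)"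
          using f(2)[of n] f(2)[of m] D(2)[of m] dle[OF MC] N[OF nm(1)] by argo
      qed (use e B in auto)
      also have "\<dots> \<le> \<eta>" using e(2) B by simp
      finally show "hval p (\<lambda>z. f n j z - f m j z) \<le> \<eta>" .
    qed
  qed
  have "\<exists>g. g \<in> hardy_space p \<and> (\<forall>z. (\<lambda>n. f n j z) \<longlonglongrightarrow> g z) \<and> (\<lambda>n. hval p (\<lambda>z. g z - f n j z)) \<longlonglongrightarrow> 0" for j
  proof -
    have c: "\<exists>N. \<forall>n\<ge>N. \<forall>m\<ge>n. hval p (\<lambda>z. f n j z - f m j z) \<le> \<eta>" if "\<eta> > 0" for \<eta>
      using cauchy[OF that] by blast
    obtain g where "g \<in> hardy_space p" "\<And>z. (\<lambda>n. f n j z) \<longlonglongrightarrow> g z" "(\<lambda>n. hval p (\<lambda>z. g z - f n j z)) \<longlonglongrightarrow> 0"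
      using hardy_complete[of "\<lambda>n. f n j", OF fH p c] by blast
    then show ?thesis by blast
  qed
  then obtain g where g: "\<And>j. g j \<in> hardy_space p" "\<And>j z. (\<lambda>n. f n j z) \<longlonglongrightarrow> g j z"
    "\<And>j. (\<lambda>n. hval p (\<lambda>z. g j z - f n j z)) \<longlonglongrightarrow> 0" by metis
  have "(\<lambda>n. hardy_dist p g (f n)) \<longlonglongrightarrow> (\<Sum>j\<in>(UNIV::'k set). 0 powr (1 / p))"
    unfolding hardy_dist_def hardy_norm_hval
    using p by (intro tendsto_sum tendsto_powr' g(3) tendsto_const) (auto simp: hval_nonneg)
  then show thesis using that[OF f(1) _ g(2)] g(1) by (simp add: hardy_power_def)
qed

text \<open>Each summand depends on its own variable, so the supremum of the sum over the polydisc
  is the sum of the suprema: pick a near-maximizer for every j, with error e divided by the number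
  of components.\<close>

lemma Hinf_ball_I:
  fixes g :: "'k::finite \<Rightarrow> complex \<Rightarrow> complex"
  assumes g: "\<And>j. g j \<in> disc_holomorphic" and le: "\<And>a. (\<And>j. norm (a j) < 1) \<Longrightarrow> (\<Sum>j\<in>UNIV. norm (g j (a j))) \<le> R"
  shows "g \<in> Hinf_ball R"
proof -
  have one: "norm (g j z) \<le> R" if "norm z < 1" for j z
  proof -
    have "norm (g j ((\<lambda>_. z) j)) \<le> (\<Sum>i\<in>UNIV. norm (g i ((\<lambda>_. z) i)))"
      by (rule member_le_sum) auto
    then show ?thesis using le[of "\<lambda>_. z"] that by simp
  qed
  have b: "bdd_above ((\<lambda>z. norm (g j z)) ` unit_disc)" for j
    using one by (intro bdd_aboveI[of _ R]) auto
  have "bounded (g j ` unit_disc)" for j using one by (intro boundedI[of _ R]) auto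
  moreover have "(\<Sum>j\<in>UNIV. Hinf_norm (g j)) \<le> R"
  proof (rule field_le_epsilon)
    fix e :: real assume e: "e > 0"
    define \<epsilon> where "\<epsilon> = e / real CARD('k)"
    have \<epsilon>: "\<epsilon> > 0" using e by (simp add: \<epsilon>_def)
    have "\<exists>z\<in>unit_disc. Hinf_norm (g j) - \<epsilon> < norm (g j z)" for j
      using less_cSUP_iff[of unit_disc "\<lambda>z. norm (g j z)" "Hinf_norm (g j) - \<epsilon>"] b[of j] \<epsilon> by (simp add: Hinf_norm_def)
    then obtain a where a: "\<And>j. a j \<in> unit_disc" "\<And>j. Hinf_norm (g j) - \<epsilon> < norm (g j (a j))" by metis
    have "(\<Sum>j\<in>UNIV. Hinf_norm (g j)) \<le> (\<Sum>j\<in>UNIV. norm (g j (a j)) + \<epsilon>)"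
      using a(2) by (intro sum_mono) (simp add: algebra_simps less_imp_le)
    also have "\<dots> = (\<Sum>j\<in>UNIV. norm (g j (a j))) + e" by (simp add: sum.distrib \<epsilon>_def)
    also have "\<dots> \<le> R + e" using a(1) le[of a] by simp
    finally show "(\<Sum>j\<in>UNIV. Hinf_norm (g j)) \<le> R + e" .
  qed
  ultimately show ?thesis using g by (simp add: Hinf_ball_def Hinf_space_def)
qed

text \<open>The polydisc is viewed in \<open>complex ^ 'k\<close>, whose topology provides a
  countable dense subset. A strict violation of the bound would hold on an open set, hence at some
  point of the sequence.\<close>

lemma dense_polydisc_sequence:
  obtains e :: "nat \<Rightarrow> 'k::finite \<Rightarrow> complex" where "\<forall>i j. norm (e i j) < 1"
    "\<forall>g a R. (\<forall>j. g j holomorphic_on unit_disc) \<longrightarrow> (\<forall>i. (\<Sum>j\<in>UNIV. norm (g j (e i j))) \<le> R) \<longrightarrow>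
      (\<forall>j. norm (a j) < 1) \<longrightarrow> (\<Sum>j\<in>UNIV. norm (g j (a j))) \<le> R"
proof -
  define P where "P = {x :: complex ^ 'k. \<forall>j. norm (x $ j) < 1}"
  obtain T where T: "countable T" "T \<subseteq> P" "P \<subseteq> closure T" by (rule separable)
  have oP: "open P" unfolding P_def
    unfolding Collect_all_eq by (intro open_INT finite ballI open_Collect_less continuous_intros)
  have "0 \<in> P" by (simp add: P_def)
  then have "T \<noteq> {}" using T by auto
  define e where "e i j = from_nat_into T i $ j" for i j
  show thesis
  proof (rule that[of e]; (intro allI impI)?)
    show "norm (e i j) < 1" for i j
      using from_nat_into[OF \<open>T \<noteq> {}\<close>, of i] T(2) by (auto simp: e_def P_def)
    fix g :: "'k \<Rightarrow> complex \<Rightarrow> complex" and a :: "'k \<Rightarrow> complex" and R :: real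
    assume g: "\<forall>j. g j holomorphic_on unit_disc" and le: "\<forall>i. (\<Sum>j\<in>UNIV. norm (g j (e i j))) \<le> R"
      and a: "\<forall>j. norm (a j) < 1"
    define h where "h x = (\<Sum>j\<in>UNIV. norm (g j (x $ j)))" for x :: "complex ^ 'k"
    have "continuous_on P h" unfolding h_def[abs_def]
    proof (intro continuous_on_sum continuous_on_norm)
      fix j
      show "continuous_on P (\<lambda>x. g j (x $ j))"
        by (rule continuous_on_compose2[OF holomorphic_on_imp_continuous_on[OF spec[OF g]]])
           (auto intro!: continuous_intros simp: P_def)
    qed
    then have oU: "open (h -` {R<..} \<inter> P)"
      unfolding continuous_on_open_vimage[OF oP] by simp
    have hT: "h x \<le> R" if "x \<in> T" for x
      using spec[OF le, of "to_nat_on T x"] from_nat_into_to_nat_on[OF T(1) that] by (simp add: e_def h_def)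
    have "(h -` {R<..} \<inter> P) \<inter> T = {}"
    proof (rule equals0I)
      fix x assume "x \<in> (h -` {R<..} \<inter> P) \<inter> T"
      then have "R < h x" "x \<in> T" by auto
      then show False using hT[of x] by linarith
    qed
    then have "(h -` {R<..} \<inter> P) \<inter> closure T = {}" by (simp only: open_Int_closure_eq_empty[OF oU])
    moreover have "(vec_lambda a :: complex ^ 'k) \<in> P" using a by (simp add: P_def)
    ultimately have "\<not> h (vec_lambda a) > R" using T(3) by auto
    then show "(\<Sum>j\<in>UNIV. norm (g j (a j))) \<le> R" by (simp add: h_def)
  qed
qed

lemma PS_ball_imp_Hinf_ball:
  fixes A :: "('k::finite \<Rightarrow> complex \<Rightarrow> complex) set"
  assumes p: "p > 1" and cl: "closedin (hardy_topology p) A" and cx: "convex_tuples A"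
    and H: "\<And>u :: 'k \<Rightarrow> complex \<Rightarrow> ereal. (\<And>j. u j \<in> exhaustions1) \<Longrightarrow> A \<inter> PS_ball u p 1 \<noteq> {}"
  shows "A \<inter> Hinf_ball 1 \<noteq> {}"
proof -
  have sub: "A \<subseteq> hardy_power p" by (rule hardy_closed_subset[OF p cl])
  obtain e :: "nat \<Rightarrow> 'k \<Rightarrow> complex" where e': "\<forall>i j. norm (e i j) < 1" and dense:
    "\<forall>g a R. (\<forall>j. g j holomorphic_on unit_disc) \<longrightarrow> (\<forall>i. (\<Sum>j\<in>UNIV. norm (g j (e i j))) \<le> R) \<longrightarrow>
      (\<forall>j. norm (a j) < 1) \<longrightarrow> (\<Sum>j\<in>UNIV. norm (g j (a j))) \<le> R"
    by (rule dense_polydisc_sequence)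
  have e: "norm (e i j) < 1" for i j using e' by blast
  \<comment> \<open>As n grows, the number of tests increases and the tolerance shrinks, so these
    sets decrease.\<close>
  define C where "C n = {f\<in>A. \<forall>i\<le>n. test_fun p e i f \<le> 1 + 1 / real (Suc n)}" for n
  have CA: "C n \<subseteq> A" for n by (auto simp: C_def)
  have le2: "1 + 1 / real (Suc m) \<le> 1 + 1 / real (Suc n)" if "n \<le> m" for n m
    using that by (intro add_left_mono divide_left_mono) auto
  have bd: "hval p (f j) \<le> 2 powr p" if "f \<in> C 0" for f j
  proof -
    \<comment> \<open>At n = 0 the tolerance 1 + 1/1 is 2, and the norm functional is among the
      tests from the start; this bounds the whole sequence in norm.\<close>
    have "test_fun p e 0 f \<le> 2" using that by (auto simp: C_def)
    moreover have "hardy_norm p (f j) \<le> test_fun p e 0 f"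
      unfolding test_fun_def nat.case by (rule member_le_sum) (auto simp: hardy_norm_nonneg)
    ultimately show ?thesis
      using p by (simp add: hval_hardy_norm hardy_norm_nonneg powr_mono2)
  qed
  obtain f g where f: "\<And>n. f n \<in> C n" and g: "g \<in> hardy_power p" "\<And>j z. (\<lambda>n. f n j z) \<longlonglongrightarrow> g j z"
    "(\<lambda>n. hardy_dist p g (f n)) \<longlonglongrightarrow> 0"
  proof (rule nested_mixing_limit[of p C "2 powr p"])
    show "hval p (f j) \<le> 2 powr p" if "f \<in> C 0" for f j using that by (rule bd)
    show "C n \<subseteq> hardy_power p" for n using CA sub by blast
    show "C n \<noteq> {}" for n
    proof -
      have "\<exists>f\<in>A. \<forall>i\<le>n. test_fun p e i f \<le> 1 + 1 / real (Suc n)"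
        by (rule PS_ball_test[OF p sub cx e H]) auto
      then show ?thesis unfolding C_def by blast
    qed
    show "decseq C" unfolding decseq_def
    proof (intro allI impI subsetI)
      fix n m f assume nm: "n \<le> m" and "f \<in> C m"
      then have "f \<in> A" and t: "\<And>i. i \<le> m \<Longrightarrow> test_fun p e i f \<le> 1 + 1 / real (Suc m)" by (auto simp: C_def)
      have "test_fun p e i f \<le> 1 + 1 / real (Suc n)" if "i \<le> n" for i
        using t[of i] le2[OF nm] nm that by linarith
      then show "f \<in> C n" using \<open>f \<in> A\<close> by (simp add: C_def)
    qed
    show "mixing_closed tuple_mix (C n)" for n
    proof -
      have "mixing_closed tuple_mix {f\<in>A. test_fun p e i f \<le> 1 + 1 / real (Suc n)}" for i
        using cx by (intro mixing_sublevel test_fun_convex[OF p sub]) (simp add: mixing_closed_tuples)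
      then show ?thesis unfolding mixing_closed_def C_def by fast
    qed
  qed (rule p, blast)
  have "g \<in> A" using hardy_closed_sequence[OF p cl _ g(1,3)] f CA by blast
  have gd: "g j \<in> disc_holomorphic" for j using g(1) by (auto simp: hardy_power_def hardy_space_def)
  have "(\<Sum>j\<in>UNIV. norm (g j (e i j))) \<le> 1" for i
  proof (rule LIMSEQ_le)
    show "(\<lambda>n. \<Sum>j\<in>UNIV. norm (f n j (e i j))) \<longlonglongrightarrow> (\<Sum>j\<in>UNIV. norm (g j (e i j)))"
      by (intro tendsto_sum tendsto_norm g(2))
    have "(\<lambda>n. 1 + 1 / real (Suc n)) \<longlonglongrightarrow> 1 + 0"
      by (intro tendsto_add tendsto_const lim_1_over_n[THEN LIMSEQ_Suc])
    then show "(\<lambda>n. 1 + 1 / real (Suc n)) \<longlonglongrightarrow> 1" by simp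
    \<comment> \<open>Evaluation at \<open>e i\<close> is test number i + 1, so it is controlled
      from n = i + 1 on.\<close>
    have "(\<Sum>j\<in>UNIV. norm (f n j (e i j))) \<le> 1 + 1 / real (Suc n)" if "n \<ge> Suc i" for n
    proof -
      have "test_fun p e (Suc i) (f n) \<le> 1 + 1 / real (Suc n)" using f[of n] that unfolding C_def by blast
      then show ?thesis by (simp add: test_fun_def)
    qed
    then show "\<exists>N. \<forall>n\<ge>N. (\<Sum>j\<in>UNIV. norm (f n j (e i j))) \<le> 1 + 1 / real (Suc n)" by blast
  qed
  then have "g \<in> Hinf_ball 1"
    using dense[rule_format, of g 1] gd by (intro Hinf_ball_I gd) (auto simp: disc_holomorphic_def)
  then show ?thesis using \<open>g \<in> A\<close> by blast
qed

theorem theorem4p1: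
  fixes p :: real and A :: "('k::finite \<Rightarrow> complex \<Rightarrow> complex) set"
  assumes "1 < p"
    and "closedin (hardy_topology p) A"
    and "convex_tuples A"
  shows "A \<inter> Hinf_ball 1 \<noteq> {} \<longleftrightarrow>
    (\<forall>u :: 'k \<Rightarrow> complex \<Rightarrow> ereal. (\<forall>j. u j \<in> exhaustions1) \<longrightarrow> A \<inter> PS_ball u p 1 \<noteq> {})"
proof
  assume ne: "A \<inter> Hinf_ball 1 \<noteq> {}"
  show "\<forall>u :: 'k \<Rightarrow> complex \<Rightarrow> ereal. (\<forall>j. u j \<in> exhaustions1) \<longrightarrow> A \<inter> PS_ball u p 1 \<noteq> {}"
  proof (intro allI impI)
    fix u :: "'k \<Rightarrow> complex \<Rightarrow> ereal" assume "\<forall>j. u j \<in> exhaustions1"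
    then have "Hinf_ball 1 \<subseteq> PS_ball u p 1" using assms(1) by (intro Hinf_ball_subset_PS_ball) auto
    then show "A \<inter> PS_ball u p 1 \<noteq> {}" using ne by blast
  qed
next
  assume "\<forall>u :: 'k \<Rightarrow> complex \<Rightarrow> ereal. (\<forall>j. u j \<in> exhaustions1) \<longrightarrow> A \<inter> PS_ball u p 1 \<noteq> {}"
  then show "A \<inter> Hinf_ball 1 \<noteq> {}" using assms by (intro PS_ball_imp_Hinf_ball[of p]) auto
qed

end
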